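(* Let $G$ be a Lie group acting properly (and smoothly) on a smooth manifold $M$, and let $H\subset G$ be a closed co-compact subgroup. Let $h\in C^\infty(M)^G$, let $(h_\lambda)$ be an $H$-perturbation of $h$, and let $m\in M$ be a $G$-nondegenerate critical point of $h$. Then there is a $G$-invariant neighbourhood $U\subset M$ of $m$ such that, if $\lambda$ is sufficiently small, there exists a function $f_\lambda\in C^\infty(G/G_m)^H$ whose critical points are in one-to-one correspondence with the critical points of $h_\lambda$ in $U$.
   Context: $C^\infty(M)^G$ denotes the ring of $G$-invariant smooth real-valued functions on $M$ (similarly for $H$). $G_m$ is the stabilizer of $m$, and $H$ acts on $G/G_m$ by left multiplication. A closed subgroup $H\subset G$ is co-compact if the orbit space $H\backslash G$ of the left multiplication action of $H$ on $G$ is compact. An $H$-perturbation of $h\in C^\infty(M)^G$ is a family of functions $h_\lambda\in C^\infty(M)^H$, with $\lambda$ in a neighbourhood of $0$ in $\mathbb{R}$, such that $(m,\lambda)\mapsto h_\lambda(m)$ is smooth and $h_0=h$. For $x\in\mathfrak g$ (the Lie algebra of $G$), $x_M(m)=\frac{d}{dt}\big|_{t=0}\exp(tx)\cdot m$, and $\mathfrak g\cdot m=\{x_M(m): x\in\mathfrak g\}$ is the tangent space at $m$ of the orbit $G\cdot m$. A $G$-nondegenerate critical point of $h\in C^\infty(M)^G$ is a point $m\in M$ such that (i) $dh(m)=0$, and (ii) if $\mathcal N$ is any subspace of $T_mM$ complementary to $\mathfrak g\cdot m$, the restriction of the Hessian $D^2h(m)$ to $\mathcal N\times\mathcal N$ is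 non-singular. *)

theory Defs
  imports "HOL-Analysis.Analysis" "HOL-Algebra.Group_Action"
begin

section \<open>Smooth maps between open subsets of finite-dimensional vector spaces\<close>

text \<open>
  A finite-dimensional vector space is represented as a linear subspace \<open>V\<close> of a type of class
  \<^class>\<open>euclidean_space\<close>. The dimension may then be \<open>0\<close>, and it may depend on terms, as is needed
  for the homogeneous spaces below.
\<close>

definition dir_deriv :: "'e::real_normed_vector \<Rightarrow> ('e \<Rightarrow> 'f::real_normed_vector) \<Rightarrow> 'e \<Rightarrow> 'f" where
  "dir_deriv v f x = vector_derivative (\<lambda>t. f (x + t *\<^sub>R v)) (at 0)"

text \<open>
  For \<open>S\<close> relatively open in \<open>V\<close>, \<open>f\<close> is of class \<open>C\<^sup>k\<close> on \<open>S\<close> iff all its iterated directional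
  derivatives along \<open>V\<close> up to order \<open>k\<close> exist and are continuous on \<open>S\<close>. Values of \<open>f\<close> outside
  \<open>S\<close> do not matter.
\<close>

primrec Ck_on :: "nat \<Rightarrow> 'e::real_normed_vector set \<Rightarrow> 'e set \<Rightarrow> ('e \<Rightarrow> 'f::real_normed_vector) \<Rightarrow> bool" where
  "Ck_on 0 V S f \<longleftrightarrow> continuous_on S f"
| "Ck_on (Suc k) V S f \<longleftrightarrow> continuous_on S f \<and>
     (\<forall>v\<in>V. (\<forall>x\<in>S. (\<lambda>t::real. f (x + t *\<^sub>R v)) differentiable (at 0)) \<and> Ck_on k V S (dir_deriv v f))"

definition smooth_on :: "'e::real_normed_vector set \<Rightarrow> 'e set \<Rightarrow> ('e \<Rightarrow> 'f::real_normed_vector) \<Rightarrow> bool" where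
  "smooth_on V S f \<longleftrightarrow> (\<forall>k. Ck_on k V S f)"


section \<open>Smooth manifolds\<close>

text \<open>A chart \<open>(U, V, \<phi>)\<close> has domain \<open>U\<close> and maps it to a relatively open subset of the linear
  subspace \<open>V\<close>.\<close>

type_synonym ('a, 'e) chart = "'a set \<times> 'e set \<times> ('a \<Rightarrow> 'e)"

record ('a, 'e) manifold =
  topo :: "'a topology"
  atlas :: "('a, 'e) chart set"

fun topological_chart :: "'a topology \<Rightarrow> ('a, 'e::euclidean_space) chart \<Rightarrow> bool" where
  "topological_chart X (U, V, \<phi>) \<longleftrightarrow>
     openin X U \<and> subspace V \<and> openin (top_of_set V) (\<phi> ` U) \<and>
     homeomorphic_map (subtopology X U) (top_of_set (\<phi> ` U)) \<phi>"

fun smoothly_compatible :: "('a, 'e::euclidean_space) chart \<Rightarrow> ('a, 'e) chart \<Rightarrow> bool" where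
  "smoothly_compatible (U, V, \<phi>) (W, V', \<psi>) \<longleftrightarrow> smooth_on V (\<phi> ` (U \<inter> W)) (\<psi> \<circ> inv_into U \<phi>)"

text \<open>The atlas need not be maximal. All nonempty charts have the same dimension.\<close>

definition smooth_manifold :: "('a, 'e::euclidean_space) manifold \<Rightarrow> bool" where
  "smooth_manifold M \<longleftrightarrow>
     Hausdorff_space (topo M) \<and> second_countable (topo M) \<and>
     (\<forall>c\<in>atlas M. topological_chart (topo M) c) \<and>
     (\<Union>(U, V, \<phi>)\<in>atlas M. U) = topspace (topo M) \<and>
     (\<exists>n. \<forall>(U, V, \<phi>)\<in>atlas M. U \<noteq> {} \<longrightarrow> dim V = n) \<and>
     (\<forall>c\<in>atlas M. \<forall>d\<in>atlas M. smoothly_compatible c d)"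

definition flat_manifold :: "'e::euclidean_space set \<Rightarrow> 'e set \<Rightarrow> ('e, 'e) manifold" where
  "flat_manifold V S = \<lparr>topo = top_of_set S, atlas = {(S, V, id)}\<rparr>"

abbreviation real_line :: "(real, real) manifold" where
  "real_line \<equiv> flat_manifold UNIV UNIV"

definition prod_manifold ::
    "('a, 'e::euclidean_space) manifold \<Rightarrow> ('b, 'f::euclidean_space) manifold \<Rightarrow> ('a \<times> 'b, 'e \<times> 'f) manifold" where
  "prod_manifold M N =
     \<lparr>topo = prod_topology (topo M) (topo N),
      atlas = {(U \<times> W, V \<times> V', map_prod \<phi> \<psi>) | U V \<phi> W V' \<psi>. (U, V, \<phi>) \<in> atlas M \<and> (W, V', \<psi>) \<in> atlas N}\<rparr>"

definition open_submanifold :: "('a, 'e::euclidean_space) manifold \<Rightarrow> 'a set \<Rightarrow> ('a, 'e) manifold" where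
  "open_submanifold M S =
     \<lparr>topo = subtopology (topo M) S, atlas = {(U \<inter> S, V, \<phi>) | U V \<phi>. (U, V, \<phi>) \<in> atlas M}\<rparr>"

definition smooth_map ::
    "('a, 'e::euclidean_space) manifold \<Rightarrow> ('b, 'f::euclidean_space) manifold \<Rightarrow> ('a \<Rightarrow> 'b) \<Rightarrow> bool" where
  "smooth_map M N f \<longleftrightarrow>
     continuous_map (topo M) (topo N) f \<and>
     (\<forall>(U, V, \<phi>)\<in>atlas M. \<forall>(W, V', \<psi>)\<in>atlas N.
        smooth_on V (\<phi> ` {x \<in> U. f x \<in> W}) (\<psi> \<circ> f \<circ> inv_into U \<phi>))"


section \<open>Tangent spaces, differentials and Hessians\<close>

text \<open>
  A tangent vector at \<open>m\<close> is represented by its coordinates with respect to one fixed chosen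
  chart at \<open>m\<close>.
\<close>

definition chart_at :: "('a, 'e::euclidean_space) manifold \<Rightarrow> 'a \<Rightarrow> ('a, 'e) chart" where
  "chart_at M m = (SOME c. c \<in> atlas M \<and> m \<in> fst c)"

definition tangent_space :: "('a, 'e::euclidean_space) manifold \<Rightarrow> 'a \<Rightarrow> 'e set" where
  "tangent_space M m = fst (snd (chart_at M m))"

definition coord_at :: "('a, 'e::euclidean_space) manifold \<Rightarrow> 'a \<Rightarrow> 'a \<Rightarrow> 'e" where
  "coord_at M m = snd (snd (chart_at M m))"

definition param_at :: "('a, 'e::euclidean_space) manifold \<Rightarrow> 'a \<Rightarrow> 'e \<Rightarrow> 'a" where
  "param_at M m = inv_into (fst (chart_at M m)) (coord_at M m)"

definition differential ::
    "('a, 'e::euclidean_space) manifold \<Rightarrow> ('b, 'f::euclidean_space) manifold \<Rightarrow> ('a \<Rightarrow> 'b) \<Rightarrow> 'a \<Rightarrow> 'e \<Rightarrow> 'f" where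
  "differential M N f m v = dir_deriv v (coord_at N (f m) \<circ> f \<circ> param_at M m) (coord_at M m m)"

definition velocity :: "('a, 'e::euclidean_space) manifold \<Rightarrow> (real \<Rightarrow> 'a) \<Rightarrow> real \<Rightarrow> 'e" where
  "velocity M c t = differential real_line M c t 1"

definition smooth_submersion ::
    "('a, 'e::euclidean_space) manifold \<Rightarrow> ('b, 'f::euclidean_space) manifold \<Rightarrow> ('a \<Rightarrow> 'b) \<Rightarrow> bool" where
  "smooth_submersion M N f \<longleftrightarrow>
     smooth_map M N f \<and>
     (\<forall>x\<in>topspace (topo M). differential M N f x ` tangent_space M x = tangent_space N (f x))"

definition critical_point :: "('a, 'e::euclidean_space) manifold \<Rightarrow> ('a \<Rightarrow> real) \<Rightarrow> 'a \<Rightarrow> bool" where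
  "critical_point M f m \<longleftrightarrow>
     m \<in> topspace (topo M) \<and> (\<forall>v\<in>tangent_space M m. differential M real_line f m v = 0)"

text \<open>Only meaningful at critical points, where it does not depend on the choice of the chart.\<close>

definition hessian :: "('a, 'e::euclidean_space) manifold \<Rightarrow> ('a \<Rightarrow> real) \<Rightarrow> 'a \<Rightarrow> 'e \<Rightarrow> 'e \<Rightarrow> real" where
  "hessian M f m u v = dir_deriv u (dir_deriv v (f \<circ> param_at M m)) (coord_at M m m)"


section \<open>Lie groups\<close>

definition lie_group :: "('g, 'x) monoid_scheme \<Rightarrow> ('g, 'k::euclidean_space) manifold \<Rightarrow> bool" where
  "lie_group G GM \<longleftrightarrow>
     group G \<and> smooth_manifold GM \<and> topspace (topo GM) = carrier G \<and>
     smooth_map (prod_manifold GM GM) GM (\<lambda>(a, b). a \<otimes>\<^bsub>G\<^esub> b) \<and>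
     smooth_map GM GM (\<lambda>a. inv\<^bsub>G\<^esub> a)"

text \<open>The Lie algebra is \<open>tangent_space GM \<one>\<close>; its bracket is not needed.\<close>

definition lie_algebra :: "('g, 'x) monoid_scheme \<Rightarrow> ('g, 'k::euclidean_space) manifold \<Rightarrow> 'k set" where
  "lie_algebra G GM = tangent_space GM \<one>\<^bsub>G\<^esub>"

definition one_parameter_subgroup ::
    "('g, 'x) monoid_scheme \<Rightarrow> ('g, 'k::euclidean_space) manifold \<Rightarrow> (real \<Rightarrow> 'g) \<Rightarrow> bool" where
  "one_parameter_subgroup G GM \<gamma> \<longleftrightarrow>
     smooth_map real_line GM \<gamma> \<and> (\<forall>s t. \<gamma> (s + t) = \<gamma> s \<otimes>\<^bsub>G\<^esub> \<gamma> t)"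

text \<open>\<open>exp x = \<gamma> 1\<close> for the unique one-parameter subgroup \<open>\<gamma>\<close> with initial velocity \<open>x\<close>.\<close>

definition lie_exp :: "('g, 'x) monoid_scheme \<Rightarrow> ('g, 'k::euclidean_space) manifold \<Rightarrow> 'k \<Rightarrow> 'g" where
  "lie_exp G GM x = (THE \<gamma>. one_parameter_subgroup G GM \<gamma> \<and> velocity GM \<gamma> 0 = x) 1"


section \<open>Quotients\<close>

definition quotient_topology :: "'a topology \<Rightarrow> ('a \<Rightarrow> 'b) \<Rightarrow> 'b topology" where
  "quotient_topology X p = topology (\<lambda>U. U \<subseteq> p ` topspace X \<and> openin X {x \<in> topspace X. p x \<in> U})"

lemma openin_quotient_topology:
  "openin (quotient_topology X p) U \<longleftrightarrow> U \<subseteq> p ` topspace X \<and> openin X {x \<in> topspace X. p x \<in> U}"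
proof -
  have *: "openin X {x \<in> topspace X. p x \<in> S \<inter> T}"
    if "openin X {x \<in> topspace X. p x \<in> S}" "openin X {x \<in> topspace X. p x \<in> T}" for S T
  proof -
    have "{x \<in> topspace X. p x \<in> S \<inter> T} = {x \<in> topspace X. p x \<in> S} \<inter> {x \<in> topspace X. p x \<in> T}"
      by blast
    then show ?thesis using openin_Int[OF that] by simp
  qed
  have **: "openin X {x \<in> topspace X. p x \<in> \<Union>\<K>}"
    if "\<forall>K\<in>\<K>. openin X {x \<in> topspace X. p x \<in> K}" for \<K>
  proof -
    have "{x \<in> topspace X. p x \<in> \<Union>\<K>} = (\<Union>K\<in>\<K>. {x \<in> topspace X. p x \<in> K})"
      by blast
    moreover have "openin X (\<Union>K\<in>\<K>. {x \<in> topspace X. p x \<in> K})"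
      using that by (intro openin_Union) blast
    ultimately show ?thesis by simp
  qed
  have "istopology (\<lambda>U. U \<subseteq> p ` topspace X \<and> openin X {x \<in> topspace X. p x \<in> U})"
    unfolding istopology_def
  proof (intro conjI allI impI)
    fix S T
    assume S: "S \<subseteq> p ` topspace X \<and> openin X {x \<in> topspace X. p x \<in> S}"
      and T: "T \<subseteq> p ` topspace X \<and> openin X {x \<in> topspace X. p x \<in> T}"
    show "S \<inter> T \<subseteq> p ` topspace X" using S by blast
    show "openin X {x \<in> topspace X. p x \<in> S \<inter> T}" using S T * by blast
  next
    fix \<K>
    assume K: "\<forall>K\<in>\<K>. K \<subseteq> p ` topspace X \<and> openin X {x \<in> topspace X. p x \<in> K}"
    show "\<Union>\<K> \<subseteq> p ` topspace X" using K by blast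
    show "openin X {x \<in> topspace X. p x \<in> \<Union>\<K>}" using K by (intro **) blast
  qed
  then show ?thesis
    unfolding quotient_topology_def by (subst topology_inverse') (assumption, rule refl)
qed

lemma quotient_map_quotient_topology: "quotient_map X (quotient_topology X p) p"
proof -
  have 1: "topspace (quotient_topology X p) \<subseteq> p ` topspace X"
    using openin_topspace[of "quotient_topology X p"] unfolding openin_quotient_topology by (rule conjunct1)
  have "{x \<in> topspace X. p x \<in> p ` topspace X} = topspace X"
    by blast
  then have "openin (quotient_topology X p) (p ` topspace X)"
    unfolding openin_quotient_topology by simp
  then have "p ` topspace X \<subseteq> topspace (quotient_topology X p)"
    by (rule openin_subset)
  with 1 have "topspace (quotient_topology X p) = p ` topspace X"
    by (rule antisym)
  then show ?thesis
    unfolding quotient_map_def openin_quotient_topology by simp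
qed

text \<open>A closed subgroup \<open>H\<close> is co-compact if the space of its right cosets \<open>H a\<close>, the orbits of left
  multiplication by \<open>H\<close>, is compact.\<close>

definition closed_cocompact_subgroup ::
    "('g, 'x) monoid_scheme \<Rightarrow> ('g, 'k::euclidean_space) manifold \<Rightarrow> 'g set \<Rightarrow> bool" where
  "closed_cocompact_subgroup G GM H \<longleftrightarrow>
     subgroup H G \<and> closedin (topo GM) H \<and>
     compact_space (quotient_topology (topo GM) (\<lambda>a. H #>\<^bsub>G\<^esub> a))"

text \<open>
  The homogeneous space \<open>G / K\<close> of left cosets, with the quotient topology and its unique smooth
  structure for which the projection \<open>G \<rightarrow> G / K\<close> is a smooth submersion. The atlas is the maximal
  one: it consists of all topological charts which become smooth submersions after composition with
  the projection. These charts cover \<open>G / K\<close> whenever \<open>K\<close> is a closed subgroup of a Lie group \<open>G\<close>;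
  since \<open>dim (G / K) \<le> dim G\<close>, the type of the coordinates of \<open>G\<close> is large enough for \<open>G / K\<close>.
\<close>

definition homogeneous_space ::
    "('g, 'x) monoid_scheme \<Rightarrow> ('g, 'k::euclidean_space) manifold \<Rightarrow> 'g set \<Rightarrow> ('g set, 'k) manifold" where
  "homogeneous_space G GM K =
     (let p = (\<lambda>a. a <#\<^bsub>G\<^esub> K); X = quotient_topology (topo GM) p
      in \<lparr>topo = X,
          atlas = {(U, V, \<phi>) | U V \<phi>. topological_chart X (U, V, \<phi>) \<and>
            smooth_submersion (open_submanifold GM {a \<in> topspace (topo GM). p a \<in> U})
                              (flat_manifold V (\<phi> ` U)) (\<phi> \<circ> p)}\<rparr>)"


section \<open>Proper actions and nondegenerate critical points\<close>

definition proper_smooth_action ::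
    "('g, 'x) monoid_scheme \<Rightarrow> ('g, 'k::euclidean_space) manifold \<Rightarrow> ('m, 'e::euclidean_space) manifold \<Rightarrow>
     ('g \<Rightarrow> 'm \<Rightarrow> 'm) \<Rightarrow> bool" where
  "proper_smooth_action G GM M act \<longleftrightarrow>
     group_action G (topspace (topo M)) act \<and>
     smooth_map (prod_manifold GM M) M (\<lambda>(g, x). act g x) \<and>
     proper_map (prod_topology (topo GM) (topo M)) (prod_topology (topo M) (topo M)) (\<lambda>(g, x). (act g x, x))"

definition invariant_smooth_functions ::
    "('m, 'e::euclidean_space) manifold \<Rightarrow> 'g set \<Rightarrow> ('g \<Rightarrow> 'm \<Rightarrow> 'm) \<Rightarrow> ('m \<Rightarrow> real) set" where
  "invariant_smooth_functions M S act =
     {f. smooth_map M real_line f \<and> (\<forall>g\<in>S. \<forall>x\<in>topspace (topo M). f (act g x) = f x)}"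

definition is_perturbation ::
    "('m, 'e::euclidean_space) manifold \<Rightarrow> 'g set \<Rightarrow> ('g \<Rightarrow> 'm \<Rightarrow> 'm) \<Rightarrow> ('m \<Rightarrow> real) \<Rightarrow> (real \<Rightarrow> 'm \<Rightarrow> real) \<Rightarrow> bool" where
  "is_perturbation M H act h hl \<longleftrightarrow>
     (\<exists>\<Lambda>. open \<Lambda> \<and> 0 \<in> \<Lambda> \<and>
        (\<forall>l\<in>\<Lambda>. hl l \<in> invariant_smooth_functions M H act) \<and>
        smooth_map (prod_manifold M (flat_manifold UNIV \<Lambda>)) real_line (\<lambda>(x, l). hl l x)) \<and>
     (\<forall>x\<in>topspace (topo M). hl 0 x = h x)"

definition infinitesimal_generator ::
    "('g, 'x) monoid_scheme \<Rightarrow> ('g, 'k::euclidean_space) manifold \<Rightarrow> ('m, 'e::euclidean_space) manifold \<Rightarrow>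
     ('g \<Rightarrow> 'm \<Rightarrow> 'm) \<Rightarrow> 'k \<Rightarrow> 'm \<Rightarrow> 'e" where
  "infinitesimal_generator G GM M act x m = velocity M (\<lambda>t. act (lie_exp G GM (t *\<^sub>R x)) m) 0"

definition orbit_tangent_space ::
    "('g, 'x) monoid_scheme \<Rightarrow> ('g, 'k::euclidean_space) manifold \<Rightarrow> ('m, 'e::euclidean_space) manifold \<Rightarrow>
     ('g \<Rightarrow> 'm \<Rightarrow> 'm) \<Rightarrow> 'm \<Rightarrow> 'e set" where
  "orbit_tangent_space G GM M act m = {infinitesimal_generator G GM M act x m | x. x \<in> lie_algebra G GM}"

definition complementary_subspaces :: "'e::real_vector set \<Rightarrow> 'e set \<Rightarrow> 'e set \<Rightarrow> bool" where
  "complementary_subspaces T A B \<longleftrightarrow>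
     subspace A \<and> subspace B \<and> A \<inter> B = {0} \<and> {a + b | a b. a \<in> A \<and> b \<in> B} = T"

definition nondegenerate_critical_point ::
    "('g, 'x) monoid_scheme \<Rightarrow> ('g, 'k::euclidean_space) manifold \<Rightarrow> ('m, 'e::euclidean_space) manifold \<Rightarrow>
     ('g \<Rightarrow> 'm \<Rightarrow> 'm) \<Rightarrow> ('m \<Rightarrow> real) \<Rightarrow> 'm \<Rightarrow> bool" where
  "nondegenerate_critical_point G GM M act h m \<longleftrightarrow>
     critical_point M h m \<and>
     (\<forall>N. complementary_subspaces (tangent_space M m) N (orbit_tangent_space G GM M act m) \<longrightarrow>
        (\<forall>u\<in>N. (\<forall>v\<in>N. hessian M h m u v = 0) \<longrightarrow> u = 0))"

end

theory Submission
  imports Defs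
begin

text \<open>
  The proof is a Lyapunov--Schmidt reduction along the orbit of \<open>m\<close>. By properness the isotropy group
  \<open>K = G\<^sub>m\<close> is compact; averaging over it yields a \<open>K\<close>-equivariant slice \<open>D\<close> through \<open>m\<close>, transverse
  to the orbit, such that \<open>g D\<close> meets \<open>D\<close> only for \<open>g \<in> K\<close>, and \<open>U = G D\<close> is open. Nondegeneracy
  says that \<open>m\<close> is a nondegenerate critical point of \<open>h\<close> restricted to \<open>D\<close>. Hence for small \<open>\<lambda>\<close> and
  every \<open>g \<in> G\<close> the restriction of \<open>v \<mapsto> h\<^sub>\<lambda>(g v)\<close> to \<open>D\<close> has exactly one critical point
  \<open>v\<^sub>\<lambda>(g)\<close>; as it depends only on the coset \<open>H g\<close>, compactness of \<open>H \ G\<close> makes the bound on \<open>\<lambda>\<close>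
  uniform in \<open>g\<close>. By uniqueness \<open>v\<^sub>\<lambda>(g k) = k\<^sup>-\<^sup>1 v\<^sub>\<lambda>(g)\<close> for \<open>k \<in> K\<close>, so \<open>g v\<^sub>\<lambda>(g)\<close> depends only
  on \<open>g K\<close>, and \<open>f\<^sub>\<lambda>(g K) = h\<^sub>\<lambda>(g v\<^sub>\<lambda>(g))\<close> is a smooth function on \<open>G / K\<close>. Since \<open>h\<^sub>\<lambda>\<close> is already critical
  in the slice direction at \<open>g v\<^sub>\<lambda>(g)\<close>, that point is critical for \<open>h\<^sub>\<lambda>\<close> if and only if \<open>g K\<close> is critical
  for \<open>f\<^sub>\<lambda>\<close>.
\<close>

section \<open>Calculus of \<open>C\<^sup>k\<close> functions\<close>

text \<open>Tangent spaces are subspaces whose dimension depends on terms, while derivatives live on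
  a fixed type. So every chart inverse and every map on a subspace is extended to the ambient type
  by a linear projection \<open>P\<close>, and a map that is to be inverted receives a summand such
  as \<open>v - P v\<close>, which makes its differential invertible on the whole type. The isotropy
  group is never turned into a submanifold. The mean over it is built from its topology alone, and
  charts of \<open>G/K\<close> come from the orbit map: its rank is constant near
  \<open>\<one>\<close>, because its differential at \<open>u\<close> takes values in the translate
  by \<open>u\<close> of the tangent space of the orbit at \<open>m\<close>. As
  \<open>lie_exp\<close> is a definite description, one-parameter subgroups must be shown to exist
  and to be unique before the infinitesimal orbit directions can be identified with the range of the
  differential of the orbit map. The zeros on the slices are found by a contraction with explicit
  constants: an implicit function theorem applied at each \<open>g\<close> would give neighbourhoods
  without a common size, whereas estimates can be compared for all \<open>g\<close> at once.\<close>

lemma dir_deriv_eqI: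
  assumes "((\<lambda>t. f (x + t *\<^sub>R v)) has_vector_derivative d) (at 0)"
  shows "dir_deriv v f x = d"
  unfolding dir_deriv_def using assms by (rule vector_derivative_at)

lemma has_derivative_along_line:
  assumes "(f has_derivative f') (at x)"
  shows "((\<lambda>t. f (x + t *\<^sub>R v)) has_vector_derivative f' v) (at 0)"
proof -
  have "(f has_derivative f') (at (x + 0 *\<^sub>R v))" using assms by simp
  moreover have "((\<lambda>t::real. x + t *\<^sub>R v) has_vector_derivative v) (at 0)"
    by (auto intro!: derivative_eq_intros)
  ultimately show ?thesis
    using vector_derivative_diff_chain_within[of "\<lambda>t. x + t *\<^sub>R v" v 0 UNIV f f']
    by (simp add: comp_def has_derivative_at_withinI)
qed

lemma has_derivative_dir_deriv:
  assumes "(f has_derivative f') (at x)"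
  shows "dir_deriv v f x = f' v"
  using has_derivative_along_line[OF assms] by (rule dir_deriv_eqI)

lemma dir_deriv_cong:
  assumes "open S" "x \<in> S" "\<And>y. y \<in> S \<Longrightarrow> f y = g y"
  shows "dir_deriv v f x = dir_deriv v g x"
    and "(\<lambda>t::real. f (x + t *\<^sub>R v)) differentiable (at 0) \<Longrightarrow> (\<lambda>t. g (x + t *\<^sub>R v)) differentiable (at 0)"
proof -
  have "((\<lambda>t::real. x + t *\<^sub>R v) \<longlongrightarrow> x + 0 *\<^sub>R v) (nhds 0)"
    by (intro tendsto_intros filterlim_ident)
  then have ev: "\<forall>\<^sub>F t in nhds (0::real). x + t *\<^sub>R v \<in> S"
    using assms(1,2) by (auto simp: tendsto_def)
  then have ev': "\<forall>\<^sub>F t in nhds (0::real). f (x + t *\<^sub>R v) = g (x + t *\<^sub>R v)"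
    by eventually_elim (use assms(3) in auto)
  show "dir_deriv v f x = dir_deriv v g x"
    unfolding dir_deriv_def by (rule vector_derivative_cong_eq) (use ev' in auto)
  have ev'': "\<forall>\<^sub>F t in at (0::real). f (x + t *\<^sub>R v) = g (x + t *\<^sub>R v)"
    using ev' by (auto simp: eventually_at_filter elim: eventually_mono)
  assume "(\<lambda>t::real. f (x + t *\<^sub>R v)) differentiable (at 0)"
  then obtain D where D: "((\<lambda>t::real. f (x + t *\<^sub>R v)) has_derivative D) (at 0)"
    unfolding differentiable_def by blast
  have "((\<lambda>t::real. g (x + t *\<^sub>R v)) has_derivative D) (at 0)"
    using has_derivative_transform_eventually[OF D ev''] assms(2,3) by simp
  then show "(\<lambda>t. g (x + t *\<^sub>R v)) differentiable (at 0)"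
    unfolding differentiable_def by blast
qed

lemma Ck_on_continuous: "Ck_on k V S f \<Longrightarrow> continuous_on S f"
  by (cases k) auto

lemma Ck_on_Suc_imp: "Ck_on (Suc k) V S f \<Longrightarrow> Ck_on k V S f"
proof (induction k arbitrary: f)
  case (Suc k)
  then show ?case by (simp del: Ck_on.simps add: Ck_on.simps(2)[of "Suc k"] Ck_on.simps(2)[of k])
qed simp

lemma Ck_on_SucD:
  assumes "Ck_on (Suc k) V S f" "v \<in> V"
  shows "Ck_on k V S (dir_deriv v f)"
    and "x \<in> S \<Longrightarrow> (\<lambda>t::real. f (x + t *\<^sub>R v)) differentiable (at 0)"
  using assms by auto

lemma Ck_on_subset: "Ck_on k V S f \<Longrightarrow> T \<subseteq> S \<Longrightarrow> Ck_on k V T f"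
  by (induction k arbitrary: f) (auto intro: continuous_on_subset)

lemma Ck_on_cong:
  assumes "open S" "\<And>y. y \<in> S \<Longrightarrow> f y = g y" "Ck_on k V S f"
  shows "Ck_on k V S g"
  using assms(2,3)
proof (induction k arbitrary: f g)
  case 0
  then show ?case using continuous_on_cong[of S S f g] by auto
next
  case (Suc k)
  have "continuous_on S g"
    using Suc.prems continuous_on_cong[of S S f g] by auto
  moreover have "Ck_on k V S (dir_deriv v g)" if "v \<in> V" for v
  proof (rule Suc.IH)
    show "dir_deriv v f y = dir_deriv v g y" if "y \<in> S" for y
      using assms(1) that Suc.prems(1) by (rule dir_deriv_cong(1))
  qed (rule Ck_on_SucD[OF Suc.prems(2) that])
  moreover have "(\<lambda>t::real. g (x + t *\<^sub>R v)) differentiable (at 0)" if "v \<in> V" "x \<in> S" for v x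
    using assms(1) that(2) Suc.prems(1) Ck_on_SucD(2)[OF Suc.prems(2) that] by (rule dir_deriv_cong(2))
  ultimately show ?case by auto
qed

lemma continuous_on_locally_open:
  fixes f :: "'a::real_normed_vector \<Rightarrow> 'b::topological_space"
  assumes "\<And>x. x \<in> S \<Longrightarrow> \<exists>U. open U \<and> x \<in> U \<and> continuous_on (U \<inter> S) f"
  shows "continuous_on S f"
  unfolding continuous_on_eq_continuous_within
proof
  fix x assume x: "x \<in> S"
  with assms obtain U where U: "open U" "x \<in> U" "continuous_on (U \<inter> S) f" by blast
  then have "continuous (at x within (U \<inter> S)) f" using x by (auto simp: continuous_on_eq_continuous_within)
  moreover have "at x within (U \<inter> S) = at x within S"
    using U by (intro at_within_nhd[of x U]) auto
  ultimately show "continuous (at x within S) f" by simp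
qed

lemma Ck_on_local:
  assumes "\<And>x. x \<in> S \<Longrightarrow> \<exists>U. open U \<and> x \<in> U \<and> Ck_on k V (U \<inter> S) f"
  shows "Ck_on k V S f"
  using assms
proof (induction k arbitrary: f)
  case 0
  show ?case unfolding Ck_on.simps
    by (rule continuous_on_locally_open) (use 0 in auto)
next
  case (Suc k)
  have 1: "Ck_on k V S (dir_deriv v f)" if "v \<in> V" for v
    by (rule Suc.IH) (use Suc.prems that in fastforce)
  have 2: "(\<lambda>t::real. f (x + t *\<^sub>R v)) differentiable (at 0)" if "v \<in> V" "x \<in> S" for v x
    using Suc.prems[OF that(2)] that by auto
  have 3: "continuous_on S f"
    by (rule continuous_on_locally_open) (use Suc.prems in fastforce)
  show ?case using 1 2 3 by auto
qed

text \<open>Mean value inequality for the curve minus its linear part. It turns uniform closeness of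
  derivatives into a first-order remainder, for partial derivatives as well as under the
  mean.\<close>

lemma line_bound:
  fixes \<phi> :: "real \<Rightarrow> 'b::real_normed_vector"
  assumes "\<And>s. s \<in> closed_segment 0 c \<Longrightarrow> (\<phi> has_vector_derivative \<phi>' s) (at s)"
    and "\<And>s. s \<in> closed_segment 0 c \<Longrightarrow> norm (\<phi>' s - d) \<le> e"
  shows "norm (\<phi> c - \<phi> 0 - c *\<^sub>R d) \<le> \<bar>c\<bar> * e"
proof -
  have "norm ((\<lambda>s. \<phi> s - s *\<^sub>R d) c - (\<lambda>s. \<phi> s - s *\<^sub>R d) 0) \<le> e * norm (c - 0)"
  proof (rule differentiable_bound[where S="closed_segment 0 c" and f'="\<lambda>s h. h *\<^sub>R (\<phi>' s - d)"])
    fix s assume s: "s \<in> closed_segment 0 c"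
    have "((\<lambda>s. \<phi> s - s *\<^sub>R d) has_vector_derivative (\<phi>' s - d)) (at s)"
      by (rule has_vector_derivative_diff[OF assms(1)[OF s]]) (auto intro!: derivative_eq_intros)
    then show "((\<lambda>s. \<phi> s - s *\<^sub>R d) has_derivative (\<lambda>h. h *\<^sub>R (\<phi>' s - d))) (at s within closed_segment 0 c)"
      by (auto simp: has_vector_derivative_def intro: has_derivative_at_withinI)
    show "onorm (\<lambda>h. h *\<^sub>R (\<phi>' s - d)) \<le> e"
    proof (rule onorm_bound)
      show "0 \<le> e" using order_trans[OF norm_ge_zero assms(2)[OF s]] .
      show "norm (h *\<^sub>R (\<phi>' s - d)) \<le> e * norm h" for h
        using mult_right_mono[OF assms(2)[OF s], of "\<bar>h\<bar>"] by (simp add: mult.commute)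
    qed
  qed auto
  then show ?thesis by (simp add: mult.commute algebra_simps)
qed

text \<open>\<open>Ck_on\<close> speaks of directional derivatives only. Continuity of the partial
  derivatives assembles them into a total derivative: the increment is split into steps along the
  basis vectors, each controlled by \<open>line_bound\<close>.\<close>

lemma Ck_on_1_has_derivative:
  fixes f :: "'a::euclidean_space \<Rightarrow> 'b::real_normed_vector"
  assumes S: "open S" "x \<in> S" and f: "Ck_on (Suc k) UNIV S f"
  shows "(f has_derivative (\<lambda>v. dir_deriv v f x)) (at x)"
proof -
  define L where "L h = (\<Sum>b\<in>Basis. (h \<bullet> b) *\<^sub>R dir_deriv b f x)" for h
  have vd: "((\<lambda>t. f (y + t *\<^sub>R v)) has_vector_derivative dir_deriv v f (y + s *\<^sub>R v)) (at s)"
    if "y + s *\<^sub>R v \<in> S" for y v s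
  proof -
    have "(\<lambda>t. f ((y + s *\<^sub>R v) + t *\<^sub>R v)) differentiable (at 0)"
      using f that by auto
    then have "((\<lambda>t. f ((y + s *\<^sub>R v) + t *\<^sub>R v)) has_vector_derivative dir_deriv v f (y + s *\<^sub>R v)) (at 0)"
      by (simp add: dir_deriv_def vector_derivative_works)
    then have "((\<lambda>t. f ((y + s *\<^sub>R v) + t *\<^sub>R v)) has_vector_derivative dir_deriv v f (y + s *\<^sub>R v)) (at (s - s))"
      by simp
    moreover have "((\<lambda>t. t - s) has_vector_derivative 1) (at s)"
      by (auto intro!: derivative_eq_intros)
    ultimately have "((\<lambda>t. f ((y + s *\<^sub>R v) + t *\<^sub>R v)) \<circ> (\<lambda>t. t - s) has_vector_derivative 1 *\<^sub>R dir_deriv v f (y + s *\<^sub>R v)) (at s)"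
      by (intro vector_diff_chain_at) auto
    then show ?thesis by (simp add: comp_def algebra_simps)
  qed
  \<comment> \<open>Induction over the set of coordinates already moved; a new coordinate
    contributes half of \<open>e\<close>, the induction hypothesis the other half.\<close>
  have claim: "\<forall>e>0. \<exists>\<delta>>0. \<forall>h. norm h < \<delta> \<longrightarrow>
      norm (f (x + (\<Sum>b\<in>A. (h \<bullet> b) *\<^sub>R b)) - f x - (\<Sum>b\<in>A. (h \<bullet> b) *\<^sub>R dir_deriv b f x)) \<le> e * norm h"
    if A: "finite A" "A \<subseteq> Basis" for A
    using A
  proof (induction A)
    case empty
    then show ?case by (auto intro: exI[of _ 1])
  next
    case (insert a A)
    show ?case
    proof (intro allI impI)
      fix e :: real assume e: "e > 0"
      then obtain \<delta>1 where \<delta>1: "\<delta>1 > 0" "\<And>h. norm h < \<delta>1 \<Longrightarrow>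
        norm (f (x + (\<Sum>b\<in>A. (h \<bullet> b) *\<^sub>R b)) - f x - (\<Sum>b\<in>A. (h \<bullet> b) *\<^sub>R dir_deriv b f x)) \<le> (e/2) * norm h"
        using insert.IH insert.prems by (meson half_gt_zero insert_subset)
      have "continuous_on S (dir_deriv a f)"
        using f by (auto dest: Ck_on_continuous)
      then have "continuous (at x) (dir_deriv a f)"
        using S by (simp add: continuous_on_eq_continuous_at)
      then obtain \<delta>2 where \<delta>2: "\<delta>2 > 0" "\<And>y. dist y x < \<delta>2 \<Longrightarrow> dist (dir_deriv a f y) (dir_deriv a f x) < e/2"
        unfolding continuous_at_eps_delta using e by (meson half_gt_zero)
      obtain \<delta>3 where \<delta>3: "\<delta>3 > 0" "ball x \<delta>3 \<subseteq> S"
        using S open_contains_ball by blast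
      \<comment> \<open>Every coordinate of \<open>h\<close> is at most \<open>norm h\<close> and at
        most \<open>n\<close> coordinates have been moved, so all intermediate points stay within
        \<open>n * norm h\<close> of \<open>x\<close>.\<close>
      define n where "n = real (card A) + 1"
      have n: "n > 0" by (simp add: n_def add_nonneg_pos)
      define \<delta> where "\<delta> = min \<delta>1 (min \<delta>2 \<delta>3 / n)"
      have "\<delta> > 0" using \<delta>1 \<delta>2 \<delta>3 n by (simp add: \<delta>_def)
      moreover have "norm (f (x + (\<Sum>b\<in>insert a A. (h \<bullet> b) *\<^sub>R b)) - f x - (\<Sum>b\<in>insert a A. (h \<bullet> b) *\<^sub>R dir_deriv b f x)) \<le> e * norm h"
        if h: "norm h < \<delta>" for h
      proof -
        define y where "y = x + (\<Sum>b\<in>A. (h \<bullet> b) *\<^sub>R b)"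
        have near: "dist (y + s *\<^sub>R a) x < min \<delta>2 \<delta>3" if s: "s \<in> closed_segment 0 (h \<bullet> a)" for s
        proof -
          have "\<bar>s\<bar> \<le> \<bar>h \<bullet> a\<bar>" using s by (auto simp: closed_segment_eq_real_ivl split: if_splits)
          then have 1: "\<bar>s\<bar> \<le> norm h" using Basis_le_norm[of a h] insert.prems by auto
          have "norm (\<Sum>b\<in>A. (h \<bullet> b) *\<^sub>R b) \<le> (\<Sum>b\<in>A. norm h)"
            by (rule sum_norm_le) (use insert.prems Basis_le_norm in \<open>auto simp: subset_iff\<close>)
          then have "norm (y + s *\<^sub>R a - x) \<le> card A * norm h + norm h"
            unfolding y_def using 1 insert.prems norm_triangle_ineq[of "\<Sum>b\<in>A. (h \<bullet> b) *\<^sub>R b" "s *\<^sub>R a"]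
            by (simp add: algebra_simps)
          also have "\<dots> = n * norm h" by (simp add: n_def algebra_simps)
          also have "\<dots> < n * (min \<delta>2 \<delta>3 / n)"
            using h n by (intro mult_strict_left_mono) (auto simp: \<delta>_def)
          finally show ?thesis using n by (simp add: dist_norm)
        qed
        have "norm (f (y + (h \<bullet> a) *\<^sub>R a) - f (y + 0 *\<^sub>R a) - (h \<bullet> a) *\<^sub>R dir_deriv a f x) \<le> \<bar>h \<bullet> a\<bar> * (e/2)"
        proof (rule line_bound)
          fix s assume "s \<in> closed_segment 0 (h \<bullet> a)"
          from near[OF this] have "y + s *\<^sub>R a \<in> S" and "norm (dir_deriv a f (y + s *\<^sub>R a) - dir_deriv a f x) < e/2"
            using \<delta>3 \<delta>2(2)[of "y + s *\<^sub>R a"] by (auto simp: dist_commute dist_norm norm_minus_commute)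
          then show "norm (dir_deriv a f (y + s *\<^sub>R a) - dir_deriv a f x) \<le> e/2"
            "((\<lambda>s. f (y + s *\<^sub>R a)) has_vector_derivative dir_deriv a f (y + s *\<^sub>R a)) (at s)"
            by (auto intro: vd)
        qed
        also have "\<bar>h \<bullet> a\<bar> * (e/2) \<le> (e/2) * norm h"
          using e Basis_le_norm[of a h] insert.prems by (simp add: mult.commute)
        finally have 2: "norm (f (y + (h \<bullet> a) *\<^sub>R a) - f y - (h \<bullet> a) *\<^sub>R dir_deriv a f x) \<le> (e/2) * norm h" by simp
        have 3: "norm (f y - f x - (\<Sum>b\<in>A. (h \<bullet> b) *\<^sub>R dir_deriv b f x)) \<le> (e/2) * norm h"
          unfolding y_def using h by (intro \<delta>1) (simp add: \<delta>_def)
        have eq: "f (x + (\<Sum>b\<in>insert a A. (h \<bullet> b) *\<^sub>R b)) - f x - (\<Sum>b\<in>insert a A. (h \<bullet> b) *\<^sub>R dir_deriv b f x)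
           = (f (y + (h \<bullet> a) *\<^sub>R a) - f y - (h \<bullet> a) *\<^sub>R dir_deriv a f x) + (f y - f x - (\<Sum>b\<in>A. (h \<bullet> b) *\<^sub>R dir_deriv b f x))"
          using insert.hyps by (simp add: y_def algebra_simps)
        show ?thesis unfolding eq
          using norm_triangle_le[OF add_mono[OF 2 3]] by (simp add: algebra_simps)
      qed
      ultimately show "\<exists>\<delta>>0. \<forall>h. norm h < \<delta> \<longrightarrow> norm (f (x + (\<Sum>b\<in>insert a A. (h \<bullet> b) *\<^sub>R b)) - f x - (\<Sum>b\<in>insert a A. (h \<bullet> b) *\<^sub>R dir_deriv b f x)) \<le> e * norm h"
        by blast
    qed
  qed
  have "bounded_linear L"
    unfolding L_def by (intro bounded_linear_intros)
  moreover have "\<forall>e>0. \<exists>\<delta>>0. \<forall>h. norm h < \<delta> \<longrightarrow> norm (f (x + h) - f x - L h) \<le> e * norm h"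
    using claim[of Basis] by (simp add: L_def euclidean_representation)
  ultimately have "(f has_derivative L) (at x)"
    unfolding has_derivative_at_alt by (metis add_diff_cancel_left' add.commute diff_add_cancel)
  then show ?thesis
    using has_derivative_dir_deriv[of f L x] by (simp add: has_derivative_def ext)
qed

text \<open>The induction step of the closure properties below: once the total derivative is known
  in closed form, only its regularity, one order lower, remains to be shown.\<close>

lemma Ck_on_SucI:
  assumes S: "open S" and d: "\<And>x. x \<in> S \<Longrightarrow> (f has_derivative f' x) (at x)"
    and k: "\<And>v. Ck_on k UNIV S (\<lambda>x. f' x v)"
  shows "Ck_on (Suc k) UNIV S f"
proof -
  have "continuous_on S f"
    using d by (intro continuous_at_imp_continuous_on) (auto intro: has_derivative_continuous)
  moreover have "(\<lambda>t::real. f (x + t *\<^sub>R v)) differentiable (at 0)" if "x \<in> S" for x v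
    using has_derivative_along_line[OF d[OF that]] by (rule differentiableI_vector)
  moreover have "Ck_on k UNIV S (dir_deriv v f)" for v
    by (rule Ck_on_cong[OF S _ k[of v]]) (use has_derivative_dir_deriv[OF d] in auto)
  ultimately show ?thesis by auto
qed

lemma Ck_on_const:
  fixes V :: "'a::real_normed_vector set"
  shows "Ck_on k V S (\<lambda>x. c)"
proof (induction k arbitrary: c)
  case (Suc k)
  have "dir_deriv v (\<lambda>x. c) = (\<lambda>x. 0)" for v :: 'a by (auto simp: dir_deriv_def)
  then have "Ck_on k V S (dir_deriv v (\<lambda>x. c))" for v using Suc[of 0] by metis
  then show ?case by simp
qed simp

lemma Ck_on_bounded_linear:
  assumes "bounded_linear L"
  shows "Ck_on k V S L"
proof (cases k)
  case 0
  then show ?thesis using assms by (simp add: linear_continuous_on)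
next
  case (Suc j)
  have "dir_deriv v L = (\<lambda>x. L v)" for v
    using has_derivative_dir_deriv[OF bounded_linear_imp_has_derivative[OF assms]] by auto
  moreover have "(\<lambda>t::real. L (x + t *\<^sub>R v)) differentiable (at 0)" for x v
    using has_derivative_along_line[OF bounded_linear_imp_has_derivative[OF assms]] differentiableI_vector by blast
  moreover have "Ck_on j V S (dir_deriv v L)" for v
    unfolding calculation by (rule Ck_on_const)
  ultimately show ?thesis unfolding Suc using assms
    by (simp add: linear_continuous_on)
qed

lemma Ck_on_linear:
  fixes L :: "'a::euclidean_space \<Rightarrow> 'b::real_normed_vector"
  shows "linear L \<Longrightarrow> Ck_on k V S L"
  by (simp add: Ck_on_bounded_linear linear_conv_bounded_linear)

lemma Ck_on_id: "Ck_on k V S (\<lambda>x. x)"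
  by (rule Ck_on_bounded_linear) (rule bounded_linear_ident)

lemma Ck_on_bounded_linear_compose:
  fixes f :: "'a::euclidean_space \<Rightarrow> 'b::real_normed_vector"
  assumes S: "open S" and L: "bounded_linear L" and f: "Ck_on k UNIV S f"
  shows "Ck_on k UNIV S (\<lambda>x. L (f x))"
  using f
proof (induction k arbitrary: f)
  case 0
  then show ?case using L by (simp add: bounded_linear.continuous_on)
next
  case (Suc k)
  show ?case
  proof (rule Ck_on_SucI[OF S])
    show "((\<lambda>x. L (f x)) has_derivative (\<lambda>v. L (dir_deriv v f x))) (at x)" if "x \<in> S" for x
      using bounded_linear.has_derivative[OF L Ck_on_1_has_derivative[OF S that Suc.prems]] .
    show "Ck_on k UNIV S (\<lambda>x. L (dir_deriv v f x))" for v
      using Suc by auto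
  qed
qed

lemma Ck_on_add:
  fixes f g :: "'a::euclidean_space \<Rightarrow> 'b::real_normed_vector"
  assumes S: "open S" and "Ck_on k UNIV S f" "Ck_on k UNIV S g"
  shows "Ck_on k UNIV S (\<lambda>x. f x + g x)"
  using assms(2,3)
proof (induction k arbitrary: f g)
  case 0
  then show ?case by (simp add: continuous_on_add)
next
  case (Suc k)
  show ?case
  proof (rule Ck_on_SucI[OF S])
    show "((\<lambda>x. f x + g x) has_derivative (\<lambda>v. dir_deriv v f x + dir_deriv v g x)) (at x)" if "x \<in> S" for x
      by (intro has_derivative_add Ck_on_1_has_derivative[OF S that Suc.prems(1)] Ck_on_1_has_derivative[OF S that Suc.prems(2)])
    show "Ck_on k UNIV S (\<lambda>x. dir_deriv v f x + dir_deriv v g x)" for v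
      using Suc by auto
  qed
qed

lemma Ck_on_sum:
  fixes f :: "'i \<Rightarrow> 'a::euclidean_space \<Rightarrow> 'b::real_normed_vector"
  assumes S: "open S" and f: "\<And>i. i \<in> I \<Longrightarrow> Ck_on k UNIV S (f i)"
  shows "Ck_on k UNIV S (\<lambda>x. \<Sum>i\<in>I. f i x)"
  using f by (induction I rule: infinite_finite_induct) (auto intro: Ck_on_add[OF S] Ck_on_const)

lemma Ck_on_bilinear:
  fixes f :: "'a::euclidean_space \<Rightarrow> 'b::real_normed_vector" and g :: "'a \<Rightarrow> 'c::real_normed_vector"
  assumes S: "open S" and B: "bounded_bilinear B" and "Ck_on k UNIV S f" "Ck_on k UNIV S g"
  shows "Ck_on k UNIV S (\<lambda>x. B (f x) (g x))"
  using assms(3,4)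
proof (induction k arbitrary: f g)
  case 0
  then show ?case using bounded_bilinear.continuous_on[OF B] by auto
next
  case (Suc k)
  show ?case
  proof (rule Ck_on_SucI[OF S])
    show "((\<lambda>x. B (f x) (g x)) has_derivative (\<lambda>v. B (f x) (dir_deriv v g x) + B (dir_deriv v f x) (g x))) (at x)" if "x \<in> S" for x
      by (intro bounded_bilinear.FDERIV[OF B] Ck_on_1_has_derivative[OF S that Suc.prems(1)] Ck_on_1_has_derivative[OF S that Suc.prems(2)])
    show "Ck_on k UNIV S (\<lambda>x. B (f x) (dir_deriv v g x) + B (dir_deriv v f x) (g x))" for v
      by (intro Ck_on_add[OF S] Suc.IH Ck_on_Suc_imp[OF Suc.prems(1)] Ck_on_Suc_imp[OF Suc.prems(2)]
          Ck_on_SucD(1)[OF Suc.prems(1) UNIV_I] Ck_on_SucD(1)[OF Suc.prems(2) UNIV_I])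
  qed
qed

text \<open>The chain rule differentiates \<open>g\<close> in the direction
  \<open>dir_deriv v f x\<close>, which varies with \<open>x\<close>, so the induction hypothesis
  does not apply as it stands. Expanding the direction in the basis leaves products of components of
  a derivative of \<open>f\<close> with fixed partial derivatives of \<open>g\<close> along
  \<open>f\<close>.\<close>

lemma Ck_on_compose:
  fixes f :: "'a::euclidean_space \<Rightarrow> 'b::euclidean_space" and g :: "'b \<Rightarrow> 'c::real_normed_vector"
  assumes S: "open S" and T: "open T" and sub: "f ` S \<subseteq> T"
    and f: "Ck_on k UNIV S f" and g: "Ck_on k UNIV T g"
  shows "Ck_on k UNIV S (\<lambda>x. g (f x))"
  using f g
proof (induction k arbitrary: g)
  case 0
  then show ?case using sub by (auto intro: continuous_on_compose2)
next
  case (Suc k)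
  have fk: "Ck_on k UNIV S f" using Suc.prems(1) by (rule Ck_on_Suc_imp)
  show ?case
  proof (rule Ck_on_SucI[OF S])
    fix x assume x: "x \<in> S"
    then have "f x \<in> T" using sub by auto
    note df = Ck_on_1_has_derivative[OF S x Suc.prems(1)]
    note dg = Ck_on_1_has_derivative[OF T \<open>f x \<in> T\<close> Suc.prems(2)]
    have "((\<lambda>x. g (f x)) has_derivative (\<lambda>v. dir_deriv (dir_deriv v f x) g (f x))) (at x)"
      using diff_chain_at[OF df dg] by (simp add: comp_def)
    moreover have "dir_deriv w g (f x) = (\<Sum>b\<in>Basis. (w \<bullet> b) *\<^sub>R dir_deriv b g (f x))" for w
    proof -
      interpret lg: bounded_linear "\<lambda>v. dir_deriv v g (f x)" using dg by (rule has_derivative_bounded_linear)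
      have "dir_deriv w g (f x) = dir_deriv (\<Sum>b\<in>Basis. (w \<bullet> b) *\<^sub>R b) g (f x)" by (simp add: euclidean_representation)
      also have "\<dots> = (\<Sum>b\<in>Basis. (w \<bullet> b) *\<^sub>R dir_deriv b g (f x))" by (simp add: lg.sum lg.scale)
      finally show ?thesis .
    qed
    then have "(\<lambda>v. dir_deriv (dir_deriv v f x) g (f x)) = (\<lambda>v. \<Sum>b\<in>Basis. (dir_deriv v f x \<bullet> b) *\<^sub>R dir_deriv b g (f x))"
      by blast
    ultimately show "((\<lambda>x. g (f x)) has_derivative (\<lambda>v. \<Sum>b\<in>Basis. (dir_deriv v f x \<bullet> b) *\<^sub>R dir_deriv b g (f x))) (at x)"
      by (simp only:)
  next
    fix v
    show "Ck_on k UNIV S (\<lambda>x. \<Sum>b\<in>Basis. (dir_deriv v f x \<bullet> b) *\<^sub>R dir_deriv b g (f x))"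
      using Suc.prems fk
      by (intro Ck_on_sum[OF S] Ck_on_bilinear[OF S bounded_bilinear_scaleR]
          Ck_on_bounded_linear_compose[OF S bounded_linear_inner_left] Suc.IH) auto
  qed
qed

lemma Ck_on_Pair:
  fixes f :: "'a::euclidean_space \<Rightarrow> 'b::real_normed_vector" and g :: "'a \<Rightarrow> 'c::real_normed_vector"
  assumes S: "open S" and "Ck_on k UNIV S f" "Ck_on k UNIV S g"
  shows "Ck_on k UNIV S (\<lambda>x. (f x, g x))"
proof -
  have 1: "bounded_linear (\<lambda>x. (x, 0::'c))" "bounded_linear (\<lambda>x. (0::'b, x))"
    by (intro bounded_linear_Pair bounded_linear_ident bounded_linear_zero)+
  have "Ck_on k UNIV S (\<lambda>x. (f x, 0) + (0, g x))"
    by (intro Ck_on_add[OF S] Ck_on_bounded_linear_compose[OF S 1(1)] Ck_on_bounded_linear_compose[OF S 1(2)] assms)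
  then show ?thesis by simp
qed

text \<open>A subspace \<open>V\<close> is reduced to the full space by composing with a linear projection onto \<open>V\<close>.\<close>

definition lproj :: "'e::euclidean_space set \<Rightarrow> 'e \<Rightarrow> 'e" where
  "lproj V = (SOME P. linear P \<and> range P \<subseteq> V \<and> (\<forall>v\<in>V. P v = v))"

lemma lproj:
  assumes "subspace V"
  shows "linear (lproj V)" "lproj V y \<in> V" "v \<in> V \<Longrightarrow> lproj V v = v"
proof -
  have "\<exists>P::'a\<Rightarrow>'a. linear P \<and> range P \<subseteq> V \<and> (\<forall>v\<in>V. P v = v)"
    using linear_exists_left_inverse_on[of id V] assms linear_id by auto
  then have *: "linear (lproj V) \<and> range (lproj V) \<subseteq> V \<and> (\<forall>v\<in>V. lproj V v = v)"
    unfolding lproj_def by (rule someI_ex)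
  then show "linear (lproj V)" "lproj V y \<in> V" "v \<in> V \<Longrightarrow> lproj V v = v" by auto
qed

lemma dir_deriv_lproj:
  assumes "subspace V"
  shows "dir_deriv v (\<lambda>y. f (lproj V y)) = (\<lambda>y. dir_deriv (lproj V v) f (lproj V y))"
  using lproj(1)[OF assms] by (auto simp: dir_deriv_def linear_add linear_scale)

lemma continuous_on_lproj:
  assumes V: "subspace V" and S: "S \<subseteq> V"
  shows "continuous_on S f \<longleftrightarrow> continuous_on {y. lproj V y \<in> S} (\<lambda>y. f (lproj V y))"
proof
  assume "continuous_on S f"
  then show "continuous_on {y. lproj V y \<in> S} (\<lambda>y. f (lproj V y))"
    using linear_continuous_on[of "lproj V" "{y. lproj V y \<in> S}"] lproj[OF V]
    by (auto intro!: continuous_on_compose2[of S f] simp: linear_conv_bounded_linear)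
next
  assume "continuous_on {y. lproj V y \<in> S} (\<lambda>y. f (lproj V y))"
  then have "continuous_on S (\<lambda>y. f (lproj V y))"
    by (rule continuous_on_subset) (use S lproj(3)[OF V] in auto)
  then show "continuous_on S f"
    by (rule continuous_on_eq) (use S lproj(3)[OF V] in auto)
qed

text \<open>Differentiating \<open>f (lproj V y)\<close> along \<open>v\<close> is differentiating
  \<open>f\<close> along \<open>lproj V v\<close>, so the induction matches derivatives on both
  sides. The calculus of open subsets of the whole type thereby serves charts with values in a
  proper subspace.\<close>

lemma Ck_on_lproj:
  assumes V: "subspace V" and S: "S \<subseteq> V"
  shows "Ck_on k V S f \<longleftrightarrow> Ck_on k UNIV {y. lproj V y \<in> S} (\<lambda>y. f (lproj V y))"
proof (induction k arbitrary: f)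
  case 0
  show ?case by (simp add: continuous_on_lproj[OF assms])
next
  case (Suc k)
  note cont = continuous_on_lproj[OF assms, of f]
  have 1: "(\<lambda>t::real. f (lproj V (y + t *\<^sub>R v))) = (\<lambda>t. f (lproj V y + t *\<^sub>R lproj V v))" for y v
    using lproj(1)[OF V] by (simp add: linear_add linear_scale)
  define D where "D x v \<longleftrightarrow> (\<lambda>t::real. f (x + t *\<^sub>R v)) differentiable (at 0)" for x v
  define B where "B v \<longleftrightarrow> Ck_on k V S (dir_deriv v f)" for v
  have L: "Ck_on (Suc k) V S f \<longleftrightarrow> continuous_on S f \<and> (\<forall>v\<in>V. (\<forall>x\<in>S. D x v) \<and> B v)"
    by (simp add: D_def B_def)
  have R: "Ck_on (Suc k) UNIV {y. lproj V y \<in> S} (\<lambda>y. f (lproj V y)) \<longleftrightarrow>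
     continuous_on S f \<and> (\<forall>v. (\<forall>y. lproj V y \<in> S \<longrightarrow> D (lproj V y) (lproj V v)) \<and> B (lproj V v))"
    unfolding Ck_on.simps cont dir_deriv_lproj[OF V] 1 D_def B_def Suc.IH by simp
  show ?case unfolding L R
  proof (intro conj_cong refl iffI ballI allI impI conjI)
    fix v assume H: "\<forall>v\<in>V. (\<forall>x\<in>S. D x v) \<and> B v"
    show "B (lproj V v)" using H lproj(2)[OF V] by simp
    fix y assume "lproj V y \<in> S"
    then show "D (lproj V y) (lproj V v)" using H lproj(2)[OF V] by simp
  next
    fix v assume H: "\<forall>v. (\<forall>y. lproj V y \<in> S \<longrightarrow> D (lproj V y) (lproj V v)) \<and> B (lproj V v)" and v: "v \<in> V"
    have v': "lproj V v = v" using v lproj(3)[OF V] by simp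
    show "B v" using H v' by metis
    fix x assume x: "x \<in> S"
    then have "lproj V x = x" using S lproj(3)[OF V] by auto
    then show "D x v" using H v' x by metis
  qed
qed

lemma open_lproj_vimage:
  assumes V: "subspace V" and S: "openin (top_of_set V) S"
  shows "open {y. lproj V y \<in> S}"
proof -
  obtain T where T: "open T" "S = V \<inter> T" using S by (auto simp: openin_open)
  then have "{y. lproj V y \<in> S} = lproj V -` T" using lproj[OF V] by auto
  moreover have "continuous_on UNIV (lproj V)"
    using lproj(1)[OF V] by (simp add: linear_continuous_on linear_conv_bounded_linear)
  ultimately show ?thesis using T by (simp add: open_vimage)
qed

declare Ck_on.simps(2) [simp del]

lemma smooth_onD: "smooth_on V S f \<Longrightarrow> Ck_on k V S f"
  by (simp add: smooth_on_def)

lemma smooth_on_continuous: "smooth_on V S f \<Longrightarrow> continuous_on S f"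
  using smooth_onD Ck_on_continuous by blast

lemma smooth_on_subset: "smooth_on V S f \<Longrightarrow> T \<subseteq> S \<Longrightarrow> smooth_on V T f"
  using Ck_on_subset unfolding smooth_on_def by blast

lemma smooth_on_cong: "smooth_on V S f \<Longrightarrow> open S \<Longrightarrow> (\<And>y. y \<in> S \<Longrightarrow> f y = g y) \<Longrightarrow> smooth_on V S g"
  using Ck_on_cong unfolding smooth_on_def by blast

lemma smooth_on_local:
  assumes "\<And>x. x \<in> S \<Longrightarrow> \<exists>U. open U \<and> x \<in> U \<and> smooth_on V (U \<inter> S) f"
  shows "smooth_on V S f"
  unfolding smooth_on_def using assms by (intro allI Ck_on_local) (metis smooth_onD)

lemma smooth_on_has_derivative:
  fixes f :: "'a::euclidean_space \<Rightarrow> 'b::real_normed_vector"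
  assumes "smooth_on UNIV S f" "open S" "x \<in> S"
  shows "(f has_derivative (\<lambda>v. dir_deriv v f x)) (at x)"
  using assms smooth_onD Ck_on_1_has_derivative by blast

lemma smooth_on_dir_deriv_linear:
  fixes f :: "'a::euclidean_space \<Rightarrow> 'b::real_normed_vector"
  assumes "smooth_on UNIV S f" "open S" "x \<in> S"
  shows "bounded_linear (\<lambda>v. dir_deriv v f x)"
  using smooth_on_has_derivative[OF assms] by (rule has_derivative_bounded_linear)

lemma smooth_on_dir_deriv_expand:
  fixes f :: "'a::euclidean_space \<Rightarrow> 'b::real_normed_vector"
  assumes "smooth_on UNIV S f" "open S" "x \<in> S"
  shows "dir_deriv v f x = (\<Sum>b\<in>Basis. (v \<bullet> b) *\<^sub>R dir_deriv b f x)"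
proof -
  interpret bounded_linear "\<lambda>v. dir_deriv v f x" by (rule smooth_on_dir_deriv_linear[OF assms])
  have "dir_deriv v f x = dir_deriv (\<Sum>b\<in>Basis. (v \<bullet> b) *\<^sub>R b) f x" by (simp add: euclidean_representation)
  also have "\<dots> = (\<Sum>b\<in>Basis. (v \<bullet> b) *\<^sub>R dir_deriv b f x)" by (simp only: sum scale)
  finally show ?thesis .
qed

lemma smooth_on_dir_deriv: "smooth_on V S f \<Longrightarrow> v \<in> V \<Longrightarrow> smooth_on V S (dir_deriv v f)"
  unfolding smooth_on_def using Ck_on_SucD(1) by blast

lemma smooth_on_const: "smooth_on V S (\<lambda>x. c)"
  by (simp add: smooth_on_def Ck_on_const)

lemma smooth_on_id: "smooth_on V S (\<lambda>x. x)"
  by (simp add: smooth_on_def Ck_on_id)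

lemma smooth_on_linear:
  fixes L :: "'a::euclidean_space \<Rightarrow> 'b::real_normed_vector"
  shows "linear L \<Longrightarrow> smooth_on V S L"
  by (simp add: smooth_on_def Ck_on_linear)

lemma smooth_on_compose:
  fixes f :: "'a::euclidean_space \<Rightarrow> 'b::euclidean_space" and g :: "'b \<Rightarrow> 'c::real_normed_vector"
  assumes "smooth_on UNIV T g" "smooth_on UNIV S f" "open S" "open T" "\<And>x. x \<in> S \<Longrightarrow> f x \<in> T"
  shows "smooth_on UNIV S (\<lambda>x. g (f x))"
  using assms Ck_on_compose[of S T f _ g] unfolding smooth_on_def by blast

lemma smooth_on_linear_compose:
  fixes f :: "'a::euclidean_space \<Rightarrow> 'b::euclidean_space" and L :: "'b \<Rightarrow> 'c::real_normed_vector"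
  shows "linear L \<Longrightarrow> smooth_on UNIV S f \<Longrightarrow> open S \<Longrightarrow> smooth_on UNIV S (\<lambda>x. L (f x))"
  by (rule smooth_on_compose[of UNIV]) (auto intro: smooth_on_linear)

lemma smooth_on_add:
  fixes f g :: "'a::euclidean_space \<Rightarrow> 'b::real_normed_vector"
  shows "smooth_on UNIV S f \<Longrightarrow> smooth_on UNIV S g \<Longrightarrow> open S \<Longrightarrow> smooth_on UNIV S (\<lambda>x. f x + g x)"
  by (simp add: smooth_on_def Ck_on_add)

lemma smooth_on_minus:
  fixes f :: "'a::euclidean_space \<Rightarrow> 'b::real_normed_vector"
  shows "smooth_on UNIV S f \<Longrightarrow> open S \<Longrightarrow> smooth_on UNIV S (\<lambda>x. - f x)"
  unfolding smooth_on_def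
  by (intro allI Ck_on_bounded_linear_compose[where L=uminus] bounded_linear_minus bounded_linear_ident) auto

lemma smooth_on_diff:
  fixes f g :: "'a::euclidean_space \<Rightarrow> 'b::real_normed_vector"
  shows "smooth_on UNIV S f \<Longrightarrow> smooth_on UNIV S g \<Longrightarrow> open S \<Longrightarrow> smooth_on UNIV S (\<lambda>x. f x - g x)"
  using smooth_on_add[of S f "\<lambda>x. - g x"] smooth_on_minus[of S g] by simp

lemma smooth_on_sum:
  fixes f :: "'i \<Rightarrow> 'a::euclidean_space \<Rightarrow> 'b::real_normed_vector"
  assumes "\<And>i. i \<in> I \<Longrightarrow> smooth_on UNIV S (f i)" "open S"
  shows "smooth_on UNIV S (\<lambda>x. \<Sum>i\<in>I. f i x)"
  using assms unfolding smooth_on_def by (intro allI Ck_on_sum) auto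

lemma smooth_on_scaleR:
  fixes f :: "'a::euclidean_space \<Rightarrow> real" and g :: "'a \<Rightarrow> 'b::real_normed_vector"
  shows "smooth_on UNIV S f \<Longrightarrow> smooth_on UNIV S g \<Longrightarrow> open S \<Longrightarrow> smooth_on UNIV S (\<lambda>x. f x *\<^sub>R g x)"
  unfolding smooth_on_def by (intro allI Ck_on_bilinear[OF _ bounded_bilinear_scaleR]) auto

lemma smooth_on_inner_left:
  fixes f :: "'a::euclidean_space \<Rightarrow> 'b::euclidean_space"
  shows "smooth_on UNIV S f \<Longrightarrow> open S \<Longrightarrow> smooth_on UNIV S (\<lambda>x. f x \<bullet> b)"
  by (rule smooth_on_linear_compose[of "\<lambda>x. x \<bullet> b"]) (auto simp: bounded_linear.linear bounded_linear_inner_left)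

lemma smooth_on_Pair:
  fixes f :: "'a::euclidean_space \<Rightarrow> 'b::real_normed_vector" and g :: "'a \<Rightarrow> 'c::real_normed_vector"
  shows "smooth_on UNIV S f \<Longrightarrow> smooth_on UNIV S g \<Longrightarrow> open S \<Longrightarrow> smooth_on UNIV S (\<lambda>x. (f x, g x))"
  by (simp add: smooth_on_def Ck_on_Pair)

lemma linear_fst [simp, intro]: "linear fst" and linear_snd [simp, intro]: "linear snd"
  by (auto simp: linear_iff)

lemma smooth_on_fst:
  fixes S :: "('a::euclidean_space \<times> 'b::euclidean_space) set"
  shows "smooth_on UNIV S fst"
  by (rule smooth_on_linear) simp

lemma smooth_on_snd:
  fixes S :: "('a::euclidean_space \<times> 'b::euclidean_space) set"
  shows "smooth_on UNIV S snd"
  by (rule smooth_on_linear) simp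

lemma smooth_on_lproj:
  fixes f :: "'e::euclidean_space \<Rightarrow> 'b::real_normed_vector"
  assumes "subspace V" "S \<subseteq> V"
  shows "smooth_on V S f \<longleftrightarrow> smooth_on UNIV {y. lproj V y \<in> S} (\<lambda>y. f (lproj V y))"
  unfolding smooth_on_def using Ck_on_lproj[OF assms, of _ f] by blast

lemma dir_deriv_chain:
  assumes "(g has_derivative g') (at (f x))" "(f has_derivative f') (at x)"
  shows "dir_deriv v (\<lambda>x. g (f x)) x = g' (f' v)"
  using has_derivative_dir_deriv[OF diff_chain_at[OF assms(2,1)]] by (simp add: comp_def)

lemma dir_deriv_compose:
  fixes f :: "'a::euclidean_space \<Rightarrow> 'b::euclidean_space" and g :: "'b \<Rightarrow> 'c::real_normed_vector"
  assumes "smooth_on UNIV T g" "smooth_on UNIV S f" "open S" "open T" "x \<in> S" "f x \<in> T"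
  shows "dir_deriv v (\<lambda>x. g (f x)) x = dir_deriv (dir_deriv v f x) g (f x)"
  using dir_deriv_chain[OF smooth_on_has_derivative[OF assms(1,4,6)] smooth_on_has_derivative[OF assms(2,3,5)]] .

section \<open>The smooth inverse function theorem\<close>

text \<open>A product rule in which the second factor is only continuous: since \<open>q\<close>
  vanishes at \<open>y\<close>, the variation of \<open>a\<close> enters as a product of two small
  quantities. It differentiates the derivative of an inverse function before that derivative is
  known to be differentiable.\<close>

lemma has_derivative_scaleR_zero:
  fixes q :: "'a::real_normed_vector \<Rightarrow> real" and a :: "'a \<Rightarrow> 'b::real_normed_vector"
  assumes q: "(q has_derivative q') (at y)" "q y = 0" and a: "isCont a y"
  shows "((\<lambda>x. q x *\<^sub>R a x) has_derivative (\<lambda>w. q' w *\<^sub>R a y)) (at y)"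
proof -
  have bl: "bounded_linear q'" using q(1) by (rule has_derivative_bounded_linear)
  then obtain K where K: "\<And>w. norm (q' w) \<le> norm w * K" "K > 0"
    using bounded_linear.pos_bounded by blast
  have 1: "((\<lambda>x. q x *\<^sub>R a y) has_derivative (\<lambda>w. q' w *\<^sub>R a y)) (at y)"
    using q(1) by (auto intro!: derivative_eq_intros)
  have 2: "((\<lambda>x. q x *\<^sub>R (a x - a y)) has_derivative (\<lambda>w. 0)) (at y)"
    unfolding has_derivative_at_alt
  proof (intro conjI allI impI)
    fix e :: real assume e: "e > 0"
    obtain d1 where d1: "d1 > 0" "\<And>x. norm (x - y) < d1 \<Longrightarrow> norm (q x - q y - q' (x - y)) \<le> 1 * norm (x - y)"
      using q(1) unfolding has_derivative_at_alt using zero_less_one by blast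
    obtain d2 where d2: "d2 > 0" "\<And>x. norm (x - y) < d2 \<Longrightarrow> norm (a x - a y) < e / (1 + K)"
      using a e K(2) unfolding continuous_at_eps_delta dist_norm
      by (metis add_pos_pos divide_pos_pos zero_less_one)
    show "\<exists>d>0. \<forall>x. norm (x - y) < d \<longrightarrow> norm (q x *\<^sub>R (a x - a y) - q y *\<^sub>R (a y - a y) - 0) \<le> e * norm (x - y)"
    proof (intro exI[of _ "min d1 d2"] conjI allI impI)
      fix x assume x: "norm (x - y) < min d1 d2"
      have "norm (q x) \<le> norm (q x - q y - q' (x - y)) + norm (q' (x - y))"
        using q(2) norm_triangle_ineq[of "q x - q' (x - y)" "q' (x - y)"] by simp
      also have "\<dots> \<le> (1 + K) * norm (x - y)"
        using d1(2)[of x] x K(1)[of "x - y"] by (simp add: algebra_simps)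
      finally have A: "norm (q x) \<le> (1 + K) * norm (x - y)" .
      have "norm (q x) * norm (a x - a y) \<le> ((1 + K) * norm (x - y)) * (e / (1 + K))"
        using A d2(2)[of x] x K(2) by (intro mult_mono) auto
      also have "\<dots> = e * norm (x - y)" using K(2) by (simp add: field_simps)
      finally show "norm (q x *\<^sub>R (a x - a y) - q y *\<^sub>R (a y - a y) - 0) \<le> e * norm (x - y)" by simp
    qed (use d1 d2 in auto)
  qed auto
  have "((\<lambda>x. q x *\<^sub>R a y + q x *\<^sub>R (a x - a y)) has_derivative (\<lambda>w. q' w *\<^sub>R a y + 0)) (at y)"
    by (rule has_derivative_add[OF 1 2])
  then show ?thesis by (simp add: algebra_simps)
qed

text \<open>\<open>inverse_function_theorem\<close> supplies a differentiable inverse; the rest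
  raises its regularity. The derivative \<open>a v y\<close> of \<open>g\<close> along
  \<open>v\<close> solves a linear equation whose coefficients are derivatives of \<open>f\<close>
  at \<open>g y\<close>. Hence it is continuous, then differentiable with a derivative polynomial in
  values of \<open>a\<close> and second derivatives of \<open>f\<close> along \<open>g\<close>, and
  induction gives every order.\<close>

theorem smooth_inverse_function:
  fixes f :: "'a::euclidean_space \<Rightarrow> 'a"
  assumes S: "open S" "x0 \<in> S" and f: "smooth_on UNIV S f"
    and inj: "\<And>v. dir_deriv v f x0 = 0 \<Longrightarrow> v = 0"
  obtains A B g where "open A" "x0 \<in> A" "A \<subseteq> S" "open B" "homeomorphism A B f g" "smooth_on UNIV B g"
    "\<And>y w. y \<in> B \<Longrightarrow> dir_deriv (dir_deriv w g y) f (g y) = w"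
proof -
  define F where "F x = Blinfun (\<lambda>v. dir_deriv v f x)" for x
  have F: "blinfun_apply (F x) = (\<lambda>v. dir_deriv v f x)" if "x \<in> S" for x
    unfolding F_def using smooth_on_dir_deriv_linear[OF f S(1) that] by (rule bounded_linear_Blinfun_apply)
  have contF: "continuous_on S F"
  proof (rule continuous_on_blinfun_componentwise)
    fix i :: 'a
    have "continuous_on S (dir_deriv i f)"
      using smooth_on_continuous[OF smooth_on_dir_deriv[OF f]] by simp
    then show "continuous_on S (\<lambda>x. blinfun_apply (F x) i)"
      by (rule continuous_on_eq) (simp add: F)
  qed
  have linF: "linear (blinfun_apply (F x))" for x by (simp add: blinfun.bounded_linear_right bounded_linear.linear)
  have injF: "inj (blinfun_apply (F x0))"
    using inj F[OF S(2)] linear_injective_0[OF linF, of x0] by metis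
  obtain c where c: "c > 0" "\<And>w. 2 * c * norm w \<le> norm (F x0 w)"
  proof -
    obtain B where "B > 0" "\<And>w. B * norm w \<le> norm (F x0 w)"
      using linear_inj_bounded_below_pos[OF linF injF] by blast
    then show ?thesis by (intro that[of "B/2"]) auto
  qed
  \<comment> \<open>At \<open>x0\<close> the differential is bounded below by \<open>2 * c\<close>;
    where it has moved by less than \<open>c\<close>, the lower bound \<open>c\<close>
    survives.\<close>
  define S' where "S' = {x \<in> S. dist (F x) (F x0) < c}"
  have oS': "open S'"
    unfolding S'_def using contF S(1)
    using continuous_open_preimage[OF contF S(1) open_ball[of "F x0" c]]
    by (auto simp: vimage_def Int_def dist_commute)
  have S': "x0 \<in> S'" "S' \<subseteq> S" using c S by (auto simp: S'_def)
  have low: "c * norm w \<le> norm (dir_deriv w f x)" if "x \<in> S'" for x w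
  proof -
    have "norm ((F x - F x0) w) \<le> norm (F x - F x0) * norm w" by (rule norm_blinfun)
    also have "\<dots> \<le> c * norm w" using that by (intro mult_right_mono) (auto simp: S'_def dist_norm)
    finally have "norm (F x w - F x0 w) \<le> c * norm w" by (simp add: blinfun.diff_left)
    moreover have "norm (F x0 w) - norm (F x w) \<le> norm (F x w - F x0 w)"
      by (metis norm_minus_commute norm_triangle_ineq2)
    ultimately have "c * norm w \<le> norm (F x w)" using c(2)[of w] by linarith
    then show ?thesis using F that S' by auto
  qed
  obtain J where J: "linear J" "J \<circ> blinfun_apply (F x0) = id"
    using linear_injective_left_inverse[OF linF injF] by blast
  have Jinv: "Blinfun J o\<^sub>L F x0 = id_blinfun"
    using J by (intro blinfun_eqI) (simp add: bounded_linear_Blinfun_apply linear_conv_bounded_linear comp_def id_def fun_eq_iff)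
  have df: "(f has_derivative blinfun_apply (F x)) (at x)" if "x \<in> S'" for x
    using smooth_on_has_derivative[OF f S(1)] F that S' by auto
  obtain A B g g' where IF: "open A" "A \<subseteq> S'" "x0 \<in> A" "open B" "f x0 \<in> B" "homeomorphism A B f g"
    "\<And>y. y \<in> B \<Longrightarrow> (g has_derivative (g' y)) (at y)"
    "\<And>y. y \<in> B \<Longrightarrow> g' y = inv_into UNIV (blinfun_apply (F (g y)))"
    "\<And>y. y \<in> B \<Longrightarrow> bij (blinfun_apply (F (g y)))"
    using inverse_function_theorem[OF oS' df continuous_on_subset[OF contF S'(2)] S'(1) Jinv] by metis
  have gB: "g y \<in> S'" "g y \<in> S" if "y \<in> B" for y
    using IF(2) S' IF(6) that unfolding homeomorphism_def by auto
  define a where "a v y = g' y v" for v y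
  have a: "dir_deriv (a v y) f (g y) = v" if "y \<in> B" for v y
    using IF(8,9)[OF that] F[OF gB(2)[OF that]] unfolding a_def by (metis bij_inv_eq_iff)
  have a_eqI: "u = a v y" if "y \<in> B" "dir_deriv u f (g y) = v" for u v y
    using IF(8,9)[OF that(1)] F[OF gB(2)[OF that(1)]] that(2) unfolding a_def by (metis bij_inv_eq_iff)
  have gd: "(g has_derivative (\<lambda>v. a v y)) (at y)" if "y \<in> B" for y
    using IF(7)[OF that] unfolding a_def by simp
  have ga: "dir_deriv v g y = a v y" if "y \<in> B" for v y
    using has_derivative_dir_deriv[OF gd[OF that]] .
  have blin: "bounded_linear (\<lambda>v. a v y)" if "y \<in> B" for y
    using gd[OF that] by (rule has_derivative_bounded_linear)
  have contg: "continuous_on B g" using IF(6) by (simp add: homeomorphism_def)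
  have contDf: "continuous_on B (\<lambda>y. dir_deriv u f (g y))" for u
    using smooth_on_continuous[OF smooth_on_dir_deriv[OF f UNIV_I]] contg gB
    by (auto intro: continuous_on_compose2)
  have dlin: "linear (\<lambda>v. dir_deriv v f (g y))" if "y \<in> B" for y
    using smooth_on_dir_deriv_linear[OF f S(1) gB(2)[OF that]] by (rule bounded_linear.linear)
  \<comment> \<open>The differential at \<open>g z\<close> sends \<open>a v z - a v y\<close> to
    \<open>v - dir_deriv (a v y) f (g z)\<close>, which tends to 0 as \<open>z\<close> tends to
    \<open>y\<close>; the lower bound \<open>low\<close> transfers this to the difference
    itself.\<close>
  have conta: "isCont (a v) y" if y: "y \<in> B" for v y
  proof -
    have *: "norm (a v z - a v y) \<le> norm (v - dir_deriv (a v y) f (g z)) / c" if z: "z \<in> B" for z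
    proof -
      have "c * norm (a v z - a v y) \<le> norm (dir_deriv (a v z - a v y) f (g z))"
        by (rule low[OF gB(1)[OF z]])
      also have "dir_deriv (a v z - a v y) f (g z) = v - dir_deriv (a v y) f (g z)"
        using linear_diff[OF dlin[OF z], of "a v z" "a v y"] a[OF z] by simp
      finally show ?thesis using c by (simp add: field_simps)
    qed
    have "((\<lambda>z. norm (v - dir_deriv (a v y) f (g z)) / c) \<longlongrightarrow> norm (v - dir_deriv (a v y) f (g y)) / c) (at y)"
      using contDf[of "a v y"] IF(4) y c
      by (intro tendsto_intros) (auto simp: continuous_on_eq_continuous_at isCont_def)
    then have "((\<lambda>z. norm (v - dir_deriv (a v y) f (g z)) / c) \<longlongrightarrow> 0) (at y)"
      by (simp add: a[OF y])
    moreover have "\<forall>\<^sub>F z in at y. norm (a v z - a v y) \<le> norm (v - dir_deriv (a v y) f (g z)) / c"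
      using * IF(4) y by (auto simp: eventually_at_topological)
    ultimately have "((\<lambda>z. a v z - a v y) \<longlongrightarrow> 0) (at y)"
      by (rule Lim_null_comparison[rotated])
    then show ?thesis unfolding isCont_def by (simp add: LIM_zero_iff)
  qed
  \<comment> \<open>The second derivative of \<open>f\<close> at \<open>g y\<close> in the
    directions \<open>a w y\<close> and \<open>a v y\<close>, written with constant directions so
    that its regularity can be read off term by term.\<close>
  define H where "H v w y = (\<Sum>i\<in>Basis. \<Sum>j\<in>Basis. ((a w y \<bullet> i) * (a v y \<bullet> j)) *\<^sub>R dir_deriv i (dir_deriv j f) (g y))" for v w y
  have ada: "(a v has_derivative (\<lambda>w. - (\<Sum>b\<in>Basis. (H v w y \<bullet> b) *\<^sub>R a b y))) (at y)" if y: "y \<in> B" for v y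
  proof -
    define u where "u = a v y"
    \<comment> \<open>With \<open>u = a v y\<close> frozen this is an identity and no approximation:
      the differential at \<open>g z\<close> sends both sides to \<open>v\<close>. The coefficients
      vanish at \<open>z = y\<close>, so \<open>has_derivative_scaleR_zero\<close> applies although
      \<open>a b\<close> is only known to be continuous.\<close>
    have e: "a v z = u - (\<Sum>b\<in>Basis. ((dir_deriv u f (g z) - v) \<bullet> b) *\<^sub>R a b z)" if z: "z \<in> B" for z
    proof -
      interpret l: bounded_linear "\<lambda>v. dir_deriv v f (g z)" using smooth_on_dir_deriv_linear[OF f S(1) gB(2)[OF z]] .
      have "dir_deriv (u - (\<Sum>b\<in>Basis. ((dir_deriv u f (g z) - v) \<bullet> b) *\<^sub>R a b z)) f (g z)
         = dir_deriv u f (g z) - (\<Sum>b\<in>Basis. ((dir_deriv u f (g z) - v) \<bullet> b) *\<^sub>R b)"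
        by (simp only: l.diff l.sum l.scale a[OF z])
      also have "\<dots> = v" by (simp only: euclidean_representation) simp
      finally show ?thesis using a_eqI[OF z] by metis
    qed
    have dq: "((\<lambda>z. (dir_deriv u f (g z) - v) \<bullet> b) has_derivative (\<lambda>w. dir_deriv (a w y) (dir_deriv u f) (g y) \<bullet> b)) (at y)" for b
    proof -
      have "((\<lambda>z. dir_deriv u f (g z)) has_derivative (\<lambda>w. dir_deriv (a w y) (dir_deriv u f) (g y))) (at y)"
        using diff_chain_at[OF gd[OF y] smooth_on_has_derivative[OF smooth_on_dir_deriv[OF f UNIV_I] S(1) gB(2)[OF y]]]
        by (simp add: comp_def)
      from has_derivative_inner_left[OF has_derivative_diff[OF this has_derivative_const[of v]], of b]
      show ?thesis by simp
    qed
    have "((\<lambda>z. u - (\<Sum>b\<in>Basis. ((dir_deriv u f (g z) - v) \<bullet> b) *\<^sub>R a b z)) has_derivative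
      (\<lambda>w. 0 - (\<Sum>b\<in>Basis. (dir_deriv (a w y) (dir_deriv u f) (g y) \<bullet> b) *\<^sub>R a b y))) (at y)"
      by (intro has_derivative_diff has_derivative_const has_derivative_sum has_derivative_scaleR_zero[OF dq] conta[OF y])
         (simp add: u_def a[OF y])
    then have "(a v has_derivative (\<lambda>w. 0 - (\<Sum>b\<in>Basis. (dir_deriv (a w y) (dir_deriv u f) (g y) \<bullet> b) *\<^sub>R a b y))) (at y)"
      by (rule has_derivative_transform_within_open[OF _ IF(4) y]) (use e in auto)
    moreover have "dir_deriv (a w y) (dir_deriv u f) (g y) = H v w y" for w
    proof -
      have "dir_deriv (a w y) (dir_deriv u f) (g y) = (\<Sum>i\<in>Basis. (a w y \<bullet> i) *\<^sub>R dir_deriv i (dir_deriv u f) (g y))"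
        by (rule smooth_on_dir_deriv_expand[OF smooth_on_dir_deriv[OF f UNIV_I] S(1) gB(2)[OF y]])
      moreover have "dir_deriv i (dir_deriv u f) (g y) = (\<Sum>j\<in>Basis. (u \<bullet> j) *\<^sub>R dir_deriv i (dir_deriv j f) (g y))" for i
      proof -
        have "dir_deriv i (dir_deriv u f) (g y) = dir_deriv i (\<lambda>x. \<Sum>j\<in>Basis. (u \<bullet> j) *\<^sub>R dir_deriv j f x) (g y)"
          using smooth_on_dir_deriv_expand[OF f S(1)] by (intro dir_deriv_cong(1)[OF S(1) gB(2)[OF y]])
        also have "\<dots> = (\<Sum>j\<in>Basis. (u \<bullet> j) *\<^sub>R dir_deriv i (dir_deriv j f) (g y))"
          by (rule has_derivative_dir_deriv) (intro has_derivative_sum has_derivative_scaleR_right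
             smooth_on_has_derivative[OF smooth_on_dir_deriv[OF f UNIV_I] S(1) gB(2)[OF y]])
        finally show ?thesis .
      qed
      ultimately show ?thesis
        by (simp add: H_def u_def scaleR_sum_right)
    qed
    ultimately show ?thesis by simp
  qed
  \<comment> \<open>\<open>g\<close> gains an order from \<open>a\<close>, and \<open>a\<close>
    gains one from \<open>H\<close>, which involves both at the lower order; hence the joint
    induction.\<close>
  have Ck: "Ck_on k UNIV B g \<and> (\<forall>v. Ck_on k UNIV B (a v))" for k
  proof (induction k)
    case 0
    show ?case using contg conta IF(4) by (auto simp: continuous_on_eq_continuous_at)
  next
    case (Suc k)
    have g: "Ck_on (Suc k) UNIV B g"
      using gd Suc by (intro Ck_on_SucI[OF IF(4)]) auto
    have ck2: "Ck_on k UNIV B (\<lambda>y. dir_deriv i (dir_deriv j f) (g y))" for i j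
    proof (rule Ck_on_compose[OF IF(4) S(1), where f=g])
      show "g ` B \<subseteq> S" using gB by blast
      show "Ck_on k UNIV B g" using Suc by blast
      show "Ck_on k UNIV S (dir_deriv i (dir_deriv j f))"
        by (rule smooth_onD) (rule smooth_on_dir_deriv[OF smooth_on_dir_deriv[OF f UNIV_I] UNIV_I])
    qed
    have ak: "Ck_on k UNIV B (a v)" for v using Suc by blast
    have inn: "Ck_on k UNIV B (\<lambda>y. F y \<bullet> b)" if "Ck_on k UNIV B F" for F and b :: 'a
      by (rule Ck_on_bounded_linear_compose[OF IF(4) bounded_linear_inner_left that])
    have "Ck_on k UNIV B (\<lambda>y. H v w y)" for v w
      unfolding H_def
      by (intro Ck_on_sum[OF IF(4)] Ck_on_bilinear[OF IF(4) bounded_bilinear_scaleR]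
          Ck_on_bilinear[OF IF(4) bounded_bilinear_mult] inn ck2 ak)
    then have Hk: "Ck_on k UNIV B (\<lambda>y. - (\<Sum>b\<in>Basis. (H v w y \<bullet> b) *\<^sub>R a b y))" for v w
      by (intro Ck_on_bounded_linear_compose[OF IF(4), of uminus] bounded_linear_minus bounded_linear_ident
          Ck_on_sum[OF IF(4)] Ck_on_bilinear[OF IF(4) bounded_bilinear_scaleR] inn ak) blast
    have "Ck_on (Suc k) UNIV B (a v)" for v
      by (rule Ck_on_SucI[OF IF(4) ada Hk])
    then show ?case using g by blast
  qed
  show ?thesis
  proof (rule that[OF IF(1,3) _ IF(4,6)])
    show "A \<subseteq> S" using IF(2) S' by auto
    show "smooth_on UNIV B g" using Ck by (simp add: smooth_on_def)
    show "dir_deriv (dir_deriv w g y) f (g y) = w" if "y \<in> B" for y w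
      using a ga that by simp
  qed
qed

section \<open>Plots\<close>

text \<open>Smoothness of maps between manifolds is tested on plots, that is, on smooth maps
  from open subsets of Euclidean spaces.\<close>

definition charted :: "('a, 'e::euclidean_space) manifold \<Rightarrow> bool" where
  "charted M \<longleftrightarrow> (\<forall>c\<in>atlas M. topological_chart (topo M) c) \<and> (\<Union>(U, V, \<phi>)\<in>atlas M. U) = topspace (topo M)"

definition plot :: "('a, 'e::euclidean_space) manifold \<Rightarrow> 'z::euclidean_space set \<Rightarrow> ('z \<Rightarrow> 'a) \<Rightarrow> bool" where
  "plot M S c \<longleftrightarrow> open S \<and> continuous_map (top_of_set S) (topo M) c \<and>
     (\<forall>(U, V, \<phi>)\<in>atlas M. smooth_on UNIV {x\<in>S. c x \<in> U} (\<lambda>x. \<phi> (c x)))"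

text \<open>The inverse of a chart, precomposed with the projection onto its model space. It is
  constant along the kernel of the projection and lives on \<open>chart_dom c\<close>, which is open
  in the whole type; so it can be a plot.\<close>

definition chart_param :: "('a, 'e::euclidean_space) chart \<Rightarrow> 'e \<Rightarrow> 'a" where
  "chart_param c y = inv_into (fst c) (snd (snd c)) (lproj (fst (snd c)) y)"

definition chart_dom :: "('a, 'e::euclidean_space) chart \<Rightarrow> 'e set" where
  "chart_dom c = {y. lproj (fst (snd c)) y \<in> snd (snd c) ` fst c}"

lemma smooth_manifold_charted: "smooth_manifold M \<Longrightarrow> charted M"
  by (simp add: smooth_manifold_def charted_def)

lemma topological_chartD:
  assumes "topological_chart X (U, V, \<phi>)"
  shows "openin X U" "U \<subseteq> topspace X" "subspace V" "openin (top_of_set V) (\<phi> ` U)" "inj_on \<phi> U" "\<phi> ` U \<subseteq> V"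
    "continuous_map (subtopology X U) euclidean \<phi>"
    "homeomorphic_maps (subtopology X U) (top_of_set (\<phi> ` U)) \<phi> (inv_into U \<phi>)"
    "continuous_map (top_of_set (\<phi> ` U)) X (inv_into U \<phi>)"
proof -
  show 1: "openin X U" "subspace V" "openin (top_of_set V) (\<phi> ` U)" using assms by auto
  show 2: "U \<subseteq> topspace X" using 1 openin_subset by blast
  then have ts: "topspace (subtopology X U) = U" by auto
  have h: "homeomorphic_map (subtopology X U) (top_of_set (\<phi> ` U)) \<phi>" using assms by auto
  show inj: "inj_on \<phi> U" using homeomorphic_imp_injective_map[OF h] ts by simp
  show "\<phi> ` U \<subseteq> V" using openin_imp_subset[OF 1(3)] .
  obtain g where g: "homeomorphic_maps (subtopology X U) (top_of_set (\<phi> ` U)) \<phi> g"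
    using h homeomorphic_map_maps by blast
  have gi: "g y = inv_into U \<phi> y" if y: "y \<in> \<phi> ` U" for y
  proof -
    obtain x where "x \<in> U" "y = \<phi> x" using y by blast
    then show ?thesis using g inj 2 by (auto simp: homeomorphic_maps_def)
  qed
  show hm: "homeomorphic_maps (subtopology X U) (top_of_set (\<phi> ` U)) \<phi> (inv_into U \<phi>)"
    by (rule homeomorphic_maps_eq[OF g]) (auto simp: gi)
  show "continuous_map (top_of_set (\<phi> ` U)) X (inv_into U \<phi>)"
    using hm by (auto simp: homeomorphic_maps_def continuous_map_in_subtopology)
  have "continuous_map (subtopology X U) (top_of_set (\<phi> ` U)) \<phi>"
    using hm by (auto simp: homeomorphic_maps_def)
  then show "continuous_map (subtopology X U) euclidean \<phi>"
    by (auto simp: continuous_map_in_subtopology)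
qed

lemma chartedD: "charted M \<Longrightarrow> (U, V, \<phi>) \<in> atlas M \<Longrightarrow> topological_chart (topo M) (U, V, \<phi>)"
  by (auto simp: charted_def)

lemma charted_obtain:
  assumes "charted M" "x \<in> topspace (topo M)"
  obtains U V \<phi> where "(U, V, \<phi>) \<in> atlas M" "x \<in> U"
  using assms unfolding charted_def by blast

lemma topological_chart_openin_image:
  assumes "topological_chart X (U, V, \<phi>)" "openin X W" "W \<subseteq> U"
  shows "openin (top_of_set V) (\<phi> ` W)"
proof -
  have "homeomorphic_map (subtopology X U) (top_of_set (\<phi> ` U)) \<phi>" using assms by auto
  moreover have "openin (subtopology X U) W" using assms(2,3) by (metis openin_subtopology_Int2 inf.absorb_iff2)
  ultimately have "openin (top_of_set (\<phi> ` U)) (\<phi> ` W)"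
    using homeomorphic_imp_open_map open_map_def by blast
  then show ?thesis using topological_chartD(4)[OF assms(1)] openin_trans by blast
qed

lemma plotI:
  assumes "open S" "continuous_map (top_of_set S) (topo M) c"
    "\<And>U V \<phi>. (U, V, \<phi>) \<in> atlas M \<Longrightarrow> smooth_on UNIV {x\<in>S. c x \<in> U} (\<lambda>x. \<phi> (c x))"
  shows "plot M S c"
  using assms unfolding plot_def by blast

lemma plot_open: "plot M S c \<Longrightarrow> open S"
  by (simp add: plot_def)

lemma plot_continuous: "plot M S c \<Longrightarrow> continuous_map (top_of_set S) (topo M) c"
  by (simp add: plot_def)

lemma plot_in: "plot M S c \<Longrightarrow> x \<in> S \<Longrightarrow> c x \<in> topspace (topo M)"
  using plot_continuous continuous_map_image_subset_topspace by fastforce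

lemma plot_vimage_open:
  assumes "plot M S c" "openin (topo M) U"
  shows "open {x\<in>S. c x \<in> U}"
proof -
  have "openin (top_of_set S) {x \<in> topspace (top_of_set S). c x \<in> U}"
    using openin_continuous_map_preimage[OF plot_continuous[OF assms(1)] assms(2)] .
  then show ?thesis using plot_open[OF assms(1)] by (simp add: openin_open_eq)
qed

lemma plot_coord:
  assumes "plot M S c" "(U, V, \<phi>) \<in> atlas M"
  shows "smooth_on UNIV {x\<in>S. c x \<in> U} (\<lambda>x. \<phi> (c x))"
  using assms by (auto simp: plot_def)

lemma plot_compose:
  assumes "plot M S c" "smooth_on UNIV T u" "open T" "\<And>x. x \<in> T \<Longrightarrow> u x \<in> S" "charted M"
  shows "plot M T (\<lambda>x. c (u x))"
proof (rule plotI)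
  show "open T" by fact
  have cu: "continuous_on T u" using assms(2) by (rule smooth_on_continuous)
  then show "continuous_map (top_of_set T) (topo M) (\<lambda>x. c (u x))"
    using continuous_map_compose[of "top_of_set T" "top_of_set S" u "topo M" c] plot_continuous[OF assms(1)] assms(4)
    by (auto simp: continuous_map_in_subtopology comp_def)
  fix U V \<phi> assume c: "(U, V, \<phi>) \<in> atlas M"
  have o: "open {x\<in>S. c x \<in> U}"
    using plot_vimage_open[OF assms(1)] topological_chartD(1)[OF chartedD[OF assms(5) c]] by blast
  have "{x\<in>T. c (u x) \<in> U} = T \<inter> u -` {x\<in>S. c x \<in> U}" using assms(4) by auto
  then have o': "open {x\<in>T. c (u x) \<in> U}" using continuous_open_preimage[OF cu assms(3) o] by simp
  show "smooth_on UNIV {x\<in>T. c (u x) \<in> U} (\<lambda>x. \<phi> (c (u x)))"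
    by (rule smooth_on_compose[OF plot_coord[OF assms(1) c] smooth_on_subset[OF assms(2)] o' o]) (use assms(4) in auto)
qed

lemma plot_subset:
  assumes "plot M S c" "open T" "T \<subseteq> S" "charted M"
  shows "plot M T c"
  by (rule plot_compose[OF assms(1) smooth_on_id assms(2) _ assms(4)]) (use assms(3) in auto)

lemma plot_cong:
  assumes "plot M S c" "\<And>x. x \<in> S \<Longrightarrow> c x = d x" "charted M"
  shows "plot M S d"
proof (rule plotI)
  show "open S" using plot_open[OF assms(1)] .
  show "continuous_map (top_of_set S) (topo M) d"
    using plot_continuous[OF assms(1)] by (rule continuous_map_eq) (use assms(2) in auto)
  fix U V \<phi> assume c: "(U, V, \<phi>) \<in> atlas M"
  have e: "{x\<in>S. d x \<in> U} = {x\<in>S. c x \<in> U}" using assms(2) by auto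
  have o: "open {x\<in>S. c x \<in> U}"
    using plot_vimage_open[OF assms(1)] topological_chartD(1)[OF chartedD[OF assms(3) c]] by blast
  show "smooth_on UNIV {x\<in>S. d x \<in> U} (\<lambda>x. \<phi> (d x))"
    unfolding e by (rule smooth_on_cong[OF plot_coord[OF assms(1) c] o]) (use assms(2) in auto)
qed

lemma plot_local:
  assumes "open S" "charted M" "\<And>x. x \<in> S \<Longrightarrow> \<exists>T. x \<in> T \<and> T \<subseteq> S \<and> plot M T c"
  shows "plot M S c"
proof (rule plotI)
  show "open S" by fact
  show "continuous_map (top_of_set S) (topo M) c"
    unfolding continuous_map_def
  proof (intro conjI allI impI)
    show "c \<in> topspace (top_of_set S) \<rightarrow> topspace (topo M)"
    proof
      fix x assume "x \<in> topspace (top_of_set S)"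
      then obtain T where "x \<in> T" "plot M T c" using assms(3)[of x] by auto
      then show "c x \<in> topspace (topo M)" using plot_in by blast
    qed
    fix U assume U: "openin (topo M) U"
    have "open {x \<in> S. c x \<in> U}"
    proof (rule open_subopen[THEN iffD2], rule ballI)
      fix x assume x: "x \<in> {x \<in> S. c x \<in> U}"
      then obtain T where T: "x \<in> T" "T \<subseteq> S" "plot M T c" using assms(3)[of x] by auto
      show "\<exists>T. open T \<and> x \<in> T \<and> T \<subseteq> {x \<in> S. c x \<in> U}"
        using plot_vimage_open[OF T(3) U] T x by (intro exI[of _ "{y\<in>T. c y \<in> U}"]) auto
    qed
    then show "openin (top_of_set S) {x \<in> topspace (top_of_set S). c x \<in> U}"
      using assms(1) by (simp add: openin_open_eq)
  qed
  fix U V \<phi> assume c: "(U, V, \<phi>) \<in> atlas M"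
  show "smooth_on UNIV {x\<in>S. c x \<in> U} (\<lambda>x. \<phi> (c x))"
  proof (rule smooth_on_local)
    fix x assume "x \<in> {x\<in>S. c x \<in> U}"
    then obtain T where T: "x \<in> T" "T \<subseteq> S" "plot M T c" using assms(3) by blast
    have "T \<inter> {x\<in>S. c x \<in> U} = {x\<in>T. c x \<in> U}" using T by auto
    then show "\<exists>T. open T \<and> x \<in> T \<and> smooth_on UNIV (T \<inter> {x \<in> S. c x \<in> U}) (\<lambda>x. \<phi> (c x))"
      using plot_coord[OF T(3) c] plot_open[OF T(3)] T(1) by metis
  qed
qed

lemma chart_dom_open:
  assumes "topological_chart X c" shows "open (chart_dom c)"
proof -
  obtain U V \<phi> where c: "c = (U, V, \<phi>)" by (cases c)
  show ?thesis using open_lproj_vimage topological_chartD(3,4) assms unfolding c chart_dom_def by fastforce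
qed

lemma plot_chart_param:
  assumes M: "smooth_manifold M" and c: "c \<in> atlas M"
  shows "plot M (chart_dom c) (chart_param c)"
proof -
  obtain U V \<phi> where ceq: "c = (U, V, \<phi>)" by (cases c)
  note c = c[unfolded ceq]
  have tc: "topological_chart (topo M) (U, V, \<phi>)" using chartedD[OF smooth_manifold_charted[OF M] c] .
  note tcD = topological_chartD[OF tc]
  have P: "continuous_on UNIV (lproj V)"
    using lproj(1)[OF tcD(3)] by (simp add: linear_continuous_on linear_conv_bounded_linear)
  show ?thesis
  proof (rule plotI)
    show "open (chart_dom c)" using chart_dom_open[OF tc] ceq by simp
    have "continuous_map (top_of_set (chart_dom c)) (top_of_set (\<phi> ` U)) (lproj V)"
      using P unfolding chart_dom_def ceq by (auto simp: continuous_map_in_subtopology intro: continuous_on_subset)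
    from continuous_map_compose[OF this tcD(9)]
    show "continuous_map (top_of_set (chart_dom c)) (topo M) (chart_param c)"
      unfolding chart_param_def[abs_def] ceq by (simp add: comp_def)
    fix W V' \<psi> assume d: "(W, V', \<psi>) \<in> atlas M"
    have "smoothly_compatible (U, V, \<phi>) (W, V', \<psi>)"
      using M c d unfolding smooth_manifold_def by blast
    then have "smooth_on V (\<phi> ` (U \<inter> W)) (\<psi> \<circ> inv_into U \<phi>)" by simp
    moreover have "\<phi> ` (U \<inter> W) \<subseteq> V" using tcD(6) by auto
    ultimately have "smooth_on UNIV {y. lproj V y \<in> \<phi> ` (U \<inter> W)} (\<lambda>y. (\<psi> \<circ> inv_into U \<phi>) (lproj V y))"
      using smooth_on_lproj[OF tcD(3)] by blast
    moreover have "{y. lproj V y \<in> \<phi> ` (U \<inter> W)} = {x \<in> chart_dom c. chart_param c x \<in> W}"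
      unfolding chart_dom_def chart_param_def ceq using tcD(5) by (auto simp: inv_into_f_f)
    ultimately show "smooth_on UNIV {x \<in> chart_dom c. chart_param c x \<in> W} (\<lambda>x. \<psi> (chart_param c x))"
      unfolding chart_param_def ceq by (simp add: comp_def)
  qed
qed

text \<open>\<open>smooth_map\<close> is stated in charts; near each parameter the plot is factored
  through one chart of \<open>M\<close>. This is what makes plots composable with the group
  operations and with the action.\<close>

lemma plot_smooth_map:
  assumes M: "charted M" and N: "charted N" and f: "smooth_map M N f" and c: "plot M S c"
  shows "plot N S (\<lambda>x. f (c x))"
proof (rule plotI)
  show "open S" using plot_open[OF c] .
  have cf: "continuous_map (topo M) (topo N) f" using f by (simp add: smooth_map_def)
  from continuous_map_compose[OF plot_continuous[OF c] this]
  show cfc: "continuous_map (top_of_set S) (topo N) (\<lambda>x. f (c x))" by (simp add: comp_def)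
  fix W V' \<psi> assume d: "(W, V', \<psi>) \<in> atlas N"
  have W: "openin (topo N) W" using topological_chartD(1)[OF chartedD[OF N d]] .
  show "smooth_on UNIV {x \<in> S. f (c x) \<in> W} (\<lambda>x. \<psi> (f (c x)))"
  proof (rule smooth_on_local)
    fix x assume "x \<in> {x \<in> S. f (c x) \<in> W}"
    then have x: "x \<in> S" "f (c x) \<in> W" by auto
    then obtain U V \<phi> where e: "(U, V, \<phi>) \<in> atlas M" "c x \<in> U"
      using charted_obtain[OF M plot_in[OF c x(1)]] by blast
    note tc = chartedD[OF M e(1)] note tcD = topological_chartD[OF tc]
    define T where "T = {y \<in> topspace (topo M). f y \<in> W} \<inter> U"
    have T: "openin (topo M) T" "T \<subseteq> U" unfolding T_def
      using openin_continuous_map_preimage[OF cf W] tcD(1) by auto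
    have Teq: "{x \<in> U. f x \<in> W} = T" unfolding T_def using tcD(2) by auto
    have "smooth_on V (\<phi> ` T) (\<psi> \<circ> f \<circ> inv_into U \<phi>)"
      using f e d Teq unfolding smooth_map_def by fastforce
    moreover have "\<phi> ` T \<subseteq> V" using T(2) tcD(6) by auto
    ultimately have s1: "smooth_on UNIV {y. lproj V y \<in> \<phi> ` T} (\<lambda>y. (\<psi> \<circ> f \<circ> inv_into U \<phi>) (lproj V y))"
      using smooth_on_lproj[OF tcD(3)] by blast
    have o1: "open {y. lproj V y \<in> \<phi> ` T}"
      using open_lproj_vimage[OF tcD(3) topological_chart_openin_image[OF tc T]] .
    have o2: "open {z\<in>S. c z \<in> T}" using plot_vimage_open[OF c T(1)] .
    have s2: "smooth_on UNIV {z\<in>S. c z \<in> T} (\<lambda>z. \<phi> (c z))"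
      using plot_coord[OF c e(1)] by (rule smooth_on_subset) (use T in auto)
    have lp: "lproj V (\<phi> y) = \<phi> y" if "y \<in> U" for y using lproj(3)[OF tcD(3)] tcD(6) that by auto
    have "smooth_on UNIV {z\<in>S. c z \<in> T} (\<lambda>z. (\<psi> \<circ> f \<circ> inv_into U \<phi>) (lproj V (\<phi> (c z))))"
      by (rule smooth_on_compose[OF s1 s2 o2 o1]) (use T lp in auto)
    then have "smooth_on UNIV {z\<in>S. c z \<in> T} (\<lambda>z. \<psi> (f (c z)))"
      by (rule smooth_on_cong[OF _ o2]) (use T lp tcD(5) in auto)
    moreover have "{z\<in>S. c z \<in> T} \<inter> {x \<in> S. f (c x) \<in> W} = {z\<in>S. c z \<in> T}" unfolding T_def by auto
    ultimately show "\<exists>U. open U \<and> x \<in> U \<and> smooth_on UNIV (U \<inter> {x \<in> S. f (c x) \<in> W}) (\<lambda>x. \<psi> (f (c x)))"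
      using o2 x e plot_in[OF c x(1)] by (intro exI[of _ "{z\<in>S. c z \<in> T}"]) (auto simp: T_def)
  qed
qed

lemma charted_flat: "openin (top_of_set V) S \<Longrightarrow> subspace V \<Longrightarrow> charted (flat_manifold V S)"
  by (auto simp: charted_def flat_manifold_def subtopology_subtopology)

lemma charted_flat_UNIV: "open S \<Longrightarrow> charted (flat_manifold UNIV S)"
  by (rule charted_flat) auto

lemma plot_flat:
  assumes "open S" "smooth_on UNIV S u" "\<And>x. x \<in> S \<Longrightarrow> u x \<in> T"
  shows "plot (flat_manifold V T) S u"
proof -
  have "{x\<in>S. u x \<in> T} = S" using assms(3) by auto
  then show ?thesis using assms smooth_on_continuous[OF assms(2)]
    by (auto simp: plot_def flat_manifold_def continuous_map_in_subtopology)
qed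

lemma plot_flatD:
  assumes "plot (flat_manifold V T) S u"
  shows "smooth_on UNIV S u"
proof -
  have "topspace (topo (flat_manifold V T)) = T" by (simp add: flat_manifold_def)
  then have "{x\<in>S. u x \<in> T} = S" using plot_in[OF assms] by auto
  then show ?thesis using assms by (auto simp: plot_def flat_manifold_def)
qed

lemma charted_prod:
  assumes "charted M" "charted N"
  shows "charted (prod_manifold M N)"
  unfolding charted_def
proof
  show "\<forall>c\<in>atlas (prod_manifold M N). topological_chart (topo (prod_manifold M N)) c"
  proof
    fix c assume "c \<in> atlas (prod_manifold M N)"
    then obtain U V \<phi> W V' \<psi> where c: "c = (U \<times> W, V \<times> V', map_prod \<phi> \<psi>)" "(U, V, \<phi>) \<in> atlas M" "(W, V', \<psi>) \<in> atlas N"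
      by (auto simp: prod_manifold_def)
    note 1 = topological_chartD[OF chartedD[OF assms(1) c(2)]]
    note 2 = topological_chartD[OF chartedD[OF assms(2) c(3)]]
    have im: "map_prod \<phi> \<psi> ` (U \<times> W) = \<phi> ` U \<times> \<psi> ` W" by auto
    have "homeomorphic_maps (prod_topology (subtopology (topo M) U) (subtopology (topo N) W))
        (prod_topology (top_of_set (\<phi> ` U)) (top_of_set (\<psi> ` W)))
        (\<lambda>(x, y). (\<phi> x, \<psi> y)) (\<lambda>(x, y). (inv_into U \<phi> x, inv_into W \<psi> y))"
      using 1(8) 2(8) homeomorphic_maps_prod by blast
    then have "homeomorphic_map (subtopology (prod_topology (topo M) (topo N)) (U \<times> W)) (top_of_set (\<phi> ` U \<times> \<psi> ` W)) (map_prod \<phi> \<psi>)"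
      by (auto simp: homeomorphic_map_maps subtopology_Times map_prod_def)
    then show "topological_chart (topo (prod_manifold M N)) c"
      unfolding c prod_manifold_def using 1(1,3,4) 2(1,3,4) im
      by (auto simp: openin_prod_Times_iff subspace_Times openin_Times)
  qed
  have "p \<in> (\<Union>(U, V, \<phi>)\<in>atlas (prod_manifold M N). U)" if p: "p \<in> topspace (topo M) \<times> topspace (topo N)" for p
  proof -
    have pp: "fst p \<in> topspace (topo M)" "snd p \<in> topspace (topo N)" using p by auto
    obtain U V \<phi> where 1: "(U, V, \<phi>) \<in> atlas M" "fst p \<in> U" using charted_obtain[OF assms(1) pp(1)] .
    obtain W V' \<psi> where 2: "(W, V', \<psi>) \<in> atlas N" "snd p \<in> W" using charted_obtain[OF assms(2) pp(2)] .
    have "(U \<times> W, V \<times> V', map_prod \<phi> \<psi>) \<in> atlas (prod_manifold M N)"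
      unfolding prod_manifold_def using 1(1) 2(1) by simp blast
    moreover have "p \<in> U \<times> W" using 1(2) 2(2) by (simp add: mem_Times_iff)
    ultimately show ?thesis by blast
  qed
  moreover have "A \<subseteq> topspace (topo M) \<times> topspace (topo N)" if A: "(A, B, f) \<in> atlas (prod_manifold M N)" for A B f
  proof -
    obtain U V \<phi> W V' \<psi> where c: "A = U \<times> W" "(U, V, \<phi>) \<in> atlas M" "(W, V', \<psi>) \<in> atlas N"
      using A by (auto simp: prod_manifold_def)
    show ?thesis using topological_chartD(2)[OF chartedD[OF assms(1) c(2)]] topological_chartD(2)[OF chartedD[OF assms(2) c(3)]] c(1)
      by auto
  qed
  ultimately have "(\<Union>(U, V, \<phi>)\<in>atlas (prod_manifold M N). U) = topspace (topo M) \<times> topspace (topo N)"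
    by (intro equalityI subsetI) blast+
  then show "(\<Union>(U, V, \<phi>)\<in>atlas (prod_manifold M N). U) = topspace (topo (prod_manifold M N))"
    by (simp add: prod_manifold_def)
qed

lemma plot_Pair:
  assumes M: "charted M" and N: "charted N" and c: "plot M S c" and d: "plot N S d"
  shows "plot (prod_manifold M N) S (\<lambda>x. (c x, d x))"
proof (rule plotI)
  show "open S" using plot_open[OF c] .
  show "continuous_map (top_of_set S) (topo (prod_manifold M N)) (\<lambda>x. (c x, d x))"
    using plot_continuous[OF c] plot_continuous[OF d] by (simp add: prod_manifold_def continuous_map_pairedI)
  fix A B f assume "(A, B, f) \<in> atlas (prod_manifold M N)"
  then obtain U V \<phi> W V' \<psi> where e: "A = U \<times> W" "f = map_prod \<phi> \<psi>" "(U, V, \<phi>) \<in> atlas M" "(W, V', \<psi>) \<in> atlas N"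
    by (auto simp: prod_manifold_def)
  have o: "open ({x\<in>S. c x \<in> U} \<inter> {x\<in>S. d x \<in> W})"
    using plot_vimage_open[OF c topological_chartD(1)[OF chartedD[OF M e(3)]]]
          plot_vimage_open[OF d topological_chartD(1)[OF chartedD[OF N e(4)]]] by blast
  have eq: "{x \<in> S. (c x, d x) \<in> A} = {x\<in>S. c x \<in> U} \<inter> {x\<in>S. d x \<in> W}" using e by auto
  have "smooth_on UNIV ({x\<in>S. c x \<in> U} \<inter> {x\<in>S. d x \<in> W}) (\<lambda>x. (\<phi> (c x), \<psi> (d x)))"
    by (rule smooth_on_Pair[OF smooth_on_subset[OF plot_coord[OF c e(3)]] smooth_on_subset[OF plot_coord[OF d e(4)]] o]) auto
  then show "smooth_on UNIV {x \<in> S. (c x, d x) \<in> A} (\<lambda>x. f (c x, d x))"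
    by (simp only: eq e(2) map_prod_simp)
qed

lemma plot_const:
  assumes "open S" "charted M" "x \<in> topspace (topo M)"
  shows "plot M S (\<lambda>_. x)"
  using assms by (auto simp: plot_def smooth_on_const)

lemma smooth_map_real_plot:
  assumes "charted M" "smooth_map M real_line f" "plot M S c"
  shows "smooth_on UNIV S (\<lambda>x. f (c x))"
  using plot_flatD plot_smooth_map[OF assms(1) charted_flat_UNIV[OF open_UNIV] assms(2,3)] by blast

section \<open>Charts at points and critical points\<close>

lemma chart_at:
  assumes "charted M" "x \<in> topspace (topo M)"
  shows "chart_at M x \<in> atlas M" "x \<in> fst (chart_at M x)"
proof -
  obtain U V \<phi> where "(U, V, \<phi>) \<in> atlas M" "x \<in> U" using charted_obtain[OF assms] by blast
  then have "\<exists>c. c \<in> atlas M \<and> x \<in> fst c" by force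
  from someI_ex[OF this] show "chart_at M x \<in> atlas M" "x \<in> fst (chart_at M x)"
    unfolding chart_at_def by auto
qed

lemma chart_dom_chart_param:
  assumes "topological_chart X (U, V, \<phi>)"
  shows "x \<in> U \<Longrightarrow> \<phi> x \<in> chart_dom (U, V, \<phi>)" "x \<in> U \<Longrightarrow> chart_param (U, V, \<phi>) (\<phi> x) = x"
    "y \<in> chart_dom (U, V, \<phi>) \<Longrightarrow> chart_param (U, V, \<phi>) y \<in> U"
    "y \<in> chart_dom (U, V, \<phi>) \<Longrightarrow> \<phi> (chart_param (U, V, \<phi>) y) = lproj V y"
    "x \<in> U \<Longrightarrow> lproj V (\<phi> x) = \<phi> x"
proof -
  note D = topological_chartD[OF assms]
  have lp: "lproj V (\<phi> x) = \<phi> x" if "x \<in> U" for x using lproj(3)[OF D(3)] D(6) that by auto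
  then show "x \<in> U \<Longrightarrow> lproj V (\<phi> x) = \<phi> x" .
  show "x \<in> U \<Longrightarrow> \<phi> x \<in> chart_dom (U, V, \<phi>)" using lp by (simp add: chart_dom_def)
  show "x \<in> U \<Longrightarrow> chart_param (U, V, \<phi>) (\<phi> x) = x" using lp D(5) by (simp add: chart_param_def)
  show "y \<in> chart_dom (U, V, \<phi>) \<Longrightarrow> chart_param (U, V, \<phi>) y \<in> U"
    "y \<in> chart_dom (U, V, \<phi>) \<Longrightarrow> \<phi> (chart_param (U, V, \<phi>) y) = lproj V y"
    by (auto simp: chart_dom_def chart_param_def inv_into_into f_inv_into_f)
qed

lemma chart_at_flat: "x \<in> S \<Longrightarrow> chart_at (flat_manifold V S) x = (S, V, id)"
proof -
  assume "x \<in> S"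
  then have "\<exists>c. c \<in> atlas (flat_manifold V S) \<and> x \<in> fst c" by (auto simp: flat_manifold_def)
  from someI_ex[OF this] show ?thesis unfolding chart_at_def by (simp add: flat_manifold_def)
qed

lemma coord_at_real_line [simp]: "coord_at real_line x = id" "param_at real_line x = id" "tangent_space real_line x = UNIV"
  by (auto simp: coord_at_def param_at_def tangent_space_def chart_at_flat inv_id)

lemma velocity_eq: "velocity M c t = dir_deriv 1 (\<lambda>t. coord_at M (c t0) (c t)) t" if "t0 = t" for t0
  using that by (simp add: velocity_def differential_def comp_def id_def)

lemma dir_deriv_chart_param:
  assumes "topological_chart X (U, V, \<phi>)"
  shows "dir_deriv v (\<lambda>y. f (chart_param (U, V, \<phi>) y)) y =
     dir_deriv (lproj V v) (\<lambda>y. f (inv_into U \<phi> y)) (lproj V y)"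
  using dir_deriv_lproj[OF topological_chartD(3)[OF assms], of v "\<lambda>y. f (inv_into U \<phi> y)"]
  by (simp add: chart_param_def fun_eq_iff)

text \<open>The derivative along \<open>chart_param\<close> in all directions of the ambient space is determined by
  the directions tangent to the chart, as \<open>chart_param\<close> factors through \<open>lproj\<close>.\<close>

lemma critical_point_chart:
  assumes M: "charted M" and x: "x \<in> topspace (topo M)"
  shows "critical_point M f x \<longleftrightarrow>
    (\<forall>v. dir_deriv v (\<lambda>y. f (chart_param (chart_at M x) y)) (coord_at M x x) = 0)"
proof -
  obtain U V \<phi> where c: "chart_at M x = (U, V, \<phi>)" by (cases "chart_at M x")
  note ca = chart_at[OF M x, unfolded c]
  have tc: "topological_chart (topo M) (U, V, \<phi>)" using chartedD[OF M ca(1)] .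
  note D = topological_chartD[OF tc]
  have "lproj V (\<phi> x) = \<phi> x" using chart_dom_chart_param(5)[OF tc] ca by auto
  then have "dir_deriv v (\<lambda>y. f (chart_param (U, V, \<phi>) y)) (\<phi> x) = dir_deriv (lproj V v) (\<lambda>y. f (inv_into U \<phi> y)) (\<phi> x)" for v
    using dir_deriv_chart_param[OF tc, of v f "\<phi> x"] by simp
  then have "(\<forall>v. dir_deriv v (\<lambda>y. f (chart_param (U, V, \<phi>) y)) (\<phi> x) = 0)
      \<longleftrightarrow> (\<forall>v\<in>V. dir_deriv v (\<lambda>y. f (inv_into U \<phi> y)) (\<phi> x) = 0)"
    using lproj(2,3)[OF D(3)] by metis
  then show ?thesis using x c
    by (simp add: critical_point_def differential_def tangent_space_def param_at_def comp_def coord_at_def[of M])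
qed

lemma critical_point_plot:
  assumes M: "smooth_manifold M" and f: "smooth_map M real_line f"
    and crit: "critical_point M f x" and c: "plot M S c" "z \<in> S" "c z = x"
  shows "dir_deriv v (\<lambda>z. f (c z)) z = 0"
proof -
  note Mc = smooth_manifold_charted[OF M]
  have x: "x \<in> topspace (topo M)" using crit by (simp add: critical_point_def)
  obtain U V \<phi> where ce: "chart_at M x = (U, V, \<phi>)" by (cases "chart_at M x")
  note ca = chart_at[OF Mc x, unfolded ce]
  have tc: "topological_chart (topo M) (U, V, \<phi>)" using chartedD[OF Mc ca(1)] .
  note cd = chart_dom_chart_param[OF tc]
  define T where "T = {z\<in>S. c z \<in> U}"
  have T: "open T" "z \<in> T" unfolding T_def using plot_vimage_open[OF c(1) topological_chartD(1)[OF tc]] c ca by auto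
  have s1: "smooth_on UNIV T (\<lambda>z. \<phi> (c z))" unfolding T_def by (rule plot_coord[OF c(1) ca(1)])
  have s2: "smooth_on UNIV (chart_dom (U, V, \<phi>)) (\<lambda>y. f (chart_param (U, V, \<phi>) y))"
    by (rule smooth_map_real_plot[OF Mc f plot_chart_param[OF M ca(1)]])
  have "dir_deriv v (\<lambda>z. f (c z)) z = dir_deriv v (\<lambda>z. f (chart_param (U, V, \<phi>) (\<phi> (c z)))) z"
    by (rule dir_deriv_cong(1)[OF T]) (auto simp: T_def cd)
  also have "\<dots> = dir_deriv (dir_deriv v (\<lambda>z. \<phi> (c z)) z) (\<lambda>y. f (chart_param (U, V, \<phi>) y)) (\<phi> (c z))"
    by (rule dir_deriv_compose[OF s2 s1 T(1) chart_dom_open[OF tc] T(2)]) (use cd T in \<open>auto simp: T_def\<close>)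
  also have "\<dots> = 0" using crit critical_point_chart[OF Mc x] c(3) by (simp add: ce coord_at_def)
  finally show ?thesis .
qed

text \<open>A converse of \<open>critical_point_plot\<close> for plots covering a neighbourhood:
  \<open>u\<close> lifts the chart at \<open>x\<close> through \<open>c\<close>, so every derivative
  at \<open>x\<close> is a derivative along \<open>c\<close>.\<close>

lemma critical_pointI_plot:
  assumes M: "smooth_manifold M" and f: "smooth_map M real_line f"
    and c: "plot M S c" "z \<in> S" "c z = x"
    and d: "\<And>v. dir_deriv v (\<lambda>z. f (c z)) z = 0"
    and u: "open B" "coord_at M x x \<in> B" "smooth_on UNIV B u" "u (coord_at M x x) = z"
       "\<And>y. y \<in> B \<Longrightarrow> u y \<in> S \<and> c (u y) = chart_param (chart_at M x) y"
  shows "critical_point M f x"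
proof -
  note Mc = smooth_manifold_charted[OF M]
  have x: "x \<in> topspace (topo M)" using plot_in[OF c(1,2)] c(3) by simp
  have "dir_deriv v (\<lambda>y. f (chart_param (chart_at M x) y)) (coord_at M x x) = 0" for v
  proof -
    have s2: "smooth_on UNIV S (\<lambda>z. f (c z))" by (rule smooth_map_real_plot[OF Mc f c(1)])
    have "dir_deriv v (\<lambda>y. f (chart_param (chart_at M x) y)) (coord_at M x x) = dir_deriv v (\<lambda>y. f (c (u y))) (coord_at M x x)"
      by (rule dir_deriv_cong(1)[OF u(1,2)]) (use u(5) in auto)
    also have "\<dots> = dir_deriv (dir_deriv v u (coord_at M x x)) (\<lambda>z. f (c z)) (u (coord_at M x x))"
      by (rule dir_deriv_compose[OF s2 u(3,1) plot_open[OF c(1)] u(2)]) (use u(2,5) in auto)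
    finally show ?thesis using d u(4) by simp
  qed
  then show ?thesis using critical_point_chart[OF Mc x] by blast
qed

section \<open>The invariant mean of a compact group\<close>

text \<open>With \<open>d\<close> dense in \<open>K\<close>, iterating the averaging operator
  \<open>f \<mapsto> \<Sum>\<^sub>i 2\<^bsup>-(i+1)\<^esup> f(\<cdot> d\<^sub>i)\<close> flattens every continuous function on \<open>K\<close> to a constant, its mean.\<close>

locale compact_group = group G for G (structure) +
  fixes K :: "'a set" and X :: "'a topology" and d :: "nat \<Rightarrow> 'a"
  assumes subK: "subgroup K G"
    and topX: "topspace X = K"
    and compX: "compact_space X"
    and contX: "continuous_map (prod_topology X X) X (\<lambda>(a, b). a \<otimes> b)"
    and dense: "\<And>U. openin X U \<Longrightarrow> U \<noteq> {} \<Longrightarrow> \<exists>i. d i \<in> U"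
    and dK: "d i \<in> K"
begin

definition avg :: "('a \<Rightarrow> real) \<Rightarrow> 'a \<Rightarrow> real" where
  "avg f x = (\<Sum>i. (1/2)^Suc i * f (x \<otimes> d i))"

definition mean :: "('a \<Rightarrow> real) \<Rightarrow> real" where
  "mean f = lim (\<lambda>n. (avg ^^ n) f \<one>)"

definition bdd :: "('a \<Rightarrow> real) \<Rightarrow> bool" where
  "bdd f \<longleftrightarrow> (\<exists>B. \<forall>x\<in>K. \<bar>f x\<bar> \<le> B)"

text \<open>One of \<open>d 0\<close>, ..., \<open>d N\<close> carries \<open>x\<close> so close to
  a prescribed \<open>y\<close> that the left translates of \<open>f\<close> by
  \<open>x \<otimes> d i\<close> and by \<open>y\<close> agree up to \<open>e\<close>. Quantifying
  over the right factor \<open>k\<close> makes the property survive averaging with the same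
  \<open>e\<close> and \<open>N\<close>.\<close>

definition appr :: "real \<Rightarrow> nat \<Rightarrow> ('a \<Rightarrow> real) \<Rightarrow> bool" where
  "appr e N f \<longleftrightarrow> (\<forall>x\<in>K. \<forall>y\<in>K. \<exists>i\<le>N. \<forall>k\<in>K. \<bar>f (x \<otimes> d i \<otimes> k) - f (y \<otimes> k)\<bar> \<le> e)"

lemma K_mult: "x \<in> K \<Longrightarrow> y \<in> K \<Longrightarrow> x \<otimes> y \<in> K"
  using subK by (rule subgroup.m_closed)

lemma K_one: "\<one> \<in> K"
  using subK by (rule subgroup.one_closed)

lemma K_inv: "x \<in> K \<Longrightarrow> inv x \<in> K"
  using subK by (rule subgroup.m_inv_closed)

lemma K_carrier: "x \<in> K \<Longrightarrow> x \<in> carrier G"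
  using subK by (rule subgroup.mem_carrier)

lemma avg_sums:
  assumes "bdd f" "x \<in> K"
  shows "(\<lambda>i. (1/2)^Suc i * f (x \<otimes> d i)) sums avg f x"
proof -
  obtain B where B: "\<And>x. x \<in> K \<Longrightarrow> \<bar>f x\<bar> \<le> B" using assms(1) by (auto simp: bdd_def)
  have "summable (\<lambda>i. (1/2)^Suc i * f (x \<otimes> d i))"
  proof (rule summable_comparison_test')
    show "summable (\<lambda>i. (1/2)^Suc i * B)"
      using power_half_series by (intro summable_mult2) (simp add: sums_iff)
    show "norm ((1/2)^Suc i * f (x \<otimes> d i)) \<le> (1/2)^Suc i * B" if "i \<ge> 0" for i
      using B[OF K_mult[OF assms(2) dK], of i] by (simp add: abs_mult)
  qed
  then show ?thesis unfolding avg_def by (rule summable_sums)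
qed

lemma avg_bounds:
  assumes f: "bdd f" and x: "x \<in> K"
  shows "(\<And>y. y \<in> K \<Longrightarrow> f y \<le> M) \<Longrightarrow> avg f x \<le> M"
    and "(\<And>y. y \<in> K \<Longrightarrow> m \<le> f y) \<Longrightarrow> m \<le> avg f x"
proof -
  have M: "(\<lambda>i. (1/2)^Suc i * c) sums c" for c :: real
    using sums_mult2[OF power_half_series, of c] by simp
  show "avg f x \<le> M" if "\<And>y. y \<in> K \<Longrightarrow> f y \<le> M"
    by (rule sums_le[OF _ avg_sums[OF f x] M]) (use that K_mult[OF x dK] in \<open>simp add: mult_left_mono\<close>)
  show "m \<le> avg f x" if "\<And>y. y \<in> K \<Longrightarrow> m \<le> f y"
    by (rule sums_le[OF _ M avg_sums[OF f x]]) (use that K_mult[OF x dK] in \<open>simp add: mult_left_mono\<close>)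
qed

lemma avg_bdd:
  assumes "bdd f" shows "bdd (avg f)"
proof -
  obtain B where B: "\<And>x. x \<in> K \<Longrightarrow> \<bar>f x\<bar> \<le> B" using assms(1) by (auto simp: bdd_def)
  have "\<bar>avg f x\<bar> \<le> B" if "x \<in> K" for x
    using avg_bounds(1)[OF assms that, of B] avg_bounds(2)[OF assms that, of "-B"] B by fastforce
  then show ?thesis by (auto simp: bdd_def)
qed

lemma avg_iter_bdd: "bdd f \<Longrightarrow> bdd ((avg ^^ n) f)"
  by (induction n) (auto intro: avg_bdd)

lemma avg_iter_bounds:
  assumes f: "bdd f" and x: "x \<in> K"
  shows "(\<And>y. y \<in> K \<Longrightarrow> f y \<le> M) \<Longrightarrow> (avg ^^ n) f x \<le> M"
    and "(\<And>y. y \<in> K \<Longrightarrow> m \<le> f y) \<Longrightarrow> m \<le> (avg ^^ n) f x"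
proof -
  show "(avg ^^ n) f x \<le> M" if "\<And>y. y \<in> K \<Longrightarrow> f y \<le> M"
    using x by (induction n arbitrary: x) (auto intro!: that avg_bounds avg_iter_bdd f)
  show "m \<le> (avg ^^ n) f x" if "\<And>y. y \<in> K \<Longrightarrow> m \<le> f y"
    using x by (induction n arbitrary: x) (auto intro!: that avg_bounds avg_iter_bdd f)
qed

text \<open>The factor \<open>d j\<close> that averaging adds on the right is absorbed into
  \<open>k\<close>.\<close>

lemma avg_appr:
  assumes f: "bdd f" and a: "appr e N f"
  shows "appr e N (avg f)"
  unfolding appr_def
proof (intro ballI)
  fix x y assume xy: "x \<in> K" "y \<in> K"
  then obtain i where i: "i \<le> N" "\<And>k. k \<in> K \<Longrightarrow> \<bar>f (x \<otimes> d i \<otimes> k) - f (y \<otimes> k)\<bar> \<le> e"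
    using a unfolding appr_def by blast
  have "\<bar>avg f (x \<otimes> d i \<otimes> k) - avg f (y \<otimes> k)\<bar> \<le> e" if k: "k \<in> K" for k
  proof -
    have xk: "x \<otimes> d i \<otimes> k \<in> K" "y \<otimes> k \<in> K" using xy k dK K_mult by auto
    have M: "(\<lambda>j. (1/2)^Suc j * c) sums c" for c :: real
      using sums_mult2[OF power_half_series, of c] by simp
    have s: "(\<lambda>j. (1/2)^Suc j * (f (x \<otimes> d i \<otimes> k \<otimes> d j) - f (y \<otimes> k \<otimes> d j))) sums (avg f (x \<otimes> d i \<otimes> k) - avg f (y \<otimes> k))"
      using sums_diff[OF avg_sums[OF f xk(1)] avg_sums[OF f xk(2)]] by (simp add: algebra_simps)
    have b: "\<bar>f (x \<otimes> d i \<otimes> k \<otimes> d j) - f (y \<otimes> k \<otimes> d j)\<bar> \<le> e" for j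
      using i(2)[OF K_mult[OF k dK[of j]]] xy k dK by (simp add: m_assoc K_carrier K_mult)
    have "avg f (x \<otimes> d i \<otimes> k) - avg f (y \<otimes> k) \<le> e"
      by (rule sums_le[OF _ s M]) (use b in \<open>auto intro!: mult_left_mono simp: abs_le_iff\<close>)
    moreover have "- e \<le> avg f (x \<otimes> d i \<otimes> k) - avg f (y \<otimes> k)"
    proof -
      have "- e \<le> f (x \<otimes> d i \<otimes> k \<otimes> d j) - f (y \<otimes> k \<otimes> d j)" for j using b[of j] by linarith
      then have "(1/2)^Suc j * - e \<le> (1/2)^Suc j * (f (x \<otimes> d i \<otimes> k \<otimes> d j) - f (y \<otimes> k \<otimes> d j))" for j
        by (intro mult_left_mono) auto
      then show ?thesis by (rule sums_le[OF _ M s])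
    qed
    ultimately show ?thesis by linarith
  qed
  then show "\<exists>i\<le>N. \<forall>k\<in>K. \<bar>avg f (x \<otimes> d i \<otimes> k) - avg f (y \<otimes> k)\<bar> \<le> e" using i(1) by blast
qed

text \<open>Among the first \<open>N + 1\<close> terms of the average one is a value within
  \<open>e\<close> of \<open>f \<one>\<close>, and its weight is at least
  \<open>(1/2)^Suc N\<close>; all other values are at most \<open>M\<close>. As the reference value
  \<open>f \<one>\<close> is the same for all \<open>x\<close>, upper and lower bounds move towards
  each other.\<close>

lemma avg_contract_upper:
  assumes f: "bdd f" and a: "appr e N f" and x: "x \<in> K"
    and M: "\<And>y. y \<in> K \<Longrightarrow> f y \<le> M"
  shows "avg f x \<le> (1 - (1/2)^Suc N) * M + (1/2)^Suc N * (f \<one> + e)"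
proof -
  obtain i where i: "i \<le> N" "\<bar>f (x \<otimes> d i \<otimes> \<one>) - f (\<one> \<otimes> \<one>)\<bar> \<le> e"
    using a x K_one unfolding appr_def by blast
  then have fi: "f (x \<otimes> d i) \<le> f \<one> + e" using x dK by (simp add: K_carrier K_mult)
  define w where "w = (1/2::real)^Suc i"
  have w: "(1/2)^Suc N \<le> w" unfolding w_def using i(1) by (intro power_decreasing) auto
  have s1: "(\<lambda>j. (1/2)^Suc j * M + (if j = i then w * (f (x \<otimes> d i) - M) else 0)) sums (M + w * (f (x \<otimes> d i) - M))"
    using sums_add[OF sums_mult2[OF power_half_series, of M] sums_single[of i "\<lambda>j. w * (f (x \<otimes> d i) - M)"]] by simp
  have le: "avg f x \<le> M + w * (f (x \<otimes> d i) - M)"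
  proof (rule sums_le[OF _ avg_sums[OF f x] s1])
    fix j
    show "(1/2)^Suc j * f (x \<otimes> d j) \<le> (1/2)^Suc j * M + (if j = i then w * (f (x \<otimes> d i) - M) else 0)"
      using mult_left_mono[OF M[OF K_mult[OF x dK[of j]]], of "(1/2)^Suc j"]
      by (auto simp: w_def[symmetric] right_diff_distrib simp del: power_Suc)
  qed
  have eq: "(1 - w0) * M + w0 * (f \<one> + e) = M + w0 * (f \<one> + e - M)" for w0
    by (simp add: algebra_simps)
  \<comment> \<open>Lowering the weight from \<open>w\<close> to \<open>(1/2)^Suc N\<close> weakens
    the bound only if \<open>f \<one> + e \<le> M\<close>; otherwise the trivial bound
    \<open>M\<close> is already the better one.\<close>
  show ?thesis unfolding eq
  proof (cases "f \<one> + e \<le> M")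
    case True
    have "w * (f (x \<otimes> d i) - M) \<le> w * (f \<one> + e - M)" using fi by (intro mult_left_mono) (auto simp: w_def)
    also have "\<dots> \<le> (1/2)^Suc N * (f \<one> + e - M)" using True w by (intro mult_right_mono_neg) auto
    finally show "avg f x \<le> M + (1/2)^Suc N * (f \<one> + e - M)" using le by linarith
  next
    case False
    have "avg f x \<le> M" by (rule avg_bounds(1)[OF f x M])
    also have "M \<le> M + (1/2)^Suc N * (f \<one> + e - M)" using False by simp
    finally show "avg f x \<le> M + (1/2)^Suc N * (f \<one> + e - M)" .
  qed
qed

lemma bdd_uminus: "bdd f \<Longrightarrow> bdd (\<lambda>x. - f x)" and appr_uminus: "appr e N f \<Longrightarrow> appr e N (\<lambda>x. - f x)"
  by (auto simp: bdd_def appr_def abs_minus_commute)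

lemma avg_linear:
  assumes "bdd f" "bdd g" "x \<in> K"
  shows "avg (\<lambda>x. a * f x + b * g x) x = a * avg f x + b * avg g x"
proof -
  have "(\<lambda>i. a * ((1/2)^Suc i * f (x \<otimes> d i)) + b * ((1/2)^Suc i * g (x \<otimes> d i))) sums (a * avg f x + b * avg g x)"
    by (intro sums_add sums_mult avg_sums assms)
  then have "(\<lambda>i. (1/2)^Suc i * (a * f (x \<otimes> d i) + b * g (x \<otimes> d i))) sums (a * avg f x + b * avg g x)"
    by (simp add: algebra_simps)
  then show ?thesis unfolding avg_def by (simp add: sums_iff)
qed

lemma avg_cong: "(\<And>y. y \<in> K \<Longrightarrow> f y = g y) \<Longrightarrow> x \<in> K \<Longrightarrow> avg f x = avg g x"
  unfolding avg_def using K_mult dK by simp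

lemma avg_iter_cong: "(\<And>y. y \<in> K \<Longrightarrow> f y = g y) \<Longrightarrow> x \<in> K \<Longrightarrow> (avg ^^ n) f x = (avg ^^ n) g x"
  by (induction n arbitrary: x) (auto intro: avg_cong)

lemma avg_iter_linear:
  assumes "bdd f" "bdd g" "x \<in> K"
  shows "(avg ^^ n) (\<lambda>x. a * f x + b * g x) x = a * (avg ^^ n) f x + b * (avg ^^ n) g x"
  using assms(3)
proof (induction n arbitrary: x)
  case (Suc n)
  have "(avg ^^ Suc n) (\<lambda>x. a * f x + b * g x) x = avg (\<lambda>x. a * (avg ^^ n) f x + b * (avg ^^ n) g x) x"
    using Suc by (auto intro: avg_cong)
  then show ?case using avg_linear[OF avg_iter_bdd[OF assms(1)] avg_iter_bdd[OF assms(2)] Suc.prems] by simp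
qed simp

lemma avg_contract_lower:
  assumes f: "bdd f" and a: "appr e N f" and x: "x \<in> K"
    and m: "\<And>y. y \<in> K \<Longrightarrow> m \<le> f y"
  shows "(1 - (1/2)^Suc N) * m + (1/2)^Suc N * (f \<one> - e) \<le> avg f x"
proof -
  have "avg (\<lambda>x. - f x) x = - avg f x"
    using avg_linear[OF f f x, of "-1" 0] by simp
  then have "- avg f x \<le> (1 - (1/2)^Suc N) * (- m) + (1/2)^Suc N * (- f \<one> + e)"
    using avg_contract_upper[OF bdd_uminus[OF f] appr_uminus[OF a] x, of "-m"] m by simp
  moreover have "(1 - w) * (- m) + w * (- f \<one> + e) = - ((1 - w) * m + w * (f \<one> - e))" for w
    by (simp add: algebra_simps)
  ultimately show ?thesis by (metis neg_le_iff_le)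
qed

text \<open>With \<open>w = (1/2)^Suc N\<close>, one step turns an oscillation \<open>o\<close> into
  at most \<open>(1 - w) * o + 2 * w * e\<close>. The fixed point of this recursion is
  \<open>2 * e\<close>, and the excess over it shrinks by the factor \<open>1 - w\<close>.\<close>

lemma avg_iter_osc:
  assumes f: "bdd f" and a: "appr e N f"
    and B: "\<And>x. x \<in> K \<Longrightarrow> \<bar>f x\<bar> \<le> B"
  shows "\<exists>m M. (\<forall>x\<in>K. m \<le> (avg ^^ n) f x \<and> (avg ^^ n) f x \<le> M) \<and> M - m \<le> 2 * e + (1 - (1/2)^Suc N)^n * (2 * B)"
proof (induction n)
  case 0
  have "e \<ge> 0" using a K_one unfolding appr_def by (meson abs_ge_zero order_trans)
  then show ?case using B by (intro exI[of _ "-B"] exI[of _ B]) (auto simp: abs_le_iff minus_le_iff)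
next
  case (Suc n)
  define w where "w = (1/2::real)^Suc N"
  have w: "0 \<le> 1 - w" unfolding w_def using power_le_one[of "1/2::real" "Suc N"] by linarith
  from Suc obtain m M where mM: "\<And>x. x \<in> K \<Longrightarrow> m \<le> (avg ^^ n) f x" "\<And>x. x \<in> K \<Longrightarrow> (avg ^^ n) f x \<le> M"
    "M - m \<le> 2 * e + (1 - w)^n * (2 * B)" unfolding w_def by blast
  let ?g = "(avg ^^ n) f"
  have g: "bdd ?g" by (rule avg_iter_bdd[OF f])
  have ga: "appr e N ?g" by (induction n) (auto intro: avg_appr avg_iter_bdd f a)
  have "(1 - w) * (M - m) \<le> (1 - w) * (2 * e + (1 - w)^n * (2 * B))" by (rule mult_left_mono[OF mM(3) w])
  then have "((1 - w) * M + w * (?g \<one> + e)) - ((1 - w) * m + w * (?g \<one> - e)) \<le> 2 * e + (1 - w)^Suc n * (2 * B)"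
    by (simp add: algebra_simps)
  then show ?case
    using avg_contract_upper[OF g ga _ mM(2)] avg_contract_lower[OF g ga _ mM(1)] unfolding w_def[symmetric]
    by (intro exI[of _ "(1 - w) * m + w * (?g \<one> - e)"] exI[of _ "(1 - w) * M + w * (?g \<one> + e)"]) auto
qed

lemma continuous_bdd:
  assumes "continuous_map X euclideanreal f" shows "bdd f"
proof -
  have "compactin euclideanreal (f ` K)"
    using image_compactin[OF _ assms, of K] compX topX by (simp add: compact_space_def)
  then have "bounded (f ` K)" by (simp add: compact_imp_bounded)
  then show ?thesis unfolding bdd_def bounded_iff by auto
qed

text \<open>Compactness of \<open>K \<times> K\<close>. For a pair \<open>(x, y)\<close> the element
  \<open>inv x \<otimes> y\<close> carries \<open>x\<close> to \<open>y\<close> exactly; continuity,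
  made uniform in \<open>k\<close> by a tube around the compact \<open>K\<close>, allows replacing
  it by some \<open>d i\<close> and moving the pair a little.\<close>

lemma continuous_appr:
  assumes f: "continuous_map X euclideanreal f" and e: "e > 0"
  shows "\<exists>N. appr e N f"
proof -
  let ?X2 = "prod_topology X X"
  have loc: "\<exists>A i. openin ?X2 A \<and> p \<in> A \<and> (\<forall>(x,y)\<in>A. \<forall>k\<in>K. \<bar>f (x \<otimes> d i \<otimes> k) - f (y \<otimes> k)\<bar> < e)"
    if p: "p \<in> K \<times> K" for p
  proof -
    obtain x y where xy: "p = (x, y)" "x \<in> K" "y \<in> K" using p by auto
    let ?X4 = "prod_topology (prod_topology ?X2 X) X"
    define F where "F = (\<lambda>(((x, y), z), k). f (x \<otimes> z \<otimes> k) - f (y \<otimes> k))"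
    have mul: "continuous_map Y X (\<lambda>q. a q \<otimes> b q)" if "continuous_map Y X a" "continuous_map Y X b" for Y and a b :: "_ \<Rightarrow> 'a"
      using continuous_map_compose[OF continuous_map_pairedI[OF that] contX] by (simp add: comp_def)
    have pr: "continuous_map ?X4 X (\<lambda>q. fst (fst (fst q)))" "continuous_map ?X4 X (\<lambda>q. snd (fst (fst q)))"
      "continuous_map ?X4 X (\<lambda>q. snd (fst q))" "continuous_map ?X4 X snd"
      by (intro continuous_map_fst_of continuous_map_snd_of continuous_map_id[unfolded id_def] continuous_map_snd
           continuous_map_compose[of _ ?X2 "\<lambda>q. fst (fst q)" X fst, unfolded comp_def]
           continuous_map_compose[of _ ?X2 "\<lambda>q. fst (fst q)" X snd, unfolded comp_def]
           continuous_map_compose[of _ "prod_topology ?X2 X" fst ?X2 fst, unfolded comp_def]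
           continuous_map_compose[of _ "prod_topology ?X2 X" fst X snd, unfolded comp_def]
           continuous_map_fst)+
    have "continuous_map ?X4 euclideanreal F"
      unfolding F_def split_beta
      by (intro continuous_map_diff continuous_map_compose[OF _ f, unfolded comp_def] mul pr)
    then have W: "openin ?X4 {q \<in> topspace ?X4. F q \<in> {-e<..<e}}"
      by (rule openin_continuous_map_preimage) auto
    let ?W = "{q \<in> topspace ?X4. F q \<in> {-e<..<e}}"
    define z where "z = inv x \<otimes> y"
    have z: "z \<in> K" "x \<otimes> z = y"
      using xy by (auto simp: z_def K_mult K_inv K_carrier m_assoc[symmetric])
    have sub: "{((x, y), z)} \<times> K \<subseteq> ?W"
      using xy z e by (auto simp: F_def topX)
    obtain P Q where PQ: "openin (prod_topology ?X2 X) P" "openin X Q" "{((x, y), z)} \<subseteq> P" "K \<subseteq> Q" "P \<times> Q \<subseteq> ?W"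
    proof (rule Wallace_theorem_prod_topology[OF _ _ W sub])
      show "compactin (prod_topology ?X2 X) {((x, y), z)}" using xy z by (simp add: topX)
      show "compactin X K" using compX topX by (simp add: compact_space_def)
    qed auto
    have "((x, y), z) \<in> P" using PQ(3) by simp
    then obtain A Z where AZ: "openin ?X2 A" "openin X Z" "(x, y) \<in> A" "z \<in> Z" "A \<times> Z \<subseteq> P"
      using openin_prod_topology_alt[THEN iffD1, OF PQ(1), rule_format, of "(x, y)" z] by auto
    obtain i where i: "d i \<in> Z" using dense[OF AZ(2)] AZ(4) by blast
    have "\<bar>f (x' \<otimes> d i \<otimes> k) - f (y' \<otimes> k)\<bar> < e" if "(x', y') \<in> A" "k \<in> K" for x' y' k
    proof -
      have "(((x', y'), d i), k) \<in> ?W" using that i AZ(5) PQ(4,5) by blast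
      then show ?thesis by (auto simp: F_def abs_less_iff)
    qed
    then show ?thesis using AZ xy by (intro exI[of _ A] exI[of _ i]) auto
  qed
  define Q where "Q U i \<longleftrightarrow> (\<forall>(x,y)\<in>U. \<forall>k\<in>K. \<bar>f (x \<otimes> d i \<otimes> k) - f (y \<otimes> k)\<bar> < e)" for U i
  define \<U> where "\<U> = {U. openin ?X2 U \<and> (\<exists>i. Q U i)}"
  have "compact_space ?X2" using compX by (simp add: compact_space_prod_topology)
  then have "compactin ?X2 (K \<times> K)" by (simp add: compact_space_def topX)
  moreover have "openin ?X2 U" if "U \<in> \<U>" for U using that by (simp add: \<U>_def)
  moreover have "K \<times> K \<subseteq> \<Union>\<U>"
  proof
    fix p assume "p \<in> K \<times> K"
    from loc[OF this] obtain A i where "openin ?X2 A" "p \<in> A" "Q A i" unfolding Q_def by blast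
    then show "p \<in> \<Union>\<U>" unfolding \<U>_def by blast
  qed
  ultimately have "\<exists>\<F>. finite \<F> \<and> \<F> \<subseteq> \<U> \<and> K \<times> K \<subseteq> \<Union>\<F>"
    by (rule compactinD)
  then obtain \<F> where \<F>: "finite \<F>" "\<F> \<subseteq> \<U>" "K \<times> K \<subseteq> \<Union>\<F>" by blast
  define i where "i U = (SOME i. Q U i)" for U
  have i: "Q U (i U)" if "U \<in> \<F>" for U
    unfolding i_def using \<F>(2) that by (intro someI_ex[of "Q U"]) (auto simp: \<U>_def)
  have "appr e (Max (insert 0 (i ` \<F>))) f"
    unfolding appr_def
  proof (intro ballI)
    fix x y assume xy: "x \<in> K" "y \<in> K"
    then obtain U where U: "U \<in> \<F>" "(x, y) \<in> U" using \<F>(3) by blast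
    have "i U \<le> Max (insert 0 (i ` \<F>))" using \<F>(1) U(1) by (intro Max_ge) auto
    moreover have "\<bar>f (x \<otimes> d (i U) \<otimes> k) - f (y \<otimes> k)\<bar> \<le> e" if "k \<in> K" for k
      using i[OF U(1)] U(2) that unfolding Q_def by fastforce
    ultimately show "\<exists>j\<le>Max (insert 0 (i ` \<F>)). \<forall>k\<in>K. \<bar>f (x \<otimes> d j \<otimes> k) - f (y \<otimes> k)\<bar> \<le> e" by blast
  qed
  then show ?thesis by blast
qed

lemma avg_iter_flat:
  assumes f: "continuous_map X euclideanreal f" and e: "e > 0"
  shows "\<exists>n c. \<forall>j\<ge>n. \<forall>x\<in>K. \<bar>(avg ^^ j) f x - c\<bar> \<le> e"
proof -
  have b: "bdd f" by (rule continuous_bdd[OF f])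
  then obtain B where B: "\<And>x. x \<in> K \<Longrightarrow> \<bar>f x\<bar> \<le> B" by (auto simp: bdd_def)
  have "B \<ge> 0" using B[OF K_one] by simp
  \<comment> \<open>With \<open>e/4\<close> the limiting oscillation is \<open>e/2\<close>, which
    leaves \<open>e/2\<close> for the geometric remainder.\<close>
  obtain N where N: "appr (e/4) N f" using continuous_appr[OF f, of "e/4"] e by auto
  have "(1/2::real)^Suc N \<le> 1" "(1/2::real)^Suc N > 0" by (rule power_le_one) auto
  then have "norm (1 - (1/2::real)^Suc N) < 1" by (simp only: real_norm_def abs_less_iff) linarith
  then have "(\<lambda>n. (1 - (1/2::real)^Suc N)^n * (2 * B)) \<longlonglongrightarrow> 0 * (2 * B)"
    by (intro tendsto_intros LIMSEQ_power_zero)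
  then have "\<forall>\<^sub>F n in sequentially. (1 - (1/2::real)^Suc N)^n * (2 * B) < e/2"
    using e by (intro order_tendstoD) auto
  then obtain n where n: "(1 - (1/2::real)^Suc N)^n * (2 * B) < e/2"
    by (auto simp: eventually_sequentially)
  obtain m M where mM: "\<And>x. x \<in> K \<Longrightarrow> m \<le> (avg ^^ n) f x" "\<And>x. x \<in> K \<Longrightarrow> (avg ^^ n) f x \<le> M" "M - m \<le> e"
    using avg_iter_osc[OF b N B, of n] n by fastforce
  \<comment> \<open>Averaging never leaves the range of values, so all later iterates stay between
    \<open>m\<close> and \<open>M\<close>.\<close>
  have "\<bar>(avg ^^ j) f x - m\<bar> \<le> e" if "j \<ge> n" "x \<in> K" for j x
  proof -
    have "(avg ^^ j) f = (avg ^^ (j - n)) ((avg ^^ n) f)"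
      using that(1) by (metis funpow_add comp_apply le_add_diff_inverse2)
    then have "m \<le> (avg ^^ j) f x" "(avg ^^ j) f x \<le> M"
      using avg_iter_bounds[OF avg_iter_bdd[OF b] that(2)] mM by auto
    then show ?thesis using mM(3) by linarith
  qed
  then show ?thesis by blast
qed

lemma mean_tendsto:
  assumes f: "continuous_map X euclideanreal f" and x: "x \<in> K"
  shows "(\<lambda>n. (avg ^^ n) f x) \<longlonglongrightarrow> mean f"
proof -
  have "Cauchy (\<lambda>n. (avg ^^ n) f \<one>)"
  proof (rule metric_CauchyI)
    fix e :: real assume "e > 0"
    then obtain n c where nc: "\<And>j. j \<ge> n \<Longrightarrow> \<bar>(avg ^^ j) f \<one> - c\<bar> \<le> e/3"
      using avg_iter_flat[OF f, of "e/3"] K_one by auto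
    then have "dist ((avg ^^ i) f \<one>) ((avg ^^ j) f \<one>) < e" if "i \<ge> n" "j \<ge> n" for i j
      using nc[OF that(1)] nc[OF that(2)] \<open>e > 0\<close> unfolding dist_real_def by linarith
    then show "\<exists>M. \<forall>m\<ge>M. \<forall>n\<ge>M. dist ((avg ^^ m) f \<one>) ((avg ^^ n) f \<one>) < e" by blast
  qed
  then have 1: "(\<lambda>n. (avg ^^ n) f \<one>) \<longlonglongrightarrow> mean f"
    unfolding mean_def by (simp add: Cauchy_convergent convergent_LIMSEQ_iff[symmetric])
  have "(\<lambda>n. (avg ^^ n) f x - (avg ^^ n) f \<one>) \<longlonglongrightarrow> 0"
  proof (rule LIMSEQ_I)
    fix e :: real assume "e > 0"
    then obtain n c where n: "\<And>j x. j \<ge> n \<Longrightarrow> x \<in> K \<Longrightarrow> \<bar>(avg ^^ j) f x - c\<bar> \<le> e/3"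
      using avg_iter_flat[OF f, of "e/3"] by auto
    have "norm ((avg ^^ j) f x - (avg ^^ j) f \<one> - 0) < e" if "j \<ge> n" for j
      using n[OF that x] n[OF that K_one] \<open>e > 0\<close> unfolding real_norm_def diff_0_right by linarith
    then show "\<exists>no. \<forall>n\<ge>no. norm ((avg ^^ n) f x - (avg ^^ n) f \<one> - 0) < e" by blast
  qed
  from tendsto_add[OF this 1] show ?thesis by simp
qed

lemma mean_linear:
  assumes "continuous_map X euclideanreal f" "continuous_map X euclideanreal g"
  shows "mean (\<lambda>x. a * f x + b * g x) = a * mean f + b * mean g"
proof -
  have c: "continuous_map X euclideanreal (\<lambda>x. a * f x + b * g x)"
    by (intro continuous_intros continuous_map_real_mult continuous_map_add assms) auto
  have "(\<lambda>n. a * (avg ^^ n) f \<one> + b * (avg ^^ n) g \<one>) \<longlonglongrightarrow> a * mean f + b * mean g"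
    by (intro tendsto_intros mean_tendsto assms K_one)
  then show ?thesis
    using mean_tendsto[OF c K_one] avg_iter_linear[OF continuous_bdd[OF assms(1)] continuous_bdd[OF assms(2)] K_one]
    by (simp add: LIMSEQ_unique)
qed

lemma mean_bound:
  assumes "continuous_map X euclideanreal f" "\<And>x. x \<in> K \<Longrightarrow> \<bar>f x\<bar> \<le> B"
  shows "\<bar>mean f\<bar> \<le> B"
proof -
  have b: "bdd f" by (rule continuous_bdd[OF assms(1)])
  have "(avg ^^ n) f \<one> \<in> {-B..B}" for n
    using avg_iter_bounds[OF b K_one, of B n] avg_iter_bounds(2)[OF b K_one, of "-B" n] assms(2)
    by (fastforce simp: abs_le_iff)
  then have "mean f \<in> {-B..B}"
    using closed_sequentially[OF closed_atLeastAtMost _ mean_tendsto[OF assms(1) K_one]] by blast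
  then show ?thesis by auto
qed

lemma mean_const: "mean (\<lambda>_. c) = c"
proof -
  have b: "bdd (\<lambda>_. c)" by (auto simp: bdd_def)
  have "(avg ^^ n) (\<lambda>_. c) \<one> = c" for n
    using avg_iter_bounds[OF b K_one, of c n] avg_iter_bounds(2)[OF b K_one, of c n] by force
  then show ?thesis by (simp add: mean_def)
qed

lemma mean_cong: "(\<And>x. x \<in> K \<Longrightarrow> f x = g x) \<Longrightarrow> mean f = mean g"
  unfolding mean_def using avg_iter_cong[of f g \<one>] K_one by simp

text \<open>Averaging multiplies on the right and so commutes with left translations: the iterates
  of the translated function at \<open>\<one>\<close> are those of \<open>f\<close> at
  \<open>a\<close>, and by \<open>mean_tendsto\<close> the limit is the same at every point.\<close>

lemma mean_left_invariant:
  assumes f: "continuous_map X euclideanreal f" and a: "a \<in> K"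
  shows "mean (\<lambda>x. f (a \<otimes> x)) = mean f"
proof -
  have "(avg ^^ n) (\<lambda>x. f (a \<otimes> x)) x = (avg ^^ n) f (a \<otimes> x)" if "x \<in> K" for n x
    using that
  proof (induction n arbitrary: x)
    case (Suc n)
    have "(avg ^^ Suc n) (\<lambda>x. f (a \<otimes> x)) x = avg (\<lambda>x. (avg ^^ n) f (a \<otimes> x)) x"
      using Suc by (auto intro: avg_cong)
    also have "\<dots> = (avg ^^ Suc n) f (a \<otimes> x)"
      using a Suc.prems dK by (simp add: avg_def m_assoc K_carrier)
    finally show ?case .
  qed simp
  then have "(\<lambda>n. (avg ^^ n) (\<lambda>x. f (a \<otimes> x)) \<one>) = (\<lambda>n. (avg ^^ n) f a)"
    using K_one a by (simp add: K_carrier)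
  then have "(\<lambda>n. (avg ^^ n) (\<lambda>x. f (a \<otimes> x)) \<one>) \<longlonglongrightarrow> mean f" using mean_tendsto[OF f a] by simp
  then show ?thesis unfolding mean_def by (rule limI)
qed

end

section \<open>Vector-valued means and differentiation under the mean\<close>

context compact_group begin

definition vmean :: "('a \<Rightarrow> 'v::euclidean_space) \<Rightarrow> 'v" where
  "vmean f = (\<Sum>b\<in>Basis. mean (\<lambda>k. f k \<bullet> b) *\<^sub>R b)"

lemma continuous_inner:
  fixes f :: "'a \<Rightarrow> 'v::euclidean_space"
  assumes "continuous_map X euclidean f"
  shows "continuous_map X euclideanreal (\<lambda>k. f k \<bullet> u)"
  using continuous_map_compose[OF assms, of euclideanreal "\<lambda>x. x \<bullet> u"]
  by (simp add: comp_def continuous_on_inner continuous_on_id continuous_on_const)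

lemma mean_sum:
  assumes "finite B" "\<And>b. b \<in> B \<Longrightarrow> continuous_map X euclideanreal (f b)"
  shows "mean (\<lambda>k. \<Sum>b\<in>B. c b * f b k) = (\<Sum>b\<in>B. c b * mean (f b))"
  using assms
proof (induction B)
  case (insert a B)
  have "continuous_map X euclideanreal (\<lambda>k. \<Sum>b\<in>B. c b * f b k)"
    using insert by (intro continuous_map_sum continuous_map_real_mult_left) auto
  then have "mean (\<lambda>k. c a * f a k + 1 * (\<Sum>b\<in>B. c b * f b k)) = c a * mean (f a) + 1 * mean (\<lambda>k. \<Sum>b\<in>B. c b * f b k)"
    using insert.prems by (intro mean_linear) auto
  then show ?case using insert by simp
qed (simp add: mean_const)

lemma vmean_inner:
  assumes "continuous_map X euclidean f"
  shows "vmean f \<bullet> u = mean (\<lambda>k. f k \<bullet> u)"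
proof -
  have "mean (\<lambda>k. f k \<bullet> u) = mean (\<lambda>k. \<Sum>b\<in>Basis. (u \<bullet> b) * (f k \<bullet> b))"
    by (rule mean_cong) (subst euclidean_inner, simp add: mult.commute)
  also have "\<dots> = (\<Sum>b\<in>Basis. (u \<bullet> b) * mean (\<lambda>k. f k \<bullet> b))"
    by (rule mean_sum) (auto intro: continuous_inner assms)
  also have "\<dots> = vmean f \<bullet> u"
    unfolding vmean_def inner_sum_left inner_scaleR_left
    by (intro sum.cong refl) (metis inner_commute mult.commute)
  finally show ?thesis by simp
qed

text \<open>Tested against vectors, \<open>L\<close> moves to the other side as its adjoint, where
  \<open>vmean_inner\<close> applies to an arbitrary vector and not just to the basis.\<close>

lemma vmean_linear:
  fixes L :: "'v::euclidean_space \<Rightarrow> 'w::euclidean_space"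
  assumes "continuous_map X euclidean f" "linear L"
  shows "vmean (\<lambda>k. L (f k)) = L (vmean f)"
proof (rule euclidean_eqI)
  fix c :: 'w
  have "continuous_map X euclidean (\<lambda>k. L (f k))"
    using continuous_map_compose[OF assms(1), of euclidean L] assms(2)
    by (simp add: comp_def linear_continuous_on linear_conv_bounded_linear)
  then show "vmean (\<lambda>k. L (f k)) \<bullet> c = L (vmean f) \<bullet> c"
    using vmean_inner[OF assms(1), of "adjoint L c"] by (simp add: vmean_inner adjoint_works[OF assms(2)])
qed

lemma vmean_add:
  fixes f g :: "'a \<Rightarrow> 'v::euclidean_space"
  assumes "continuous_map X euclidean f" "continuous_map X euclidean g"
  shows "vmean (\<lambda>k. f k + g k) = vmean f + vmean g"
proof (rule euclidean_eqI)
  fix c :: 'v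
  have "continuous_map X euclidean (\<lambda>k. f k + g k)" using assms by (rule continuous_map_add)
  then show "vmean (\<lambda>k. f k + g k) \<bullet> c = (vmean f + vmean g) \<bullet> c"
    using mean_linear[OF continuous_inner[OF assms(1)] continuous_inner[OF assms(2)], of 1 c 1 c]
    by (simp add: vmean_inner assms inner_add_left)
qed

lemma vmean_cong: "(\<And>x. x \<in> K \<Longrightarrow> f x = g x) \<Longrightarrow> vmean f = vmean g"
  unfolding vmean_def by (intro sum.cong refl arg_cong2[of _ _ _ _ scaleR] mean_cong) auto

lemma vmean_diff:
  fixes f g :: "'a \<Rightarrow> 'v::euclidean_space"
  assumes "continuous_map X euclidean f" "continuous_map X euclidean g"
  shows "vmean (\<lambda>k. f k - g k) = vmean f - vmean g"
proof -
  have "continuous_map X euclidean (\<lambda>k. f k - g k)" using assms by (rule continuous_map_diff)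
  from vmean_add[OF this assms(2)] show ?thesis by simp
qed

lemma vmean_const: "vmean (\<lambda>_. v) = v"
  by (simp add: vmean_def mean_const euclidean_representation)

text \<open>Pairing with the mean itself and using the Cauchy-Schwarz inequality gives the sharp
  constant, which separate bounds on the components would not.\<close>

lemma vmean_bound:
  assumes "continuous_map X euclidean f" "\<And>x. x \<in> K \<Longrightarrow> norm (f x) \<le> B"
  shows "norm (vmean f) \<le> B"
proof -
  let ?v = "vmean f"
  have "\<bar>mean (\<lambda>k. f k \<bullet> ?v)\<bar> \<le> B * norm ?v"
  proof (rule mean_bound[OF continuous_inner[OF assms(1)]])
    fix x assume "x \<in> K"
    then show "\<bar>f x \<bullet> ?v\<bar> \<le> B * norm ?v"
      by (intro order_trans[OF Cauchy_Schwarz_ineq2] mult_right_mono assms(2)) auto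
  qed
  then have "norm ?v * norm ?v \<le> B * norm ?v"
    using vmean_inner[OF assms(1), of ?v] by (simp add: power2_norm_eq_inner[symmetric] power2_eq_square)
  moreover have "0 \<le> B" using order_trans[OF norm_ge_zero assms(2)[OF K_one]] .
  ultimately show ?thesis by (cases "norm ?v = 0") auto
qed

lemma vmean_left_invariant:
  fixes f :: "'a \<Rightarrow> 'v::euclidean_space"
  assumes "continuous_map X euclidean f" "a \<in> K"
  shows "vmean (\<lambda>x. f (a \<otimes> x)) = vmean f"
  unfolding vmean_def using mean_left_invariant[OF continuous_inner[OF assms(1)] assms(2)] by simp

definition par_cont :: "'z::euclidean_space set \<Rightarrow> ('a \<Rightarrow> 'z \<Rightarrow> 'v::euclidean_space) \<Rightarrow> bool" where
  "par_cont S f \<longleftrightarrow> continuous_map (prod_topology X (top_of_set S)) euclidean (\<lambda>(k, y). f k y)"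

lemma par_cont_section:
  assumes "par_cont S f" "y \<in> S"
  shows "continuous_map X euclidean (\<lambda>k. f k y)"
proof -
  have "continuous_map X (prod_topology X (top_of_set S)) (\<lambda>k. (k, y))"
    using assms(2) by (intro continuous_map_pairedI) (auto simp: continuous_map_id[unfolded id_def])
  from continuous_map_compose[OF this assms(1)[unfolded par_cont_def]] show ?thesis by (simp add: comp_def)
qed

text \<open>A tube around the compact \<open>K \<times> {y}\<close> turns joint continuity into
  continuity at \<open>y\<close> that is uniform in \<open>k\<close>.\<close>

lemma par_cont_uniform:
  assumes f: "par_cont S f" and S: "open S" "y \<in> S" and e: "e > 0"
  obtains r where "r > 0" "ball y r \<subseteq> S" "\<And>y' k. y' \<in> ball y r \<Longrightarrow> k \<in> K \<Longrightarrow> norm (f k y' - f k y) < e"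
proof -
  let ?P = "prod_topology X (top_of_set S)"
  have c1: "continuous_map ?P euclidean (\<lambda>q. f (fst q) (snd q))"
    using f unfolding par_cont_def by (simp add: case_prod_unfold)
  have c2: "continuous_map ?P euclidean (\<lambda>q. f (fst q) y)"
    using continuous_map_compose[OF continuous_map_fst par_cont_section[OF f S(2)]] by (simp add: comp_def)
  have "continuous_map ?P euclideanreal (\<lambda>q. norm (f (fst q) (snd q) - f (fst q) y))"
    by (intro continuous_map_norm continuous_map_diff c1 c2)
  then have W: "openin ?P {q \<in> topspace ?P. norm (f (fst q) (snd q) - f (fst q) y) \<in> {..<e}}"
    by (rule openin_continuous_map_preimage) auto
  have sub: "K \<times> {y} \<subseteq> {q \<in> topspace ?P. norm (f (fst q) (snd q) - f (fst q) y) \<in> {..<e}}"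
    using S e by (auto simp: topX)
  obtain U V where UV: "openin X U" "openin (top_of_set S) V" "K \<subseteq> U" "{y} \<subseteq> V"
    "U \<times> V \<subseteq> {q \<in> topspace ?P. norm (f (fst q) (snd q) - f (fst q) y) \<in> {..<e}}"
  proof (rule Wallace_theorem_prod_topology[OF _ _ W sub])
    show "compactin X K" using compX topX by (simp add: compact_space_def)
    show "compactin (top_of_set S) {y}" using S by simp
  qed
  have V: "open V" "V \<subseteq> S" "y \<in> V" using UV(2,4) S(1) by (auto simp: openin_open_eq)
  then obtain r where r: "r > 0" "ball y r \<subseteq> V" using open_contains_ball by blast
  show ?thesis
  proof (rule that[OF r(1)])
    show "ball y r \<subseteq> S" using r(2) V(2) by blast
    fix y' k assume "y' \<in> ball y r" "k \<in> K"
    then have "(k, y') \<in> U \<times> V" using r(2) UV(3) by blast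
    then show "norm (f k y' - f k y) < e" using UV(5) by auto
  qed
qed

lemma vmean_continuous:
  assumes f: "par_cont S f" and S: "open S"
  shows "continuous_on S (\<lambda>y. vmean (\<lambda>k. f k y))"
proof (intro continuous_at_imp_continuous_on ballI)
  fix y assume y: "y \<in> S"
  show "isCont (\<lambda>y. vmean (\<lambda>k. f k y)) y"
    unfolding continuous_at_eps_delta
  proof (intro allI impI)
    fix e :: real assume "e > 0"
    then obtain r where r: "r > 0" "ball y r \<subseteq> S" "\<And>y' k. y' \<in> ball y r \<Longrightarrow> k \<in> K \<Longrightarrow> norm (f k y' - f k y) < e/2"
      using par_cont_uniform[OF f S y, of "e/2"] by auto
    have "dist (vmean (\<lambda>k. f k y')) (vmean (\<lambda>k. f k y)) < e" if "dist y' y < r" for y'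
    proof -
      have y': "y' \<in> ball y r" "y' \<in> S" using that r(2) by (auto simp: dist_commute)
      have "norm (vmean (\<lambda>k. f k y' - f k y)) \<le> e/2"
        by (rule vmean_bound) (use r(3)[OF y'(1)] y y' f in \<open>auto intro: continuous_map_diff par_cont_section less_imp_le\<close>)
      then show ?thesis using \<open>e > 0\<close> vmean_diff[OF par_cont_section[OF f y'(2)] par_cont_section[OF f y]]
        by (simp add: dist_norm)
    qed
    then show "\<exists>d>0. \<forall>x'. dist x' y < d \<longrightarrow> dist (vmean (\<lambda>k. f k x')) (vmean (\<lambda>k. f k y)) < e"
      using r(1) by blast
  qed
qed

text \<open>Iterated derivatives in \<open>y\<close> exist and are jointly continuous in
  \<open>(k, y)\<close>: the hypothesis for differentiating under the mean. The dependence on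
  \<open>k\<close> is only continuous, as \<open>K\<close> carries just a topology.\<close>

primrec par_Ck :: "nat \<Rightarrow> 'z::euclidean_space set \<Rightarrow> ('a \<Rightarrow> 'z \<Rightarrow> 'v::euclidean_space) \<Rightarrow> bool" where
  "par_Ck 0 S f \<longleftrightarrow> par_cont S f"
| "par_Ck (Suc n) S f \<longleftrightarrow> par_cont S f \<and>
     (\<forall>v. (\<forall>k\<in>K. \<forall>y\<in>S. (\<lambda>t::real. f k (y + t *\<^sub>R v)) differentiable (at 0)) \<and> par_Ck n S (\<lambda>k. dir_deriv v (f k)))"

lemma par_Ck_cont: "par_Ck n S f \<Longrightarrow> par_cont S f"
  by (cases n) auto

text \<open>The difference quotients converge uniformly in \<open>k\<close>:
  \<open>par_cont_uniform\<close> controls the derivative near \<open>y\<close>,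
  \<open>line_bound\<close> the first-order remainder, and \<open>vmean_bound\<close> carries the
  estimate through the mean.\<close>

lemma vmean_dir_deriv:
  assumes f: "par_Ck (Suc n) S f" and S: "open S" and y: "y \<in> S"
  shows "((\<lambda>t. vmean (\<lambda>k. f k (y + t *\<^sub>R v))) has_vector_derivative vmean (\<lambda>k. dir_deriv v (f k) y)) (at 0)"
proof -
  let ?D = "\<lambda>k. dir_deriv v (f k)"
  have D: "par_cont S ?D" and fc: "par_cont S f" using f par_Ck_cont by auto
  have bl: "bounded_linear (\<lambda>t::real. t *\<^sub>R vmean (\<lambda>k. ?D k y))" by (rule bounded_linear_scaleR_left)
  have vd: "((\<lambda>t. f k (y + t *\<^sub>R v)) has_vector_derivative ?D k (y + s *\<^sub>R v)) (at s)"
    if "k \<in> K" "y + s *\<^sub>R v \<in> S" for k s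
  proof -
    have "(\<lambda>t. f k ((y + s *\<^sub>R v) + t *\<^sub>R v)) differentiable (at 0)"
      using f that by auto
    then have "((\<lambda>t. f k ((y + s *\<^sub>R v) + t *\<^sub>R v)) has_vector_derivative ?D k (y + s *\<^sub>R v)) (at (s - s))"
      by (simp add: dir_deriv_def vector_derivative_works)
    moreover have "((\<lambda>t. t - s) has_vector_derivative 1) (at s)"
      by (auto intro!: derivative_eq_intros)
    ultimately have "((\<lambda>t. f k ((y + s *\<^sub>R v) + t *\<^sub>R v)) \<circ> (\<lambda>t. t - s) has_vector_derivative 1 *\<^sub>R ?D k (y + s *\<^sub>R v)) (at s)"
      by (intro vector_diff_chain_at) auto
    then show ?thesis by (simp add: comp_def algebra_simps)
  qed
  have "\<exists>d>0. \<forall>t. norm (t - 0) < d \<longrightarrow> norm (vmean (\<lambda>k. f k (y + t *\<^sub>R v)) - vmean (\<lambda>k. f k (y + 0 *\<^sub>R v)) - (t - 0) *\<^sub>R vmean (\<lambda>k. ?D k y)) \<le> e * norm (t - 0)"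
    if e: "e > 0" for e :: real
  proof -
    obtain r where r: "r > 0" "ball y r \<subseteq> S" "\<And>y' k. y' \<in> ball y r \<Longrightarrow> k \<in> K \<Longrightarrow> norm (?D k y' - ?D k y) < e"
      using par_cont_uniform[OF D S y e] by blast
    \<comment> \<open>The \<open>1\<close> keeps the quotient meaningful for
      \<open>v = 0\<close>.\<close>
    define d where "d = r / (1 + norm v)"
    have "d > 0" unfolding d_def using r by (simp add: add_pos_nonneg)
    moreover have "norm (vmean (\<lambda>k. f k (y + t *\<^sub>R v)) - vmean (\<lambda>k. f k (y + 0 *\<^sub>R v)) - t *\<^sub>R vmean (\<lambda>k. ?D k y)) \<le> e * \<bar>t\<bar>"
      if t: "\<bar>t\<bar> < d" for t
    proof -
      have near: "y + s *\<^sub>R v \<in> ball y r" if "\<bar>s\<bar> \<le> \<bar>t\<bar>" for s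
      proof -
        have "\<bar>s\<bar> * norm v \<le> \<bar>t\<bar> * (1 + norm v)" using that by (intro mult_mono) auto
        also have "\<dots> < d * (1 + norm v)" using t by (intro mult_strict_right_mono) (auto simp: add_pos_nonneg)
        also have "\<dots> = r" by (simp add: d_def add_nonneg_eq_0_iff)
        finally show ?thesis by (simp add: dist_norm)
      qed
      have tS: "y + t *\<^sub>R v \<in> S" using near[of t] r(2) by auto
      have b: "norm (f k (y + t *\<^sub>R v) - f k y - t *\<^sub>R ?D k y) \<le> \<bar>t\<bar> * e" if k: "k \<in> K" for k
      proof -
        have "norm (f k (y + t *\<^sub>R v) - f k (y + 0 *\<^sub>R v) - t *\<^sub>R ?D k y) \<le> \<bar>t\<bar> * e"
        proof (rule line_bound)
          fix s assume "s \<in> closed_segment 0 t"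
          then have "\<bar>s\<bar> \<le> \<bar>t\<bar>" by (auto simp: closed_segment_eq_real_ivl split: if_splits)
          from near[OF this] show "((\<lambda>s. f k (y + s *\<^sub>R v)) has_vector_derivative ?D k (y + s *\<^sub>R v)) (at s)"
            "norm (?D k (y + s *\<^sub>R v) - ?D k y) \<le> e"
            using vd[OF k] r k by (auto intro: less_imp_le)
        qed
        then show ?thesis by simp
      qed
      note c1 = par_cont_section[OF fc tS] par_cont_section[OF fc y] par_cont_section[OF D y]
      have lin: "linear (\<lambda>x. t *\<^sub>R x)" by (simp add: linear_iff algebra_simps)
      have c3: "continuous_map X euclidean (\<lambda>k. t *\<^sub>R ?D k y)"
        using continuous_map_compose[OF c1(3), of euclidean "\<lambda>x. t *\<^sub>R x"] by (simp add: comp_def continuous_on_scaleR continuous_on_id continuous_on_const)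
      have "norm (vmean (\<lambda>k. f k (y + t *\<^sub>R v) - f k y - t *\<^sub>R ?D k y)) \<le> \<bar>t\<bar> * e"
        by (rule vmean_bound[OF continuous_map_diff[OF continuous_map_diff[OF c1(1,2)] c3] b])
      moreover have "vmean (\<lambda>k. f k (y + t *\<^sub>R v) - f k y - t *\<^sub>R ?D k y) = vmean (\<lambda>k. f k (y + t *\<^sub>R v)) - vmean (\<lambda>k. f k y) - t *\<^sub>R vmean (\<lambda>k. ?D k y)"
        by (simp add: vmean_diff[OF continuous_map_diff[OF c1(1,2)] c3] vmean_diff[OF c1(1,2)] vmean_linear[OF c1(3) lin])
      ultimately show ?thesis by (simp add: mult.commute)
    qed
    ultimately show ?thesis by auto
  qed
  then show ?thesis unfolding has_vector_derivative_def has_derivative_at_alt using bl by blast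
qed

lemma vmean_Ck:
  assumes "par_Ck n S f" "open S"
  shows "Ck_on n UNIV S (\<lambda>y. vmean (\<lambda>k. f k y))"
  using assms(1)
proof (induction n arbitrary: f)
  case 0
  then show ?case using vmean_continuous[OF _ assms(2)] by simp
next
  case (Suc n)
  have c: "continuous_on S (\<lambda>y. vmean (\<lambda>k. f k y))"
    using vmean_continuous[OF par_Ck_cont[OF Suc.prems] assms(2)] .
  have d: "((\<lambda>t. vmean (\<lambda>k. f k (y + t *\<^sub>R v))) has_vector_derivative vmean (\<lambda>k. dir_deriv v (f k) y)) (at 0)" if "y \<in> S" for y v
    by (rule vmean_dir_deriv[OF Suc.prems assms(2) that])
  have "Ck_on n UNIV S (dir_deriv v (\<lambda>y. vmean (\<lambda>k. f k y)))" for v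
  proof (rule Ck_on_cong[OF assms(2)])
    show "Ck_on n UNIV S (\<lambda>y. vmean (\<lambda>k. dir_deriv v (f k) y))"
      using Suc.prems by (intro Suc.IH) auto
    show "vmean (\<lambda>k. dir_deriv v (f k) y) = dir_deriv v (\<lambda>y. vmean (\<lambda>k. f k y)) y" if "y \<in> S" for y
      using dir_deriv_eqI[OF d[OF that]] by simp
  qed
  then show ?case using c d by (auto simp: Ck_on.simps(2) intro: differentiableI_vector)
qed

text \<open>A criterion for a group without charts of its own: locally
  \<open>f k y = F (\<phi> k, y)\<close> with \<open>F\<close> smooth and \<open>\<phi>\<close>
  merely continuous. This form is inherited by derivatives in \<open>y\<close>, since these
  differentiate \<open>F\<close> along \<open>(0, v)\<close>.\<close>

lemma par_Ck_plots:
  fixes f :: "'a \<Rightarrow> 'z::euclidean_space \<Rightarrow> 'v::euclidean_space"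
  assumes S: "open S"
    and loc: "\<And>k y. k \<in> K \<Longrightarrow> y \<in> S \<Longrightarrow> \<exists>U (\<phi> :: 'a \<Rightarrow> 'w::euclidean_space) T R F. openin X U \<and> k \<in> U \<and>
      continuous_map (subtopology X U) euclidean \<phi> \<and> open T \<and> \<phi> ` U \<subseteq> T \<and> open R \<and> y \<in> R \<and> R \<subseteq> S \<and>
      smooth_on UNIV (T \<times> R) F \<and> (\<forall>k\<in>U. \<forall>y\<in>R. f k y = F (\<phi> k, y))"
  shows "par_Ck n S f"
  using loc
proof (induction n arbitrary: f)
  have pc: "par_cont S f" if loc: "\<And>k y. k \<in> K \<Longrightarrow> y \<in> S \<Longrightarrow> \<exists>U (\<phi> :: 'a \<Rightarrow> 'w::euclidean_space) T R F. openin X U \<and> k \<in> U \<and>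
      continuous_map (subtopology X U) euclidean \<phi> \<and> open T \<and> \<phi> ` U \<subseteq> T \<and> open R \<and> y \<in> R \<and> R \<subseteq> S \<and>
      smooth_on UNIV (T \<times> R) F \<and> (\<forall>k\<in>U. \<forall>y\<in>R. f k y = F (\<phi> k, y))" for f :: "'a \<Rightarrow> 'z \<Rightarrow> 'v"
    unfolding par_cont_def
  proof (rule continuous_map_openin_preimage_eq[THEN iffD2], intro conjI allI impI)
    fix W :: "'v set" assume W: "openin euclidean W"
    let ?P = "prod_topology X (top_of_set S)"
    show "openin ?P (topspace ?P \<inter> (\<lambda>(k, y). f k y) -` W)"
    proof (rule openin_subopen[THEN iffD2], rule ballI)
      fix q assume q: "q \<in> topspace ?P \<inter> (\<lambda>(k, y). f k y) -` W"
      then have "fst q \<in> K" "snd q \<in> S" by (auto simp: topX)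
      from loc[OF this] obtain U T R F and \<phi> :: "'a \<Rightarrow> 'w" where U: "openin X U" "fst q \<in> U"
        "continuous_map (subtopology X U) euclidean \<phi>" "open T" "\<phi> ` U \<subseteq> T" "open R" "snd q \<in> R" "R \<subseteq> S"
        "smooth_on UNIV (T \<times> R) F" "\<And>k y. k \<in> U \<Longrightarrow> y \<in> R \<Longrightarrow> f k y = F (\<phi> k, y)" by blast
      have UK: "U \<subseteq> topspace X" using U(1) by (rule openin_subset)
      let ?PU = "prod_topology (subtopology X U) (subtopology (top_of_set S) R)"
      have R: "subtopology (top_of_set S) R = top_of_set R" using U(8) by (simp add: subtopology_subtopology Int_absorb1)
      have c1: "continuous_map ?PU (top_of_set (T \<times> R)) (\<lambda>q. (\<phi> (fst q), snd q))"
      proof -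
        have "continuous_map ?PU (prod_topology euclidean euclidean) (\<lambda>q. (\<phi> (fst q), snd q))"
          using continuous_map_compose[OF continuous_map_fst U(3)] unfolding R
          by (intro continuous_map_pairedI) (auto simp: comp_def intro: continuous_map_into_fulltopology[OF continuous_map_snd])
        then show ?thesis using U(5) by (auto simp: continuous_map_in_subtopology)
      qed
      have c2: "continuous_map (top_of_set (T \<times> R)) euclidean F"
        using smooth_on_continuous[OF U(9)] by simp
      have "openin ?PU {q \<in> topspace ?PU. (F \<circ> (\<lambda>q. (\<phi> (fst q), snd q))) q \<in> W}"
        using openin_continuous_map_preimage[OF continuous_map_compose[OF c1 c2] W] .
      moreover have "openin ?P (U \<times> R)" using U(1,8) open_subset[OF U(8,6)] by (simp add: openin_prod_Times_iff)
      moreover have "?PU = subtopology ?P (U \<times> R)"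
        by (simp only: subtopology_Times)
      ultimately have o: "openin ?P {q \<in> topspace ?PU. (F \<circ> (\<lambda>q. (\<phi> (fst q), snd q))) q \<in> W}"
        using openin_trans_full[of ?P "U \<times> R"] by simp
      show "\<exists>T. openin ?P T \<and> q \<in> T \<and> T \<subseteq> topspace ?P \<inter> (\<lambda>(k, y). f k y) -` W"
        by (intro exI conjI, rule o) (use q U UK in auto)
    qed
  qed auto
  { case 0 then show ?case using pc by simp }
  { case (Suc n)
    have "(\<lambda>t::real. f k (y + t *\<^sub>R v)) differentiable (at 0)" if k: "k \<in> K" and y: "y \<in> S" for k y v
    proof -
      obtain U T R F and \<phi> :: "'a \<Rightarrow> 'w" where U: "k \<in> U"
        "open T" "\<phi> ` U \<subseteq> T" "open R" "y \<in> R" "smooth_on UNIV (T \<times> R) F"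
        "\<And>k y. k \<in> U \<Longrightarrow> y \<in> R \<Longrightarrow> f k y = F (\<phi> k, y)" using Suc.prems[OF k y] by blast
      have "(\<lambda>t::real. F ((\<phi> k, y) + t *\<^sub>R (0, v))) differentiable (at 0)"
        using has_derivative_along_line[OF smooth_on_has_derivative[OF U(6) open_Times[OF U(2,4)]], of "(\<phi> k, y)" "(0, v)"] U(1,3,5)
        by (auto intro: differentiableI_vector)
      then have "(\<lambda>t::real. F (\<phi> k, y + t *\<^sub>R v)) differentiable (at 0)" by simp
      then show ?thesis using dir_deriv_cong(2)[OF U(4,5), of "\<lambda>y. F (\<phi> k, y)" "f k" v] U(1,7) by simp
    qed
    moreover have "par_Ck n S (\<lambda>k. dir_deriv v (f k))" for v
    proof (rule Suc.IH)
      fix k y assume "k \<in> K" "y \<in> S"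
      from Suc.prems[OF this] obtain U T R F and \<phi> :: "'a \<Rightarrow> 'w" where U: "openin X U" "k \<in> U"
        "continuous_map (subtopology X U) euclidean \<phi>" "open T" "\<phi> ` U \<subseteq> T" "open R" "y \<in> R" "R \<subseteq> S" "smooth_on UNIV (T \<times> R) F"
        "\<And>k y. k \<in> U \<Longrightarrow> y \<in> R \<Longrightarrow> f k y = F (\<phi> k, y)" by blast
      have "dir_deriv v (f k) y = dir_deriv (0, v) F (\<phi> k, y)" if "k \<in> U" "y \<in> R" for k y
      proof -
        have "dir_deriv v (f k) y = dir_deriv v (\<lambda>y. F (\<phi> k, y)) y"
          using U(10) that by (intro dir_deriv_cong(1)[OF U(6)]) auto
        then show ?thesis by (simp add: dir_deriv_def)
      qed
      then show "\<exists>U (\<phi> :: 'a \<Rightarrow> 'w) T R F. openin X U \<and> k \<in> U \<and>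
        continuous_map (subtopology X U) euclidean \<phi> \<and> open T \<and> \<phi> ` U \<subseteq> T \<and> open R \<and> y \<in> R \<and> R \<subseteq> S \<and>
        smooth_on UNIV (T \<times> R) F \<and> (\<forall>k\<in>U. \<forall>y\<in>R. dir_deriv v (f k) y = F (\<phi> k, y))"
        using U(1-8) smooth_on_dir_deriv[OF U(9) UNIV_I, of "(0, v)"] by blast
    qed
    ultimately show ?case using pc[OF Suc.prems] by simp }
qed

lemma vmean_smooth:
  assumes "open S" "\<And>n. par_Ck n S f"
  shows "smooth_on UNIV S (\<lambda>y. vmean (\<lambda>k. f k y))"
  using vmean_Ck assms unfolding smooth_on_def by blast

end

section \<open>Local existence and uniqueness for autonomous differential equations\<close>

lemma smooth_local_lipschitz:
  fixes f :: "'a::euclidean_space \<Rightarrow> 'b::real_normed_vector"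
  assumes S: "open S" "x0 \<in> S" and f: "smooth_on UNIV S f"
  obtains r L where "r > 0" "L > 0" "cball x0 r \<subseteq> S"
    "\<And>x y. x \<in> cball x0 r \<Longrightarrow> y \<in> cball x0 r \<Longrightarrow> norm (f x - f y) \<le> L * norm (x - y)"
proof -
  obtain r where r: "r > 0" "cball x0 r \<subseteq> S" using S open_contains_cball by blast
  have "\<exists>B. \<forall>x\<in>cball x0 r. norm (dir_deriv b f x) \<le> B" for b
  proof -
    have "continuous_on (cball x0 r) (dir_deriv b f)"
      using smooth_on_continuous[OF smooth_on_dir_deriv[OF f UNIV_I]] r(2) continuous_on_subset by blast
    then have "bounded (dir_deriv b f ` cball x0 r)"
      by (intro compact_imp_bounded compact_continuous_image) auto
    then show ?thesis by (auto simp: bounded_iff)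
  qed
  then obtain B where B: "\<And>b x. x \<in> cball x0 r \<Longrightarrow> norm (dir_deriv b f x) \<le> B b" by metis
  define L where "L = (\<Sum>b\<in>(Basis::'a set). \<bar>B b\<bar>) + 1"
  have L: "L > 0" unfolding L_def by (intro add_nonneg_pos sum_nonneg) auto
  have "norm (f x - f y) \<le> L * norm (x - y)" if "x \<in> cball x0 r" "y \<in> cball x0 r" for x y
  proof (rule differentiable_bound[of "cball x0 r" f "\<lambda>x v. dir_deriv v f x"])
    fix x assume x: "x \<in> cball x0 r"
    then have xS: "x \<in> S" using r by auto
    show "(f has_derivative (\<lambda>v. dir_deriv v f x)) (at x within cball x0 r)"
      using smooth_on_has_derivative[OF f S(1) xS] by (rule has_derivative_at_withinI)
    show "onorm (\<lambda>v. dir_deriv v f x) \<le> L"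
    proof (rule onorm_bound)
      fix v
      have "norm (dir_deriv v f x) = norm (\<Sum>b\<in>Basis. (v \<bullet> b) *\<^sub>R dir_deriv b f x)"
        using smooth_on_dir_deriv_expand[OF f S(1) xS, of v] by simp
      also have "\<dots> \<le> (\<Sum>b\<in>Basis. \<bar>B b\<bar> * norm v)"
      proof (rule sum_norm_le)
        fix b :: 'a assume "b \<in> Basis"
        have "norm (dir_deriv b f x) \<le> \<bar>B b\<bar>" using B[OF x, of b] by linarith
        then show "norm ((v \<bullet> b) *\<^sub>R dir_deriv b f x) \<le> \<bar>B b\<bar> * norm v"
          using Basis_le_norm[OF \<open>b \<in> Basis\<close>, of v] mult_mono[of "\<bar>v \<bullet> b\<bar>" "norm v" "norm (dir_deriv b f x)" "\<bar>B b\<bar>"]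
          by (simp add: mult.commute)
      qed
      also have "\<dots> \<le> L * norm v"
        unfolding L_def sum_distrib_right[symmetric] by (intro mult_right_mono) auto
      finally show "norm (dir_deriv v f x) \<le> L * norm v" .
    qed (use L in simp)
  qed (use that in auto)
  then show ?thesis using that[OF r(1) L r(2)] by blast
qed

text \<open>The integral is based at \<open>-a\<close>, so that \<open>{-a..t}\<close> is a proper
  interval for every \<open>t\<close> in question, and then normalised to vanish at
  \<open>0\<close>; this covers negative times as well.\<close>

lemma antiderivative:
  fixes f :: "real \<Rightarrow> 'a::euclidean_space"
  assumes a: "a > 0" and f: "continuous_on {-a..a} f"
  defines "F \<equiv> \<lambda>t. integral {-a..t} f - integral {-a..0} f"
  shows "F 0 = 0"
    and "t \<in> {-a..a} \<Longrightarrow> (F has_vector_derivative f t) (at t within {-a..a})"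
    and "(\<And>t. t \<in> {-a..a} \<Longrightarrow> norm (f t) \<le> B) \<Longrightarrow> t \<in> {-a..a} \<Longrightarrow> norm (F t) \<le> a * B"
proof -
  show F0: "F 0 = 0" by (simp add: F_def)
  show d: "(F has_vector_derivative f t) (at t within {-a..a})" if "t \<in> {-a..a}" for t
    using has_vector_derivative_diff[OF integral_has_vector_derivative[OF f that] has_vector_derivative_const[of "integral {-a..0} f"]]
    unfolding F_def by simp
  assume B: "\<And>t. t \<in> {-a..a} \<Longrightarrow> norm (f t) \<le> B" and t: "t \<in> {-a..a}"
  have B0: "B \<ge> 0" using order_trans[OF norm_ge_zero B[OF t]] .
  have "norm (F t - F 0) \<le> B * norm (t - 0)"
  proof (rule differentiable_bound[of "{-a..a}" F "\<lambda>s h. h *\<^sub>R f s"])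
    fix s assume s: "s \<in> {-a..a}"
    show "(F has_derivative (\<lambda>h. h *\<^sub>R f s)) (at s within {-a..a})"
      using d[OF s] by (simp add: has_vector_derivative_def)
    show "onorm (\<lambda>h. h *\<^sub>R f s) \<le> B"
    proof (rule onorm_bound[OF B0])
      show "norm (h *\<^sub>R f s) \<le> B * norm h" for h
        using mult_left_mono[OF B[OF s], of "\<bar>h\<bar>"] by (simp add: mult.commute)
    qed
  qed (use t a in auto)
  also have "\<dots> \<le> a * B" using t B0 by (simp add: mult.commute mult_left_mono abs_le_iff)
  finally show "norm (F t) \<le> a * B" using F0 by simp
qed

text \<open>Picard iteration; the telescoping differences are dominated by a geometric series, so
  the iterates converge uniformly.\<close>

theorem ode_local_solution:
  fixes X :: "'a::euclidean_space \<Rightarrow> 'a"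
  assumes r: "r > 0" and L: "L > 0"
    and lip: "\<And>x y. x \<in> cball z0 r \<Longrightarrow> y \<in> cball z0 r \<Longrightarrow> norm (X x - X y) \<le> L * norm (x - y)"
  obtains a y where "a > 0" "y 0 = z0" "\<And>t. t \<in> {-a..a} \<Longrightarrow> y t \<in> cball z0 r"
    "\<And>t. t \<in> {-a..a} \<Longrightarrow> (y has_vector_derivative X (y t)) (at t within {-a..a})"
proof -
  define M where "M = norm (X z0) + L * r + 1"
  have M: "M > 0" unfolding M_def using r L by (simp add: add_nonneg_pos)
  have XM: "norm (X x) \<le> M" if "x \<in> cball z0 r" for x
  proof -
    have "norm (X x - X z0) \<le> L * norm (x - z0)" using lip[OF that] r by auto
    also have "\<dots> \<le> L * r" using that L by (simp add: dist_norm norm_minus_commute)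
    finally show ?thesis using norm_triangle_sub[of "X x" "X z0"] by (simp add: M_def)
  qed
  \<comment> \<open>The first bound keeps the iterates in the ball, where \<open>X\<close> is
    bounded by \<open>M\<close>; the second makes one iteration step halve the distance of two
    curves.\<close>
  define a where "a = min (r / M) (1 / (2 * L))"
  have a: "a > 0" "a * M \<le> r" "a * L \<le> 1/2"
    using r L M by (auto simp: a_def min_def field_simps)
  let ?I = "{-a..a}"
  have contX: "continuous_on (cball z0 r) X"
  proof (rule continuous_on_subset[OF _ order_refl])
    have "L-lipschitz_on (cball z0 r) X"
      using lip L by (intro lipschitz_onI) (auto simp: dist_norm)
    then show "continuous_on (cball z0 r) X" by (rule lipschitz_on_continuous_on)
  qed
  define J where "J f t = integral {-a..t} f - integral {-a..0} f" for f :: "real \<Rightarrow> 'a" and t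
  have J: "J f 0 = 0" "\<And>t. t \<in> ?I \<Longrightarrow> (J f has_vector_derivative f t) (at t within ?I)"
    "\<And>B t. (\<And>t. t \<in> ?I \<Longrightarrow> norm (f t) \<le> B) \<Longrightarrow> t \<in> ?I \<Longrightarrow> norm (J f t) \<le> a * B"
    if "continuous_on ?I f" for f
    using antiderivative[OF a(1) that] unfolding J_def by blast+
  have Jdiff: "J f t - J g t = J (\<lambda>t. f t - g t) t" if "continuous_on ?I f" "continuous_on ?I g" "t \<in> ?I" for f g t
  proof -
    have i: "f integrable_on {-a..s}" "g integrable_on {-a..s}" if "s \<in> ?I" for s
      using that \<open>continuous_on ?I f\<close> \<open>continuous_on ?I g\<close>
      by (auto intro!: integrable_continuous_interval continuous_on_subset[of ?I])
    have 0: "0 \<in> ?I" using a by auto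
    show ?thesis unfolding J_def
      using Henstock_Kurzweil_Integration.integral_diff[OF i[OF that(3)]] Henstock_Kurzweil_Integration.integral_diff[OF i[OF 0]] by simp
  qed
  define Y where "Y = rec_nat (\<lambda>t. z0) (\<lambda>n y t. z0 + J (\<lambda>t. X (y t)) t)"
  have Y0: "Y 0 = (\<lambda>t. z0)" and YS: "Y (Suc n) t = z0 + J (\<lambda>t. X (Y n t)) t" for n t
    by (simp_all add: Y_def)
  have step: "continuous_on ?I (\<lambda>t. z0 + J (\<lambda>t. X (y t)) t)" "\<And>t. t \<in> ?I \<Longrightarrow> z0 + J (\<lambda>t. X (y t)) t \<in> cball z0 r"
    "continuous_on ?I (\<lambda>t. X (y t))"
    if y: "continuous_on ?I y" "\<And>t. t \<in> ?I \<Longrightarrow> y t \<in> cball z0 r" for y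
  proof -
    show c: "continuous_on ?I (\<lambda>t. X (y t))"
      by (rule continuous_on_compose2[OF contX y(1)]) (use y(2) in auto)
    have "continuous_on ?I (J (\<lambda>t. X (y t)))"
      by (rule continuous_on_vector_derivative[OF J(2)[OF c]])
    then show "continuous_on ?I (\<lambda>t. z0 + J (\<lambda>t. X (y t)) t)" by (intro continuous_intros)
    fix t assume t: "t \<in> ?I"
    have "norm (J (\<lambda>t. X (y t)) t) \<le> a * M" using XM y(2) by (intro J(3)[OF c _ t]) auto
    then show "z0 + J (\<lambda>t. X (y t)) t \<in> cball z0 r" using a(2) by (simp add: dist_norm)
  qed
  have Yc: "continuous_on ?I (Y n) \<and> (\<forall>t\<in>?I. Y n t \<in> cball z0 r)" for n
  proof (induction n)
    case 0
    show ?case using r by (simp add: Y0)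
  next
    case (Suc n)
    then show ?case using step[of "Y n"] YS[abs_def] by simp
  qed
  have contr: "norm ((z0 + J (\<lambda>t. X (y t)) t) - (z0 + J (\<lambda>t. X (y' t)) t)) \<le> B / 2"
    if y: "continuous_on ?I y" "\<And>t. t \<in> ?I \<Longrightarrow> y t \<in> cball z0 r"
      and y': "continuous_on ?I y'" "\<And>t. t \<in> ?I \<Longrightarrow> y' t \<in> cball z0 r"
      and B: "\<And>t. t \<in> ?I \<Longrightarrow> norm (y t - y' t) \<le> B" and t: "t \<in> ?I" for y y' B t
  proof -
    have c: "continuous_on ?I (\<lambda>t. X (y t))" "continuous_on ?I (\<lambda>t. X (y' t))" using step(3) y y' by auto
    have "norm (J (\<lambda>t. X (y t) - X (y' t)) t) \<le> a * (L * B)"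
    proof (rule J(3)[OF _ _ t])
      show "continuous_on ?I (\<lambda>t. X (y t) - X (y' t))" using c by (intro continuous_intros)
      fix s assume s: "s \<in> ?I"
      show "norm (X (y s) - X (y' s)) \<le> L * B"
        using lip[OF y(2)[OF s] y'(2)[OF s]] mult_left_mono[OF B[OF s], of L] L by linarith
    qed
    also have "\<dots> \<le> B / 2"
      using mult_right_mono[OF a(3), of B] order_trans[OF norm_ge_zero B[OF t]] by (simp add: mult.assoc)
    finally show ?thesis using Jdiff[OF c t] by simp
  qed
  have Yd: "norm (Y (Suc n) t - Y n t) \<le> r * (1/2)^n" if "t \<in> ?I" for n t
    using that
  proof (induction n arbitrary: t)
    case 0
    then show ?case using Yc[of 1] by (simp add: Y0 dist_norm norm_minus_commute)
  next
    case (Suc n)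
    have c: "continuous_on ?I (Y j)" "\<And>t. t \<in> ?I \<Longrightarrow> Y j t \<in> cball z0 r" for j using Yc by blast+
    have "norm (Y (Suc (Suc n)) t - Y (Suc n) t) \<le> (r * (1/2)^n) / 2"
      using contr[OF c c Suc.IH Suc.prems] by (simp only: YS[of "Suc n" t, symmetric] YS[of n t, symmetric])
    then show ?case by simp
  qed
  define y where "y t = z0 + (\<Sum>i. Y (Suc i) t - Y i t)" for t
  define S where "S n t = (\<Sum>i<n. Y (Suc i) t - Y i t)" for n t
  have Ysum: "Y n t = z0 + S n t" for n t
    unfolding S_def by (induction n) (simp_all add: Y0 algebra_simps)
  have "uniform_limit ?I S (\<lambda>t. y t - z0) sequentially"
    unfolding S_def[abs_def] y_def add_diff_cancel_left'
    by (rule Weierstrass_m_test[OF Yd]) (auto intro!: summable_mult)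
  then have "uniform_limit ?I (\<lambda>n t. z0 + S n t) (\<lambda>t. z0 + (y t - z0)) sequentially"
    by (intro uniform_limit_add uniform_limit_const)
  moreover have "(\<lambda>n t. z0 + S n t) = Y" by (simp add: fun_eq_iff Ysum)
  ultimately have ul: "uniform_limit ?I Y y sequentially" by simp
  have yc: "continuous_on ?I y"
    by (rule uniform_limit_theorem[OF _ ul]) (use Yc in auto)
  have yr: "y t \<in> cball z0 r" if "t \<in> ?I" for t
    using closed_sequentially[OF closed_cball _ tendsto_uniform_limitI[OF ul that]] Yc that by blast
  \<comment> \<open>An iteration step is Lipschitz for the uniform distance, so applying it to the
    uniformly convergent iterates yields the integral equation for the limit.\<close>
  have eq: "y t = z0 + J (\<lambda>t. X (y t)) t" if t: "t \<in> ?I" for t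
  proof -
    have "(\<lambda>n. Y (Suc n) t) \<longlonglongrightarrow> z0 + J (\<lambda>t. X (y t)) t"
    proof (rule LIMSEQ_I)
      fix e :: real assume e: "e > 0"
      then obtain N where N: "\<And>n t. n \<ge> N \<Longrightarrow> t \<in> ?I \<Longrightarrow> norm (Y n t - y t) < e"
        using uniform_limitD[OF ul e] unfolding eventually_sequentially dist_norm by blast
      have "norm (Y (Suc n) t - (z0 + J (\<lambda>t. X (y t)) t)) < e" if n: "n \<ge> N" for n
      proof -
        have "norm (Y (Suc n) t - (z0 + J (\<lambda>t. X (y t)) t)) \<le> e / 2"
          unfolding YS by (rule contr[OF _ _ yc yr _ t]) (use Yc N[OF n] in \<open>auto simp del: mem_cball intro: less_imp_le\<close>)
        then show ?thesis using e by linarith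
      qed
      then show "\<exists>no. \<forall>n\<ge>no. norm (Y (Suc n) t - (z0 + J (\<lambda>t. X (y t)) t)) < e" by blast
    qed
    moreover have "(\<lambda>n. Y (Suc n) t) \<longlonglongrightarrow> y t"
      using tendsto_uniform_limitI[OF ul t] by (rule LIMSEQ_Suc)
    ultimately show ?thesis by (rule LIMSEQ_unique[symmetric])
  qed
  show ?thesis
  proof (rule that[OF a(1) _ yr])
    have c: "continuous_on ?I (\<lambda>t. X (y t))" using step(3)[OF yc yr] .
    show "y 0 = z0" using eq[of 0] J(1)[OF c] a by simp
    fix t assume t: "t \<in> ?I"
    have "((\<lambda>t. z0 + J (\<lambda>t. X (y t)) t) has_vector_derivative X (y t)) (at t within ?I)"
      using J(2)[OF c t] by (auto intro!: derivative_eq_intros)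
    then show "(y has_vector_derivative X (y t)) (at t within ?I)"
      by (rule has_vector_derivative_transform[OF t, rotated]) (use eq in auto)
  qed
qed

text \<open>Let \<open>m\<close> be the maximal distance of the two curves on the interval. The
  Lipschitz estimate bounds the velocity of their difference by \<open>L * m\<close>, which gives
  \<open>m \<le> (\<tau> * L) * m\<close> and hence \<open>m = 0\<close>.\<close>

lemma ode_unique:
  fixes X :: "'a::euclidean_space \<Rightarrow> 'a"
  assumes lip: "\<And>x y. x \<in> D \<Longrightarrow> y \<in> D \<Longrightarrow> norm (X x - X y) \<le> L * norm (x - y)"
    and tau: "\<tau> > 0" "\<tau> * L < 1" "L > 0"
    and y: "\<And>t. t \<in> {-\<tau>..\<tau>} \<Longrightarrow> y t \<in> D"
      "\<And>t. t \<in> {-\<tau>..\<tau>} \<Longrightarrow> (y has_vector_derivative X (y t)) (at t within {-\<tau>..\<tau>})"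
    and z: "\<And>t. t \<in> {-\<tau>..\<tau>} \<Longrightarrow> z t \<in> D"
      "\<And>t. t \<in> {-\<tau>..\<tau>} \<Longrightarrow> (z has_vector_derivative X (z t)) (at t within {-\<tau>..\<tau>})"
    and init: "y 0 = z 0" and t: "t \<in> {-\<tau>..\<tau>}"
  shows "y t = z t"
proof -
  let ?I = "{-\<tau>..\<tau>}"
  have c: "continuous_on ?I (\<lambda>t. norm (y t - z t))"
    using continuous_on_vector_derivative[OF y(2)] continuous_on_vector_derivative[OF z(2)]
    by (intro continuous_intros) auto
  have "?I \<noteq> {}" using tau by auto
  then obtain s where s: "s \<in> ?I" "\<And>t. t \<in> ?I \<Longrightarrow> norm (y t - z t) \<le> norm (y s - z s)"
    using continuous_attains_sup[OF compact_Icc _ c] by blast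
  define m where "m = norm (y s - z s)"
  have "norm ((y s - z s) - (y 0 - z 0)) \<le> (L * m) * norm (s - 0)"
  proof (rule differentiable_bound[of ?I "\<lambda>t. y t - z t" "\<lambda>t h. h *\<^sub>R (X (y t) - X (z t))"])
    fix t assume t: "t \<in> ?I"
    show "((\<lambda>t. y t - z t) has_derivative (\<lambda>h. h *\<^sub>R (X (y t) - X (z t)))) (at t within ?I)"
      using has_vector_derivative_diff[OF y(2)[OF t] z(2)[OF t]] by (simp add: has_vector_derivative_def)
    have "norm (X (y t) - X (z t)) \<le> L * m"
      using lip[OF y(1)[OF t] z(1)[OF t]] mult_left_mono[OF s(2)[OF t], of L] tau(3) unfolding m_def by linarith
    then show "onorm (\<lambda>h. h *\<^sub>R (X (y t) - X (z t))) \<le> L * m"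
      by (intro onorm_bound) (auto simp: mult.commute m_def tau(3) less_imp_le intro!: mult_left_mono)
  qed (use s tau in auto)
  also have "\<dots> \<le> (L * m) * \<tau>" using s(1) tau(3) by (intro mult_left_mono) (auto simp: m_def)
  finally have "m \<le> (\<tau> * L) * m" using init by (simp add: m_def mult_ac)
  then have "m = 0" using tau(2) by (metis m_def mult_less_cancel_right2 norm_ge_zero not_less order_le_less)
  then have "norm (y t - z t) \<le> 0" using s(2)[OF t] m_def by simp
  then show ?thesis by simp
qed

text \<open>The equation itself raises the regularity: if the solution has order \<open>k\<close>,
  so has its velocity \<open>X (y t)\<close>.\<close>

lemma ode_solution_smooth:
  fixes X :: "'a::euclidean_space \<Rightarrow> 'a"
  assumes S: "open S" and X: "smooth_on UNIV S X" and I: "open I"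
    and y: "\<And>t. t \<in> I \<Longrightarrow> y t \<in> S" "\<And>t. t \<in> I \<Longrightarrow> (y has_vector_derivative X (y t)) (at t)"
  shows "smooth_on UNIV I y"
  unfolding smooth_on_def
proof
  fix k show "Ck_on k UNIV I y"
  proof (induction k)
    case 0
    show ?case unfolding Ck_on.simps
      by (rule continuous_at_imp_continuous_on) (use y(2) in \<open>auto intro: has_vector_derivative_continuous\<close>)
  next
    case (Suc k)
    have c: "Ck_on k UNIV I (\<lambda>t. X (y t))"
      by (rule Ck_on_compose[OF I S _ Suc smooth_onD[OF X]]) (use y(1) in auto)
    show ?case
    proof (rule Ck_on_SucI[OF I])
      show "(y has_derivative (\<lambda>v. v *\<^sub>R X (y t))) (at t)" if "t \<in> I" for t
        using y(2)[OF that] by (simp add: has_vector_derivative_def)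
      show "Ck_on k UNIV I (\<lambda>t. v *\<^sub>R X (y t))" for v
        by (rule Ck_on_bounded_linear_compose[OF I bounded_linear_scaleR_right c])
    qed
  qed
qed

section \<open>Extending local homomorphisms from the real line\<close>

text \<open>The extension is \<open>\<gamma> (t / N) [^] N\<close> for any \<open>N\<close> with
  \<open>\<bar>t\<bar> \<le> N * \<tau>\<close>; two admissible choices agree because each agrees
  with the choice of their product.\<close>

lemma (in group) local_hom_extend:
  fixes \<gamma> :: "real \<Rightarrow> 'a"
  assumes tau: "\<tau> > 0" and car: "\<And>t. \<bar>t\<bar> \<le> \<tau> \<Longrightarrow> \<gamma> t \<in> carrier G"
    and hom: "\<And>s t. \<bar>s\<bar> \<le> \<tau> \<Longrightarrow> \<bar>t\<bar> \<le> \<tau> \<Longrightarrow> \<bar>s + t\<bar> \<le> \<tau> \<Longrightarrow> \<gamma> (s + t) = \<gamma> s \<otimes> \<gamma> t"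
  obtains \<Gamma> where "\<And>t. \<Gamma> t \<in> carrier G" "\<And>s t. \<Gamma> (s + t) = \<Gamma> s \<otimes> \<Gamma> t" "\<And>t. \<bar>t\<bar> \<le> \<tau> \<Longrightarrow> \<Gamma> t = \<gamma> t"
proof -
  have pow: "\<gamma> (real M * s) = \<gamma> s [^] M" if "\<bar>real M * s\<bar> \<le> \<tau>" for M s
    using that
  proof (induction M)
    case 0
    have "\<gamma> 0 \<otimes> \<gamma> 0 = \<gamma> 0" using hom[of 0 0] tau by simp
    then have "\<gamma> 0 = \<one>" using car[of 0] tau by (simp add: l_cancel_one)
    then show ?case by simp
  next
    case (Suc M)
    have 1: "\<bar>real M * s\<bar> \<le> \<bar>real (Suc M) * s\<bar>" "\<bar>s\<bar> \<le> \<bar>real (Suc M) * s\<bar>"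
      by (auto simp: abs_mult mult_right_mono intro: mult_right_mono[of 1 _ "\<bar>s\<bar>", simplified])
    have "\<gamma> (real M * s + s) = \<gamma> (real M * s) \<otimes> \<gamma> s"
      using 1 Suc.prems by (intro hom) (auto simp: algebra_simps)
    then show ?case using Suc 1 by (simp add: algebra_simps)
  qed
  define E where "E N t = \<gamma> (t / real N) [^] (N::nat)" for N t
  have Emul: "E (N * M) t = E N t" if "N > 0" "M > 0" "\<bar>t\<bar> \<le> real N * \<tau>" for N M t
  proof -
    have "\<bar>t / real N\<bar> \<le> \<tau>" using that by (simp add: field_simps)
    then have a: "\<bar>real M * (t / (real N * real M))\<bar> \<le> \<tau>" using that by simp
    have b: "\<bar>t / (real N * real M)\<bar> \<le> \<tau>"
    proof -
      have "\<bar>t / real N\<bar> / real M \<le> \<bar>t / real N\<bar> / 1" using that by (intro divide_left_mono) auto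
      then show ?thesis using \<open>\<bar>t / real N\<bar> \<le> \<tau>\<close> by (simp add: abs_divide)
    qed
    have "\<gamma> (t / real N) = \<gamma> (t / (real N * real M)) [^] M"
      using pow[OF a] that by simp
    then show ?thesis using car[OF b] by (simp add: E_def nat_pow_pow mult.commute)
  qed
  have Eeq: "E N t = E M t" if "N > 0" "M > 0" "\<bar>t\<bar> \<le> real N * \<tau>" "\<bar>t\<bar> \<le> real M * \<tau>" for N M t
    using Emul[of N M t] Emul[of M N t] that by (simp add: mult.commute)
  define n where "n t = nat \<lceil>\<bar>t\<bar> / \<tau>\<rceil> + 1" for t :: real
  have n: "n t > 0" "\<bar>t\<bar> \<le> real (n t) * \<tau>" for t
  proof -
    show "n t > 0" by (simp add: n_def)
    have "\<bar>t\<bar> / \<tau> \<le> real (n t)" unfolding n_def using tau by linarith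
    then show "\<bar>t\<bar> \<le> real (n t) * \<tau>" using tau by (simp add: field_simps)
  qed
  define \<Gamma> where "\<Gamma> t = E (n t) t" for t
  have \<Gamma>E: "\<Gamma> t = E N t" if "N > 0" "\<bar>t\<bar> \<le> real N * \<tau>" for N t
    unfolding \<Gamma>_def using Eeq n that by blast
  show ?thesis
  proof (rule that[of \<Gamma>])
    show "\<Gamma> t \<in> carrier G" for t
      unfolding \<Gamma>_def E_def using n[of t] by (intro nat_pow_closed car) (simp add: field_simps)
    show "\<Gamma> t = \<gamma> t" if "\<bar>t\<bar> \<le> \<tau>" for t
      using \<Gamma>E[of 1 t] car[OF that] that by (simp add: E_def)
    fix s t
    \<comment> \<open>One exponent for \<open>s\<close>, \<open>t\<close> and \<open>s + t\<close>.
      The two factors commute because \<open>s + t = t + s\<close>, so the power of the product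
      splits.\<close>
    define N where "N = n s + n t"
    have N: "N > 0" "\<bar>s\<bar> \<le> real N * \<tau>" "\<bar>t\<bar> \<le> real N * \<tau>" "\<bar>s + t\<bar> \<le> real N * \<tau>"
      using n[of s] n[of t] tau by (auto simp: N_def algebra_simps intro: order_trans[OF abs_triangle_ineq])
    have b: "\<bar>s / real N\<bar> \<le> \<tau>" "\<bar>t / real N\<bar> \<le> \<tau>" "\<bar>s / real N + t / real N\<bar> \<le> \<tau>"
      using N by (simp_all add: field_simps flip: add_divide_distrib)
    have 1: "\<gamma> (s / real N + t / real N) = \<gamma> (s / real N) \<otimes> \<gamma> (t / real N)" using hom b by blast
    have 2: "\<gamma> (t / real N + s / real N) = \<gamma> (t / real N) \<otimes> \<gamma> (s / real N)" using b by (intro hom) (auto simp: add.commute)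
    have "\<Gamma> (s + t) = (\<gamma> (s / real N) \<otimes> \<gamma> (t / real N)) [^] N"
      using \<Gamma>E[OF N(1,4)] 1 by (simp add: E_def add_divide_distrib)
    also have "\<dots> = \<gamma> (s / real N) [^] N \<otimes> \<gamma> (t / real N) [^] N"
      using 1 2 car b by (intro pow_mult_distrib) (auto simp: add.commute)
    finally show "\<Gamma> (s + t) = \<Gamma> s \<otimes> \<Gamma> t"
      using \<Gamma>E[OF N(1,2)] \<Gamma>E[OF N(1,3)] by (simp add: E_def)
  qed
qed

lemma (in group) real_hom_pow:
  fixes \<Gamma> :: "real \<Rightarrow> 'a"
  assumes "\<And>t. \<Gamma> t \<in> carrier G" "\<And>s t. \<Gamma> (s + t) = \<Gamma> s \<otimes> \<Gamma> t"
  shows "\<Gamma> (real N * t) = \<Gamma> t [^] N"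
proof (induction N)
  case 0
  have "\<Gamma> 0 \<otimes> \<Gamma> 0 = \<Gamma> 0" using assms(2)[of 0 0] by simp
  then have "\<Gamma> 0 = \<one>" using assms(1)[of 0] by (simp add: l_cancel_one)
  then show ?case by simp
next
  case (Suc N)
  then show ?case using assms(2)[of "real N * t" t] by (simp add: algebra_simps)
qed

lemma dir_deriv_Pair_right: "dir_deriv v (\<lambda>y. F (x, y)) y = dir_deriv (0, v) F (x, y)"
  by (simp add: dir_deriv_def)

lemma dir_deriv_Pair_left: "dir_deriv v (\<lambda>x. F (x, y)) x = dir_deriv (v, 0) F (x, y)"
  by (simp add: dir_deriv_def)

text \<open>The total derivative along a graph, split into its two partial contributions. Where the
  second partial derivative vanishes, the derivative of \<open>y\<close> does not enter.\<close>

lemma dir_deriv_graph: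
  fixes F :: "'a::euclidean_space \<times> 'b::euclidean_space \<Rightarrow> 'c::real_normed_vector"
  assumes F: "smooth_on UNIV D F" "open D" "(x, y x) \<in> D" and y: "(y has_derivative y') (at x)"
  shows "dir_deriv v (\<lambda>t. F (t, y t)) x = dir_deriv v (\<lambda>a. F (a, y x)) x + dir_deriv (y' v) (\<lambda>b. F (x, b)) (y x)"
proof -
  interpret D: bounded_linear "\<lambda>v. dir_deriv v F (x, y x)" by (rule smooth_on_dir_deriv_linear[OF F])
  have "dir_deriv v (\<lambda>t. F (t, y t)) x = dir_deriv (v, y' v) F (x, y x)"
    using dir_deriv_chain[OF smooth_on_has_derivative[OF F] has_derivative_Pair[OF has_derivative_ident y]] .
  also have "\<dots> = dir_deriv (v, 0) F (x, y x) + dir_deriv (0, y' v) F (x, y x)"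
    using D.add[of "(v, 0)" "(0, y' v)"] by simp
  also have "dir_deriv (v, 0) F (x, y x) = dir_deriv v (\<lambda>a. F (a, y x)) x" by (rule dir_deriv_Pair_left[symmetric])
  also have "dir_deriv (0, y' v) F (x, y x) = dir_deriv (y' v) (\<lambda>b. F (x, b)) (y x)" by (rule dir_deriv_Pair_right[symmetric])
  finally show ?thesis .
qed

lemma has_vector_derivative_compose_smooth:
  fixes F :: "'a::euclidean_space \<Rightarrow> 'b::real_normed_vector"
  assumes F: "smooth_on UNIV S F" "open S" "y t \<in> S" and y: "(y has_vector_derivative y') (at t within I)"
  shows "((\<lambda>t. F (y t)) has_vector_derivative dir_deriv y' F (y t)) (at t within I)"
  using vector_derivative_diff_chain_within[OF y has_derivative_at_withinI[OF smooth_on_has_derivative[OF F]]]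
  by (simp add: comp_def)

lemma smooth_on_has_vector_derivative:
  fixes f :: "real \<Rightarrow> 'b::real_normed_vector"
  assumes "smooth_on UNIV S f" "open S" "t \<in> S"
  shows "(f has_vector_derivative dir_deriv 1 f t) (at t)"
proof -
  have "(f has_derivative (\<lambda>v. dir_deriv v f t)) (at t)" by (rule smooth_on_has_derivative[OF assms])
  moreover have "dir_deriv v f t = v *\<^sub>R dir_deriv 1 f t" for v
    using smooth_on_dir_deriv_expand[OF assms, of v] by simp
  then have "(\<lambda>v. dir_deriv v f t) = (\<lambda>v. v *\<^sub>R dir_deriv 1 f t)" by blast
  ultimately show ?thesis unfolding has_vector_derivative_def by (simp only:)
qed

lemma smooth_map_real_line_iff: "smooth_map real_line M c \<longleftrightarrow> plot M UNIV c"
  by (simp add: smooth_map_def plot_def flat_manifold_def comp_def)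

section \<open>One-parameter subgroups\<close>

locale lie_grp = group G for G (structure) +
  fixes GM :: "('a, 'k::euclidean_space) manifold"
  assumes lie: "lie_group G GM"
begin

definition dom :: "'k set" where "dom = chart_dom (chart_at GM \<one>)"
definition psi :: "'k \<Rightarrow> 'a" where "psi = chart_param (chart_at GM \<one>)"
definition phi :: "'a \<Rightarrow> 'k" where "phi = coord_at GM \<one>"
definition V1 :: "'k set" where "V1 = tangent_space GM \<one>"
definition U1 :: "'a set" where "U1 = fst (chart_at GM \<one>)"
definition z1 :: 'k where "z1 = phi \<one>"
definition mu :: "'k \<times> 'k \<Rightarrow> 'k" where "mu p = phi (psi (fst p) \<otimes> psi (snd p))"
definition Om :: "('k \<times> 'k) set" where "Om = {p \<in> dom \<times> dom. psi (fst p) \<otimes> psi (snd p) \<in> U1}"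
text \<open>The left-invariant vector field with value \<open>x\<close> at \<open>\<one>\<close>, in
  the chart at \<open>\<one>\<close>: the product \<open>mu (z, v)\<close> is differentiated in its
  right factor at the neutral element.\<close>

definition lfield :: "'k \<Rightarrow> 'k \<Rightarrow> 'k" where "lfield x z = dir_deriv (0, x) mu (z, z1)"

lemma GM: "smooth_manifold GM" "charted GM" "topspace (topo GM) = carrier G"
  using lie smooth_manifold_charted by (auto simp: lie_group_def)

lemma chart_one: "chart_at GM \<one> = (U1, V1, phi)"
  by (simp add: U1_def V1_def phi_def tangent_space_def coord_at_def)

lemma chart_one_atlas: "(U1, V1, phi) \<in> atlas GM" "\<one> \<in> U1"
  using chart_at[OF GM(2), of \<one>] GM(3) by (auto simp: chart_one)

lemma chart_one_top: "topological_chart (topo GM) (U1, V1, phi)"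
  using chartedD[OF GM(2) chart_one_atlas(1)] .

lemma subspace_V1: "subspace V1" and U1_open: "openin (topo GM) U1" and U1_carrier: "U1 \<subseteq> carrier G"
  using topological_chartD[OF chart_one_top] GM(3) by auto

lemma open_dom: "open dom"
  using chart_dom_open[OF chart_one_top] by (simp add: dom_def chart_one)

lemma psi_phi: "x \<in> U1 \<Longrightarrow> psi (phi x) = x" "x \<in> U1 \<Longrightarrow> phi x \<in> dom" "x \<in> U1 \<Longrightarrow> lproj V1 (phi x) = phi x"
  using chart_dom_chart_param[OF chart_one_top] by (auto simp: psi_def dom_def chart_one)

lemma phi_psi: "y \<in> dom \<Longrightarrow> phi (psi y) = lproj V1 y" "y \<in> dom \<Longrightarrow> psi y \<in> U1" "y \<in> dom \<Longrightarrow> psi y \<in> carrier G"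
  using chart_dom_chart_param[OF chart_one_top] U1_carrier by (auto simp: psi_def dom_def chart_one)

lemma z1: "z1 \<in> dom" "psi z1 = \<one>" "lproj V1 z1 = z1"
  using psi_phi chart_one_atlas(2) by (auto simp: z1_def)

lemma lproj_dom: "lproj V1 y \<in> dom \<longleftrightarrow> y \<in> dom" "psi (lproj V1 y) = psi y"
  using lproj[OF subspace_V1] by (auto simp: dom_def chart_dom_def chart_one psi_def chart_param_def)

lemma psi_plot: "plot GM dom psi"
  using plot_chart_param[OF GM(1) chart_one_atlas(1)] by (simp add: dom_def psi_def chart_one)

lemma mult_plot:
  assumes "plot GM S c" "plot GM S d"
  shows "plot GM S (\<lambda>z. c z \<otimes> d z)"
proof -
  have "smooth_map (prod_manifold GM GM) GM (\<lambda>(a, b). a \<otimes> b)" using lie by (simp add: lie_group_def)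
  from plot_smooth_map[OF charted_prod[OF GM(2) GM(2)] GM(2) this plot_Pair[OF GM(2) GM(2) assms]]
  show ?thesis by simp
qed

lemma inv_plot:
  assumes "plot GM S c"
  shows "plot GM S (\<lambda>z. inv (c z))"
proof -
  have "smooth_map GM GM (\<lambda>a. inv a)" using lie by (simp add: lie_group_def)
  from plot_smooth_map[OF GM(2) GM(2) this assms] show ?thesis .
qed

lemma const_plot: "open S \<Longrightarrow> g \<in> carrier G \<Longrightarrow> plot GM S (\<lambda>_. g)"
  using plot_const[OF _ GM(2)] GM(3) by blast

lemma translate_plot:
  assumes "plot GM S c" "g \<in> carrier G"
  shows "plot GM S (\<lambda>z. g \<otimes> c z)" "plot GM S (\<lambda>z. c z \<otimes> g)"
  using mult_plot[OF const_plot[OF plot_open[OF assms(1)] assms(2)] assms(1)]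
    mult_plot[OF assms(1) const_plot[OF plot_open[OF assms(1)] assms(2)]] by auto

lemma psi2_plot: "plot GM (dom \<times> dom) (\<lambda>p. psi (fst p) \<otimes> psi (snd p))"
proof (rule mult_plot)
  show "plot GM (dom \<times> dom) (\<lambda>p. psi (fst p))"
    by (rule plot_compose[OF psi_plot smooth_on_fst open_Times[OF open_dom open_dom] _ GM(2)]) auto
  show "plot GM (dom \<times> dom) (\<lambda>p. psi (snd p))"
    by (rule plot_compose[OF psi_plot smooth_on_snd open_Times[OF open_dom open_dom] _ GM(2)]) auto
qed

lemma open_Om: "open Om"
  using plot_vimage_open[OF psi2_plot U1_open] by (simp add: Om_def)

lemma mu_smooth: "smooth_on UNIV Om mu"
  using plot_coord[OF psi2_plot chart_one_atlas(1)] by (simp add: Om_def mu_def[abs_def])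

lemma Om_z1: "z \<in> dom \<Longrightarrow> (z, z1) \<in> Om" "z \<in> dom \<Longrightarrow> (z1, z) \<in> Om"
  and mu_z1: "z \<in> dom \<Longrightarrow> mu (z, z1) = lproj V1 z" "z \<in> dom \<Longrightarrow> mu (z1, z) = lproj V1 z"
  using z1 phi_psi by (auto simp: Om_def mu_def)

lemma psi_mu: "p \<in> Om \<Longrightarrow> psi (mu p) = psi (fst p) \<otimes> psi (snd p)" and mu_dom: "p \<in> Om \<Longrightarrow> mu p \<in> dom"
  and lproj_mu: "p \<in> Om \<Longrightarrow> lproj V1 (mu p) = mu p"
  using psi_phi by (auto simp: Om_def mu_def)

lemma lfield_smooth: "smooth_on UNIV dom (lfield x)"
  unfolding lfield_def[abs_def]
  by (rule smooth_on_compose[OF smooth_on_dir_deriv[OF mu_smooth UNIV_I]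
        smooth_on_Pair[OF smooth_on_id smooth_on_const open_dom] open_dom open_Om]) (simp add: Om_z1)

lemma lproj_linear: "linear (lproj V1)" using lproj(1)[OF subspace_V1] .

lemma lproj_bounded_linear: "bounded_linear (lproj V1)"
  using lproj_linear by (simp add: linear_conv_bounded_linear)

text \<open>The field is constant along the kernel of the projection and tangent to
  \<open>V1\<close>, so projecting a solution of its differential equation onto \<open>V1\<close>
  yields a solution again.\<close>

lemma lfield_lproj:
  assumes "z \<in> dom" shows "lfield x (lproj V1 z) = lfield x z" "lproj V1 (lfield x z) = lfield x z"
proof -
  have e: "lfield x z = dir_deriv x (\<lambda>v. mu (z, v)) z1" for z
    by (simp add: lfield_def dir_deriv_Pair_right)
  show "lfield x (lproj V1 z) = lfield x z"
    unfolding e by (simp add: mu_def lproj_dom)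
  have "lproj V1 (dir_deriv (0, x) mu (z, z1)) = dir_deriv (0, x) (\<lambda>p. lproj V1 (mu p)) (z, z1)"
    using dir_deriv_chain[OF linear_imp_has_derivative[OF lproj_linear] smooth_on_has_derivative[OF mu_smooth open_Om Om_z1(1)[OF assms]]]
    by simp
  also have "\<dots> = dir_deriv (0, x) mu (z, z1)"
    by (rule dir_deriv_cong(1)[OF open_Om Om_z1(1)[OF assms] lproj_mu])
  finally show "lproj V1 (lfield x z) = lfield x z" unfolding lfield_def .
qed

lemma lfield_z1: "x \<in> V1 \<Longrightarrow> lfield x z1 = x"
proof -
  assume x: "x \<in> V1"
  have "lfield x z1 = dir_deriv x (\<lambda>v. mu (z1, v)) z1"
    by (simp add: lfield_def dir_deriv_Pair_right)
  also have "\<dots> = dir_deriv x (lproj V1) z1"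
    by (rule dir_deriv_cong(1)[OF open_dom z1(1)]) (rule mu_z1)
  also have "\<dots> = x"
    using has_derivative_dir_deriv[OF linear_imp_has_derivative[OF lproj_linear]] lproj(3)[OF subspace_V1 x] by simp
  finally show ?thesis .
qed

text \<open>Left invariance is associativity, differentiated: take the derivative of
  \<open>mu (w, mu (y, v)) = mu (mu (w, y), v)\<close> in \<open>v\<close> at the neutral
  element.\<close>

lemma lfield_translate:
  assumes "(w, y) \<in> Om" "lproj V1 y = y"
  shows "dir_deriv (0, lfield x y) mu (w, y) = lfield x (mu (w, y))"
proof -
  have wy: "w \<in> dom" "y \<in> dom" using assms(1) by (auto simp: Om_def)
  define S where "S = {v. (y, v) \<in> Om}"
  have S: "open S" "z1 \<in> S"
  proof -
    have "S = (\<lambda>v. (y, v)) -` Om" by (auto simp: S_def)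
    moreover have "open ((\<lambda>v. (y, v)) -` Om)" by (intro open_vimage open_Om continuous_intros)
    ultimately show "open S" by simp
    show "z1 \<in> S" using Om_z1 wy by (simp add: S_def)
  qed
  have sm: "smooth_on UNIV S (\<lambda>v. mu (y, v))"
    by (rule smooth_on_compose[OF mu_smooth smooth_on_Pair[OF smooth_on_const smooth_on_id S(1)] S(1) open_Om])
       (simp add: S_def)
  have my: "mu (y, z1) = y" using mu_z1 wy assms(2) by simp
  have d1: "dir_deriv x (\<lambda>v. (w, mu (y, v))) z1 = (0, lfield x y)"
  proof -
    have "((\<lambda>v. (w, mu (y, v))) has_derivative (\<lambda>x. (0, dir_deriv x (\<lambda>v. mu (y, v)) z1))) (at z1)"
      by (intro has_derivative_Pair has_derivative_const smooth_on_has_derivative[OF sm S])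
    from has_derivative_dir_deriv[OF this] show ?thesis by (simp add: lfield_def dir_deriv_Pair_right)
  qed
  have "dir_deriv x (\<lambda>v. mu (w, mu (y, v))) z1 = dir_deriv (0, lfield x y) mu (w, y)"
    using dir_deriv_compose[OF mu_smooth smooth_on_Pair[OF smooth_on_const sm S(1)] S(1) open_Om S(2), of w x] assms(1)
    by (simp add: d1 my)
  moreover have "dir_deriv x (\<lambda>v. mu (w, mu (y, v))) z1 = dir_deriv x (\<lambda>v. mu (mu (w, y), v)) z1"
  proof (rule dir_deriv_cong(1)[OF S])
    fix v assume "v \<in> S"
    then have yv: "(y, v) \<in> Om" "v \<in> dom" by (auto simp: S_def Om_def)
    have "mu (w, mu (y, v)) = phi (psi w \<otimes> (psi y \<otimes> psi v))"
      using psi_mu[OF yv(1)] by (simp add: mu_def[of "(w, mu (y, v))"])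
    also have "\<dots> = phi ((psi w \<otimes> psi y) \<otimes> psi v)" using wy yv(2) phi_psi(3) by (simp add: m_assoc)
    also have "\<dots> = mu (mu (w, y), v)" using psi_mu[OF assms(1)] by (simp add: mu_def[of "(mu (w, y), v)"])
    finally show "mu (w, mu (y, v)) = mu (mu (w, y), v)" .
  qed
  ultimately show ?thesis by (simp add: lfield_def dir_deriv_Pair_right)
qed

text \<open>The integral curve of the left-invariant field through \<open>\<one>\<close>. For fixed
  \<open>s\<close> both \<open>y (s + t)\<close> and \<open>mu (y s, y t)\<close> solve the equation
  of the field in \<open>t\<close> with the same initial value, so \<open>ode_unique\<close> makes
  the curve a local homomorphism.\<close>

lemma local_one_parameter:
  assumes x: "x \<in> V1"
  obtains \<tau> y where "\<tau> > 0" "y 0 = z1" "\<And>t. \<bar>t\<bar> \<le> \<tau> \<Longrightarrow> y t \<in> dom" "smooth_on UNIV {-\<tau><..<\<tau>} y"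
    "(y has_vector_derivative x) (at 0)"
    "\<And>s t. \<bar>s\<bar> \<le> \<tau> \<Longrightarrow> \<bar>t\<bar> \<le> \<tau> \<Longrightarrow> psi (y (s + t)) = psi (y s) \<otimes> psi (y t)"
proof -
  let ?X = "lfield x"
  obtain r L where rL: "r > 0" "L > 0" "cball z1 r \<subseteq> dom"
    "\<And>p q. p \<in> cball z1 r \<Longrightarrow> q \<in> cball z1 r \<Longrightarrow> norm (?X p - ?X q) \<le> L * norm (p - q)"
    using smooth_local_lipschitz[OF open_dom z1(1) lfield_smooth] by blast
  obtain a y0 where y0: "a > 0" "y0 0 = z1" "\<And>t. t \<in> {-a..a} \<Longrightarrow> y0 t \<in> cball z1 r"
    "\<And>t. t \<in> {-a..a} \<Longrightarrow> (y0 has_vector_derivative ?X (y0 t)) (at t within {-a..a})"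
    using ode_local_solution[OF rL(1,2,4)] by blast
  define y where "y t = lproj V1 (y0 t)" for t
  let ?I = "{-a<..<a}"
  have y00: "y 0 = z1" by (simp add: y_def y0 z1)
  have yV: "lproj V1 (y t) = y t" for t using lproj(2,3)[OF subspace_V1] by (simp add: y_def)
  have ydom: "y t \<in> dom" if "t \<in> ?I" for t
    using y0(3)[of t] rL(3) that by (auto simp: y_def lproj_dom)
  have yd: "(y has_vector_derivative ?X (y t)) (at t)" if t: "t \<in> ?I" for t
  proof -
    have d: "y0 t \<in> dom" using y0(3)[of t] rL(3) t by auto
    have "(y0 has_vector_derivative ?X (y0 t)) (at t within ?I)"
      using y0(4)[of t] t by (auto intro: has_vector_derivative_within_subset)
    moreover have "at t within ?I = at t" by (rule at_within_open[OF t]) simp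
    ultimately have "(y0 has_vector_derivative ?X (y0 t)) (at t)" by (simp only:)
    then have "(y has_vector_derivative lproj V1 (?X (y0 t))) (at t)"
      unfolding y_def[abs_def] by (rule bounded_linear.has_vector_derivative[OF lproj_bounded_linear])
    then show ?thesis using lfield_lproj[OF d] by (simp add: y_def)
  qed
  have ysm: "smooth_on UNIV ?I y"
    by (rule ode_solution_smooth[OF open_dom lfield_smooth[of x] _ ydom yd]) auto
  \<comment> \<open>Products are kept in the ball on which the field is Lipschitz, as
    \<open>ode_unique\<close> requires for the curve
    \<open>t \<mapsto> mu (y s, y t)\<close>.\<close>
  define Om' where "Om' = {p \<in> Om. mu p \<in> ball z1 r}"
  have Om': "open Om'"
    using continuous_open_preimage[OF smooth_on_continuous[OF mu_smooth] open_Om open_ball[of z1 r]]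
    by (simp add: Om'_def vimage_def Int_def)
  have yc: "continuous_on ?I y" using smooth_on_continuous[OF ysm] .
  have "continuous_on (?I \<times> ?I) (\<lambda>q. (y (fst q), y (snd q)))"
    by (intro continuous_on_Pair continuous_on_compose2[OF yc] continuous_on_fst continuous_on_snd continuous_on_id) auto
  from continuous_open_preimage[OF this _ Om']
  have "open (?I \<times> ?I \<inter> (\<lambda>q. (y (fst q), y (snd q))) -` Om')" by (simp add: open_Times)
  moreover have "(0, 0) \<in> ?I \<times> ?I \<inter> (\<lambda>q. (y (fst q), y (snd q))) -` Om'"
    using y0(1) rL(1) Om_z1 mu_z1 z1 by (simp add: Om'_def y00)
  ultimately obtain \<rho> where \<rho>: "\<rho> > 0" "ball (0, 0) \<rho> \<subseteq> ?I \<times> ?I \<inter> (\<lambda>q. (y (fst q), y (snd q))) -` Om'"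
    by (meson open_contains_ball)
  have near: "s \<in> ?I \<and> t \<in> ?I \<and> (y s, y t) \<in> Om' " if "\<bar>s\<bar> < \<rho> / 2" "\<bar>t\<bar> < \<rho> / 2" for s t
  proof -
    have "norm (s, t) \<le> \<bar>s\<bar> + \<bar>t\<bar>" using norm_Pair_le[of s t] by simp
    moreover have "dist (0, 0) (s, t) = norm (s, t)" by (simp add: dist_norm norm_Pair)
    ultimately have "(s, t) \<in> ball (0, 0) \<rho>" using that by simp
    then show ?thesis using \<rho>(2) by auto
  qed
  \<comment> \<open>With \<open>\<tau> < \<rho> / 4\<close> also \<open>s + t\<close> stays in the
    range of \<open>near\<close>; the second bound is the smallness condition of
    \<open>ode_unique\<close>.\<close>
  define \<tau> where "\<tau> = min (\<rho> / 8) (1 / (2 * L))"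
  have \<tau>: "\<tau> > 0" "\<tau> * L < 1" "\<tau> < \<rho> / 4"
    using \<rho>(1) rL(2) by (auto simp: \<tau>_def min_def field_simps)
  have hom: "mu (y s, y t) = y (s + t)" if s: "\<bar>s\<bar> \<le> \<tau>" and t: "\<bar>t\<bar> \<le> \<tau>" for s t
  proof (rule ode_unique[where D="cball z1 r" and X="?X" and L=L and \<tau>=\<tau> and y="\<lambda>t. mu (y s, y t)" and z="\<lambda>t. y (s + t)"])
    show "norm (?X p - ?X q) \<le> L * norm (p - q)" if "p \<in> cball z1 r" "q \<in> cball z1 r" for p q
      using rL(4) that .
    show "\<tau> > 0" "\<tau> * L < 1" "L > 0" using \<tau> rL by auto
    show "mu (y s, y 0) = y (s + 0)"
      using near[of s 0] s \<tau> \<rho>(1) mu_z1 yV ydom by (auto simp: y00)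
    show "t \<in> {-\<tau>..\<tau>}" using t by auto
    fix t assume "t \<in> {-\<tau>..\<tau>}"
    then have t: "\<bar>t\<bar> \<le> \<tau>" by auto
    have n: "s \<in> ?I" "t \<in> ?I" "(y s, y t) \<in> Om'" using near[of s t] s t \<tau> by auto
    have "\<bar>s + t\<bar> < \<rho> / 2" using s t \<tau>(3) by linarith
    then have st: "s + t \<in> ?I" "(y 0, y (s + t)) \<in> Om'"
      using near[of 0 "s + t"] \<rho>(1) by auto
    show "mu (y s, y t) \<in> cball z1 r" using n(3) by (auto simp: Om'_def)
    show "y (s + t) \<in> cball z1 r" using st ydom[OF st(1)] mu_z1(2)[of "y (s + t)"] yV by (auto simp: Om'_def y00)
    have "((\<lambda>t. (y s, y t)) has_vector_derivative (0, ?X (y t))) (at t)"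
      by (intro has_vector_derivative_Pair has_vector_derivative_const yd n(2))
    from has_vector_derivative_compose_smooth[OF mu_smooth open_Om _ this] n(3)
    have "((\<lambda>t. mu (y s, y t)) has_vector_derivative dir_deriv (0, ?X (y t)) mu (y s, y t)) (at t)"
      by (simp add: Om'_def)
    then have "((\<lambda>t. mu (y s, y t)) has_vector_derivative ?X (mu (y s, y t))) (at t)"
      using lfield_translate[of "y s" "y t" x] n(3) yV by (simp add: Om'_def)
    then show "((\<lambda>t. mu (y s, y t)) has_vector_derivative ?X (mu (y s, y t))) (at t within {-\<tau>..\<tau>})"
      by (rule has_vector_derivative_at_within)
    have "((\<lambda>t. s + t) has_vector_derivative 1) (at t)" by (auto intro!: derivative_eq_intros)
    from vector_diff_chain_at[OF this, of y "?X (y (s + t))"] yd[OF st(1)]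
    have "((\<lambda>t. y (s + t)) has_vector_derivative ?X (y (s + t))) (at t)" by (simp add: comp_def)
    then show "((\<lambda>t. y (s + t)) has_vector_derivative ?X (y (s + t))) (at t within {-\<tau>..\<tau>})"
      by (rule has_vector_derivative_at_within)
  qed
  have "\<tau> < a"
  proof (rule ccontr)
    assume "\<not> \<tau> < a"
    then have "a \<in> ?I" using near[of a 0] \<tau> y0(1) \<rho>(1) by auto
    then show False by simp
  qed
  show ?thesis
  proof (rule that[of \<tau> y])
    show "\<tau> > 0" "y 0 = z1" using \<tau>(1) y00 .
    show "y t \<in> dom" if "\<bar>t\<bar> \<le> \<tau>" for t
      by (rule ydom) (use that \<open>\<tau> < a\<close> in \<open>unfold greaterThanLessThan_iff, linarith\<close>)
    show "smooth_on UNIV {-\<tau><..<\<tau>} y" by (rule smooth_on_subset[OF ysm]) (use \<open>\<tau> < a\<close> in auto)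
    show "(y has_vector_derivative x) (at 0)" using yd[of 0] y0(1) lfield_z1[OF x] by (simp add: y00)
    fix s t assume st: "\<bar>s\<bar> \<le> \<tau>" "\<bar>t\<bar> \<le> \<tau>"
    then have "(y s, y t) \<in> Om" using near[of s t] \<tau> by (auto simp: Om'_def)
    then show "psi (y (s + t)) = psi (y s) \<otimes> psi (y t)" using psi_mu hom[OF st] by fastforce
  qed
qed

lemma one_parameter_carrier:
  assumes "one_parameter_subgroup G GM \<gamma>"
  shows "\<gamma> t \<in> carrier G" "\<gamma> 0 = \<one>" "plot GM UNIV \<gamma>"
proof -
  show p: "plot GM UNIV \<gamma>" using assms by (simp add: one_parameter_subgroup_def smooth_map_real_line_iff)
  then show c: "\<gamma> t \<in> carrier G" for t using plot_in GM(3) by blast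
  have "\<gamma> 0 \<otimes> \<gamma> 0 = \<gamma> 0" using assms unfolding one_parameter_subgroup_def by (metis add_0)
  then show "\<gamma> 0 = \<one>" using c[of 0] by (simp add: l_cancel_one)
qed

lemma velocity_one: "\<gamma> 0 = \<one> \<Longrightarrow> velocity GM \<gamma> 0 = dir_deriv 1 (\<lambda>t. phi (\<gamma> t)) 0"
  by (simp add: velocity_eq[of 0 0] phi_def)

lemma one_parameter_exists:
  assumes x: "x \<in> V1"
  obtains \<gamma> where "one_parameter_subgroup G GM \<gamma>" "velocity GM \<gamma> 0 = x"
proof -
  obtain \<tau> y where y: "\<tau> > 0" "y 0 = z1" "\<And>t. \<bar>t\<bar> \<le> \<tau> \<Longrightarrow> y t \<in> dom" "smooth_on UNIV {-\<tau><..<\<tau>} y"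
    "(y has_vector_derivative x) (at 0)"
    "\<And>s t. \<bar>s\<bar> \<le> \<tau> \<Longrightarrow> \<bar>t\<bar> \<le> \<tau> \<Longrightarrow> psi (y (s + t)) = psi (y s) \<otimes> psi (y t)"
    using local_one_parameter[OF x] by blast
  obtain \<Gamma> where \<Gamma>: "\<And>t. \<Gamma> t \<in> carrier G" "\<And>s t. \<Gamma> (s + t) = \<Gamma> s \<otimes> \<Gamma> t" "\<And>t. \<bar>t\<bar> \<le> \<tau> \<Longrightarrow> \<Gamma> t = psi (y t)"
    using local_hom_extend[of \<tau> "\<lambda>t. psi (y t)"] y phi_psi(3) by blast
  have p0: "plot GM {-\<tau><..<\<tau>} (\<lambda>t. psi (y t))"
    by (rule plot_compose[OF psi_plot y(4) _ _ GM(2)]) (use y(3) in auto)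
  \<comment> \<open>Smoothness at \<open>t0\<close> is smoothness at \<open>0\<close>, carried over
    by \<open>\<Gamma> t = \<Gamma> t0 \<otimes> \<Gamma> (t - t0)\<close>.\<close>
  have "plot GM UNIV \<Gamma>"
  proof (rule plot_local[OF open_UNIV GM(2)])
    fix t0 :: real
    let ?T = "{t0 - \<tau><..<t0 + \<tau>}"
    have "plot GM ?T (\<lambda>t. psi (y (t - t0)))"
      by (rule plot_compose[OF p0 smooth_on_diff[OF smooth_on_id smooth_on_const]]) (auto simp: GM)
    then have "plot GM ?T (\<lambda>t. \<Gamma> t0 \<otimes> psi (y (t - t0)))" using translate_plot(1) \<Gamma>(1) by blast
    then have "plot GM ?T \<Gamma>"
    proof (rule plot_cong[OF _ _ GM(2)])
      fix t assume "t \<in> ?T"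
      then have "\<Gamma> (t - t0) = psi (y (t - t0))" by (intro \<Gamma>(3)) auto
      then show "\<Gamma> t0 \<otimes> psi (y (t - t0)) = \<Gamma> t" using \<Gamma>(2)[of t0 "t - t0"] by simp
    qed
    then show "\<exists>T. t0 \<in> T \<and> T \<subseteq> UNIV \<and> plot GM T \<Gamma>" using y(1) by (intro exI[of _ ?T]) auto
  qed
  then have ops: "one_parameter_subgroup G GM \<Gamma>"
    using \<Gamma>(2) by (simp add: one_parameter_subgroup_def smooth_map_real_line_iff)
  have "velocity GM \<Gamma> 0 = dir_deriv 1 (\<lambda>t. phi (\<Gamma> t)) 0"
    using velocity_one one_parameter_carrier(2)[OF ops] by blast
  also have "\<dots> = dir_deriv 1 (\<lambda>t. lproj V1 (y t)) 0"
    by (rule dir_deriv_cong(1)[of "{-\<tau><..<\<tau>}"]) (use y \<Gamma>(3) phi_psi in auto)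
  also have "\<dots> = lproj V1 x"
    by (rule dir_deriv_eqI) (simp add: bounded_linear.has_vector_derivative[OF lproj_bounded_linear y(5)])
  also have "\<dots> = x" using lproj(3)[OF subspace_V1 x] .
  finally show ?thesis using that[OF ops] by blast
qed

text \<open>Differentiate \<open>\<gamma> (t + s) = \<gamma> t \<otimes> \<gamma> s\<close> in
  \<open>s\<close> at \<open>0\<close>.\<close>

lemma one_parameter_ode:
  assumes \<gamma>: "one_parameter_subgroup G GM \<gamma>" and t: "\<gamma> t \<in> U1"
  shows "((\<lambda>t. phi (\<gamma> t)) has_vector_derivative lfield (velocity GM \<gamma> 0) (phi (\<gamma> t))) (at t)"
proof -
  note c = one_parameter_carrier[OF \<gamma>]
  define T where "T = {t\<in>UNIV. \<gamma> t \<in> U1}"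
  have T: "open T" "0 \<in> T" "t \<in> T"
    unfolding T_def using plot_vimage_open[OF c(3) U1_open] chart_one_atlas(2) c(2) t by auto
  have sm: "smooth_on UNIV T (\<lambda>t. phi (\<gamma> t))"
    unfolding T_def by (rule plot_coord[OF c(3) chart_one_atlas(1)])
  have d: "dir_deriv 1 (\<lambda>s. (phi (\<gamma> t), phi (\<gamma> s))) 0 = (0, velocity GM \<gamma> 0)"
  proof -
    have "((\<lambda>s. (phi (\<gamma> t), phi (\<gamma> s))) has_derivative (\<lambda>v. (0, dir_deriv v (\<lambda>s. phi (\<gamma> s)) 0))) (at 0)"
      by (intro has_derivative_Pair has_derivative_const smooth_on_has_derivative[OF sm T(1,2)])
    from has_derivative_dir_deriv[OF this] show ?thesis using velocity_one[of \<gamma>] c(2) by simp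
  qed
  have pt: "(phi (\<gamma> t), phi (\<gamma> 0)) \<in> Om" using Om_z1(1)[OF psi_phi(2)[OF t]] c(2) by (simp add: z1_def)
  have "dir_deriv 1 (\<lambda>t. phi (\<gamma> t)) t = dir_deriv 1 (\<lambda>s. phi (\<gamma> (t + s))) 0"
    by (simp add: dir_deriv_def)
  also have "\<dots> = dir_deriv 1 (\<lambda>s. mu (phi (\<gamma> t), phi (\<gamma> s))) 0"
  proof (rule dir_deriv_cong(1)[OF T(1,2)])
    fix s assume "s \<in> T"
    moreover have "\<gamma> (t + s) = \<gamma> t \<otimes> \<gamma> s" using \<gamma> by (simp add: one_parameter_subgroup_def)
    ultimately show "phi (\<gamma> (t + s)) = mu (phi (\<gamma> t), phi (\<gamma> s))" using t psi_phi(1) by (simp add: mu_def T_def)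
  qed
  also have "\<dots> = dir_deriv (0, velocity GM \<gamma> 0) mu (phi (\<gamma> t), phi (\<gamma> 0))"
    using dir_deriv_compose[OF mu_smooth smooth_on_Pair[OF smooth_on_const sm T(1)] T(1) open_Om T(2), of "phi (\<gamma> t)" 1] pt d by simp
  also have "\<dots> = lfield (velocity GM \<gamma> 0) (phi (\<gamma> t))" using c(2) by (simp add: lfield_def z1_def)
  finally show ?thesis using smooth_on_has_vector_derivative[OF sm T(1,3)] by simp
qed

text \<open>Equal velocities mean the same differential equation in the chart at
  \<open>\<one>\<close>; so the subgroups agree near \<open>0\<close> and, taking powers,
  everywhere. Uniqueness is what gives the definite description in \<open>lie_exp\<close> its
  value.\<close>

lemma one_parameter_unique:
  assumes \<gamma>: "one_parameter_subgroup G GM \<gamma>" and \<delta>: "one_parameter_subgroup G GM \<delta>"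
    and v: "velocity GM \<gamma> 0 = velocity GM \<delta> 0"
  shows "\<gamma> = \<delta>"
proof -
  define x where "x = velocity GM \<gamma> 0"
  obtain r L where rL: "r > 0" "L > 0" "cball z1 r \<subseteq> dom"
    "\<And>p q. p \<in> cball z1 r \<Longrightarrow> q \<in> cball z1 r \<Longrightarrow> norm (lfield x p - lfield x q) \<le> L * norm (p - q)"
    using smooth_local_lipschitz[OF open_dom z1(1) lfield_smooth] by blast
  have nb: "\<exists>e>0. \<forall>t. \<bar>t\<bar> < e \<longrightarrow> c t \<in> U1 \<and> phi (c t) \<in> cball z1 r" if c: "one_parameter_subgroup G GM c" for c
  proof -
    note cc = one_parameter_carrier[OF c]
    define T where "T = {t\<in>UNIV. c t \<in> U1}"
    have T: "open T" "0 \<in> T"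
      unfolding T_def using plot_vimage_open[OF cc(3) U1_open] chart_one_atlas(2) cc(2) by auto
    have sm: "smooth_on UNIV T (\<lambda>t. phi (c t))"
      unfolding T_def by (rule plot_coord[OF cc(3) chart_one_atlas(1)])
    have "open (T \<inter> (\<lambda>t. phi (c t)) -` ball z1 r)"
      by (rule continuous_open_preimage[OF smooth_on_continuous[OF sm] T(1) open_ball])
    moreover have "0 \<in> T \<inter> (\<lambda>t. phi (c t)) -` ball z1 r" using T rL(1) cc(2) by (simp add: z1_def)
    ultimately obtain e where "e > 0" "ball 0 e \<subseteq> T \<inter> (\<lambda>t. phi (c t)) -` ball z1 r"
      by (meson open_contains_ball)
    then show ?thesis by (intro exI[of _ e]) (auto simp: T_def subset_iff dist_norm less_imp_le)
  qed
  obtain e1 e2 where e: "e1 > 0" "e2 > 0" "\<And>t. \<bar>t\<bar> < e1 \<Longrightarrow> \<gamma> t \<in> U1 \<and> phi (\<gamma> t) \<in> cball z1 r"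
    "\<And>t. \<bar>t\<bar> < e2 \<Longrightarrow> \<delta> t \<in> U1 \<and> phi (\<delta> t) \<in> cball z1 r"
    using nb[OF \<gamma>] nb[OF \<delta>] by blast
  define \<tau> where "\<tau> = min (min e1 e2 / 2) (1 / (2 * L))"
  have "\<tau> * L \<le> 1 / (2 * L) * L" using rL(2) by (intro mult_right_mono) (auto simp: \<tau>_def)
  then have \<tau>: "\<tau> > 0" "\<tau> * L < 1" "\<tau> < e1" "\<tau> < e2"
    using e rL(2) by (auto simp: \<tau>_def)
  have loc: "\<gamma> t = \<delta> t" if "t \<in> {-\<tau>..\<tau>}" for t
  proof -
    have 1: "\<gamma> t \<in> U1" "\<delta> t \<in> U1" "phi (\<gamma> t) \<in> cball z1 r" "phi (\<delta> t) \<in> cball z1 r" if "t \<in> {-\<tau>..\<tau>}" for t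
      using e(3,4)[of t] \<tau> that by auto
    have "phi (\<gamma> t) = phi (\<delta> t)"
    proof (rule ode_unique[where D="cball z1 r" and X="lfield x" and L=L and \<tau>=\<tau>])
      show "phi (\<gamma> 0) = phi (\<delta> 0)" using one_parameter_carrier(2)[OF \<gamma>] one_parameter_carrier(2)[OF \<delta>] by simp
      fix t assume t: "t \<in> {-\<tau>..\<tau>}"
      show "((\<lambda>t. phi (\<gamma> t)) has_vector_derivative lfield x (phi (\<gamma> t))) (at t within {-\<tau>..\<tau>})"
        using one_parameter_ode[OF \<gamma> 1(1)[OF t]] unfolding x_def by (rule has_vector_derivative_at_within)
      show "((\<lambda>t. phi (\<delta> t)) has_vector_derivative lfield x (phi (\<delta> t))) (at t within {-\<tau>..\<tau>})"
        using one_parameter_ode[OF \<delta> 1(2)[OF t]] unfolding x_def v by (rule has_vector_derivative_at_within)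
    qed (use rL \<tau> 1 that in auto)
    then show ?thesis using psi_phi(1)[OF 1(1)[OF that]] psi_phi(1)[OF 1(2)[OF that]] by metis
  qed
  show ?thesis
  proof
    fix t
    obtain N :: nat where N: "\<bar>t\<bar> / \<tau> < real N" using reals_Archimedean2 by blast
    then have N0: "real N > 0" using \<tau>(1) divide_nonneg_pos[of "\<bar>t\<bar>" \<tau>] by linarith
    then have "\<bar>t / real N\<bar> \<le> \<tau>" using N \<tau>(1) by (simp add: field_simps)
    then have "t / real N \<in> {-\<tau>..\<tau>}" unfolding atLeastAtMost_iff by linarith
    then have "\<gamma> (t / real N) = \<delta> (t / real N)" by (rule loc)
    then have "\<gamma> (real N * (t / real N)) = \<delta> (real N * (t / real N))"
      using real_hom_pow[of \<gamma> N "t / real N"] real_hom_pow[of \<delta> N "t / real N"] \<gamma> \<delta>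
        one_parameter_carrier(1)[OF \<gamma>] one_parameter_carrier(1)[OF \<delta>]
      by (simp add: one_parameter_subgroup_def)
    then show "\<gamma> t = \<delta> t" using N0 by simp
  qed
qed

text \<open>Rescaling time by \<open>t\<close> gives a one-parameter subgroup whose velocity is
  multiplied by \<open>t\<close>; by uniqueness it is the one that \<open>lie_exp\<close>
  picks.\<close>

lemma lie_exp_scale:
  assumes \<gamma>: "one_parameter_subgroup G GM \<gamma>"
  shows "lie_exp G GM (t *\<^sub>R velocity GM \<gamma> 0) = \<gamma> t"
proof -
  note c = one_parameter_carrier[OF \<gamma>]
  let ?\<delta> = "\<lambda>s. \<gamma> (t * s)"
  have lin: "linear (\<lambda>s::real. t * s)" by (simp add: linear_iff algebra_simps)
  have "plot GM UNIV ?\<delta>"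
    by (rule plot_compose[OF c(3) smooth_on_linear[OF lin] open_UNIV _ GM(2)]) auto
  then have \<delta>: "one_parameter_subgroup G GM ?\<delta>"
    using \<gamma> by (simp add: one_parameter_subgroup_def smooth_map_real_line_iff algebra_simps)
  define T where "T = {t\<in>UNIV. \<gamma> t \<in> U1}"
  have T: "open T" "0 \<in> T"
    unfolding T_def using plot_vimage_open[OF c(3) U1_open] chart_one_atlas(2) c(2) by auto
  have sm: "smooth_on UNIV T (\<lambda>t. phi (\<gamma> t))"
    unfolding T_def by (rule plot_coord[OF c(3) chart_one_atlas(1)])
  have "((\<lambda>s. t * s) has_vector_derivative t) (at 0)" by (auto intro!: derivative_eq_intros)
  from has_vector_derivative_compose_smooth[OF sm T(1) _ this] T(2)
  have "((\<lambda>s. phi (\<gamma> (t * s))) has_vector_derivative dir_deriv t (\<lambda>t. phi (\<gamma> t)) 0) (at 0)" by simp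
  then have "dir_deriv 1 (\<lambda>s. phi (\<gamma> (t * s))) 0 = dir_deriv t (\<lambda>t. phi (\<gamma> t)) 0"
    by (intro dir_deriv_eqI) simp
  also have "\<dots> = t *\<^sub>R dir_deriv 1 (\<lambda>t. phi (\<gamma> t)) 0"
    using smooth_on_dir_deriv_expand[OF sm T, of t] by simp
  finally have v: "velocity GM ?\<delta> 0 = t *\<^sub>R velocity GM \<gamma> 0"
    using velocity_one[of ?\<delta>] velocity_one[of \<gamma>] c(2) by simp
  have "(THE \<delta>. one_parameter_subgroup G GM \<delta> \<and> velocity GM \<delta> 0 = t *\<^sub>R velocity GM \<gamma> 0) = ?\<delta>"
    by (rule the_equality) (use \<delta> v one_parameter_unique in auto)
  then show ?thesis by (simp add: lie_exp_def)
qed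

end

lemma smooth_on_dir_deriv_lproj:
  fixes f :: "'a::euclidean_space \<Rightarrow> 'b::real_normed_vector"
  assumes "subspace V" "\<And>y. f (lproj V y) = f y" "lproj V y = y"
  shows "dir_deriv (lproj V v) f y = dir_deriv v f y"
  using dir_deriv_lproj[OF assms(1), of v f] assms(2,3) by (metis (no_types, lifting) ext)

lemma compact_group_exists:
  assumes G: "group G" and K: "subgroup K G" and X: "topspace X = K" "compact_space X" "second_countable X"
    and c: "continuous_map (prod_topology X X) X (\<lambda>(a, b). a \<otimes>\<^bsub>G\<^esub> b)"
  shows "\<exists>d. compact_group G K X d"
proof -
  obtain C where C: "countable C" "C \<subseteq> topspace X" "X closure_of C = topspace X"
    using second_countable_imp_separable_space[OF X(3)] unfolding separable_space_def by blast
  have ne: "topspace X \<noteq> {}" using subgroup.one_closed[OF K] X(1) by auto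
  have Cne: "C \<noteq> {}" using C(3) ne by (metis closure_of_empty)
  have "compact_group G K X (from_nat_into C)"
    unfolding compact_group_def compact_group_axioms_def
  proof (intro conjI allI impI G K X c)
    fix i show "from_nat_into C i \<in> K" using from_nat_into[OF Cne] C(2) X(1) by blast
  next
    fix U assume "openin X U" "U \<noteq> {}"
    then obtain x where "x \<in> C" "x \<in> U" using C(3) unfolding dense_intersects_open by blast
    then show "\<exists>i. from_nat_into C i \<in> U" using from_nat_into_surj[OF C(1)] by metis
  qed
  then show ?thesis by blast
qed

section \<open>The isotropy group and its linearization\<close>

locale lie_action = lie_grp G GM for G (structure) and GM :: "('a, 'k::euclidean_space) manifold" +
  fixes M :: "('m, 'e::euclidean_space) manifold" and act :: "'a \<Rightarrow> 'm \<Rightarrow> 'm" and m :: 'm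
  assumes M: "smooth_manifold M" and psa: "proper_smooth_action G GM M act" and m: "m \<in> topspace (topo M)"
begin

abbreviation TM :: "'m set" where "TM \<equiv> topspace (topo M)"

definition K :: "'a set" where "K = stabilizer G act m"
definition KX :: "'a topology" where "KX = subtopology (topo GM) K"
definition dseq :: "nat \<Rightarrow> 'a" where "dseq = (SOME d. compact_group G K KX d)"

lemma Mc: "charted M" using M by (rule smooth_manifold_charted)

lemma ga: "group_action G TM act" using psa by (simp add: proper_smooth_action_def)

lemma act_closed: "g \<in> carrier G \<Longrightarrow> x \<in> TM \<Longrightarrow> act g x \<in> TM"
  using group_action.element_image[OF ga] by blast

lemma act_mult: "x \<in> TM \<Longrightarrow> g \<in> carrier G \<Longrightarrow> h \<in> carrier G \<Longrightarrow> act (g \<otimes> h) x = act g (act h x)"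
  using group_action.composition_rule[OF ga] by blast

lemma act_one: "x \<in> TM \<Longrightarrow> act \<one> x = x"
  using group_action.id_eq_one[OF ga] by (metis restrict_apply)

lemma act_inv: "x \<in> TM \<Longrightarrow> g \<in> carrier G \<Longrightarrow> act (inv g) (act g x) = x" "x \<in> TM \<Longrightarrow> g \<in> carrier G \<Longrightarrow> act g (act (inv g) x) = x"
  using act_mult[of x "inv g" g] act_mult[of x g "inv g"] act_one by auto

lemma act_plot:
  assumes "plot GM S c" "plot M S d"
  shows "plot M S (\<lambda>z. act (c z) (d z))"
proof -
  have "smooth_map (prod_manifold GM M) M (\<lambda>(g, x). act g x)" using psa by (simp add: proper_smooth_action_def)
  from plot_smooth_map[OF charted_prod[OF GM(2) Mc] Mc this plot_Pair[OF GM(2) Mc assms]]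
  show ?thesis by simp
qed

lemma act_continuous: "continuous_map (prod_topology (topo GM) (topo M)) (topo M) (\<lambda>(g, x). act g x)"
  using psa by (simp add: proper_smooth_action_def smooth_map_def prod_manifold_def)

lemma act_continuous_right: "g \<in> carrier G \<Longrightarrow> continuous_map (topo M) (topo M) (act g)"
  using continuous_map_compose[OF continuous_map_pairedI[of "topo M" "topo GM" "\<lambda>_. g" "topo M" id] act_continuous] GM(3)
  by (simp add: comp_def id_def continuous_map_id[unfolded id_def])

lemma act_translate_plot: "plot M S d \<Longrightarrow> g \<in> carrier G \<Longrightarrow> plot M S (\<lambda>z. act g (d z))"
  using act_plot[OF const_plot] plot_open by blast

lemma K_sub: "subgroup K G"
  unfolding K_def using group_action.stabilizer_subgroup[OF ga m] .

lemma K_iff: "k \<in> K \<longleftrightarrow> k \<in> carrier G \<and> act k m = m"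
  by (auto simp: K_def stabilizer_def)

lemma KX_top: "topspace KX = K"
  unfolding KX_def using GM(3) K_iff by auto

text \<open>\<open>K\<close> is the projection to the group of the fibre over \<open>(m, m)\<close>
  of the proper map \<open>(g, x) \<mapsto> (act g x, x)\<close>.\<close>

lemma K_compactin: "compactin (topo GM) K"
proof -
  let ?P = "prod_topology (topo GM) (topo M)"
  have pm: "proper_map ?P (prod_topology (topo M) (topo M)) (\<lambda>(g, x). (act g x, x))"
    using psa by (simp add: proper_smooth_action_def)
  have "compactin ?P {q \<in> topspace ?P. (\<lambda>(g, x). (act g x, x)) q = (m, m)}"
    using pm m unfolding proper_map_def by simp
  then have "compactin (topo GM) (fst ` {q \<in> topspace ?P. (\<lambda>(g, x). (act g x, x)) q = (m, m)})"
    by (rule image_compactin) (rule continuous_map_fst)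
  moreover have "fst ` {q \<in> topspace ?P. (\<lambda>(g, x). (act g x, x)) q = (m, m)} = K"
    using m GM(3) by (force simp: K_iff image_iff)
  ultimately show ?thesis by simp
qed

lemma mult_continuous: "continuous_map (prod_topology (topo GM) (topo GM)) (topo GM) (\<lambda>(a, b). a \<otimes> b)"
  using lie by (simp add: lie_group_def smooth_map_def prod_manifold_def)

lemma compact_group_K: "compact_group G K KX dseq"
proof -
  have c: "continuous_map (prod_topology KX KX) KX (\<lambda>(a, b). a \<otimes> b)"
  proof -
    have "continuous_map (prod_topology KX KX) (topo GM) (\<lambda>(a, b). a \<otimes> b)"
      unfolding KX_def subtopology_Times[symmetric] by (rule continuous_map_from_subtopology[OF mult_continuous])
    then show ?thesis unfolding KX_def
      using subgroup.m_closed[OF K_sub] by (auto simp: continuous_map_in_subtopology)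
  qed
  have "compact_space KX" unfolding KX_def using K_compactin by (simp add: compactin_subspace)
  moreover have "second_countable KX" unfolding KX_def
    using GM(1) by (simp add: smooth_manifold_def second_countable_subtopology)
  ultimately have "\<exists>d. compact_group G K KX d"
    by (intro compact_group_exists is_group K_sub KX_top c)
  then show ?thesis unfolding dseq_def by (rule someI_ex)
qed

sublocale cg: compact_group G K KX dseq
  by (rule compact_group_K)

lemma K_carrier: "k \<in> K \<Longrightarrow> k \<in> carrier G" and K_m: "k \<in> K \<Longrightarrow> act k m = m"
  by (auto simp: K_iff)

text \<open>A tube argument over the compact \<open>K\<close>. It shrinks neighbourhoods of
  \<open>m\<close> to \<open>K\<close>-stable ones.\<close>

lemma openin_all_K:
  assumes U: "openin (topo M) U"
  shows "openin (topo M) {x \<in> TM. \<forall>k\<in>K. act k x \<in> U}"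
proof (rule openin_subopen[THEN iffD2], rule ballI)
  fix x assume x: "x \<in> {x \<in> TM. \<forall>k\<in>K. act k x \<in> U}"
  let ?P = "prod_topology (topo GM) (topo M)"
  have W: "openin ?P {q \<in> topspace ?P. (\<lambda>(g, x). act g x) q \<in> U}"
    by (rule openin_continuous_map_preimage[OF act_continuous U])
  have sub: "K \<times> {x} \<subseteq> {q \<in> topspace ?P. (\<lambda>(g, x). act g x) q \<in> U}"
    using x K_carrier GM(3) by auto
  obtain A B where AB: "openin (topo GM) A" "openin (topo M) B" "K \<subseteq> A" "{x} \<subseteq> B"
    "A \<times> B \<subseteq> {q \<in> topspace ?P. (\<lambda>(g, x). act g x) q \<in> U}"
    using Wallace_theorem_prod_topology[OF K_compactin _ W sub] x by auto
  have "B \<subseteq> {x \<in> TM. \<forall>k\<in>K. act k x \<in> U}"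
  proof
    fix y assume y: "y \<in> B"
    have "act k y \<in> U" if "k \<in> K" for k
    proof -
      have "(k, y) \<in> A \<times> B" using y that AB(3) by blast
      from subsetD[OF AB(5) this] show ?thesis by simp
    qed
    then show "y \<in> {x \<in> TM. \<forall>k\<in>K. act k x \<in> U}" using y openin_subset[OF AB(2)] by blast
  qed
  then show "\<exists>T. openin (topo M) T \<and> x \<in> T \<and> T \<subseteq> {x \<in> TM. \<forall>k\<in>K. act k x \<in> U}"
    using AB by (intro exI[of _ B]) auto
qed

section \<open>The chart at \<open>m\<close> and the isotropy representation\<close>

definition domM :: "'e set" where "domM = chart_dom (chart_at M m)"
definition psiM :: "'e \<Rightarrow> 'm" where "psiM = chart_param (chart_at M m)"
definition phiM :: "'m \<Rightarrow> 'e" where "phiM = coord_at M m"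
definition VM :: "'e set" where "VM = tangent_space M m"
definition UM :: "'m set" where "UM = fst (chart_at M m)"
definition pM :: 'e where "pM = phiM m"

lemma chart_m: "chart_at M m = (UM, VM, phiM)"
  by (simp add: UM_def VM_def phiM_def tangent_space_def coord_at_def)

lemma chart_m_atlas: "(UM, VM, phiM) \<in> atlas M" "m \<in> UM"
  using chart_at[OF Mc m] by (auto simp: chart_m)

lemma chart_m_top: "topological_chart (topo M) (UM, VM, phiM)"
  using chartedD[OF Mc chart_m_atlas(1)] .

lemma subspace_VM: "subspace VM" and UM_open: "openin (topo M) UM" and UM_TM: "UM \<subseteq> TM"
  using topological_chartD[OF chart_m_top] by auto

lemma open_domM: "open domM"
  using chart_dom_open[OF chart_m_top] by (simp add: domM_def chart_m)

lemma psiM_phiM: "x \<in> UM \<Longrightarrow> psiM (phiM x) = x" "x \<in> UM \<Longrightarrow> phiM x \<in> domM" "x \<in> UM \<Longrightarrow> lproj VM (phiM x) = phiM x"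
  "x \<in> UM \<Longrightarrow> phiM x \<in> VM"
  using chart_dom_chart_param[OF chart_m_top] topological_chartD(6)[OF chart_m_top] by (auto simp: psiM_def domM_def chart_m)

lemma phiM_psiM: "y \<in> domM \<Longrightarrow> phiM (psiM y) = lproj VM y" "y \<in> domM \<Longrightarrow> psiM y \<in> UM" "y \<in> domM \<Longrightarrow> psiM y \<in> TM"
  using chart_dom_chart_param[OF chart_m_top] UM_TM by (auto simp: psiM_def domM_def chart_m)

lemma pM: "pM \<in> domM" "psiM pM = m" "lproj VM pM = pM" "pM \<in> VM"
  using psiM_phiM chart_m_atlas(2) by (auto simp: pM_def)

lemma lproj_domM: "lproj VM y \<in> domM \<longleftrightarrow> y \<in> domM" "psiM (lproj VM y) = psiM y"
  using lproj[OF subspace_VM] by (auto simp: domM_def chart_dom_def chart_m psiM_def chart_param_def)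

lemma psiM_plot: "plot M domM psiM"
  using plot_chart_param[OF M chart_m_atlas(1)] by (simp add: domM_def psiM_def chart_m)

lemma lprojM: "linear (lproj VM)" "lproj VM v \<in> VM" "v \<in> VM \<Longrightarrow> lproj VM v = v" "bounded_linear (lproj VM)"
  "lproj VM (lproj VM v) = lproj VM v"
  using lproj[OF subspace_VM] by (auto simp: linear_conv_bounded_linear)

lemma phiM_plot:
  assumes "plot M S c"
  shows "open {z\<in>S. c z \<in> UM}" "smooth_on UNIV {z\<in>S. c z \<in> UM} (\<lambda>z. phiM (c z))"
  using plot_vimage_open[OF assms UM_open] plot_coord[OF assms chart_m_atlas(1)] by auto

lemma lproj_dir_phiM:
  assumes "plot M S c" "z \<in> S" "c z \<in> UM"
  shows "lproj VM (dir_deriv v (\<lambda>z. phiM (c z)) z) = dir_deriv v (\<lambda>z. phiM (c z)) z"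
proof -
  have z: "z \<in> {z\<in>S. c z \<in> UM}" using assms by simp
  note p = phiM_plot[OF assms(1)]
  have "lproj VM (dir_deriv v (\<lambda>z. phiM (c z)) z) = dir_deriv v (\<lambda>z. lproj VM (phiM (c z))) z"
    using dir_deriv_chain[OF bounded_linear_imp_has_derivative[OF lprojM(4)] smooth_on_has_derivative[OF p(2,1) z]] by simp
  also have "\<dots> = dir_deriv v (\<lambda>z. phiM (c z)) z"
    by (rule dir_deriv_cong(1)[OF p(1) z]) (auto simp: psiM_phiM)
  finally show ?thesis .
qed

definition afun :: "'a \<Rightarrow> 'e \<Rightarrow> 'e" where "afun g y = phiM (act g (psiM y))"
text \<open>For \<open>g\<close> in \<open>K\<close>, the linear isotropy action on the tangent
  space at \<open>m\<close>, read in the chart and extended by the projection onto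
  \<open>VM\<close>. It makes sense also outside \<open>K\<close> as long as \<open>g\<close> keeps
  \<open>m\<close> in the chart, so smooth dependence on \<open>g\<close> can be tested on plots of
  the whole group.\<close>

definition rho :: "'a \<Rightarrow> 'e \<Rightarrow> 'e" where "rho g v = dir_deriv v (afun g) pM"
definition adom :: "'a \<Rightarrow> 'e set" where "adom g = {y\<in>domM. act g (psiM y) \<in> UM}"

lemma adom_open: "g \<in> carrier G \<Longrightarrow> open (adom g)" and afun_smooth: "g \<in> carrier G \<Longrightarrow> smooth_on UNIV (adom g) (afun g)"
  using phiM_plot[OF act_translate_plot[OF psiM_plot]] by (auto simp: adom_def afun_def[abs_def])

lemma pM_adom: "act g m \<in> UM \<Longrightarrow> pM \<in> adom g" "k \<in> K \<Longrightarrow> pM \<in> adom k"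
  using pM K_m chart_m_atlas by (auto simp: adom_def)

lemma rho_linear: "g \<in> carrier G \<Longrightarrow> act g m \<in> UM \<Longrightarrow> bounded_linear (rho g)"
  unfolding rho_def[abs_def] by (rule smooth_on_dir_deriv_linear[OF afun_smooth adom_open pM_adom(1)])

lemma rho_linear_K: "k \<in> K \<Longrightarrow> bounded_linear (rho k)"
  using rho_linear K_carrier K_m chart_m_atlas(2) by simp

lemma rho_lproj: "rho g (lproj VM v) = rho g v"
  unfolding rho_def by (rule smooth_on_dir_deriv_lproj[OF subspace_VM]) (auto simp: afun_def lproj_domM pM)

lemma lproj_rho: "k \<in> K \<Longrightarrow> lproj VM (rho k v) = rho k v"
  unfolding rho_def afun_def[abs_def]
  by (rule lproj_dir_phiM[OF act_translate_plot[OF psiM_plot] pM(1)]) (auto simp: K_carrier pM K_m chart_m_atlas)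

lemma rho_plot:
  assumes c: "plot M S c" "z \<in> S" "c z = m" and k: "k \<in> K"
  shows "dir_deriv v (\<lambda>z. phiM (act k (c z))) z = rho k (dir_deriv v (\<lambda>z. phiM (c z)) z)"
proof -
  let ?S = "{z\<in>S. c z \<in> UM}"
  note p = phiM_plot[OF c(1)]
  have z: "z \<in> ?S" using c chart_m_atlas by simp
  have "dir_deriv v (\<lambda>z. phiM (act k (c z))) z = dir_deriv v (\<lambda>z. afun k (phiM (c z))) z"
    by (rule dir_deriv_cong(1)[OF p(1) z]) (auto simp: afun_def psiM_phiM)
  also have "\<dots> = dir_deriv (dir_deriv v (\<lambda>z. phiM (c z)) z) (afun k) (phiM (c z))"
    by (rule dir_deriv_compose[OF afun_smooth[OF K_carrier[OF k]] p(2,1) adom_open[OF K_carrier[OF k]] z])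
       (use pM_adom(2)[OF k] c(3) in \<open>simp add: pM_def\<close>)
  finally show ?thesis by (simp add: rho_def c(3) pM_def)
qed

lemma rho_mult: "k \<in> K \<Longrightarrow> l \<in> K \<Longrightarrow> rho (k \<otimes> l) v = rho k (rho l v)"
proof -
  assume kl: "k \<in> K" "l \<in> K"
  have "rho (k \<otimes> l) v = dir_deriv v (\<lambda>y. phiM (act k (act l (psiM y)))) pM"
    unfolding rho_def by (rule dir_deriv_cong(1)[OF open_domM pM(1)]) (simp add: afun_def act_mult K_carrier kl phiM_psiM)
  also have "\<dots> = rho k (dir_deriv v (\<lambda>y. phiM (act l (psiM y))) pM)"
    by (rule rho_plot[OF act_translate_plot[OF psiM_plot] pM(1) _ kl(1)]) (auto simp: K_carrier kl pM K_m)
  finally show ?thesis by (simp add: rho_def afun_def[abs_def])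
qed

lemma rho_one: "rho \<one> v = lproj VM v"
proof -
  have "rho \<one> v = dir_deriv v (lproj VM) pM"
    unfolding rho_def by (rule dir_deriv_cong(1)[OF open_domM pM(1)]) (simp add: afun_def act_one phiM_psiM)
  also have "\<dots> = lproj VM v"
    using has_derivative_dir_deriv[OF bounded_linear_imp_has_derivative[OF lprojM(4)]] .
  finally show ?thesis .
qed

lemma rho_inv: "k \<in> K \<Longrightarrow> rho k (rho (inv k) v) = lproj VM v" "k \<in> K \<Longrightarrow> rho (inv k) (rho k v) = lproj VM v"
  using rho_mult[of k "inv k"] rho_mult[of "inv k" k] cg.K_inv K_carrier by (auto simp: rho_one)

lemma joint_plot:
  fixes c :: "'z::euclidean_space \<Rightarrow> 'a"
  assumes "plot GM S c"
  shows "plot M (S \<times> domM) (\<lambda>p. act (c (fst p)) (psiM (snd p)))"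
  by (rule act_plot[OF plot_compose[OF assms smooth_on_fst open_Times[OF plot_open[OF assms] open_domM] _ GM(2)]
        plot_compose[OF psiM_plot smooth_on_snd open_Times[OF plot_open[OF assms] open_domM] _ Mc]]) auto

lemma rho_smooth:
  fixes c :: "'z::euclidean_space \<Rightarrow> 'a"
  assumes "plot GM S c" "open T" "T \<subseteq> S" "\<And>z. z \<in> T \<Longrightarrow> act (c z) m \<in> UM"
  shows "smooth_on UNIV T (\<lambda>z. rho (c z) v)"
proof -
  note p = phiM_plot[OF joint_plot[OF assms(1)]]
  define A where "A p = phiM (act (c (fst p)) (psiM (snd p)))" for p
  have e: "rho (c z) v = dir_deriv (0, v) A (z, pM)" for z
  proof -
    have "(\<lambda>y. A (z, y)) = afun (c z)" by (auto simp: A_def afun_def)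
    then show ?thesis unfolding rho_def dir_deriv_Pair_right[symmetric] by simp
  qed
  have "smooth_on UNIV T (\<lambda>z. dir_deriv (0, v) A (z, pM))"
  proof (rule smooth_on_compose[OF _ smooth_on_Pair[OF smooth_on_id smooth_on_const assms(2)] assms(2) p(1)])
    show "smooth_on UNIV {z \<in> S \<times> domM. act (c (fst z)) (psiM (snd z)) \<in> UM} (dir_deriv (0, v) A)"
      unfolding A_def[abs_def] by (rule smooth_on_dir_deriv[OF p(2) UNIV_I])
    show "(z, pM) \<in> {z \<in> S \<times> domM. act (c (fst z)) (psiM (snd z)) \<in> UM}" if "z \<in> T" for z
      using assms(3,4) that pM by auto
  qed
  then show ?thesis by (simp add: e)
qed

lemma rho_expand: "g \<in> carrier G \<Longrightarrow> act g m \<in> UM \<Longrightarrow> rho g w = (\<Sum>b\<in>Basis. (w \<bullet> b) *\<^sub>R rho g b)"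
  unfolding rho_def by (rule smooth_on_dir_deriv_expand[OF afun_smooth adom_open pM_adom(1)])

lemma rho_smooth_comp:
  fixes c :: "'z::euclidean_space \<Rightarrow> 'a"
  assumes "plot GM S c" "open T" "T \<subseteq> S" "\<And>z. z \<in> T \<Longrightarrow> act (c z) m \<in> UM" "smooth_on UNIV T w"
  shows "smooth_on UNIV T (\<lambda>z. rho (c z) (w z))"
proof -
  have "smooth_on UNIV T (\<lambda>z. \<Sum>b\<in>Basis. (w z \<bullet> b) *\<^sub>R rho (c z) b)"
    by (rule smooth_on_sum[OF smooth_on_scaleR[OF smooth_on_inner_left[OF assms(5,2)] rho_smooth[OF assms(1-4)] assms(2)] assms(2)])
  then show ?thesis
  proof (rule smooth_on_cong[OF _ assms(2)])
    fix z assume z: "z \<in> T"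
    have "c z \<in> carrier G" using plot_in[OF assms(1)] assms(3) z GM(3) by blast
    from rho_expand[OF this assms(4)[OF z]] show "(\<Sum>b\<in>Basis. (w z \<bullet> b) *\<^sub>R rho (c z) b) = rho (c z) (w z)" by (rule sym)
  qed
qed

text \<open>Charts of the group at points of \<open>K\<close> provide the continuous map
  \<open>\<phi>\<close> of \<open>par_Ck_plots\<close>. Means over \<open>K\<close> can thus be
  handled with plots of \<open>G\<close>, of which only the parameters with values in
  \<open>K\<close> count.\<close>

lemma par_Ck_group:
  fixes f :: "'a \<Rightarrow> 'z::euclidean_space \<Rightarrow> 'v::euclidean_space"
  assumes S: "open S"
    and loc: "\<And>A (c :: 'k \<Rightarrow> 'a) z y. plot GM A c \<Longrightarrow> z \<in> A \<Longrightarrow> c z \<in> K \<Longrightarrow> y \<in> S \<Longrightarrow>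
      \<exists>T R F. open T \<and> z \<in> T \<and> T \<subseteq> A \<and> open R \<and> y \<in> R \<and> R \<subseteq> S \<and> smooth_on UNIV (T \<times> R) F \<and>
        (\<forall>z\<in>T. \<forall>y\<in>R. c z \<in> K \<longrightarrow> f (c z) y = F (z, y))"
  shows "cg.par_Ck n S f"
proof (rule cg.par_Ck_plots[OF S])
  fix k y assume k: "k \<in> K" and y: "y \<in> S"
  have "k \<in> topspace (topo GM)" using K_carrier[OF k] GM(3) by simp
  then obtain U V \<phi> where c: "(U, V, \<phi>) \<in> atlas GM" "k \<in> U" using charted_obtain[OF GM(2)] by blast
  note tc = chartedD[OF GM(2) c(1)] note tcD = topological_chartD[OF tc] note cd = chart_dom_chart_param[OF tc]
  let ?c = "chart_param (U, V, \<phi>)"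
  have "?c (\<phi> k) \<in> K" using cd(2)[OF c(2)] k by simp
  from loc[OF plot_chart_param[OF GM(1) c(1)] cd(1)[OF c(2)] this y]
  obtain T R F where T: "open T" "\<phi> k \<in> T" "T \<subseteq> chart_dom (U, V, \<phi>)" "open R" "y \<in> R" "R \<subseteq> S" "smooth_on UNIV (T \<times> R) F"
    "\<And>z y. z \<in> T \<Longrightarrow> y \<in> R \<Longrightarrow> ?c z \<in> K \<Longrightarrow> f (?c z) y = F (z, y)" by blast
  define U' where "U' = K \<inter> {x \<in> U. \<phi> x \<in> T}"
  have "openin (subtopology (topo GM) U) {x \<in> topspace (subtopology (topo GM) U). \<phi> x \<in> T}"
    using openin_continuous_map_preimage[OF tcD(7), of T] T(1) by simp
  then have "openin (topo GM) {x \<in> topspace (subtopology (topo GM) U). \<phi> x \<in> T}"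
    using tcD(1) openin_trans_full by blast
  moreover have "{x \<in> topspace (subtopology (topo GM) U). \<phi> x \<in> T} = {x \<in> U. \<phi> x \<in> T}" using tcD(2) by auto
  ultimately have o: "openin KX U'" unfolding KX_def U'_def by (simp add: openin_subtopology_Int2)
  have "continuous_map (subtopology KX U') euclidean \<phi>"
  proof -
    have "subtopology KX U' = subtopology (subtopology (topo GM) U) U'"
      unfolding KX_def subtopology_subtopology U'_def by (rule arg_cong2[of _ _ _ _ subtopology]) auto
    then show ?thesis using continuous_map_from_subtopology[OF tcD(7)] by metis
  qed
  moreover have "f k y = F (\<phi> k, y)" if "k \<in> U'" "y \<in> R" for k y
    using T(8)[of "\<phi> k" y] cd(2)[of k] that by (simp add: U'_def)
  ultimately show "\<exists>U (\<phi> :: 'a \<Rightarrow> 'k) T R F. openin KX U \<and> k \<in> U \<and>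
      continuous_map (subtopology KX U) euclidean \<phi> \<and> open T \<and> \<phi> ` U \<subseteq> T \<and> open R \<and> y \<in> R \<and> R \<subseteq> S \<and>
      smooth_on UNIV (T \<times> R) F \<and> (\<forall>k\<in>U. \<forall>y\<in>R. f k y = F (\<phi> k, y))"
    using o T k c(2) by (intro exI[of _ U'] exI[of _ \<phi>] exI[of _ T] exI[of _ R] exI[of _ F]) (auto simp: U'_def)
qed

lemma continuous_K_plots:
  fixes f :: "'a \<Rightarrow> 'v::euclidean_space"
  assumes "\<And>A (c :: 'k \<Rightarrow> 'a) z. plot GM A c \<Longrightarrow> z \<in> A \<Longrightarrow> c z \<in> K \<Longrightarrow>
      \<exists>T. open T \<and> z \<in> T \<and> T \<subseteq> A \<and> smooth_on UNIV T (\<lambda>z. f (c z))"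
  shows "continuous_map KX euclidean f"
proof -
  have "cg.par_Ck 0 (UNIV :: 'k set) (\<lambda>k _. f k)"
  proof (rule par_Ck_group[OF open_UNIV])
    fix A and c :: "'k \<Rightarrow> 'a" and z y :: 'k assume "plot GM A c" "z \<in> A" "c z \<in> K"
    from assms[OF this] obtain T where T: "open T" "z \<in> T" "T \<subseteq> A" "smooth_on UNIV T (\<lambda>z. f (c z))" by blast
    have "smooth_on UNIV (T \<times> (UNIV :: 'k set)) (\<lambda>p. f (c (fst p)))"
      by (rule smooth_on_compose[OF T(4) smooth_on_fst open_Times[OF T(1) open_UNIV] T(1)]) auto
    then show "\<exists>T R F. open T \<and> z \<in> T \<and> T \<subseteq> A \<and> open R \<and> y \<in> R \<and> R \<subseteq> UNIV \<and> smooth_on UNIV (T \<times> R) F \<and>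
        (\<forall>z\<in>T. \<forall>y\<in>R. c z \<in> K \<longrightarrow> f (c z) = F (z, y))"
      using T by (intro exI[of _ T] exI[of _ UNIV] exI[of _ "\<lambda>p. f (c (fst p))"]) auto
  qed
  then show ?thesis using cg.par_cont_section[of UNIV "\<lambda>k _. f k" 0] by simp
qed

section \<open>Equivariant linearization at the fixed point\<close>

definition W0 :: "'m set" where "W0 = {x \<in> TM. \<forall>k\<in>K. act k x \<in> UM}"
definition D1 :: "'e set" where "D1 = {y \<in> domM. psiM y \<in> W0}"
text \<open>The chart at \<open>m\<close>, centred and averaged over \<open>K\<close> against the
  isotropy representation. Averaging makes it equivariant and leaves its differential at
  \<open>m\<close> unchanged.\<close>

definition Phi :: "'m \<Rightarrow> 'e" where
  "Phi x = cg.vmean (\<lambda>k. rho k (phiM (act (inv k) x) - pM))"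

lemma W0: "openin (topo M) W0" "m \<in> W0" "W0 \<subseteq> UM" "x \<in> W0 \<Longrightarrow> k \<in> K \<Longrightarrow> act k x \<in> W0" "x \<in> W0 \<Longrightarrow> x \<in> TM"
proof -
  show "openin (topo M) W0" unfolding W0_def by (rule openin_all_K[OF UM_open])
  show "m \<in> W0" using m K_m chart_m_atlas(2) by (simp add: W0_def)
  show "W0 \<subseteq> UM" using cg.K_one act_one by (auto simp: W0_def)
  show "act k x \<in> W0" if "x \<in> W0" "k \<in> K" using that cg.K_mult act_closed
    by (auto simp: W0_def act_mult[symmetric] K_carrier)
  show "x \<in> W0 \<Longrightarrow> x \<in> TM" by (simp add: W0_def)
qed

lemma D1: "open D1" "pM \<in> D1" "D1 \<subseteq> domM" "lproj VM y \<in> D1 \<longleftrightarrow> y \<in> D1"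
  using plot_vimage_open[OF psiM_plot W0(1)] pM W0(2) lproj_domM by (auto simp: D1_def)

lemma Phi_integrand:
  assumes c: "plot GM A c" "z \<in> A" "c z \<in> K" and y: "y \<in> D1"
  shows "\<exists>T R. open T \<and> z \<in> T \<and> T \<subseteq> A \<and> open R \<and> y \<in> R \<and> R \<subseteq> D1 \<and>
     smooth_on UNIV (T \<times> R) (\<lambda>p. rho (c (fst p)) (phiM (act (inv (c (fst p))) (psiM (snd p))) - pM))"
proof -
  note j = joint_plot[OF inv_plot[OF c(1)]]
  define \<Omega>1 where "\<Omega>1 = {p \<in> A \<times> domM. act (inv (c (fst p))) (psiM (snd p)) \<in> UM}"
  have o1: "open \<Omega>1" "smooth_on UNIV \<Omega>1 (\<lambda>p. phiM (act (inv (c (fst p))) (psiM (snd p))))"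
    unfolding \<Omega>1_def using phiM_plot[OF j] by auto
  have "act (inv (c z)) (psiM y) \<in> UM" using y c(3) cg.K_inv by (auto simp: D1_def W0_def)
  then have "(z, y) \<in> \<Omega>1" using c(2) y D1(3) by (auto simp: \<Omega>1_def)
  then obtain T1 R1 where T1: "open T1" "open R1" "(z, y) \<in> T1 \<times> R1" "T1 \<times> R1 \<subseteq> \<Omega>1"
    using open_prod_elim[OF o1(1)] by blast
  define T2 where "T2 = {z\<in>A. act (c z) m \<in> UM}"
  have T2: "open T2" "z \<in> T2"
    unfolding T2_def using plot_vimage_open[OF act_plot[OF c(1) plot_const[OF plot_open[OF c(1)] Mc m]] UM_open] c K_m chart_m_atlas(2) by auto
  let ?T = "T1 \<inter> T2 \<inter> A" let ?R = "R1 \<inter> D1"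
  have oT: "open ?T" "open ?R" using T1 T2 plot_open[OF c(1)] D1(1) by auto
  have s1: "smooth_on UNIV (?T \<times> ?R) (\<lambda>p. phiM (act (inv (c (fst p))) (psiM (snd p))) - pM)"
    by (rule smooth_on_diff[OF smooth_on_subset[OF o1(2)] smooth_on_const open_Times[OF oT]]) (use T1(4) in blast)
  have "plot GM (?T \<times> ?R) (\<lambda>p. c (fst p))"
    by (rule plot_compose[OF c(1) smooth_on_fst open_Times[OF oT] _ GM(2)]) auto
  from rho_smooth_comp[OF this open_Times[OF oT] order_refl _ s1]
  have "smooth_on UNIV (?T \<times> ?R) (\<lambda>p. rho (c (fst p)) (phiM (act (inv (c (fst p))) (psiM (snd p))) - pM))"
    by (auto simp: T2_def)
  then show ?thesis using oT T1(3) T2(2) c(2) y by (intro exI[of _ ?T] exI[of _ ?R]) auto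
qed

lemma Phi_par: "cg.par_Ck n D1 (\<lambda>k y. rho k (phiM (act (inv k) (psiM y)) - pM))"
proof (rule par_Ck_group[OF D1(1)])
  fix A and c :: "'k \<Rightarrow> 'a" and z y assume "plot GM A c" "z \<in> A" "c z \<in> K" "y \<in> D1"
  from Phi_integrand[OF this] show "\<exists>T R F. open T \<and> z \<in> T \<and> T \<subseteq> A \<and> open R \<and> y \<in> R \<and> R \<subseteq> D1 \<and> smooth_on UNIV (T \<times> R) F \<and>
        (\<forall>z\<in>T. \<forall>y\<in>R. c z \<in> K \<longrightarrow> rho (c z) (phiM (act (inv (c z)) (psiM y)) - pM) = F (z, y))"
    by force
qed

lemma Phi_continuous:
  assumes "x \<in> W0" shows "continuous_map KX euclidean (\<lambda>k. rho k (phiM (act (inv k) x) - pM))"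
proof -
  have "x \<in> UM" using assms W0 by blast
  then have "phiM x \<in> D1" "psiM (phiM x) = x" using assms psiM_phiM by (auto simp: D1_def)
  then show ?thesis using cg.par_cont_section[OF cg.par_Ck_cont[OF Phi_par], of "phiM x"] by simp
qed

lemma Phi_smooth: "smooth_on UNIV D1 (\<lambda>y. Phi (psiM y))"
  unfolding Phi_def by (rule cg.vmean_smooth[OF D1(1) Phi_par])

text \<open>Substituting \<open>a \<otimes> k\<close> for \<open>k\<close> cancels \<open>a\<close>
  in the argument of the chart and brings \<open>rho a\<close> to the front; the mean is blind to
  the substitution.\<close>

lemma Phi_equivariant:
  assumes x: "x \<in> W0" and a: "a \<in> K"
  shows "Phi (act a x) = rho a (Phi x)"
proof -
  have xT: "x \<in> TM" using W0(5)[OF x] .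
  let ?f = "\<lambda>k. rho k (phiM (act (inv k) (act a x)) - pM)"
  have "Phi (act a x) = cg.vmean (\<lambda>k. ?f (a \<otimes> k))"
    unfolding Phi_def by (rule cg.vmean_left_invariant[symmetric, OF Phi_continuous[OF W0(4)[OF x a]] a])
  also have "\<dots> = cg.vmean (\<lambda>k. rho a (rho k (phiM (act (inv k) x) - pM)))"
  proof (rule cg.vmean_cong)
    fix k assume k: "k \<in> K"
    have "act (inv (a \<otimes> k)) (act a x) = act (inv k) x"
      using a k xT act_inv(1)[OF xT K_carrier[OF a]]
      by (simp add: inv_mult_group K_carrier act_mult act_closed)
    then show "?f (a \<otimes> k) = rho a (rho k (phiM (act (inv k) x) - pM))" using rho_mult[OF a k] by simp
  qed
  also have "\<dots> = rho a (Phi x)"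
    unfolding Phi_def by (rule cg.vmean_linear[OF Phi_continuous[OF x] bounded_linear.linear[OF rho_linear_K[OF a]]])
  finally show ?thesis .
qed

lemma Phi_m: "Phi m = 0"
proof -
  have "Phi m = cg.vmean (\<lambda>k. (0::'e))"
    unfolding Phi_def
  proof (rule cg.vmean_cong)
    fix k assume k: "k \<in> K"
    then have "act (inv k) m = m" using K_m cg.K_inv by blast
    then show "rho k (phiM (act (inv k) m) - pM) = 0"
      using bounded_linear.linear[OF rho_linear_K[OF k]] by (simp add: pM_def linear_0)
  qed
  then show ?thesis by (simp add: cg.vmean_const)
qed

lemma lproj_Phi: "x \<in> W0 \<Longrightarrow> lproj VM (Phi x) = Phi x"
  unfolding Phi_def cg.vmean_linear[OF Phi_continuous lprojM(1), symmetric]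
  by (rule cg.vmean_cong) (rule lproj_rho)

text \<open>Under the mean, the derivative at \<open>pM\<close> is \<open>rho k\<close> after
  \<open>rho (inv k)\<close>, the same projection for every \<open>k\<close>.\<close>

lemma Phi_deriv: "dir_deriv v (\<lambda>y. Phi (psiM y)) pM = lproj VM v"
proof -
  let ?f = "\<lambda>k y. rho k (phiM (act (inv k) (psiM y)) - pM)"
  have "dir_deriv v (\<lambda>y. Phi (psiM y)) pM = cg.vmean (\<lambda>k. dir_deriv v (?f k) pM)"
    unfolding Phi_def by (rule dir_deriv_eqI[OF cg.vmean_dir_deriv[OF Phi_par D1(1,2)]])
  also have "\<dots> = cg.vmean (\<lambda>k. lproj VM v)"
  proof (rule cg.vmean_cong)
    fix k assume k: "k \<in> K"
    have ki: "inv k \<in> K" using cg.K_inv[OF k] .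
    have d: "((\<lambda>y. afun (inv k) y - pM) has_derivative (\<lambda>v. rho (inv k) v - 0)) (at pM)"
      unfolding rho_def
      by (rule has_derivative_diff[OF smooth_on_has_derivative[OF afun_smooth adom_open pM_adom(2)[OF ki]] has_derivative_const])
         (rule K_carrier[OF ki])+
    have "dir_deriv v (?f k) pM = rho k (rho (inv k) v)"
      using dir_deriv_chain[OF bounded_linear_imp_has_derivative[OF rho_linear_K[OF k]] d, of v] by (simp add: afun_def)
    then show "dir_deriv v (?f k) pM = lproj VM v" using rho_inv[OF k] by simp
  qed
  finally show ?thesis by (simp add: cg.vmean_const)
qed

section \<open>The tangent space of the orbit\<close>

text \<open>The differential at \<open>\<one>\<close> of the orbit map
  \<open>u \<mapsto> act u m\<close>, in charts. It factors through the projection onto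
  \<open>V1\<close>, so its range over the whole type is its range over the Lie algebra.\<close>

definition dpi :: "'k \<Rightarrow> 'e" where "dpi x = dir_deriv x (\<lambda>z. phiM (act (psi z) m)) z1"
definition TO :: "'e set" where "TO = range dpi"

lemma orbit_plot: "plot GM S c \<Longrightarrow> plot M S (\<lambda>z. act (c z) m)"
  using act_plot plot_const[OF _ Mc m] plot_open by blast

lemma orbit_smooth: "open {z\<in>dom. act (psi z) m \<in> UM}" "smooth_on UNIV {z\<in>dom. act (psi z) m \<in> UM} (\<lambda>z. phiM (act (psi z) m))"
  "z1 \<in> {z\<in>dom. act (psi z) m \<in> UM}"
  using phiM_plot[OF orbit_plot[OF psi_plot]] z1 act_one[OF m] chart_m_atlas(2) by auto

lemma dpi_linear: "linear dpi"
  unfolding dpi_def[abs_def]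
  by (rule bounded_linear.linear[OF smooth_on_dir_deriv_linear[OF orbit_smooth(2,1,3)]])

lemma dpi_lproj: "dpi (lproj V1 x) = dpi x"
  unfolding dpi_def by (rule smooth_on_dir_deriv_lproj[OF subspace_V1]) (auto simp: lproj_dom z1)

lemma lproj_dpi: "lproj VM (dpi x) = dpi x"
  unfolding dpi_def by (rule lproj_dir_phiM[OF orbit_plot[OF psi_plot] z1(1)])
    (simp add: z1 act_one[OF m] chart_m_atlas(2))

lemma subspace_TO: "subspace TO"
  unfolding TO_def by (rule linear_subspace_image[OF dpi_linear subspace_UNIV])

lemma TO_VM: "TO \<subseteq> VM"
  unfolding TO_def using lproj_dpi lprojM(2) by (metis image_subsetI)

lemma dpi_plot:
  assumes c: "plot GM S c" "z \<in> S" "c z = \<one>"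
  shows "dir_deriv v (\<lambda>z. phiM (act (c z) m)) z = dpi (dir_deriv v (\<lambda>z. phi (c z)) z)"
proof -
  let ?S = "{z\<in>S. c z \<in> U1}"
  have z: "open ?S" "z \<in> ?S" using plot_vimage_open[OF c(1) U1_open] c chart_one_atlas by auto
  have sm: "smooth_on UNIV ?S (\<lambda>z. phi (c z))" by (rule plot_coord[OF c(1) chart_one_atlas(1)])
  have "dir_deriv v (\<lambda>z. phiM (act (c z) m)) z = dir_deriv v (\<lambda>z. phiM (act (psi (phi (c z))) m)) z"
    by (rule dir_deriv_cong(1)[OF z]) (simp add: psi_phi)
  also have "\<dots> = dir_deriv (dir_deriv v (\<lambda>z. phi (c z)) z) (\<lambda>z. phiM (act (psi z) m)) (phi (c z))"
    by (rule dir_deriv_compose[OF orbit_smooth(2) sm z(1) orbit_smooth(1) z(2)])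
       (use orbit_smooth(3) c(3) in \<open>simp add: z1_def\<close>)
  finally show ?thesis by (simp add: dpi_def c(3) z1_def)
qed

text \<open>As \<open>k\<close> fixes \<open>m\<close>, it moves \<open>act u m\<close> to the point
  of the orbit belonging to the conjugate \<open>k \<otimes> u \<otimes> inv k\<close>;
  differentiate at \<open>u = \<one>\<close>.\<close>

lemma rho_TO: "k \<in> K \<Longrightarrow> t \<in> TO \<Longrightarrow> rho k t \<in> TO"
proof -
  assume k: "k \<in> K" and "t \<in> TO"
  then obtain x where t: "t = dpi x" by (auto simp: TO_def)
  have kc: "k \<in> carrier G" using k K_carrier by simp
  have p: "plot GM dom (\<lambda>z. k \<otimes> psi z \<otimes> inv k)"
    using translate_plot(2)[OF translate_plot(1)[OF psi_plot kc] inv_closed[OF kc]] .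
  have "rho k t = dir_deriv x (\<lambda>z. phiM (act k (act (psi z) m))) z1"
    unfolding t dpi_def by (rule rho_plot[symmetric, OF orbit_plot[OF psi_plot] z1(1) _ k]) (simp add: z1 act_one[OF m])
  also have "\<dots> = dir_deriv x (\<lambda>z. phiM (act (k \<otimes> psi z \<otimes> inv k) m)) z1"
  proof (rule dir_deriv_cong(1)[OF open_dom z1(1)])
    fix z assume "z \<in> dom"
    then have "act (k \<otimes> psi z \<otimes> inv k) m = act k (act (psi z) (act (inv k) m))"
      using kc phi_psi(3) by (simp add: act_mult act_closed m m_assoc)
    moreover have "act (inv k) m = m" using K_m cg.K_inv k by blast
    ultimately show "phiM (act k (act (psi z) m)) = phiM (act (k \<otimes> psi z \<otimes> inv k) m)" by simp
  qed
  also have "\<dots> \<in> TO"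
    using dpi_plot[OF p z1(1)] kc by (simp add: z1 TO_def)
  finally show ?thesis .
qed

text \<open>Along a one-parameter subgroup with velocity \<open>x\<close> the exponential is the
  subgroup itself, and \<open>dpi_plot\<close> computes the velocity of the curve it traces in the
  orbit.\<close>

lemma orbit_tangent_space_eq: "orbit_tangent_space G GM M act m = TO"
proof -
  have *: "infinitesimal_generator G GM M act x m = dpi x" if x: "x \<in> V1" for x
  proof -
    obtain \<gamma> where \<gamma>: "one_parameter_subgroup G GM \<gamma>" "velocity GM \<gamma> 0 = x" using one_parameter_exists[OF x] by blast
    note c = one_parameter_carrier[OF \<gamma>(1)]
    have e: "lie_exp G GM (t *\<^sub>R x) = \<gamma> t" for t using lie_exp_scale[OF \<gamma>(1), of t] \<gamma>(2) by simp
    have "infinitesimal_generator G GM M act x m = dir_deriv 1 (\<lambda>t. phiM (act (\<gamma> t) m)) 0"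
      unfolding infinitesimal_generator_def e by (simp add: velocity_eq[of 0 0] c(2) act_one[OF m] phiM_def)
    also have "\<dots> = dpi (dir_deriv 1 (\<lambda>t. phi (\<gamma> t)) 0)"
      by (rule dpi_plot[OF c(3) UNIV_I c(2)])
    also have "\<dots> = dpi x" using velocity_one[of \<gamma>] c(2) \<gamma>(2) by simp
    finally show ?thesis .
  qed
  have "orbit_tangent_space G GM M act m = dpi ` V1"
    unfolding orbit_tangent_space_def lie_algebra_def V1_def[symmetric] using * by force
  moreover have "dpi x \<in> dpi ` V1" for x
    by (subst dpi_lproj[symmetric]) (rule imageI, rule lproj(2)[OF subspace_V1])
  ultimately show ?thesis unfolding TO_def by blast
qed

text \<open>An arbitrary projection onto \<open>TO\<close>, averaged over its conjugates by
  \<open>K\<close> as in Maschke's theorem. Since \<open>TO\<close> is invariant, the result is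
  still a projection onto \<open>TO\<close>, and it is equivariant; its kernel in \<open>VM\<close>
  is an invariant complement, the direction of the slice.\<close>

definition ppi :: "'e \<Rightarrow> 'e" where
  "ppi v = cg.vmean (\<lambda>k. rho k (lproj TO (rho (inv k) v)))"

lemma ppi_continuous: "continuous_map KX euclidean (\<lambda>k. rho k (lproj TO (rho (inv k) v)))"
proof (rule continuous_K_plots)
  fix A and c :: "'k \<Rightarrow> 'a" and z assume c: "plot GM A c" "z \<in> A" "c z \<in> K"
  define T where "T = {z\<in>A. act (c z) m \<in> UM} \<inter> {z\<in>A. act (inv (c z)) m \<in> UM}"
  have T: "open T" "z \<in> T" "T \<subseteq> A"
    unfolding T_def using plot_vimage_open[OF orbit_plot[OF c(1)] UM_open] plot_vimage_open[OF orbit_plot[OF inv_plot[OF c(1)]] UM_open]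
      c K_m chart_m_atlas(2) cg.K_inv by auto
  have "smooth_on UNIV T (\<lambda>z. rho (inv (c z)) v)"
    by (rule rho_smooth[OF inv_plot[OF c(1)] T(1,3)]) (auto simp: T_def)
  then have "smooth_on UNIV T (\<lambda>z. lproj TO (rho (inv (c z)) v))"
    by (rule smooth_on_linear_compose[OF lproj(1)[OF subspace_TO] _ T(1)])
  then have "smooth_on UNIV T (\<lambda>z. rho (c z) (lproj TO (rho (inv (c z)) v)))"
    by (intro rho_smooth_comp[OF c(1) T(1,3)]) (auto simp: T_def)
  then show "\<exists>T. open T \<and> z \<in> T \<and> T \<subseteq> A \<and> smooth_on UNIV T (\<lambda>z. rho (c z) (lproj TO (rho (inv (c z)) v)))"
    using T by blast
qed

lemma ppi_linear: "linear ppi"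
proof (rule linearI)
  note rl = bounded_linear.linear[OF rho_linear_K]
  note pl = lproj(1)[OF subspace_TO]
  fix v w
  have "ppi (v + w) = cg.vmean (\<lambda>k. rho k (lproj TO (rho (inv k) v)) + rho k (lproj TO (rho (inv k) w)))"
    unfolding ppi_def by (rule cg.vmean_cong) (simp add: linear_add[OF rl] linear_add[OF pl] cg.K_inv)
  then show "ppi (v + w) = ppi v + ppi w" by (simp add: ppi_def cg.vmean_add[OF ppi_continuous ppi_continuous])
  fix r
  have "ppi (r *\<^sub>R v) = cg.vmean (\<lambda>k. r *\<^sub>R rho k (lproj TO (rho (inv k) v)))"
    unfolding ppi_def by (rule cg.vmean_cong) (simp add: linear_scale[OF rl] linear_scale[OF pl] cg.K_inv)
  also have "\<dots> = r *\<^sub>R ppi v"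
    unfolding ppi_def by (rule cg.vmean_linear[OF ppi_continuous]) (simp add: linear_iff algebra_simps)
  finally show "ppi (r *\<^sub>R v) = r *\<^sub>R ppi v" .
qed

lemma ppi_TO: "ppi v \<in> TO"
proof -
  have "lproj TO (ppi v) = cg.vmean (\<lambda>k. lproj TO (rho k (lproj TO (rho (inv k) v))))"
    unfolding ppi_def by (rule cg.vmean_linear[OF ppi_continuous lproj(1)[OF subspace_TO], symmetric])
  also have "\<dots> = ppi v"
    unfolding ppi_def by (rule cg.vmean_cong) (intro lproj(3)[OF subspace_TO] rho_TO lproj(2)[OF subspace_TO])
  finally show ?thesis using lproj(2)[OF subspace_TO, of "ppi v"] by simp
qed

lemma ppi_id: "t \<in> TO \<Longrightarrow> ppi t = t"
proof -
  assume t: "t \<in> TO"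
  have "ppi t = cg.vmean (\<lambda>k. t)"
    unfolding ppi_def
  proof (rule cg.vmean_cong)
    fix k assume k: "k \<in> K"
    have "lproj TO (rho (inv k) t) = rho (inv k) t" using lproj(3)[OF subspace_TO rho_TO[OF cg.K_inv[OF k] t]] .
    then show "rho k (lproj TO (rho (inv k) t)) = t"
      using rho_inv(1)[OF k] lprojM(3) TO_VM t by auto
  qed
  then show ?thesis by (simp add: cg.vmean_const)
qed

lemma ppi_lproj: "ppi (lproj VM v) = ppi v"
  unfolding ppi_def by (rule cg.vmean_cong) (simp add: rho_lproj)

lemma ppi_equivariant:
  assumes a: "a \<in> K"
  shows "ppi (rho a v) = rho a (ppi v)"
proof -
  let ?f = "\<lambda>k. rho k (lproj TO (rho (inv k) (rho a v)))"
  have "ppi (rho a v) = cg.vmean (\<lambda>k. ?f (a \<otimes> k))"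
    unfolding ppi_def by (rule cg.vmean_left_invariant[symmetric, OF ppi_continuous a])
  also have "\<dots> = cg.vmean (\<lambda>k. rho a (rho k (lproj TO (rho (inv k) v))))"
  proof (rule cg.vmean_cong)
    fix k assume k: "k \<in> K"
    have "rho (inv (a \<otimes> k)) (rho a v) = rho (inv k) (rho (inv a) (rho a v))"
      using a k rho_mult[OF cg.K_inv[OF k] cg.K_inv[OF a]] by (simp add: inv_mult_group K_carrier)
    also have "\<dots> = rho (inv k) v" using rho_inv(2)[OF a] rho_lproj by simp
    finally show "?f (a \<otimes> k) = rho a (rho k (lproj TO (rho (inv k) v)))" using rho_mult[OF a k] by simp
  qed
  also have "\<dots> = rho a (ppi v)"
    unfolding ppi_def by (rule cg.vmean_linear[OF ppi_continuous bounded_linear.linear[OF rho_linear_K[OF a]]])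
  finally show ?thesis .
qed

end

section \<open>Maps into flat manifolds and open submanifolds\<close>

lemma topological_chart_vimage_openin:
  assumes "topological_chart X (U, V, \<phi>)" "open T"
  shows "openin X {x \<in> U. \<phi> x \<in> T}"
proof -
  note D = topological_chartD[OF assms(1)]
  have "openin (subtopology X U) {x \<in> topspace (subtopology X U). \<phi> x \<in> T}"
    using openin_continuous_map_preimage[OF D(7), of T] assms(2) by simp
  then have "openin X {x \<in> topspace (subtopology X U). \<phi> x \<in> T}"
    using D(1) openin_trans_full by blast
  moreover have "{x \<in> topspace (subtopology X U). \<phi> x \<in> T} = {x \<in> U. \<phi> x \<in> T}" using D(2) by auto
  ultimately show ?thesis by simp
qed

lemma smooth_on_vimage_open:
  assumes "smooth_on UNIV S f" "open S" "open T"
  shows "open {x \<in> S. f x \<in> T}"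
  using continuous_open_preimage[OF smooth_on_continuous[OF assms(1)] assms(2,3)]
  by (simp add: vimage_def Int_def)

lemma chart_coord_open:
  assumes "topological_chart X c" "smooth_on UNIV (chart_dom c) (\<lambda>y. f (chart_param c y))" "open T"
  shows "openin X {x \<in> fst c. f x \<in> T}"
proof -
  obtain U V \<phi> where c: "c = (U, V, \<phi>)" by (cases c)
  note tc = assms(1)[unfolded c]
  have "open {y \<in> chart_dom c. f (chart_param c y) \<in> T}"
    by (rule smooth_on_vimage_open[OF assms(2) chart_dom_open[OF assms(1)] assms(3)])
  from topological_chart_vimage_openin[OF tc this]
  have "openin X {x \<in> U. \<phi> x \<in> {y \<in> chart_dom c. f (chart_param c y) \<in> T}}" .
  also have "{x \<in> U. \<phi> x \<in> {y \<in> chart_dom c. f (chart_param c y) \<in> T}} = {x \<in> fst c. f x \<in> T}"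
    using chart_dom_chart_param(1,2)[OF tc] by (auto simp: c)
  finally show ?thesis .
qed

lemma smooth_map_flatI:
  fixes f :: "'a \<Rightarrow> 'b::euclidean_space" and N :: "('a, 'e::euclidean_space) manifold"
  assumes N: "charted N" and S: "S \<subseteq> V" and f: "\<And>x. x \<in> topspace (topo N) \<Longrightarrow> f x \<in> S"
    and sm: "\<And>c. c \<in> atlas N \<Longrightarrow> smooth_on UNIV (chart_dom c) (\<lambda>y. f (chart_param c y))"
  shows "smooth_map N (flat_manifold V S) f"
proof -
  have tc: "topological_chart (topo N) c" if "c \<in> atlas N" for c using N that by (auto simp: charted_def)
  have "continuous_map (topo N) euclidean f"
    unfolding continuous_map_def
  proof (intro conjI allI impI)
    fix T :: "'b set" assume T: "openin euclidean T"
    have "topspace (topo N) = (\<Union>c\<in>atlas N. fst c)" using N by (simp add: charted_def split_beta)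
    then have "{x \<in> topspace (topo N). f x \<in> T} = (\<Union>c\<in>atlas N. {x \<in> fst c. f x \<in> T})" by blast
    moreover have "openin (topo N) {x \<in> fst c. f x \<in> T}" if "c \<in> atlas N" for c
      by (rule chart_coord_open[OF tc[OF that] sm[OF that]]) (use T in simp)
    ultimately show "openin (topo N) {x \<in> topspace (topo N). f x \<in> T}" by auto
  qed simp
  then have "continuous_map (topo N) (top_of_set S) f" using f by (auto simp: continuous_map_in_subtopology)
  moreover have "smooth_on V' (\<phi> ` {x \<in> U. f x \<in> S}) (id \<circ> f \<circ> inv_into U \<phi>)" if c: "(U, V', \<phi>) \<in> atlas N" for U V' \<phi>
  proof -
    note tcD = topological_chartD[OF tc[OF c]]
    have "{x \<in> U. f x \<in> S} = U" using tcD(2) f by auto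
    then show ?thesis
      using sm[OF c] smooth_on_lproj[OF tcD(3,6), of "\<lambda>y. f (inv_into U \<phi> y)"]
      by (simp add: chart_dom_def chart_param_def comp_def)
  qed
  ultimately show ?thesis by (auto simp: smooth_map_def flat_manifold_def)
qed

lemma smooth_map_flat_plot:
  assumes "charted N" "openin (top_of_set V) S" "subspace V" "smooth_map N (flat_manifold V S) f" "plot N D c"
  shows "smooth_on UNIV D (\<lambda>z. f (c z))"
  by (rule plot_flatD[OF plot_smooth_map[OF assms(1) charted_flat[OF assms(2,3)] assms(4,5)]])

lemma topological_chart_submanifold:
  assumes tc: "topological_chart X (U, V, \<phi>)" and P: "openin X P"
  shows "topological_chart (subtopology X P) (U \<inter> P, V, \<phi>)"
proof -
  note tcD = topological_chartD[OF tc]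
  have oi: "openin X (U \<inter> P)" using tcD(1) P by blast
  have "openin (subtopology X P) (U \<inter> P)" using oi tcD(1) by (auto simp: openin_subtopology)
  moreover have "openin (top_of_set V) (\<phi> ` (U \<inter> P))"
    by (rule topological_chart_openin_image[OF tc oi]) blast
  moreover have "homeomorphic_map (subtopology (subtopology X U) (U \<inter> P)) (subtopology (top_of_set (\<phi> ` U)) (\<phi> ` (U \<inter> P))) \<phi>"
    by (rule homeomorphic_map_subtopologies) (use tc tcD(2) in auto)
  then have "homeomorphic_map (subtopology (subtopology X P) (U \<inter> P)) (top_of_set (\<phi> ` (U \<inter> P))) \<phi>"
  proof -
    have "U \<inter> (U \<inter> P) = U \<inter> P" "P \<inter> (U \<inter> P) = U \<inter> P" "\<phi> ` U \<inter> \<phi> ` (U \<inter> P) = \<phi> ` (U \<inter> P)" by auto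
    with \<open>homeomorphic_map (subtopology (subtopology X U) (U \<inter> P)) _ \<phi>\<close> show ?thesis
      by (simp only: subtopology_subtopology)
  qed
  ultimately show ?thesis using tcD(3) by simp
qed

lemma charted_open_submanifold:
  assumes N: "charted N" and P: "openin (topo N) P"
  shows "charted (open_submanifold N P)" "topspace (topo (open_submanifold N P)) = P"
proof -
  have PT: "P \<subseteq> topspace (topo N)" using openin_subset[OF P] .
  then show t: "topspace (topo (open_submanifold N P)) = P" by (auto simp: open_submanifold_def)
  have "topological_chart (subtopology (topo N) P) (U \<inter> P, V, \<phi>)" if "(U, V, \<phi>) \<in> atlas N" for U V \<phi>
    by (rule topological_chart_submanifold[OF chartedD[OF N that] P])
  moreover have "(\<Union>(U, V, \<phi>)\<in>atlas (open_submanifold N P). U) = P"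
  proof
    show "P \<subseteq> (\<Union>(U, V, \<phi>)\<in>atlas (open_submanifold N P). U)"
    proof
      fix x assume x: "x \<in> P"
      then have "x \<in> topspace (topo N)" using PT by blast
      then obtain U V \<phi> where "(U, V, \<phi>) \<in> atlas N" "x \<in> U" by (rule charted_obtain[OF N])
      then have "(U \<inter> P, V, \<phi>) \<in> atlas (open_submanifold N P)" "x \<in> U \<inter> P" using x by (auto simp: open_submanifold_def)
      then show "x \<in> (\<Union>(U, V, \<phi>)\<in>atlas (open_submanifold N P). U)" by blast
    qed
  qed (auto simp: open_submanifold_def)
  ultimately show "charted (open_submanifold N P)" unfolding charted_def t by (auto simp: open_submanifold_def)
qed

lemma plot_open_submanifold:
  assumes "plot N S c" "\<And>z. z \<in> S \<Longrightarrow> c z \<in> P"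
  shows "plot (open_submanifold N P) S c"
proof -
  have "{x \<in> S. c x \<in> U \<inter> P} = {x \<in> S. c x \<in> U}" for U using assms(2) by auto
  then show ?thesis using assms plot_coord[OF assms(1)]
    by (auto simp: plot_def open_submanifold_def continuous_map_in_subtopology)
qed

lemma plot_submanifold_chart_param:
  assumes N: "smooth_manifold N" and P: "openin (topo N) P" and c: "c \<in> atlas (open_submanifold N P)"
  shows "plot N (chart_dom c) (chart_param c)" "y \<in> chart_dom c \<Longrightarrow> chart_param c y \<in> P"
proof -
  obtain U V \<phi> where cU: "c = (U \<inter> P, V, \<phi>)" "(U, V, \<phi>) \<in> atlas N" using c by (auto simp: open_submanifold_def)
  note Nc = smooth_manifold_charted[OF N]
  have tc: "topological_chart (topo N) (U, V, \<phi>)" by (rule chartedD[OF Nc cU(2)])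
  have tc': "topological_chart (subtopology (topo N) P) (U \<inter> P, V, \<phi>)" by (rule topological_chart_submanifold[OF tc P])
  have e: "chart_param (U, V, \<phi>) y = chart_param c y" if y: "y \<in> chart_dom c" for y
  proof -
    have x: "chart_param c y \<in> U \<inter> P" "\<phi> (chart_param c y) = lproj V y"
      using chart_dom_chart_param(3,4)[OF tc'] y by (auto simp: cU(1))
    have "inv_into U \<phi> (lproj V y) = chart_param c y"
      unfolding x(2)[symmetric] by (rule inv_into_f_f[OF topological_chartD(5)[OF tc]]) (use x(1) in blast)
    then show ?thesis by (simp add: chart_param_def[of "(U, V, \<phi>)"])
  qed
  have "chart_dom c \<subseteq> chart_dom (U, V, \<phi>)" by (auto simp: chart_dom_def cU(1))
  then have "plot N (chart_dom c) (chart_param (U, V, \<phi>))"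
    using plot_subset[OF plot_chart_param[OF N cU(2)] _ _ Nc] chart_dom_open[OF tc'] cU(1) by blast
  then show "plot N (chart_dom c) (chart_param c)" by (rule plot_cong[OF _ e Nc])
  show "y \<in> chart_dom c \<Longrightarrow> chart_param c y \<in> P" using chart_dom_chart_param(3)[OF tc'] by (auto simp: cU(1))
qed

lemma differential_flat_image:
  assumes N: "charted N" and x: "x \<in> topspace (topo N)" and fx: "f x \<in> S"
  shows "differential N (flat_manifold V S) f x ` tangent_space N x =
    range (\<lambda>v. dir_deriv v (\<lambda>y. f (chart_param (chart_at N x) y)) (coord_at N x x))"
proof -
  obtain U V' \<phi> where c: "chart_at N x = (U, V', \<phi>)" by (cases "chart_at N x")
  note ca = chart_at[OF N x, unfolded c]
  note tc = chartedD[OF N ca(1)]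
  note tcD = topological_chartD[OF tc]
  have px: "lproj V' (\<phi> x) = \<phi> x" using chart_dom_chart_param(5)[OF tc] ca by auto
  have d: "dir_deriv v (\<lambda>y. f (chart_param (U, V', \<phi>) y)) (\<phi> x) = dir_deriv (lproj V' v) (\<lambda>y. f (inv_into U \<phi> y)) (\<phi> x)" for v
    using dir_deriv_chart_param[OF tc, of v f "\<phi> x"] px by simp
  have r: "range (\<lambda>v. g (lproj V' v)) = g ` V'" for g :: "'b \<Rightarrow> 'c"
  proof (intro equalityI subsetI)
    fix y assume "y \<in> g ` V'"
    then obtain v where "v \<in> V'" "y = g v" by blast
    then have "y = g (lproj V' v)" using lproj(3)[OF tcD(3)] by simp
    then show "y \<in> range (\<lambda>v. g (lproj V' v))" by blast
  qed (use lproj(2)[OF tcD(3)] in blast)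
  show ?thesis
    using c fx r[of "\<lambda>v. dir_deriv v (\<lambda>y. f (inv_into U \<phi> y)) (\<phi> x)"] by (simp add: d differential_def tangent_space_def param_at_def comp_def coord_at_def chart_at_flat)
qed

text \<open>Surjectivity of the differential may be tested on plots through \<open>x\<close>.
  Conversely derivatives lie in \<open>V\<close> because the values of \<open>f\<close> do: the
  projection onto \<open>V\<close> leaves \<open>f\<close>, hence its derivatives,
  unchanged.\<close>

lemma smooth_submersion_flatI:
  assumes N: "charted N" and S: "S \<subseteq> V" "openin (top_of_set V) S" "subspace V" and f: "smooth_map N (flat_manifold V S) f"
    and sur: "\<And>x v. x \<in> topspace (topo N) \<Longrightarrow> v \<in> V \<Longrightarrow>
      \<exists>D q t w. plot N D (q :: 'z::euclidean_space \<Rightarrow> 'a) \<and> t \<in> D \<and> q t = x \<and> dir_deriv w (\<lambda>t. f (q t)) t = v"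
  shows "smooth_submersion N (flat_manifold V S) f"
  unfolding smooth_submersion_def
proof (intro conjI f ballI)
  fix x assume x: "x \<in> topspace (topo N)"
  have fS: "f y \<in> S" if "y \<in> topspace (topo N)" for y
    using f that by (auto simp: smooth_map_def flat_manifold_def continuous_map_def)
  obtain U V' \<phi> where c: "chart_at N x = (U, V', \<phi>)" by (cases "chart_at N x")
  note ca = chart_at[OF N x, unfolded c]
  note tc = chartedD[OF N ca(1)]
  have px: "\<phi> x \<in> chart_dom (U, V', \<phi>)" using chart_dom_chart_param(1)[OF tc] ca by auto
  have cop: "open (chart_dom (U, V', \<phi>))" by (rule chart_dom_open[OF tc])
  define g where "g y = f (chart_param (U, V', \<phi>) y)" for y
  have gs: "smooth_on UNIV (chart_dom (U, V', \<phi>)) g"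
  proof -
    have "smooth_on V' (\<phi> ` {x \<in> U. f x \<in> S}) (id \<circ> f \<circ> inv_into U \<phi>)"
      using f ca(1) by (auto simp: smooth_map_def flat_manifold_def)
    moreover have "{x \<in> U. f x \<in> S} = U" using topological_chartD(2)[OF tc] fS by auto
    ultimately show ?thesis
      using smooth_on_lproj[OF topological_chartD(3,6)[OF tc], of "\<lambda>y. f (inv_into U \<phi> y)"]
      by (simp add: chart_dom_def chart_param_def comp_def g_def[abs_def])
  qed
  have "range (\<lambda>v. dir_deriv v g (\<phi> x)) = V"
  proof (intro equalityI subsetI)
    fix z assume "z \<in> range (\<lambda>v. dir_deriv v g (\<phi> x))"
    then obtain v where v: "z = dir_deriv v g (\<phi> x)" by blast
    have bl: "bounded_linear (lproj V)" using lproj(1)[OF S(3)] by (simp add: linear_conv_bounded_linear)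
    have "lproj V z = dir_deriv v (\<lambda>y. lproj V (g y)) (\<phi> x)"
      unfolding v using dir_deriv_chain[OF bounded_linear_imp_has_derivative[OF bl] smooth_on_has_derivative[OF gs cop px]] by simp
    also have "\<dots> = z" unfolding v
    proof (rule dir_deriv_cong(1)[OF cop px])
      fix y assume "y \<in> chart_dom (U, V', \<phi>)"
      then have "g y \<in> V" unfolding g_def using chart_dom_chart_param(3)[OF tc] topological_chartD(2)[OF tc] fS S(1) by blast
      then show "lproj V (g y) = g y" by (rule lproj(3)[OF S(3)])
    qed
    finally show "z \<in> V" using lproj(2)[OF S(3), of z] by simp
  next
    fix z assume z: "z \<in> V"
    obtain D and q :: "'z \<Rightarrow> 'a" and t w where q: "plot N D q" "t \<in> D" "q t = x" "dir_deriv w (\<lambda>t. f (q t)) t = z"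
      using sur[OF x z] by blast
    define D' where "D' = {t \<in> D. q t \<in> U}"
    have oD: "open D'" unfolding D'_def by (rule plot_vimage_open[OF q(1) topological_chartD(1)[OF tc]])
    have tD: "t \<in> D'" using q ca by (simp add: D'_def)
    have sq: "smooth_on UNIV D' (\<lambda>t. \<phi> (q t))" unfolding D'_def by (rule plot_coord[OF q(1) ca(1)])
    have "z = dir_deriv w (\<lambda>t. g (\<phi> (q t))) t"
      unfolding q(4)[symmetric]
      by (rule dir_deriv_cong(1)[OF oD tD]) (simp add: g_def D'_def chart_dom_chart_param(2)[OF tc])
    also have "\<dots> = dir_deriv (dir_deriv w (\<lambda>t. \<phi> (q t)) t) g (\<phi> (q t))"
      by (rule dir_deriv_compose[OF gs sq oD cop tD]) (use px q(3) in simp)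
    finally show "z \<in> range (\<lambda>v. dir_deriv v g (\<phi> x))" using q(3) by simp
  qed
  moreover have "tangent_space (flat_manifold V S) (f x) = V" using fS[OF x] by (simp add: tangent_space_def chart_at_flat)
  ultimately show "differential N (flat_manifold V S) f x ` tangent_space N x = tangent_space (flat_manifold V S) (f x)"
    unfolding differential_flat_image[where f=f and S=S, OF N x fS[OF x]] c by (simp add: g_def[abs_def] coord_at_def[of N] c)
qed

section \<open>A local section of the orbit map\<close>

lemma zero_derivative_line:
  fixes f :: "'a::euclidean_space \<Rightarrow> 'b::real_normed_vector"
  assumes f: "smooth_on UNIV S f" "open S" and seg: "\<And>s. s \<in> {0..1} \<Longrightarrow> a + s *\<^sub>R x \<in> S"
    and z: "\<And>y. y \<in> S \<Longrightarrow> dir_deriv x f y = 0"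
  shows "f (a + x) = f a"
proof -
  have "norm (f (a + 1 *\<^sub>R x) - f (a + 0 *\<^sub>R x) - 1 *\<^sub>R 0) \<le> \<bar>1\<bar> * 0"
  proof (rule line_bound[where \<phi>="\<lambda>s. f (a + s *\<^sub>R x)" and \<phi>'="\<lambda>_. 0"])
    fix s :: real assume "s \<in> closed_segment 0 1"
    then have s: "a + s *\<^sub>R x \<in> S" using seg by (simp add: closed_segment_eq_real_ivl)
    have "((\<lambda>s. a + s *\<^sub>R x) has_vector_derivative x) (at s)" by (auto intro!: derivative_eq_intros)
    from has_vector_derivative_compose_smooth[OF f s this]
    show "((\<lambda>s. f (a + s *\<^sub>R x)) has_vector_derivative 0) (at s)" using z[OF s] by simp
  qed simp
  then show ?thesis by simp
qed

context lie_action begin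

definition fo :: "'k \<Rightarrow> 'e" where "fo z = phiM (act (psi z) m)"
definition fdom :: "'k set" where "fdom = {z\<in>dom. act (psi z) m \<in> UM}"
text \<open>The position of \<open>act u m\<close> along the orbit: \<open>ppi\<close> discards the
  transversal component of the chart.\<close>

definition tcoord :: "'a \<Rightarrow> 'e" where "tcoord u = ppi (phiM (act u m) - pM)"

lemma fo: "open fdom" "smooth_on UNIV fdom fo" "z1 \<in> fdom" "fo z1 = pM" "dir_deriv x fo z1 = dpi x"
  using orbit_smooth z1 act_one[OF m] by (auto simp: fdom_def fo_def[abs_def] dpi_def pM_def)

text \<open>Homogeneity of the orbit map: near \<open>z\<close> it is the orbit map near
  \<open>\<one>\<close> followed by the translation by \<open>psi z\<close>, so its derivatives at
  \<open>z\<close> are images of vectors of \<open>TO\<close> under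
  \<open>rho (psi z)\<close>.\<close>

lemma fo_deriv_range:
  assumes z: "z \<in> fdom"
  shows "\<exists>t\<in>TO. dir_deriv v fo z = rho (psi z) t"
proof -
  have zd: "z \<in> dom" "act (psi z) m \<in> UM" using z by (auto simp: fdom_def)
  define u where "u = psi z"
  have u: "u \<in> carrier G" "act u m \<in> UM" using zd phi_psi(3) by (auto simp: u_def)
  have pc: "plot GM dom (\<lambda>z'. inv u \<otimes> psi z')" using translate_plot(1)[OF psi_plot] u by simp
  define c where "c z' = act (inv u \<otimes> psi z') m" for z'
  have cz: "c z = m" using u act_one[OF m] by (simp add: c_def u_def[symmetric])
  have p: "plot M dom c" unfolding c_def by (rule orbit_plot[OF pc])
  let ?S = "{z\<in>dom. c z \<in> UM}"
  note pp = phiM_plot[OF p]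
  have zS: "z \<in> ?S" using zd cz chart_m_atlas by simp
  have ad: "open (adom u)" "smooth_on UNIV (adom u) (afun u)" "pM \<in> adom u"
    using adom_open afun_smooth pM_adom(1) u by auto
  have "dir_deriv v fo z = dir_deriv v (\<lambda>z'. afun u (phiM (c z'))) z"
  proof (rule dir_deriv_cong(1)[OF pp(1) zS])
    fix z' assume z': "z' \<in> ?S"
    then have "act u (c z') = act (psi z') m" unfolding c_def
      using u phi_psi(3) m by (simp add: act_mult act_closed act_inv)
    then show "fo z' = afun u (phiM (c z'))" using z' psiM_phiM by (simp add: fo_def afun_def)
  qed
  also have "\<dots> = rho u (dir_deriv v (\<lambda>z'. phiM (c z')) z)"
    using dir_deriv_compose[OF ad(2) pp(2,1) ad(1) zS] ad(3) cz by (simp add: rho_def pM_def)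
  also have "dir_deriv v (\<lambda>z'. phiM (c z')) z = dpi (dir_deriv v (\<lambda>z'. phi (inv u \<otimes> psi z')) z)"
    unfolding c_def by (rule dpi_plot[OF pc zd(1)]) (use u in \<open>simp add: u_def\<close>)
  finally show ?thesis unfolding u_def[symmetric] TO_def by blast
qed

text \<open>Derivatives of \<open>fo\<close> are images of vectors of \<open>TO\<close> under
  \<open>rho (psi z)\<close>. Near \<open>z1\<close> this map is so close to the identity on
  \<open>TO\<close> that \<open>ppi\<close> is still injective on its image. So wherever the
  \<open>TO\<close>-component is stationary, all of \<open>fo\<close> is: this is the constant
  rank.\<close>

lemma rank_constant_near:
  obtains S where "open S" "z1 \<in> S" "S \<subseteq> fdom" "\<And>z v. z \<in> S \<Longrightarrow> ppi (dir_deriv v fo z) = 0 \<Longrightarrow> dir_deriv v fo z = 0"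
proof -
  \<comment> \<open>Bounds the norm of the difference between \<open>ppi\<close> after
    \<open>rho (psi z)\<close> and \<open>ppi\<close>. Where it is below 1, \<open>ppi t = t\<close>
    and \<open>ppi (rho (psi z) t) = 0\<close> force \<open>t = 0\<close>.\<close>
  define q where "q z = (\<Sum>b\<in>Basis. norm (ppi (rho (psi z) b) - ppi b))" for z
  have sm: "smooth_on UNIV fdom (\<lambda>z. rho (psi z) b)" for b
    by (rule rho_smooth[OF psi_plot fo(1)]) (auto simp: fdom_def)
  have "continuous_on fdom q"
    unfolding q_def
    by (intro continuous_intros smooth_on_continuous[OF smooth_on_linear_compose[OF ppi_linear sm fo(1)]])
  then have o: "open (fdom \<inter> q -` {..<1})" by (rule continuous_open_preimage[OF _ fo(1)]) simp
  have q1: "q z1 = 0" by (simp add: q_def z1 rho_one ppi_lproj)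
  have "dir_deriv v fo z = 0" if z: "z \<in> fdom" "q z < 1" and 0: "ppi (dir_deriv v fo z) = 0" for z v
  proof -
    obtain t where t: "t \<in> TO" "dir_deriv v fo z = rho (psi z) t" using fo_deriv_range[OF z(1)] by blast
    have g: "psi z \<in> carrier G" "act (psi z) m \<in> UM" using z(1) phi_psi(3) by (auto simp: fdom_def)
    have "ppi t = (\<Sum>b\<in>Basis. (t \<bullet> b) *\<^sub>R ppi b)"
      by (subst euclidean_representation[symmetric, of t]) (simp only: linear_sum[OF ppi_linear] linear_scale[OF ppi_linear])
    moreover have "ppi (rho (psi z) t) = (\<Sum>b\<in>Basis. (t \<bullet> b) *\<^sub>R ppi (rho (psi z) b))"
      by (subst rho_expand[OF g]) (simp only: linear_sum[OF ppi_linear] linear_scale[OF ppi_linear])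
    ultimately have "ppi (rho (psi z) t) - ppi t = (\<Sum>b\<in>Basis. (t \<bullet> b) *\<^sub>R (ppi (rho (psi z) b) - ppi b))"
      by (simp add: sum_subtractf algebra_simps)
    also have "norm \<dots> \<le> (\<Sum>b\<in>Basis. norm t * norm (ppi (rho (psi z) b) - ppi b))"
      by (rule sum_norm_le) (auto intro!: mult_right_mono Basis_le_norm)
    also have "\<dots> = q z * norm t" by (simp add: q_def sum_distrib_left mult.commute)
    finally have "norm t \<le> q z * norm t" using 0 t ppi_id[OF t(1)] by (simp add: norm_minus_commute)
    then have "t = 0" using z(2) by (metis mult_less_cancel_right2 not_less zero_less_norm_iff norm_ge_zero order_le_less)
    then show ?thesis using t(2) linear_0[OF bounded_linear.linear[OF rho_linear[OF g]]] by simp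
  qed
  then show ?thesis using that[OF o] fo(3) q1 by auto
qed

end

text \<open>A local lift of the orbit to the group: \<open>s\<close> depends on the
  \<open>TO\<close>-component only, and near \<open>\<one>\<close> the elements \<open>u\<close> and
  \<open>s (tcoord u)\<close> move \<open>m\<close> to the same point, that is, lie in the same
  coset of \<open>K\<close>. Both the slice theorem and the charts of \<open>G/K\<close> rest on
  it.\<close>

locale orbit_section = lie_action G GM M act m for G (structure) and GM :: "('a, 'k::euclidean_space) manifold"
    and M :: "('m, 'e::euclidean_space) manifold" and act m +
  fixes d :: real and s :: "'e \<Rightarrow> 'a" and Oe :: "'a set"
  assumes d: "d > 0" and s_plot: "plot GM (ball 0 d) s" and s0: "s 0 = \<one>" and s_ppi: "\<And>t. s (ppi t) = s t"
    and s_tcoord: "\<And>t. t \<in> ball 0 d \<Longrightarrow> act (s t) m \<in> UM \<and> tcoord (s t) = ppi t"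
    and Oe: "openin (topo GM) Oe" "\<one> \<in> Oe" "\<And>u. u \<in> Oe \<Longrightarrow> act u m \<in> UM \<and> tcoord u \<in> ball 0 d \<and> act u m = act (s (tcoord u)) m"

context lie_action begin

text \<open>A form of the constant rank theorem: near \<open>\<one>\<close> the orbit map \<open>u \<mapsto> u \<cdot> m\<close> depends only on \<open>tcoord u\<close>.\<close>

lemma local_section:
  obtains d s Oe where "orbit_section G GM M act m d s Oe"
proof -
  obtain S where S: "open S" "z1 \<in> S" "S \<subseteq> fdom" "\<And>z v. z \<in> S \<Longrightarrow> ppi (dir_deriv v fo z) = 0 \<Longrightarrow> dir_deriv v fo z = 0"
    using rank_constant_near by blast
  obtain \<alpha> where \<alpha>: "linear \<alpha>" "\<And>t. t \<in> TO \<Longrightarrow> dpi (\<alpha> t) = t"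
    using linear_exists_right_inverse_on[OF dpi_linear subspace_UNIV] unfolding TO_def by auto
  \<comment> \<open>A projection along the kernel of \<open>dpi\<close>, onto the image of
    \<open>TO\<close> under \<open>\<alpha>\<close>.\<close>
  define E where "E x = \<alpha> (dpi x)" for x
  have E: "linear E" unfolding E_def[abs_def] using linear_compose[OF dpi_linear \<alpha>(1)] by (simp add: comp_def)
  have dE: "dpi (E x) = dpi x" "E (\<alpha> t) = \<alpha> t" if "t \<in> TO" for x t
    using \<alpha>(2) that by (auto simp: E_def TO_def)
  have TO0: "0 \<in> TO" using subspace_0[OF subspace_TO] .
  have fsm: "smooth_on UNIV S fo" using fo(2) S(3) by (rule smooth_on_subset)
  \<comment> \<open>New coordinates near \<open>z1\<close>: the component in the image of
    \<open>E\<close> is replaced by the \<open>TO\<close>-component of \<open>fo\<close>, the rest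
    is kept. In them \<open>fo\<close> will vary only along the image of \<open>E\<close>.\<close>
  define C where "C z = \<alpha> (ppi (fo z - pM)) + (z - E (z - z1))" for z
  have C1: "C z1 = z1" by (simp add: C_def fo(4) linear_0[OF ppi_linear] linear_0[OF \<alpha>(1)] linear_0[OF E])
  have lin1: "linear (\<lambda>y. \<alpha> (ppi y))" using linear_compose[OF ppi_linear \<alpha>(1)] by (simp add: comp_def)
  have Csm: "smooth_on UNIV S C"
    unfolding C_def[abs_def]
    by (intro smooth_on_add smooth_on_diff smooth_on_id smooth_on_linear_compose[OF lin1] smooth_on_linear_compose[OF E] smooth_on_const fsm S(1))
  have Cd: "dir_deriv v C z1 = v" for v
  proof -
    have "(C has_derivative (\<lambda>v. \<alpha> (ppi (dpi v - 0)) + (v - E (v - 0)))) (at z1)"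
      unfolding C_def[abs_def]
    proof (intro has_derivative_add has_derivative_diff has_derivative_ident)
      have f: "((\<lambda>z. fo z - pM) has_derivative (\<lambda>v. dpi v - 0)) (at z1)"
        using has_derivative_diff[OF smooth_on_has_derivative[OF fo(2,1,3)] has_derivative_const[of pM]] by (simp add: fo(5))
      show "((\<lambda>z. \<alpha> (ppi (fo z - pM))) has_derivative (\<lambda>v. \<alpha> (ppi (dpi v - 0)))) (at z1)"
        using bounded_linear.has_derivative[of "\<lambda>y. \<alpha> (ppi y)", OF _ f] lin1 by (simp add: linear_conv_bounded_linear)
      show "((\<lambda>z. E (z - z1)) has_derivative (\<lambda>v. E (v - 0))) (at z1)"
        using bounded_linear.has_derivative[of E, OF _ has_derivative_diff[OF has_derivative_ident has_derivative_const]] E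
        by (simp add: linear_conv_bounded_linear)
    qed
    from has_derivative_dir_deriv[OF this] show ?thesis
      using ppi_id[of "dpi v"] by (simp add: E_def TO_def)
  qed
  obtain A B g where IF: "open A" "z1 \<in> A" "A \<subseteq> S" "open B" "homeomorphism A B C g" "smooth_on UNIV B g"
    using smooth_inverse_function[OF S(1,2) Csm] Cd by metis
  have gA: "g w \<in> A" "C (g w) = w" if "w \<in> B" for w using IF(5) that by (auto simp: homeomorphism_def)
  have CB: "C z \<in> B" "g (C z) = z" if "z \<in> A" for z using IF(5) that by (auto simp: homeomorphism_def)
  have EC: "E (C z - z1) = \<alpha> (ppi (fo z - pM))" for z
  proof -
    have "E (C z - z1) = E (\<alpha> (ppi (fo z - pM))) + (E (z - z1) - E (E (z - z1)))"
      unfolding C_def by (simp add: linear_add[OF E] linear_diff[OF E])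
    then show ?thesis using dE(2)[OF ppi_TO] dE(1)[OF TO0] by (simp add: E_def)
  qed
  have dC: "dpi (C z - z1) = ppi (fo z - pM)" for z
    using EC[of z] dE(1)[OF TO0, of "C z - z1"] \<alpha>(2)[OF ppi_TO] by metis
  have z1B: "z1 \<in> B" using CB(1)[OF IF(2)] C1 by simp
  then obtain \<eta> where \<eta>: "\<eta> > 0" "ball z1 \<eta> \<subseteq> B" using IF(4) open_contains_ball by blast
  define ft where "ft w = fo (g w)" for w
  have ftsm: "smooth_on UNIV B ft" unfolding ft_def[abs_def]
    by (rule smooth_on_compose[OF fsm IF(6,4) S(1)]) (use gA IF(3) in auto)
  \<comment> \<open>Along the kernel of \<open>dpi\<close> the \<open>TO\<close>-component of
    \<open>ft\<close> is stationary by construction of \<open>C\<close>, so by constancy of the rank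
    all of \<open>ft\<close> is stationary.\<close>
  have ft0: "dir_deriv x ft w = 0" if x: "dpi x = 0" and w: "w \<in> B" for x w
  proof -
    have gw: "g w \<in> S" using gA(1)[OF w] IF(3) by blast
    have e: "dir_deriv x ft w = dir_deriv (dir_deriv x g w) fo (g w)"
      unfolding ft_def[abs_def] by (rule dir_deriv_compose[OF fsm IF(6,4) S(1) w gw])
    have ppb: "bounded_linear ppi" using ppi_linear by (simp add: linear_conv_bounded_linear)
    have dpb: "bounded_linear dpi" using dpi_linear by (simp add: linear_conv_bounded_linear)
    have 1: "((\<lambda>w. ppi (ft w - pM)) has_derivative (\<lambda>v. ppi (dir_deriv v ft w - 0))) (at w)"
      by (rule bounded_linear.has_derivative[OF ppb has_derivative_diff[OF smooth_on_has_derivative[OF ftsm IF(4) w] has_derivative_const]])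
    have 2: "((\<lambda>w. dpi (w - z1)) has_derivative (\<lambda>v. dpi (v - 0))) (at w)"
      by (rule bounded_linear.has_derivative[OF dpb has_derivative_diff[OF has_derivative_ident has_derivative_const]])
    have "ppi (dir_deriv x ft w) = dir_deriv x (\<lambda>w. ppi (ft w - pM)) w"
      using has_derivative_dir_deriv[OF 1, of x] by simp
    also have "\<dots> = dir_deriv x (\<lambda>w. dpi (w - z1)) w"
      by (rule dir_deriv_cong(1)[OF IF(4) w]) (use dC gA in \<open>metis ft_def\<close>)
    also have "\<dots> = 0" using has_derivative_dir_deriv[OF 2, of x] x by simp
    finally show ?thesis using S(4)[OF gw] e by simp
  qed
  obtain KE where KE: "KE > 0" "\<And>x. norm (E x) \<le> norm x * KE"
    using bounded_linear.pos_bounded[of E] E by (auto simp: linear_conv_bounded_linear)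
  \<comment> \<open>Small enough that the segment from \<open>w\<close> to its projection stays in
    the ball where \<open>g\<close> is defined.\<close>
  define \<eta>' where "\<eta>' = min \<eta> (\<eta> / KE)"
  have \<eta>': "\<eta>' > 0" using \<eta> KE by (simp add: \<eta>'_def)
  have ftE: "ft w = ft (z1 + E (w - z1))" if w: "w \<in> ball z1 \<eta>'" for w
  proof -
    define a where "a = z1 + E (w - z1)" define x where "x = w - a"
    have "norm (E (w - z1)) < \<eta>"
    proof -
      have "norm (w - z1) < \<eta> / KE" using w by (simp add: \<eta>'_def dist_norm norm_minus_commute)
      then have "norm (w - z1) * KE < \<eta>" using KE(1) by (simp add: pos_less_divide_eq)
      then show ?thesis using KE(2)[of "w - z1"] by linarith
    qed
    then have ab: "a \<in> ball z1 \<eta>" "w \<in> ball z1 \<eta>" using w by (auto simp: a_def dist_norm \<eta>'_def)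
    have "dpi x = 0"
      using dE(1)[OF TO0, of "w - z1"] by (simp add: x_def a_def linear_diff[OF dpi_linear] linear_add[OF dpi_linear])
    have "ft (a + x) = ft a"
    proof (rule zero_derivative_line[OF ftsm IF(4)])
      fix s :: real assume s: "s \<in> {0..1}"
      have "a + s *\<^sub>R x = (1 - s) *\<^sub>R a + s *\<^sub>R w" by (simp add: x_def algebra_simps)
      also have "\<dots> \<in> ball z1 \<eta>" using convex_ball[of z1 \<eta>] ab s unfolding convex_alt by auto
      finally show "a + s *\<^sub>R x \<in> B" using \<eta>(2) by blast
    qed (use ft0 \<open>dpi x = 0\<close> in blast)
    then show ?thesis by (simp add: x_def a_def)
  qed
  have "continuous_on UNIV (\<lambda>t. z1 + \<alpha> (ppi t))"
    using lin1 by (intro continuous_intros) (simp add: linear_continuous_on linear_conv_bounded_linear)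
  then have "open ((\<lambda>t. z1 + \<alpha> (ppi t)) -` ball z1 \<eta>)" by (intro open_vimage) auto
  moreover have "0 \<in> (\<lambda>t. z1 + \<alpha> (ppi t)) -` ball z1 \<eta>" using \<eta> linear_0[OF lin1] by simp
  ultimately obtain d where d: "d > 0" "ball 0 d \<subseteq> (\<lambda>t. z1 + \<alpha> (ppi t)) -` ball z1 \<eta>"
    using open_contains_ball by blast
  define s where "s t = psi (g (z1 + \<alpha> (ppi t)))" for t
  have inB: "z1 + \<alpha> (ppi t) \<in> B" if "t \<in> ball 0 d" for t using d(2) \<eta>(2) that by auto
  have gd: "g w \<in> dom" "g w \<in> fdom" if "w \<in> B" for w using gA(1)[OF that] IF(3) S(3) by (auto simp: fdom_def)
  have sp: "plot GM (ball 0 d) s"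
    unfolding s_def
  proof (rule plot_compose[OF psi_plot _ open_ball _ GM(2)])
    show "smooth_on UNIV (ball 0 d) (\<lambda>t. g (z1 + \<alpha> (ppi t)))"
      by (rule smooth_on_compose[OF IF(6) smooth_on_add[OF smooth_on_const smooth_on_linear[OF lin1]] _ IF(4) inB]) auto
    show "g (z1 + \<alpha> (ppi t)) \<in> dom" if "t \<in> ball 0 d" for t using gd inB[OF that] by blast
  qed
  have g1: "g z1 = z1" using CB(2)[OF IF(2)] C1 by simp
  have s0: "s 0 = \<one>" by (simp add: s_def linear_0[OF lin1] g1 z1)
  have spp: "s (ppi t) = s t" for t by (simp add: s_def ppi_id[OF ppi_TO])
  have st: "act (s t) m \<in> UM \<and> tcoord (s t) = ppi t" if t: "t \<in> ball 0 d" for t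
  proof
    let ?w = "z1 + \<alpha> (ppi t)"
    have "g ?w \<in> fdom" using gd inB[OF t] by blast
    then show "act (s t) m \<in> UM" by (simp add: s_def fdom_def)
    have "tcoord (s t) = ppi (fo (g ?w) - pM)" by (simp add: tcoord_def s_def fo_def)
    also have "\<dots> = dpi (C (g ?w) - z1)" using dC by simp
    also have "\<dots> = ppi t" using gA(2)[OF inB[OF t]] \<alpha>(2)[OF ppi_TO] by simp
    finally show "tcoord (s t) = ppi t" .
  qed
  define A' where "A' = {z\<in>{z\<in>A. C z \<in> ball z1 \<eta>'}. ppi (fo z - pM) \<in> ball 0 d}"
  have CA: "smooth_on UNIV A C" using Csm IF(3) by (rule smooth_on_subset)
  have oA: "open {z\<in>A. C z \<in> ball z1 \<eta>'}" by (rule smooth_on_vimage_open[OF CA IF(1)]) simp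
  have A'o: "open A'" unfolding A'_def
  proof (rule smooth_on_vimage_open[OF _ oA])
    show "smooth_on UNIV {z \<in> A. C z \<in> ball z1 \<eta>'} (\<lambda>z. ppi (fo z - pM))"
      by (rule smooth_on_linear_compose[OF ppi_linear smooth_on_diff[OF smooth_on_subset[OF fsm] smooth_on_const oA] oA]) (use IF(3) in auto)
  qed simp
  have A'1: "z1 \<in> A'" using IF(2) C1 \<eta>' d(1) fo(4) linear_0[OF ppi_linear] by (simp add: A'_def)
  define Oe where "Oe = {u \<in> U1. phi u \<in> A'}"
  have Oe: "openin (topo GM) Oe" unfolding Oe_def by (rule topological_chart_vimage_openin[OF chart_one_top A'o])
  have Oe1: "\<one> \<in> Oe" using A'1 chart_one_atlas(2) by (simp add: Oe_def z1_def)
  have Oep: "act u m \<in> UM \<and> tcoord u \<in> ball 0 d \<and> act u m = act (s (tcoord u)) m" if u: "u \<in> Oe" for u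
  proof -
    define z where "z = phi u"
    have z: "psi z = u" "z \<in> A'" using u psi_phi by (auto simp: Oe_def z_def)
    then have zA: "z \<in> A" "C z \<in> ball z1 \<eta>'" "ppi (fo z - pM) \<in> ball 0 d" by (auto simp: A'_def)
    have zf: "z \<in> fdom" using zA(1) IF(3) S(3) by blast
    have tu: "tcoord u = ppi (fo z - pM)" by (simp add: tcoord_def fo_def z(1))
    have 1: "act u m \<in> UM" using zf by (simp add: fdom_def z(1))
    have td: "tcoord u \<in> ball 0 d" using zA(3) tu by simp
    have pt: "ppi (tcoord u) = tcoord u" using ppi_id[OF ppi_TO] by (simp add: tcoord_def)
    have "fo z = ft (C z)" using CB(2)[OF zA(1)] by (simp add: ft_def)
    also have "\<dots> = ft (z1 + E (C z - z1))" by (rule ftE[OF zA(2)])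
    also have "\<dots> = fo (g (z1 + \<alpha> (ppi (tcoord u))))" by (simp only: EC ft_def tu[symmetric] pt)
    also have "\<dots> = phiM (act (s (tcoord u)) m)" by (simp add: s_def fo_def)
    finally have "phiM (act u m) = phiM (act (s (tcoord u)) m)" by (simp add: fo_def z(1))
    then have "act u m = act (s (tcoord u)) m" using psiM_phiM(1) 1 st[OF td] by metis
    then show ?thesis using 1 td by blast
  qed
  show ?thesis
    by (rule that, rule orbit_section.intro[OF lie_action_axioms orbit_section_axioms.intro]) (fact d sp s0 spp st Oe Oe1 Oep)+
qed

text \<open>The inverse of the equivariant chart \<open>Phi\<close>, which inherits its
  equivariance. Its restriction to the invariant complement of \<open>TO\<close> will parametrise
  the slice.\<close>

lemma slice_param:
  obtains e sg where "e > 0" "plot M (ball 0 e) sg" "sg 0 = m" "\<And>v. v \<in> ball 0 e \<Longrightarrow> sg v \<in> UM"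
    "\<And>v. dir_deriv v (\<lambda>w. phiM (sg w)) 0 = lproj VM v"
    "\<And>k v. k \<in> K \<Longrightarrow> v \<in> ball 0 e \<Longrightarrow> rho k v \<in> ball 0 e \<Longrightarrow> v \<in> VM \<Longrightarrow> act k (sg v) = sg (rho k v)"
proof -
  \<comment> \<open>\<open>Phi (psiM y)\<close> has values in \<open>VM\<close> and ignores the
    kernel of the projection; the second summand restores that kernel and makes the differential at
    \<open>pM\<close> the identity.\<close>
  define Ph where "Ph y = Phi (psiM y) + (y - lproj VM y)" for y
  have Phs: "smooth_on UNIV D1 Ph"
    unfolding Ph_def[abs_def]
    by (intro smooth_on_add Phi_smooth smooth_on_diff smooth_on_id smooth_on_linear[OF lprojM(1)] D1(1))
  have Phd: "dir_deriv v Ph pM = v" for v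
  proof -
    have "((\<lambda>y. Phi (psiM y)) has_derivative lproj VM) (at pM)"
      using smooth_on_has_derivative[OF Phi_smooth D1(1,2)] by (simp add: Phi_deriv)
    then have "(Ph has_derivative (\<lambda>v. lproj VM v + (v - lproj VM v))) (at pM)"
      unfolding Ph_def[abs_def]
      by (intro has_derivative_add has_derivative_diff has_derivative_ident bounded_linear_imp_has_derivative[OF lprojM(4)])
    from has_derivative_dir_deriv[OF this] show ?thesis by simp
  qed
  obtain A B g where IF: "open A" "pM \<in> A" "A \<subseteq> D1" "open B" "homeomorphism A B Ph g" "smooth_on UNIV B g"
    "\<And>y w. y \<in> B \<Longrightarrow> dir_deriv (dir_deriv w g y) Ph (g y) = w"
    using smooth_inverse_function[OF D1(1,2) Phs] Phd by metis
  have gA: "g w \<in> A" "Ph (g w) = w" if "w \<in> B" for w using IF(5) that by (auto simp: homeomorphism_def)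
  have PB: "Ph z \<in> B" "g (Ph z) = z" if "z \<in> A" for z using IF(5) that by (auto simp: homeomorphism_def)
  have Ph0: "Ph pM = 0" by (simp add: Ph_def pM Phi_m)
  have B0: "0 \<in> B" "g 0 = pM" using PB[OF IF(2)] Ph0 by auto
  define sg where "sg v = psiM (g v)" for v
  have gdom: "g w \<in> domM" "g w \<in> D1" if "w \<in> B" for w using gA(1)[OF that] IF(3) D1(3) by auto
  have sgp: "plot M B sg" unfolding sg_def
    by (rule plot_compose[OF psiM_plot IF(6,4) gdom(1) Mc])
  have Phi_sg: "Phi (sg v) = v" if "v \<in> B" "v \<in> VM" for v
  proof -
    have "sg v \<in> W0" using gdom(2)[OF that(1)] by (simp add: sg_def D1_def)
    then have "lproj VM (Phi (psiM (g v))) = Phi (psiM (g v))" using lproj_Phi by (simp add: sg_def)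
    moreover have "lproj VM v = lproj VM (Phi (psiM (g v))) + (lproj VM (g v) - lproj VM (lproj VM (g v)))"
      using gA(2)[OF that(1)] unfolding Ph_def by (metis linear_add[OF lprojM(1)] linear_diff[OF lprojM(1)])
    ultimately show ?thesis using lprojM(3)[OF that(2)] lprojM(5) by (simp add: sg_def)
  qed
  define X2 where "X2 = {x \<in> UM. phiM x \<in> A}"
  have X2: "openin (topo M) X2" unfolding X2_def by (rule topological_chart_vimage_openin[OF chart_m_top IF(1)])
  have X2p: "x \<in> W0" "sg (Phi x) = x" if "x \<in> X2" for x
  proof -
    have x: "psiM (phiM x) = x" "phiM x \<in> A" "lproj VM (phiM x) = phiM x" using that psiM_phiM by (auto simp: X2_def)
    then show "x \<in> W0" using IF(3) by (auto simp: D1_def)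
    show "sg (Phi x) = x" using PB(2)[OF x(2)] x by (simp add: Ph_def sg_def)
  qed
  \<comment> \<open>On \<open>X2\<close> the map \<open>sg\<close> inverts \<open>Phi\<close>. To
    pass from equivariance of \<open>Phi\<close> to that of \<open>sg\<close>, the translate by
    \<open>k\<close> must be in \<open>X2\<close> as well, so all translates are required to
    be.\<close>
  define X3 where "X3 = {x \<in> TM. \<forall>k\<in>K. act k x \<in> X2}"
  have X3: "openin (topo M) X3" unfolding X3_def by (rule openin_all_K[OF X2])
  have m3: "m \<in> X3" using K_m m chart_m_atlas(2) IF(2) by (auto simp: X3_def X2_def pM_def)
  have "open {v\<in>B. sg v \<in> X3}" by (rule plot_vimage_open[OF sgp X3])
  moreover have "0 \<in> {v\<in>B. sg v \<in> X3}" using B0 m3 pM(2) by (simp add: sg_def)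
  ultimately obtain e where e: "e > 0" "ball 0 e \<subseteq> {v\<in>B. sg v \<in> X3}" using open_contains_ball by blast
  have eB: "v \<in> B" "sg v \<in> X3" if "v \<in> ball 0 e" for v using e(2) that by auto
  show ?thesis
  proof (rule that[of e sg])
    show "e > 0" by (rule e(1))
    show "plot M (ball 0 e) sg" by (rule plot_subset[OF sgp open_ball _ Mc]) (use e(2) in blast)
    show "sg 0 = m" using B0 pM(2) by (simp add: sg_def)
    show "sg v \<in> UM" if "v \<in> ball 0 e" for v
      using gdom(1)[OF eB(1)[OF that]] phiM_psiM(2) by (simp add: sg_def)
    show "dir_deriv v (\<lambda>w. phiM (sg w)) 0 = lproj VM v" for v
    proof -
      have "dir_deriv v (\<lambda>w. phiM (sg w)) 0 = dir_deriv v (\<lambda>w. lproj VM (g w)) 0"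
        by (rule dir_deriv_cong(1)[OF IF(4) B0(1)]) (simp add: sg_def phiM_psiM gdom)
      also have "\<dots> = lproj VM (dir_deriv v g 0)"
        using dir_deriv_chain[OF bounded_linear_imp_has_derivative[OF lprojM(4)] smooth_on_has_derivative[OF IF(6,4) B0(1)]] .
      also have "dir_deriv v g 0 = v" using IF(7)[OF B0(1), of v] Phd by (simp add: B0(2))
      finally show ?thesis .
    qed
    fix k v assume k: "k \<in> K" and v: "v \<in> ball 0 e" "rho k v \<in> ball 0 e" "v \<in> VM"
    have x: "sg v \<in> X3" "Phi (sg v) = v" using eB[OF v(1)] Phi_sg v(3) by auto
    have 1: "\<one> \<in> K" using cg.K_one .
    have "act \<one> (sg v) = sg v" using x(1) act_one by (auto simp: X3_def)
    then have "sg v \<in> W0" "act k (sg v) \<in> X2" using x(1) k 1 X2p(1) by (auto simp: X3_def)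
    then show "act k (sg v) = sg (rho k v)"
      using X2p(2)[of "act k (sg v)"] Phi_equivariant[of "sg v" k] k x(2) by simp
  qed
qed

end

section \<open>Cosets of the isotropy group near a given coset\<close>

context orbit_section begin

abbreviation pK :: "'a \<Rightarrow> 'a set" where "pK a \<equiv> a <# K"

lemma mem_pK: "a \<in> carrier G \<Longrightarrow> b \<in> pK a \<longleftrightarrow> b \<in> carrier G \<and> inv a \<otimes> b \<in> K"
proof
  assume a: "a \<in> carrier G" and "b \<in> pK a"
  then obtain k where "k \<in> K" "b = a \<otimes> k" by (auto simp: l_coset_def)
  then show "b \<in> carrier G \<and> inv a \<otimes> b \<in> K" using a K_carrier by (simp add: m_assoc[symmetric])
next
  assume a: "a \<in> carrier G" and b: "b \<in> carrier G \<and> inv a \<otimes> b \<in> K"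
  then have "b = a \<otimes> (inv a \<otimes> b)" by (simp add: m_assoc[symmetric])
  then show "b \<in> pK a" using b by (auto simp: l_coset_def)
qed

lemma pK_eq_iff: "a \<in> carrier G \<Longrightarrow> b \<in> carrier G \<Longrightarrow> pK a = pK b \<longleftrightarrow> inv b \<otimes> a \<in> K"
  using mem_pK[of b a] mem_pK[of a a] l_repr_independence[of a b K] K_sub subgroup.one_closed[OF K_sub] by auto

lemma pK_K: "a \<in> carrier G \<Longrightarrow> k \<in> K \<Longrightarrow> pK (a \<otimes> k) = pK a"
  using pK_eq_iff[of "a \<otimes> k" a] K_carrier by (simp add: m_assoc[symmetric])

lemma pK_eqD: "a \<in> carrier G \<Longrightarrow> b \<in> carrier G \<Longrightarrow> pK a = pK b \<Longrightarrow> \<exists>k\<in>K. a = b \<otimes> k"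
  using pK_eq_iff[of a b] by (intro bexI[of _ "inv b \<otimes> a"]) (auto simp: m_assoc[symmetric])

lemma tcoord_K: "a \<in> carrier G \<Longrightarrow> k \<in> K \<Longrightarrow> tcoord (a \<otimes> k) = tcoord a"
  using m K_carrier K_m by (simp add: tcoord_def act_mult)

lemma tcoord_TO: "tcoord a \<in> TO"
  by (simp add: tcoord_def ppi_TO)

lemma tcoord_one: "tcoord \<one> = 0"
  using act_one[OF m] by (simp add: tcoord_def pM_def linear_0[OF ppi_linear])

lemma s_carrier: "t \<in> ball 0 d \<Longrightarrow> s t \<in> carrier G"
  using plot_in[OF s_plot] GM(3) by simp

lemma tcoord_s: "t \<in> ball 0 d \<Longrightarrow> t \<in> TO \<Longrightarrow> tcoord (s t) = t"
  using s_tcoord ppi_id by simp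

lemma tcoord_smooth:
  assumes "plot GM S q" "\<And>z. z \<in> S \<Longrightarrow> act (q z) m \<in> UM"
  shows "smooth_on UNIV S (\<lambda>z. tcoord (q z))"
proof -
  have "{z \<in> S. act (q z) m \<in> UM} = S" using assms(2) by auto
  then have "smooth_on UNIV S (\<lambda>z. phiM (act (q z) m))" using phiM_plot(2)[OF orbit_plot[OF assms(1)]] by simp
  then show ?thesis unfolding tcoord_def
    by (intro smooth_on_linear_compose[OF ppi_linear smooth_on_diff[OF _ smooth_on_const]] plot_open[OF assms(1)])
qed

text \<open>The factor \<open>k\<close> saturates the set: it is a union of cosets of
  \<open>K\<close>, so being open in \<open>G\<close> it has an open image in \<open>G/K\<close>,
  and \<open>tcoord (inv u \<otimes> a)\<close> depends on the coset of \<open>a\<close>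
  only.\<close>

definition NU :: "'a \<Rightarrow> 'e set \<Rightarrow> 'a set" where
  "NU u T = {a \<in> carrier G. \<exists>k\<in>K. inv u \<otimes> a \<otimes> k \<in> Oe \<and> tcoord (inv u \<otimes> a \<otimes> k) \<in> T}"

lemma NU_open:
  assumes u: "u \<in> carrier G" and T: "open T"
  shows "openin (topo GM) (NU u T)"
proof -
  have cl: "continuous_map (topo GM) (topo GM) (\<lambda>a. inv u \<otimes> a \<otimes> k)" if k: "k \<in> K" for k
  proof -
    have "continuous_map (topo GM) (prod_topology (topo GM) (topo GM)) (\<lambda>a. (inv u, a))"
      using u GM(3) by (simp add: continuous_map_pairwise comp_def)
    from continuous_map_compose[OF this mult_continuous]
    have "continuous_map (topo GM) (topo GM) (\<lambda>a. inv u \<otimes> a)" by (simp add: comp_def)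
    then have "continuous_map (topo GM) (prod_topology (topo GM) (topo GM)) (\<lambda>a. (inv u \<otimes> a, k))"
      using K_carrier[OF k] GM(3) by (simp add: continuous_map_pairwise comp_def)
    from continuous_map_compose[OF this mult_continuous] show ?thesis by (simp add: comp_def)
  qed
  have oc: "continuous_map (topo GM) (topo M) (\<lambda>a. act a m)"
  proof -
    have "continuous_map (topo GM) (prod_topology (topo GM) (topo M)) (\<lambda>a. (a, m))"
      using m by (simp add: continuous_map_pairwise comp_def)
    from continuous_map_compose[OF this act_continuous] show ?thesis by (simp add: comp_def)
  qed
  have oT: "open {y. ppi (y - pM) \<in> T}"
  proof -
    have "continuous_on UNIV (\<lambda>y. ppi (y - pM))"
      by (intro linear_continuous_on_compose[OF _ ppi_linear] continuous_intros)
    from open_vimage[OF T this] show ?thesis by (simp add: vimage_def)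
  qed
  define O1 where "O1 = {a \<in> Oe. tcoord a \<in> T}"
  have "O1 = Oe \<inter> {a \<in> topspace (topo GM). act a m \<in> {x \<in> UM. phiM x \<in> {y. ppi (y - pM) \<in> T}}}"
    using Oe(3) openin_subset[OF Oe(1)] by (auto simp: O1_def tcoord_def)
  then have o1: "openin (topo GM) O1"
    using openin_continuous_map_preimage[OF oc topological_chart_vimage_openin[OF chart_m_top oT]] Oe(1) by auto
  have "NU u T = (\<Union>k\<in>K. {a \<in> topspace (topo GM). inv u \<otimes> a \<otimes> k \<in> O1})"
    using GM(3) by (auto simp: NU_def O1_def)
  moreover have "openin (topo GM) {a \<in> topspace (topo GM). inv u \<otimes> a \<otimes> k \<in> O1}" if "k \<in> K" for k
    by (rule openin_continuous_map_preimage[OF cl[OF that] o1])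
  ultimately show ?thesis by auto
qed

lemma NU_D:
  assumes u: "u \<in> carrier G" and a: "a \<in> NU u T"
  shows "a \<in> carrier G" "act (inv u \<otimes> a) m \<in> UM" "tcoord (inv u \<otimes> a) \<in> T" "tcoord (inv u \<otimes> a) \<in> ball 0 d"
    "pK a = pK (u \<otimes> s (tcoord (inv u \<otimes> a)))"
proof -
  obtain k where k: "k \<in> K" "inv u \<otimes> a \<otimes> k \<in> Oe" "tcoord (inv u \<otimes> a \<otimes> k) \<in> T" using a by (auto simp: NU_def)
  show ac: "a \<in> carrier G" using a by (simp add: NU_def)
  have t: "tcoord (inv u \<otimes> a \<otimes> k) = tcoord (inv u \<otimes> a)" using tcoord_K[OF _ k(1)] u ac by simp
  have e: "act (inv u \<otimes> a \<otimes> k) m = act (inv u \<otimes> a) m" using m K_carrier[OF k(1)] K_m[OF k(1)] u ac by (simp add: act_mult)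
  define y where "y = tcoord (inv u \<otimes> a)"
  show "act (inv u \<otimes> a) m \<in> UM" "tcoord (inv u \<otimes> a) \<in> T" and yb: "tcoord (inv u \<otimes> a) \<in> ball 0 d"
    using Oe(3)[OF k(2)] k(3) t e by auto
  have ae: "act (inv u \<otimes> a) m = act (s y) m" using Oe(3)[OF k(2)] t e by (simp add: y_def)
  have sc: "s y \<in> carrier G" using s_carrier yb by (simp add: y_def)
  have "act (inv (u \<otimes> s y) \<otimes> a) m = act (inv (s y) \<otimes> (inv u \<otimes> a)) m"
    using u ac sc by (simp add: inv_mult_group m_assoc)
  also have "\<dots> = act (inv (s y)) (act (s y) m)" using m u ac sc ae by (simp add: act_mult)
  also have "\<dots> = m" by (rule act_inv(1)[OF m sc])
  finally have "inv (u \<otimes> s y) \<otimes> a \<in> K" using u ac sc by (simp add: K_iff)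
  then show "pK a = pK (u \<otimes> s (tcoord (inv u \<otimes> a)))" using pK_eq_iff[of a "u \<otimes> s y"] u ac sc by (simp add: y_def)
qed

lemma NU_sat:
  assumes u: "u \<in> carrier G" and a: "a \<in> NU u T" and x: "x \<in> carrier G" "pK x = pK a"
  shows "x \<in> NU u T"
proof -
  obtain k where k: "k \<in> K" "inv u \<otimes> a \<otimes> k \<in> Oe" "tcoord (inv u \<otimes> a \<otimes> k) \<in> T" "a \<in> carrier G" using a by (auto simp: NU_def)
  obtain k' where k': "k' \<in> K" "a = x \<otimes> k'" using pK_eqD[OF k(4) x(1)] x(2) by auto
  have "inv u \<otimes> a \<otimes> k = inv u \<otimes> x \<otimes> (k' \<otimes> k)" using u x(1) K_carrier[OF k(1)] K_carrier[OF k'(1)] by (simp add: k'(2) m_assoc)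
  moreover have "k' \<otimes> k \<in> K" using subgroup.m_closed[OF K_sub k'(1) k(1)] .
  ultimately show ?thesis using x(1) k by (auto simp: NU_def)
qed

lemma NU_self: "u \<in> carrier G \<Longrightarrow> 0 \<in> T \<Longrightarrow> u \<in> NU u T"
  using Oe(2) subgroup.one_closed[OF K_sub] tcoord_one by (auto simp: NU_def intro!: bexI[of _ \<one>])

end

context lie_action begin

section \<open>Slices\<close>

text \<open>The supremum over \<open>K\<close> is a norm on \<open>VM\<close> which the isotropy
  representation does not increase. Discs for it are therefore stable under \<open>K\<close>, which
  Euclidean balls need not be.\<close>

definition pn :: "'e \<Rightarrow> real" where "pn v = (SUP k\<in>K. norm (rho k v))"
definition nu :: "'e \<Rightarrow> 'e" where "nu v = lproj VM v - ppi v"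
definition disc :: "real \<Rightarrow> 'e set" where "disc r = {v. nu v = v \<and> pn v < r}"

lemma nu_linear: "linear nu"
  unfolding nu_def[abs_def] by (intro linear_compose_sub lprojM(1) ppi_linear)

lemma nu_props: "lproj VM (nu v) = nu v" "ppi (nu v) = 0" "nu (nu v) = nu v" "nu (lproj VM v) = nu v" "nu v \<in> VM"
proof -
  have pV: "lproj VM (ppi v) = ppi v" using ppi_TO TO_VM lprojM(3) by blast
  show 1: "lproj VM (nu v) = nu v" by (simp add: nu_def linear_diff[OF lprojM(1)] pV lprojM(5))
  show 2: "ppi (nu v) = 0" by (simp add: nu_def linear_diff[OF ppi_linear] ppi_lproj ppi_id[OF ppi_TO])
  show "nu (nu v) = nu v" unfolding nu_def[of "nu v"] by (simp add: 1 2)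
  show "nu (lproj VM v) = nu v" by (simp add: nu_def lprojM(5) ppi_lproj)
  show "nu v \<in> VM" using 1 lprojM(2) by metis
qed

lemma nu_fixed: "nu v = v \<longleftrightarrow> v \<in> VM \<and> ppi v = 0"
  using nu_props[of v] lprojM(3)[of v] by (auto simp: nu_def)

lemma rho_bound: "\<exists>C\<ge>0. \<forall>k\<in>K. \<forall>v. norm (rho k v) \<le> C * norm v"
proof -
  have "\<exists>B. \<forall>k\<in>K. norm (rho k b) \<le> B" for b
  proof -
    have "continuous_map KX euclidean (\<lambda>k. rho k b)"
    proof (rule continuous_K_plots)
      fix A and c :: "'k \<Rightarrow> 'a" and z assume c: "plot GM A c" "z \<in> A" "c z \<in> K"
      let ?T = "{z\<in>A. act (c z) m \<in> UM}"
      have T: "open ?T" "z \<in> ?T" using plot_vimage_open[OF orbit_plot[OF c(1)] UM_open] c K_m chart_m_atlas(2) by auto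
      show "\<exists>T. open T \<and> z \<in> T \<and> T \<subseteq> A \<and> smooth_on UNIV T (\<lambda>z. rho (c z) b)"
      proof (intro exI conjI)
        show "smooth_on UNIV ?T (\<lambda>z. rho (c z) b)" by (rule rho_smooth[OF c(1) T(1)]) auto
      qed (use T in auto)
    qed
    then have "continuous_map KX euclideanreal (\<lambda>k. norm (rho k b))" by (rule continuous_map_norm)
    from cg.continuous_bdd[OF this] show ?thesis unfolding cg.bdd_def by auto
  qed
  then have "\<forall>b. \<exists>B. \<forall>k\<in>K. norm (rho k b) \<le> B" by blast
  from choice[OF this] obtain B where B: "\<And>b k. k \<in> K \<Longrightarrow> norm (rho k b) \<le> B b" by blast
  define C where "C = (\<Sum>b\<in>(Basis::'e set). \<bar>B b\<bar>)"
  have "norm (rho k v) \<le> C * norm v" if k: "k \<in> K" for k v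
  proof -
    have g: "k \<in> carrier G" "act k m \<in> UM" using k K_carrier K_m chart_m_atlas(2) by auto
    have "norm (rho k v) = norm (\<Sum>b\<in>Basis. (v \<bullet> b) *\<^sub>R rho k b)" using rho_expand[OF g, of v] by (rule arg_cong)
    also have "\<dots> \<le> (\<Sum>b\<in>Basis. \<bar>B b\<bar> * norm v)"
    proof (rule sum_norm_le)
      fix b :: 'e assume b: "b \<in> Basis"
      have "norm (rho k b) \<le> \<bar>B b\<bar>" using B[OF k, of b] by linarith
      then show "norm ((v \<bullet> b) *\<^sub>R rho k b) \<le> \<bar>B b\<bar> * norm v"
        using Basis_le_norm[OF b, of v] mult_mono[of "\<bar>v \<bullet> b\<bar>" "norm v" "norm (rho k b)" "\<bar>B b\<bar>"]
        by (simp add: mult.commute)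
    qed
    finally show ?thesis by (simp add: C_def sum_distrib_right)
  qed
  moreover have "C \<ge> 0" unfolding C_def by (intro sum_nonneg) auto
  ultimately show ?thesis by blast
qed

lemma pn_bdd: "bdd_above ((\<lambda>k. norm (rho k v)) ` K)"
  using rho_bound by (force simp: bdd_above_def)

lemma pn_upper: "k \<in> K \<Longrightarrow> norm (rho k v) \<le> pn v"
  unfolding pn_def by (rule cSUP_upper[OF _ pn_bdd])

lemma pn_le: "(\<And>k. k \<in> K \<Longrightarrow> norm (rho k v) \<le> c) \<Longrightarrow> pn v \<le> c"
  unfolding pn_def using cg.K_one by (intro cSUP_least) auto

lemma norm_le_pn: "v \<in> VM \<Longrightarrow> norm v \<le> pn v"
  using pn_upper[OF cg.K_one, of v] lprojM(3) by (simp add: rho_one)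

lemma pn_rho: "a \<in> K \<Longrightarrow> pn (rho a v) \<le> pn v"
  by (rule pn_le) (metis rho_mult pn_upper cg.K_mult)

lemma pn_continuous: "continuous_on S pn"
proof -
  obtain C where C: "C \<ge> 0" "\<And>k v. k \<in> K \<Longrightarrow> norm (rho k v) \<le> C * norm v" using rho_bound by blast
  have le: "pn v \<le> pn w + C * norm (v - w)" for v w
  proof (rule pn_le)
    fix k assume k: "k \<in> K"
    have "norm (rho k v) \<le> norm (rho k w) + norm (rho k (v - w))"
      using norm_triangle_ineq[of "rho k w" "rho k (v - w)"] linear_diff[OF bounded_linear.linear[OF rho_linear_K[OF k]], of v w] by simp
    then show "norm (rho k v) \<le> pn w + C * norm (v - w)" using pn_upper[OF k, of w] C(2)[OF k, of "v - w"] by linarith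
  qed
  have "C-lipschitz_on S pn"
  proof (rule lipschitz_onI)
    show "dist (pn x) (pn y) \<le> C * dist x y" for x y
      using le[of x y] le[of y x] by (simp add: dist_norm abs_le_iff norm_minus_commute[of y x])
  qed (rule C(1))
  then show ?thesis by (rule lipschitz_on_continuous_on)
qed

lemma pn_zero: "pn 0 = 0"
proof -
  have "pn 0 \<le> 0" by (rule pn_le) (simp add: linear_0[OF bounded_linear.linear[OF rho_linear_K]])
  moreover have "pn 0 \<ge> 0" using order_trans[OF norm_ge_zero pn_upper[OF cg.K_one]] .
  ultimately show ?thesis by simp
qed

lemma disc_rho: "v \<in> disc r \<Longrightarrow> k \<in> K \<Longrightarrow> rho k v \<in> disc r"
  using pn_rho[of k v] lproj_rho[of k v] lprojM(2)[of "rho k v"] linear_0[OF bounded_linear.linear[OF rho_linear_K[of k]]]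
  unfolding disc_def nu_fixed by (auto simp: ppi_equivariant)

lemma disc_norm: "v \<in> disc r \<Longrightarrow> norm v < r" and disc_nu: "v \<in> disc r \<Longrightarrow> nu v = v" and disc_VM: "v \<in> disc r \<Longrightarrow> v \<in> VM"
  and disc_ppi: "v \<in> disc r \<Longrightarrow> ppi v = 0"
  using norm_le_pn[of v] unfolding disc_def nu_fixed by auto

lemma disc_mono: "r \<le> r' \<Longrightarrow> disc r \<subseteq> disc r'"
  by (auto simp: disc_def)

lemma disc_zero: "r > 0 \<Longrightarrow> 0 \<in> disc r"
  using linear_0[OF nu_linear] by (simp add: disc_def pn_zero)

lemma smooth_nu: "smooth_on UNIV S nu"
  by (rule smooth_on_linear[OF nu_linear])

end

text \<open>\<open>sg_sep\<close> keeps different cosets apart: translates of the disc that meet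
  differ by an element of \<open>K\<close>. \<open>sg_crit\<close> holds because slice and orbit
  directions together span all directions, so that criticality can be tested on each
  separately.\<close>

locale slice = orbit_section G GM M act m d s Oe for G (structure) and GM :: "('a, 'k::euclidean_space) manifold"
    and M :: "('m, 'e::euclidean_space) manifold" and act m d s Oe +
  fixes r :: real and sg :: "'e \<Rightarrow> 'm"
  assumes r: "r > 0"
    and sg_plot: "plot M (ball 0 r) sg" and sg0: "sg 0 = m" and sg_UM: "\<And>v. v \<in> ball 0 r \<Longrightarrow> sg v \<in> UM"
    and sg_deriv: "\<And>v. dir_deriv v (\<lambda>w. phiM (sg w)) 0 = lproj VM v"
    and sg_equiv: "\<And>k v. k \<in> K \<Longrightarrow> v \<in> disc r \<Longrightarrow> act k (sg v) = sg (rho k v)"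
    and sg_sep: "\<And>g v v'. g \<in> carrier G \<Longrightarrow> v \<in> disc r \<Longrightarrow> v' \<in> disc r \<Longrightarrow> act g (sg v) = sg v' \<Longrightarrow> g \<in> K"
    and sg_crit: "\<And>f g v. smooth_map M real_line f \<Longrightarrow> g \<in> carrier G \<Longrightarrow> v \<in> disc r \<Longrightarrow>
       (\<And>w. dir_deriv w (\<lambda>w. f (act g (sg (nu w)))) v = 0) \<Longrightarrow>
       (\<And>w. dir_deriv w (\<lambda>t. f (act g (act (s t) (sg v)))) 0 = 0) \<Longrightarrow> critical_point M f (act g (sg v))"
    and sg_open: "\<And>r'. r' \<le> r \<Longrightarrow> openin (topo M) {act g (sg v) | g v. g \<in> carrier G \<and> v \<in> disc r'}"

context orbit_section begin

text \<open>The tube map \<open>Th\<close> is a local diffeomorphism at \<open>0\<close>, which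
  yields openness, injectivity and the test for critical points near \<open>m\<close>; translation
  spreads them along the orbit. Separation concerns arbitrary group elements and is not local: there
  properness confines the element to a neighbourhood of \<open>K\<close>.\<close>

lemma slice_theorem:
  obtains r sg where "slice G GM M act m d s Oe r sg"
proof -
  note s = d s_plot s0 s_ppi s_tcoord Oe
  obtain e sg where sg: "e > 0" "plot M (ball 0 e) sg" "sg 0 = m" "\<And>v. v \<in> ball 0 e \<Longrightarrow> sg v \<in> UM"
    "\<And>v. dir_deriv v (\<lambda>w. phiM (sg w)) 0 = lproj VM v"
    "\<And>k v. k \<in> K \<Longrightarrow> v \<in> ball 0 e \<Longrightarrow> rho k v \<in> ball 0 e \<Longrightarrow> v \<in> VM \<Longrightarrow> act k (sg v) = sg (rho k v)"
    using slice_param by blast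
  define S0 where "S0 = ball (0::'e) d \<inter> {y. nu y \<in> ball 0 e}"
  have nuo: "open {y. nu y \<in> ball 0 e}"
    using smooth_on_vimage_open[OF smooth_nu open_UNIV open_ball, of 0 e] by simp
  have S0: "open S0" "0 \<in> S0" using nuo s(1) sg(1) linear_0[OF nu_linear] by (auto simp: S0_def)
  \<comment> \<open>One vector carries both coordinates of the tube: \<open>s y\<close> depends on
    the orbit component \<open>ppi y\<close>, the second factor on the slice component
    \<open>nu y\<close>.\<close>
  define Th where "Th y = act (s y) (sg (nu y))" for y
  have Thp2: "plot M (ball 0 d \<times> {y. nu y \<in> ball 0 e}) (\<lambda>q. act (s (fst q)) (sg (nu (snd q))))"
  proof (rule act_plot)
    note o = open_Times[OF open_ball[of "0::'e" d] nuo]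
    show "plot GM (ball 0 d \<times> {y. nu y \<in> ball 0 e}) (\<lambda>q. s (fst q))"
      by (rule plot_compose[OF s(2) smooth_on_fst o _ GM(2)]) auto
    have sn: "smooth_on UNIV (ball (0::'e) d \<times> {y. nu y \<in> ball 0 e}) (\<lambda>q. nu (snd q))"
      by (rule smooth_on_linear_compose[OF nu_linear smooth_on_snd o])
    show "plot M (ball (0::'e) d \<times> {y. nu y \<in> ball 0 e}) (\<lambda>q. sg (nu (snd q)))"
      by (rule plot_compose[OF sg(2) sn o _ Mc]) auto
  qed
  have Thp: "plot M S0 Th" unfolding Th_def
    using plot_compose[OF Thp2 smooth_on_Pair[OF smooth_on_id smooth_on_id S0(1)] S0(1) _ Mc]
    by (auto simp: S0_def)
  have Th0: "Th 0 = m" using s(3) sg(3) linear_0[OF nu_linear] act_one[OF m] by (simp add: Th_def)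
  define S where "S = {y\<in>S0. Th y \<in> UM}"
  note pp = phiM_plot[OF Thp, folded S_def]
  have S: "0 \<in> S" using S0 Th0 chart_m_atlas(2) by (simp add: S_def)
  define Thh where "Thh y = phiM (Th y) + (y - lproj VM y)" for y
  have Thhs: "smooth_on UNIV S Thh" unfolding Thh_def[abs_def]
    by (intro smooth_on_add pp smooth_on_diff smooth_on_id smooth_on_linear[OF lprojM(1)])
  \<comment> \<open>At the base point the orbit factor contributes \<open>ppi\<close> and the slice
    factor \<open>nu\<close>; their sum is the projection onto \<open>VM\<close>.\<close>
  have dTh: "dir_deriv v (\<lambda>y. phiM (Th y)) 0 = ppi v + nu v" for v
  proof -
    let ?Q = "{q \<in> ball 0 d \<times> {y. nu y \<in> ball 0 e}. act (s (fst q)) (sg (nu (snd q))) \<in> UM}"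
    define F where "F q = phiM (act (s (fst q)) (sg (nu (snd q))))" for q :: "'e \<times> 'e"
    note pq = phiM_plot[OF Thp2, folded F_def]
    have q0: "(0, 0) \<in> ?Q" using S0(2) Th0 chart_m_atlas(2) by (simp add: S0_def Th_def)
    have "dir_deriv v (\<lambda>y. F (y, y)) 0 = dir_deriv v (\<lambda>a. F (a, 0)) 0 + dir_deriv v (\<lambda>b. F (0, b)) 0"
      by (rule dir_deriv_graph[OF pq(2,1) q0 has_derivative_ident])
    also have "dir_deriv v (\<lambda>a. F (a, 0)) 0 = dir_deriv v (\<lambda>a. phiM (act (s a) m)) 0"
      by (simp add: F_def linear_0[OF nu_linear] sg(3))
    also have "\<dots> = ppi v"
    proof -
      have z: "0 \<in> ball (0::'e) d" using s(1) by simp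
      have p: "plot M (ball 0 d) (\<lambda>a. act (s a) m)" by (rule orbit_plot[OF s(2)])
      have al: "{z \<in> ball 0 d. act (s z) m \<in> UM} = ball 0 d" using s(5) by auto
      note pf = phiM_plot[OF p, unfolded al]
      have "dir_deriv v (\<lambda>a. phiM (act (s a) m)) 0 \<in> TO"
        using dpi_plot[OF s(2) z s(3), of v] by (simp add: TO_def)
      then have "dir_deriv v (\<lambda>a. phiM (act (s a) m)) 0 = ppi (dir_deriv v (\<lambda>a. phiM (act (s a) m)) 0 - 0)"
        using ppi_id by simp
      also have "\<dots> = dir_deriv v (\<lambda>a. ppi (phiM (act (s a) m) - pM)) 0"
        using has_derivative_dir_deriv[OF bounded_linear.has_derivative[of ppi, OF _ has_derivative_diff[OF smooth_on_has_derivative[OF pf(2,1) z] has_derivative_const[of pM]]], of v]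
          ppi_linear by (simp add: linear_conv_bounded_linear)
      also have "\<dots> = dir_deriv v ppi 0"
        by (rule dir_deriv_cong(1)[OF open_ball z]) (use s(5) in \<open>auto simp: tcoord_def\<close>)
      also have "\<dots> = ppi v"
        using has_derivative_dir_deriv[OF bounded_linear_imp_has_derivative[of ppi]] ppi_linear by (simp add: linear_conv_bounded_linear)
      finally show ?thesis .
    qed
    also have "dir_deriv v (\<lambda>b. F (0, b)) 0 = dir_deriv v (\<lambda>b. phiM (act \<one> (sg (nu b)))) 0"
      by (simp add: F_def s(3))
    also have "\<dots> = dir_deriv v (\<lambda>b. phiM (sg (nu b))) 0"
      by (rule dir_deriv_cong(1)[OF nuo]) (use sg(1) linear_0[OF nu_linear] plot_in[OF sg(2)] act_one in auto)
    also have "\<dots> = dir_deriv (nu v) (\<lambda>w. phiM (sg w)) 0"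
    proof -
      have al: "{z \<in> ball 0 e. sg z \<in> UM} = ball 0 e" using sg(4) by auto
      note pf = phiM_plot[OF sg(2), unfolded al]
      have "((\<lambda>w. phiM (sg w)) has_derivative (\<lambda>v. dir_deriv v (\<lambda>w. phiM (sg w)) 0)) (at (nu 0))"
        using smooth_on_has_derivative[OF pf(2,1)] sg(1) linear_0[OF nu_linear] by simp
      from dir_deriv_chain[OF this bounded_linear_imp_has_derivative[of nu]] nu_linear
      show ?thesis by (simp add: linear_conv_bounded_linear)
    qed
    also have "\<dots> = nu v" by (simp add: sg(5) nu_props(1))
    finally show ?thesis by (simp add: F_def Th_def)
  qed
  have dThh: "dir_deriv v Thh 0 = v" for v
  proof -
    have "(Thh has_derivative (\<lambda>v. dir_deriv v (\<lambda>y. phiM (Th y)) 0 + (v - lproj VM v))) (at 0)"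
      unfolding Thh_def[abs_def]
      by (intro has_derivative_add has_derivative_diff has_derivative_ident bounded_linear_imp_has_derivative[OF lprojM(4)]
          smooth_on_has_derivative[OF pp(2,1) S])
    from has_derivative_dir_deriv[OF this] show ?thesis by (simp add: dTh nu_def)
  qed
  obtain A B hh where IF: "open A" "0 \<in> A" "A \<subseteq> S" "open B" "homeomorphism A B Thh hh" "smooth_on UNIV B hh"
    using smooth_inverse_function[OF pp(1) S Thhs] dThh by metis
  have AS0: "A \<subseteq> S0" using IF(3) by (auto simp: S_def)
  have tube: "hh (phiM x) \<in> A" "hh (phiM x) \<in> VM" "Th (hh (phiM x)) = x" if x: "x \<in> UM" "phiM x \<in> B" for x
  proof -
    define y where "y = hh (phiM x)"
    show yA: "hh (phiM x) \<in> A" using IF(5) x by (auto simp: homeomorphism_def)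
    have Ty: "Thh y = phiM x" unfolding y_def using IF(5) x by (auto simp: homeomorphism_def)
    have TU: "Th y \<in> UM" using yA IF(3) by (auto simp: S_def y_def)
    have "lproj VM (Thh y) = lproj VM (phiM (Th y)) + (lproj VM y - lproj VM (lproj VM y))"
      unfolding Thh_def by (simp add: linear_add[OF lprojM(1)] linear_diff[OF lprojM(1)])
    then have "phiM x = phiM (Th y)" using psiM_phiM(3)[OF TU] psiM_phiM(3)[OF x(1)] Ty lprojM(5) by simp
    then show "Th (hh (phiM x)) = x" using psiM_phiM(1)[OF TU] psiM_phiM(1)[OF x(1)] by (simp add: y_def)
    have "y - lproj VM y = 0" using Ty \<open>phiM x = phiM (Th y)\<close> by (simp add: Thh_def)
    then show "hh (phiM x) \<in> VM" using lprojM(2)[of y] by (simp add: y_def)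
  qed
  have AB: "Thh y \<in> B" "hh (Thh y) = y" if "y \<in> A" for y using IF(5) that by (auto simp: homeomorphism_def)
  have ThhV: "Thh y = phiM (Th y)" if "y \<in> VM" for y using lprojM(3)[OF that] by (simp add: Thh_def)
  have inj: "y = y'" if "y \<in> A" "y' \<in> A" "y \<in> VM" "y' \<in> VM" "Th y = Th y'" for y y'
    using AB(2)[OF that(1)] AB(2)[OF that(2)] ThhV that by metis
  obtain e1 where e1: "e1 > 0" "ball 0 e1 \<subseteq> A" using IF(1,2) open_contains_ball by blast
  define d1 where "d1 = min d (e1/2)"
  have d1: "d1 > 0" "d1 \<le> d" "d1 \<le> e1/2" using s(1) e1(1) by (auto simp: d1_def)
  \<comment> \<open>A neighbourhood of \<open>K\<close> all of whose elements are of the form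
    \<open>s t \<otimes> k\<close> with \<open>t\<close> small.\<close>
  define QK where "QK = NU \<one> (ball 0 d1)"
  have QKo: "openin (topo GM) QK" unfolding QK_def by (rule NU_open[OF one_closed open_ball])
  have QKK: "k \<in> QK" if k: "k \<in> K" for k
    using NU_sat[OF one_closed NU_self[OF one_closed]] pK_eq_iff[of k \<one>] K_carrier[OF k] k d1(1) by (simp add: QK_def)
  have QKd: "\<exists>t k. t \<in> TO \<and> norm t < d1 \<and> k \<in> K \<and> u = s t \<otimes> k" if u: "u \<in> QK" for u
  proof -
    note D = NU_D[OF one_closed u[unfolded QK_def]]
    show ?thesis using pK_eqD[OF D(1) _ D(5)] s_carrier[OF D(4)] D(3) tcoord_TO[of "inv \<one> \<otimes> u"] by auto
  qed
  \<comment> \<open>A proper map is closed, so the image of the complement of \<open>QK\<close> is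
    closed; it avoids \<open>(m, m)\<close>, and hence a product neighbourhood of
    \<open>(m, m)\<close>.\<close>
  obtain X4 where X4: "openin (topo M) X4" "m \<in> X4" "\<And>g x. g \<in> carrier G \<Longrightarrow> x \<in> X4 \<Longrightarrow> act g x \<in> X4 \<Longrightarrow> g \<in> QK"
  proof -
    let ?P = "prod_topology (topo GM) (topo M)" let ?M2 = "prod_topology (topo M) (topo M)"
    let ?f = "\<lambda>(g, x). (act g x, x)"
    have "closedin (topo GM) (carrier G - QK)" using closedin_diff[OF closedin_topspace QKo] GM(3) by simp
    then have "closedin ?P ((carrier G - QK) \<times> TM)" by (simp add: closedin_prod_Times_iff)
    moreover have "closed_map ?P ?M2 ?f" using psa by (simp add: proper_smooth_action_def proper_map_def)
    ultimately have cl: "closedin ?M2 (?f ` ((carrier G - QK) \<times> TM))" by (simp add: closed_map_def)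
    have "(m, m) \<notin> ?f ` ((carrier G - QK) \<times> TM)"
    proof
      assume "(m, m) \<in> ?f ` ((carrier G - QK) \<times> TM)"
      then obtain h where "h \<in> carrier G - QK" "act h m = m" by auto
      then show False using QKK[of h] K_iff by blast
    qed
    then have 1: "(m, m) \<in> topspace ?M2 - ?f ` ((carrier G - QK) \<times> TM)" using m by simp
    have 2: "openin ?M2 (topspace ?M2 - ?f ` ((carrier G - QK) \<times> TM))"
      by (rule openin_diff[OF openin_topspace cl])
    obtain U V where UV: "openin (topo M) U" "openin (topo M) V" "m \<in> U" "m \<in> V"
      "U \<times> V \<subseteq> topspace ?M2 - ?f ` ((carrier G - QK) \<times> TM)"
      using openin_prod_topology_alt[THEN iffD1, OF 2, rule_format, OF 1] by blast
    show ?thesis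
    proof (rule that[of "U \<inter> V"])
      show "openin (topo M) (U \<inter> V)" "m \<in> U \<inter> V" using UV by auto
      fix g x assume g: "g \<in> carrier G" and x: "x \<in> U \<inter> V" "act g x \<in> U \<inter> V"
      have "(act g x, x) \<in> U \<times> V" using x by blast
      then have "(act g x, x) \<notin> ?f ` ((carrier G - QK) \<times> TM)" using UV(5) by blast
      moreover have "x \<in> TM" using x openin_subset[OF UV(1)] by blast
      ultimately show "g \<in> QK" using g by force
    qed
  qed
  have "open {v\<in>ball 0 e. sg v \<in> X4}" by (rule plot_vimage_open[OF sg(2) X4(1)])
  moreover have "0 \<in> {v\<in>ball 0 e. sg v \<in> X4}" using sg(1,3) X4(2) by simp
  ultimately obtain e2 where e2: "e2 > 0" "ball 0 e2 \<subseteq> {v\<in>ball 0 e. sg v \<in> X4}" using open_contains_ball by blast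
  \<comment> \<open>Halving \<open>e1\<close> leaves room in the injectivity domain for the sum of
    an orbit component and a slice component.\<close>
  define r where "r = min e2 (e1/2)"
  have r: "r > 0" "r \<le> e2" "r \<le> e1/2" using e1 e2 by (auto simp: r_def)
  have re: "ball 0 r \<subseteq> ball (0::'e) e" using subset_ball[OF r(2), of 0] e2(2) by blast
  have disc_e: "v \<in> ball 0 e" "v \<in> ball 0 r" "sg v \<in> X4" "v \<in> A" "v \<in> VM" if "v \<in> disc r" for v
  proof -
    show vr: "v \<in> ball 0 r" using disc_norm[OF that] by simp
    then have "v \<in> ball 0 e2" "v \<in> ball 0 e1" using r e1 by auto
    then show "v \<in> ball 0 e" "sg v \<in> X4" "v \<in> A" using e2(2) e1(2) by blast+
    show "v \<in> VM" using disc_VM[OF that] .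
  qed
  have equi: "act k (sg v) = sg (rho k v)" if "k \<in> K" "v \<in> disc r" for k v
    using sg(6)[OF that(1)] disc_e[OF that(2)] disc_e(1)[OF disc_rho[OF that(2,1)]] by blast
  have Thtv: "Th (t + v) = act (s t) (sg v)" if "t \<in> TO" "v \<in> disc r" for t v
  proof -
    have "s (t + v) = s (ppi (t + v))" by (simp add: s(4))
    also have "\<dots> = s t" using disc_ppi[OF that(2)] ppi_id[OF that(1)] by (simp add: linear_add[OF ppi_linear])
    finally have 1: "s (t + v) = s t" .
    have "nu t = 0" using lprojM(3)[of t] TO_VM that(1) ppi_id[OF that(1)] by (auto simp: nu_def)
    then have "nu (t + v) = v" using disc_nu[OF that(2)] by (simp add: linear_add[OF nu_linear])
    with 1 show ?thesis by (simp add: Th_def)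
  qed
  have Thv: "Th v = sg v" if "v \<in> disc r" for v
    using Thtv[OF subspace_0[OF subspace_TO] that] s(3) act_one plot_in[OF sg(2) disc_e(1)[OF that]] by simp
  show ?thesis
  proof (rule that, rule slice.intro[OF orbit_section_axioms slice_axioms.intro])
    show "r > 0" by (rule r(1))
    show "plot M (ball 0 r) sg" by (rule plot_subset[OF sg(2) open_ball re Mc])
    show "sg 0 = m" "\<And>v. dir_deriv v (\<lambda>w. phiM (sg w)) 0 = lproj VM v" by (fact sg)+
    show "sg v \<in> UM" if "v \<in> ball 0 r" for v using sg(4) re that by blast
    show "act k (sg v) = sg (rho k v)" if "k \<in> K" "v \<in> disc r" for k v using equi that .
    show "g \<in> K" if g: "g \<in> carrier G" and v: "v \<in> disc r" "v' \<in> disc r" and eq: "act g (sg v) = sg v'" for g v v'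
    proof -
      \<comment> \<open>Writing \<open>g = s t \<otimes> k\<close>, the factor \<open>k\<close>
        moves points inside the slice; the equation then compares two points of the tube, and
        injectivity gives \<open>t = 0\<close>.\<close>
      have "g \<in> QK" using X4(3)[OF g disc_e(3)[OF v(1)]] eq disc_e(3)[OF v(2)] by simp
      then obtain t k where tk: "t \<in> TO" "norm t < d1" "k \<in> K" "g = s t \<otimes> k" using QKd by blast
      have sc: "s t \<in> carrier G" using plot_in[OF s(2)] GM(3) tk(2) d1(2) by simp
      have kv: "rho k v \<in> disc r" using disc_rho[OF v(1) tk(3)] .
      have "sg v' = act (s t) (act k (sg v))"
        using eq sc K_carrier[OF tk(3)] plot_in[OF sg(2) disc_e(1)[OF v(1)]] by (simp add: tk(4) act_mult)
      also have "\<dots> = Th (t + rho k v)" using equi[OF tk(3) v(1)] Thtv[OF tk(1) kv] by simp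
      finally have e: "Th (t + rho k v) = Th v'" using Thv[OF v(2)] by simp
      have "norm (t + rho k v) < e1"
        using norm_triangle_ineq[of t "rho k v"] disc_norm[OF kv] tk(2) d1(3) r(3) by linarith
      then have A1: "t + rho k v \<in> A" using e1(2) by auto
      have V1: "t + rho k v \<in> VM" using subspace_add[OF subspace_VM] tk(1) TO_VM disc_VM[OF kv] by blast
      have "t + rho k v = v'" by (rule inj[OF A1 disc_e(4)[OF v(2)] V1 disc_e(5)[OF v(2)] e])
      then have "ppi t + ppi (rho k v) = ppi v'" by (metis linear_add[OF ppi_linear])
      then have "t = 0" using disc_ppi[OF kv] disc_ppi[OF v(2)] ppi_id[OF tk(1)] by simp
      then show "g \<in> K" using tk(3,4) s(3) K_carrier by simp
    qed
    show "critical_point M f (act g (sg v))"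
      if f: "smooth_map M real_line f" and g: "g \<in> carrier G" and v: "v \<in> disc r"
        and z1: "\<And>w. dir_deriv w (\<lambda>w. f (act g (sg (nu w)))) v = 0"
        and z2: "\<And>w. dir_deriv w (\<lambda>t. f (act g (act (s t) (sg v)))) 0 = 0" for f g v
    proof -
      have vS0: "v \<in> S0" using AS0 disc_e(4)[OF v] by blast
      define x where "x = act g (sg v)"
      have p: "plot M S0 (\<lambda>y. act g (Th y))" by (rule act_translate_plot[OF Thp g])
      have cx: "act g (Th v) = x" using Thv[OF v] by (simp add: x_def)
      have xT: "x \<in> TM" using plot_in[OF p vS0] cx by simp
      let ?O = "ball 0 d \<times> {y. nu y \<in> ball 0 e}"
      define F where "F q = f (act g (act (s (fst q)) (sg (nu (snd q)))))" for q :: "'e \<times> 'e"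
      have Fs: "smooth_on UNIV ?O F"
        unfolding F_def[abs_def] by (rule smooth_map_real_plot[OF Mc f act_translate_plot[OF Thp2 g]])
      have oO: "open ?O" by (rule open_Times[OF open_ball nuo])
      have vO: "(v, v) \<in> ?O" using vS0 by (simp add: S0_def)
      have sgT: "sg (nu b) \<in> TM" if "nu b \<in> ball 0 e" for b using plot_in[OF sg(2) that] .
      \<comment> \<open>On the diagonal the derivative splits into one along the orbit and one along
        the slice; both vanish by assumption.\<close>
      have dz: "dir_deriv w (\<lambda>y. f (act g (Th y))) v = 0" for w
      proof -
        have "dir_deriv w (\<lambda>y. F (y, y)) v = dir_deriv w (\<lambda>a. F (a, v)) v + dir_deriv w (\<lambda>b. F (v, b)) v"
          by (rule dir_deriv_graph[OF Fs oO vO has_derivative_ident])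
        also have "dir_deriv w (\<lambda>a. F (a, v)) v = dir_deriv w (\<lambda>t. f (act g (act (s t) (sg v)))) 0"
        proof -
          have "s (v + t *\<^sub>R w) = s (t *\<^sub>R w)" for t
          proof -
            have "s (v + t *\<^sub>R w) = s (ppi (v + t *\<^sub>R w))" by (simp add: s(4))
            also have "\<dots> = s (ppi (t *\<^sub>R w))" using disc_ppi[OF v] by (simp add: linear_add[OF ppi_linear])
            finally show ?thesis by (simp add: s(4))
          qed
          then show ?thesis by (simp add: F_def dir_deriv_def disc_nu[OF v])
        qed
        also have "dir_deriv w (\<lambda>b. F (v, b)) v = dir_deriv w (\<lambda>b. f (act g (sg (nu b)))) v"
        proof -
          have s1: "s v = \<one>" using s(4)[of v] disc_ppi[OF v] s(3) by simp
          show ?thesis by (rule dir_deriv_cong(1)[OF nuo]) (use vO sgT act_one in \<open>auto simp: F_def s1\<close>)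
        qed
        finally show ?thesis by (simp add: z1 z2 F_def Th_def)
      qed
      let ?c = "chart_at M x"
      obtain U V \<phi> where ce: "?c = (U, V, \<phi>)" by (cases ?c)
      note ca = chart_at[OF Mc xT, unfolded ce]
      note cd = chart_dom_chart_param[OF chartedD[OF Mc ca(1)]]
      have gi: "inv g \<in> carrier G" using g by simp
      have pc: "plot M (chart_dom ?c) (\<lambda>y. act (inv g) (chart_param ?c y))"
        using act_translate_plot[OF plot_chart_param[OF M ca(1)] gi] by (simp add: ce)
      note pcp = phiM_plot[OF pc]
      let ?R = "{y \<in> chart_dom ?c. act (inv g) (chart_param ?c y) \<in> UM}"
      define R where "R = {y \<in> ?R. phiM (act (inv g) (chart_param ?c y)) \<in> B}"
      have oR: "open R" unfolding R_def by (rule smooth_on_vimage_open[OF pcp(2,1) IF(4)])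
      \<comment> \<open>Tube coordinates of the point moved back by \<open>g\<close>. They lift the
        chart at \<open>x\<close> through the translated tube, as
        \<open>critical_pointI_plot\<close> demands.\<close>
      define u where "u y = hh (phiM (act (inv g) (chart_param ?c y)))" for y
      have us: "smooth_on UNIV R u" unfolding u_def
        by (rule smooth_on_compose[OF IF(6) smooth_on_subset[OF pcp(2)] oR IF(4)]) (auto simp: R_def)
      have sgv: "act (inv g) x = sg v" "sg v \<in> UM" "phiM (sg v) = Thh v"
        using act_inv(1)[OF plot_in[OF sg(2) disc_e(1)[OF v]] g] sg(4)[OF disc_e(1)[OF v]] ThhV[OF disc_e(5)[OF v]] Thv[OF v]
        by (auto simp: x_def)
      have cx': "coord_at M x x = \<phi> x" by (simp add: coord_at_def ce)
      have "critical_point M f x"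
      proof (rule critical_pointI_plot[OF M f p vS0 cx dz oR _ us])
        show "coord_at M x x \<in> R"
          using cd(1,2)[OF ca(2)[simplified]] sgv AB(1)[OF disc_e(4)[OF v]] by (simp add: R_def cx' ce)
        show "u (coord_at M x x) = v"
          using cd(2)[OF ca(2)[simplified]] sgv AB(2)[OF disc_e(4)[OF v]] by (simp add: u_def cx' ce)
        fix y assume y: "y \<in> R"
        let ?x = "act (inv g) (chart_param ?c y)"
        have x': "?x \<in> UM" "phiM ?x \<in> B" "y \<in> chart_dom ?c" using y by (auto simp: R_def)
        have "chart_param ?c y \<in> TM" using plot_in[OF plot_chart_param[OF M ca(1)]] x'(3) by (simp add: ce)
        then have "act g ?x = chart_param ?c y" using act_inv(2) g by blast
        then show "u y \<in> S0 \<and> act g (Th (u y)) = chart_param (chart_at M x) y"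
          using tube[OF x'(1,2)] AS0 by (auto simp: u_def)
      qed
      then show ?thesis by (simp add: x_def)
    qed
    show "openin (topo M) {act g (sg v) | g v. g \<in> carrier G \<and> v \<in> disc r'}" if r': "r' \<le> r" for r'
    proof -
      \<comment> \<open>In tube coordinates, having the slice component in the smaller disc is an
        open condition; the set in question is the union of the translates of the neighbourhood so
        obtained.\<close>
      define B' where "B' = {b\<in>B. pn (nu (hh b)) \<in> {..<r'}}"
      have "continuous_on B (\<lambda>b. pn (nu (hh b)))"
        by (rule continuous_on_compose2[OF pn_continuous[of UNIV] smooth_on_continuous[OF smooth_on_linear_compose[OF nu_linear IF(6,4)]]]) auto
      from continuous_open_preimage[OF this IF(4), of "{..<r'}"] have B': "open B'"
        by (simp add: B'_def vimage_def Int_def)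
      define N where "N = {x \<in> UM. phiM x \<in> B'}"
      have N: "openin (topo M) N" unfolding N_def by (rule topological_chart_vimage_openin[OF chart_m_top B'])
      have N1: "\<exists>h v. h \<in> carrier G \<and> v \<in> disc r' \<and> x = act h (sg v)" if x: "x \<in> N" for x
      proof -
        have xx: "x \<in> UM" "phiM x \<in> B" "pn (nu (hh (phiM x))) < r'" using x by (auto simp: N_def B'_def)
        let ?y = "hh (phiM x)"
        have "?y \<in> S0" using tube(1)[OF xx(1,2)] AS0 by blast
        then have "s ?y \<in> carrier G" using plot_in[OF s(2)] GM(3) by (auto simp: S0_def)
        moreover have "nu ?y \<in> disc r'" using xx(3) nu_props(3) by (simp add: disc_def)
        moreover have "x = act (s ?y) (sg (nu ?y))" using tube(3)[OF xx(1,2)] by (simp add: Th_def)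
        ultimately show ?thesis by blast
      qed
      have N2: "sg v \<in> N" if v: "v \<in> disc r'" for v
      proof -
        have v': "v \<in> disc r" using disc_mono[OF r'] v by blast
        have "phiM (sg v) = Thh v" using ThhV[OF disc_e(5)[OF v']] Thv[OF v'] by simp
        then show ?thesis using AB[OF disc_e(4)[OF v']] sg(4)[OF disc_e(1)[OF v']] disc_nu[OF v] v
          by (auto simp: N_def B'_def disc_def)
      qed
      have "{act g (sg v) | g v. g \<in> carrier G \<and> v \<in> disc r'} = \<Union>((\<lambda>g. {x\<in>TM. act (inv g) x \<in> N}) ` carrier G)"
      proof (intro equalityI subsetI)
        fix x assume "x \<in> {act g (sg v) | g v. g \<in> carrier G \<and> v \<in> disc r'}"
        then obtain g v where gv: "x = act g (sg v)" "g \<in> carrier G" "v \<in> disc r'" by blast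
        have "sg v \<in> N" using N2[OF gv(3)] .
        moreover have T: "sg v \<in> TM" using calculation openin_subset[OF N] by blast
        ultimately show "x \<in> \<Union>((\<lambda>g. {x\<in>TM. act (inv g) x \<in> N}) ` carrier G)"
          using gv act_inv(1)[OF T gv(2)] act_closed[OF gv(2) T] by (auto intro!: bexI[of _ g])
      next
        fix x assume "x \<in> \<Union>((\<lambda>g. {x\<in>TM. act (inv g) x \<in> N}) ` carrier G)"
        then obtain g where g: "g \<in> carrier G" "x \<in> TM" "act (inv g) x \<in> N" by blast
        obtain h v where hv: "h \<in> carrier G" "v \<in> disc r'" "act (inv g) x = act h (sg v)" using N1[OF g(3)] by blast
        have T: "sg v \<in> TM" using N2[OF hv(2)] openin_subset[OF N] by blast
        have "x = act g (act h (sg v))" using hv(3) act_inv(2)[OF g(2,1)] by simp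
        then have "x = act (g \<otimes> h) (sg v)" using act_mult[OF T g(1) hv(1)] by simp
        then show "x \<in> {act g (sg v) | g v. g \<in> carrier G \<and> v \<in> disc r'}" using g(1) hv(1,2) by blast
      qed
      moreover have "openin (topo M) (\<Union>((\<lambda>g. {x\<in>TM. act (inv g) x \<in> N}) ` carrier G))"
      proof (rule openin_Union)
        fix U assume "U \<in> (\<lambda>g. {x\<in>TM. act (inv g) x \<in> N}) ` carrier G"
        then obtain g where "g \<in> carrier G" "U = {x\<in>TM. act (inv g) x \<in> N}" by blast
        then show "openin (topo M) U"
          using openin_continuous_map_preimage[OF act_continuous_right[of "inv g"] N] by simp
      qed
      ultimately show ?thesis by simp
    qed
  qed
qed

end

section \<open>Zeros of perturbed maps\<close>

text \<open>With \<open>R\<close> the inverse of \<open>L\<close>, the map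
  \<open>v \<mapsto> v - R (A v)\<close> is a contraction by 1/2 whose fixed points are the zeros of
  \<open>A\<close>. The constants are explicit because one choice of them has to serve a whole
  family of maps. The zero is located in the small ball and is unique in the large one.\<close>

lemma perturbed_zero:
  fixes A :: "'e::euclidean_space \<Rightarrow> 'e" and L R :: "'e \<Rightarrow> 'e" and C \<kappa> \<eta> \<rho> :: real
  assumes S: "open S" "cball 0 \<eta> \<subseteq> S" and A: "smooth_on UNIV S A"
    and R: "linear R" "\<And>x. norm (R x) \<le> C * norm x" "C > 0" "\<And>x. R (L x) = x" "\<And>x. R x = 0 \<Longrightarrow> x = 0" and L: "linear L"
    and near: "\<And>v b. v \<in> cball 0 \<eta> \<Longrightarrow> b \<in> Basis \<Longrightarrow> norm (dir_deriv b A v - L b) \<le> \<kappa>"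
    and \<kappa>: "C * (DIM('e) * \<kappa>) \<le> 1/2"
    and \<rho>: "0 < \<rho>" "\<rho> \<le> \<eta>" "C * norm (A 0) \<le> \<rho> / 2"
  shows "\<exists>v\<in>cball 0 \<rho>. A v = 0"
    and "v \<in> cball 0 \<eta> \<Longrightarrow> w \<in> cball 0 \<eta> \<Longrightarrow> A v = 0 \<Longrightarrow> A w = 0 \<Longrightarrow> v = w"
    and "v \<in> cball 0 \<eta> \<Longrightarrow> dir_deriv x A v = 0 \<Longrightarrow> x = 0"
proof -
  have Ll: "norm (dir_deriv x A v - L x) \<le> DIM('e) * \<kappa> * norm x" if v: "v \<in> cball 0 \<eta>" for v x
  proof -
    have vS: "v \<in> S" using S(2) v by blast
    have "L x = (\<Sum>b\<in>Basis. (x \<bullet> b) *\<^sub>R L b)"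
      by (subst euclidean_representation[symmetric, of x]) (simp only: linear_sum[OF L] linear_scale[OF L])
    then have "dir_deriv x A v - L x = (\<Sum>b\<in>Basis. (x \<bullet> b) *\<^sub>R (dir_deriv b A v - L b))"
      using smooth_on_dir_deriv_expand[OF A S(1) vS, of x] by (simp only: sum_subtractf scaleR_diff_right)
    also have "norm \<dots> \<le> (\<Sum>b\<in>(Basis::'e set). norm x * \<kappa>)"
    proof (rule sum_norm_le)
      fix b :: 'e assume b: "b \<in> Basis"
      show "norm ((x \<bullet> b) *\<^sub>R (dir_deriv b A v - L b)) \<le> norm x * \<kappa>"
        using mult_mono[OF Basis_le_norm[OF b, of x] near[OF v b]] by simp
    qed
    finally show ?thesis by (simp add: algebra_simps)
  qed
  define T where "T v = v - R (A v)" for v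
  have Rb: "bounded_linear R" using R(1) by (simp add: linear_conv_bounded_linear)
  have RT: "norm (x - R (dir_deriv x A v)) \<le> norm x / 2" if v: "v \<in> cball 0 \<eta>" for v x
  proof -
    have "x - R (dir_deriv x A v) = R (L x - dir_deriv x A v)" by (simp add: linear_diff[OF R(1)] R(4))
    also have "norm \<dots> \<le> C * norm (dir_deriv x A v - L x)" using R(2) by (metis norm_minus_commute)
    also have "\<dots> \<le> C * (DIM('e) * \<kappa> * norm x)" using Ll[OF v] R(3) by (intro mult_left_mono) auto
    also have "\<dots> \<le> norm x / 2" using mult_right_mono[OF \<kappa>, of "norm x"] by (simp add: mult.assoc)
    finally show ?thesis .
  qed
  have contr: "norm (T v - T w) \<le> (1/2) * norm (v - w)" if "v \<in> cball 0 \<eta>" "w \<in> cball 0 \<eta>" for v w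
  proof (rule differentiable_bound[of "cball 0 \<eta>" T "\<lambda>v x. x - R (dir_deriv x A v)"])
    fix v assume v: "v \<in> cball (0::'e) \<eta>"
    then have vS: "v \<in> S" using S(2) by blast
    have "(T has_derivative (\<lambda>x. x - R (dir_deriv x A v))) (at v)"
      unfolding T_def[abs_def]
      by (rule has_derivative_diff[OF has_derivative_ident bounded_linear.has_derivative[OF Rb smooth_on_has_derivative[OF A S(1) vS]]])
    then show "(T has_derivative (\<lambda>x. x - R (dir_deriv x A v))) (at v within cball 0 \<eta>)" by (rule has_derivative_at_withinI)
    show "onorm (\<lambda>x. x - R (dir_deriv x A v)) \<le> 1/2" using RT[OF v] by (intro onorm_bound) auto
  qed (use that in auto)
  have TA: "T v = v \<longleftrightarrow> A v = 0" for v using R(5)[of "A v"] linear_0[OF R(1)] by (auto simp: T_def)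
  show "v = w" if "v \<in> cball 0 \<eta>" "w \<in> cball 0 \<eta>" "A v = 0" "A w = 0" for v w
  proof -
    have "T v = v" "T w = w" using TA that(3,4) by blast+
    then have "norm (v - w) \<le> (1/2) * norm (v - w)" using contr[OF that(1,2)] by simp
    then show "v = w" by simp
  qed
  show "x = 0" if "v \<in> cball 0 \<eta>" "dir_deriv x A v = 0" for v x
    using RT[OF that(1), of x] that(2) linear_0[OF R(1)] by simp
  have sub: "cball 0 \<rho> \<subseteq> cball (0::'e) \<eta>" using \<rho>(2) by auto
  have "\<exists>!v. v \<in> cball 0 \<rho> \<and> T v = v"
  proof (rule Banach_fix[of "cball 0 \<rho>" "1/2"])
    show "complete (cball (0::'e) \<rho>)" by (rule compact_imp_complete) simp
    show "cball (0::'e) \<rho> \<noteq> {}" using \<rho>(1) by auto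
    show "T ` cball 0 \<rho> \<subseteq> cball 0 \<rho>"
    proof
      fix y assume "y \<in> T ` cball 0 \<rho>"
      then obtain v where v: "v \<in> cball 0 \<rho>" "y = T v" by blast
      have z: "0 \<in> cball (0::'e) \<eta>" using \<rho> by auto
      have "norm (T 0) \<le> C * norm (A 0)" using R(2)[of "A 0"] by (simp add: T_def)
      moreover have "norm (T v - T 0) \<le> (1/2) * norm (v - 0)" by (rule contr) (use v sub z in blast)+
      ultimately have "norm (T v) \<le> \<rho>"
        using norm_triangle_sub[of "T v" "T 0"] v(1) \<rho>(3) by simp
      then show "y \<in> cball 0 \<rho>" using v(2) by simp
    qed
    show "\<And>x y. x \<in> cball 0 \<rho> \<Longrightarrow> y \<in> cball 0 \<rho> \<Longrightarrow> dist (T x) (T y) \<le> 1/2 * dist x y"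
      using contr sub by (auto simp: dist_norm subset_iff simp del: mem_cball)
  qed auto
  then show "\<exists>v\<in>cball 0 \<rho>. A v = 0" using TA by blast
qed

definition grad :: "('e::euclidean_space \<Rightarrow> real) \<Rightarrow> 'e \<Rightarrow> 'e" where
  "grad f v = (\<Sum>b\<in>Basis. dir_deriv b f v *\<^sub>R b)"

lemma grad_inner:
  assumes "smooth_on UNIV S f" "open S" "v \<in> S"
  shows "grad f v \<bullet> x = dir_deriv x f v"
proof -
  have "grad f v \<bullet> x = (\<Sum>b\<in>Basis. dir_deriv b f v * (b \<bullet> x))"
    unfolding grad_def by (simp add: inner_sum_left)
  also have "\<dots> = (\<Sum>b\<in>Basis. (x \<bullet> b) *\<^sub>R dir_deriv b f v)"
    by (intro sum.cong refl) (simp add: inner_commute[of x])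
  also have "\<dots> = dir_deriv x f v" by (rule smooth_on_dir_deriv_expand[OF assms, symmetric])
  finally show ?thesis .
qed

locale slice_pert = slice G GM M act m d s Oe r sg for G (structure) and GM :: "('a, 'k::euclidean_space) manifold"
    and M :: "('m, 'e::euclidean_space) manifold" and act m d s Oe r sg +
  fixes H :: "'a set" and h :: "'m \<Rightarrow> real" and hl :: "real \<Rightarrow> 'm \<Rightarrow> real" and \<Lambda> :: "real set"
  assumes H: "subgroup H G" "compact_space (quotient_topology (topo GM) (\<lambda>a. H #> a))"
    and h_inv: "\<And>g x. g \<in> carrier G \<Longrightarrow> x \<in> topspace (topo M) \<Longrightarrow> h (act g x) = h x"
    and \<Lambda>: "open \<Lambda>" "0 \<in> \<Lambda>"
    and hl_map: "\<And>l. l \<in> \<Lambda> \<Longrightarrow> smooth_map M real_line (hl l)"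
    and hl_inv: "\<And>l a x. l \<in> \<Lambda> \<Longrightarrow> a \<in> H \<Longrightarrow> x \<in> topspace (topo M) \<Longrightarrow> hl l (act a x) = hl l x"
    and hl_smooth: "smooth_map (prod_manifold M (flat_manifold UNIV \<Lambda>)) real_line (\<lambda>(x, l). hl l x)"
    and hl0: "\<And>x. x \<in> topspace (topo M) \<Longrightarrow> hl 0 x = h x"
    and nondeg: "nondegenerate_critical_point G GM M act h m"
begin

lemma H_carrier: "a \<in> H \<Longrightarrow> a \<in> carrier G" using H(1) by (rule subgroup.mem_carrier)

lemma hl_plot:
  assumes "plot M S c" "smooth_on UNIV S l" "\<And>z. z \<in> S \<Longrightarrow> l z \<in> \<Lambda>"
  shows "smooth_on UNIV S (\<lambda>z. hl (l z) (c z))"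
proof -
  have p: "plot (prod_manifold M (flat_manifold UNIV \<Lambda>)) S (\<lambda>z. (c z, l z))"
    by (rule plot_Pair[OF Mc charted_flat_UNIV[OF \<Lambda>(1)] assms(1) plot_flat[OF plot_open[OF assms(1)] assms(2,3)]])
  from smooth_map_real_plot[OF charted_prod[OF Mc charted_flat_UNIV[OF \<Lambda>(1)]] hl_smooth p]
  show ?thesis by simp
qed

text \<open>\<open>E u l\<close> is the perturbed function on the translated slice, extended to the whole type by composing
  with the projection \<open>nu\<close>. The summand \<open>v - nu v\<close> turns its critical point equation on the slice into an
  equation in the whole space, to which contraction and the inverse function theorem apply.\<close>

definition Bn :: "'e set" where "Bn = {v. nu v \<in> ball 0 r}"
definition E :: "'a \<Rightarrow> real \<Rightarrow> 'e \<Rightarrow> real" where "E u l v = hl l (act u (sg (nu v)))"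
definition Ah :: "'a \<Rightarrow> real \<Rightarrow> 'e \<Rightarrow> 'e" where "Ah u l v = nu (grad (E u l) v) + (v - nu v)"

lemma Bn: "open Bn" "0 \<in> Bn" "disc r \<subseteq> Bn"
proof -
  show "open Bn" unfolding Bn_def using smooth_on_vimage_open[OF smooth_nu open_UNIV open_ball, of 0 r] by simp
  show "0 \<in> Bn" using r linear_0[OF nu_linear] by (simp add: Bn_def)
  show "disc r \<subseteq> Bn" using disc_norm disc_nu by (auto simp: Bn_def)
qed

lemma sg_nu_plot: "plot M Bn (\<lambda>v. sg (nu v))"
  by (rule plot_compose[OF sg_plot smooth_nu Bn(1) _ Mc]) (simp add: Bn_def)

lemma E_smooth_joint:
  fixes c :: "'z::euclidean_space \<Rightarrow> 'a"
  assumes "plot GM S c"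
  shows "open (S \<times> \<Lambda> \<times> Bn)" "smooth_on UNIV (S \<times> \<Lambda> \<times> Bn) (\<lambda>q. E (c (fst q)) (fst (snd q)) (snd (snd q)))"
proof -
  show o: "open (S \<times> \<Lambda> \<times> Bn)" by (intro open_Times plot_open[OF assms] \<Lambda>(1) Bn(1))
  have f1: "smooth_on UNIV (S \<times> \<Lambda> \<times> Bn) (\<lambda>q. fst (snd q))"
    by (rule smooth_on_linear_compose[OF linear_fst smooth_on_snd o])
  have f2: "smooth_on UNIV (S \<times> \<Lambda> \<times> Bn) (\<lambda>q. snd (snd q))"
    by (rule smooth_on_linear_compose[OF linear_snd smooth_on_snd o])
  have "plot M (S \<times> \<Lambda> \<times> Bn) (\<lambda>q. act (c (fst q)) (sg (nu (snd (snd q)))))"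
  proof (rule act_plot)
    show "plot GM (S \<times> \<Lambda> \<times> Bn) (\<lambda>q. c (fst q))"
      by (rule plot_compose[OF assms smooth_on_fst o _ GM(2)]) auto
    show "plot M (S \<times> \<Lambda> \<times> Bn) (\<lambda>q. sg (nu (snd (snd q))))"
      by (rule plot_compose[OF sg_nu_plot f2 o _ Mc]) auto
  qed
  from hl_plot[OF this f1] show "smooth_on UNIV (S \<times> \<Lambda> \<times> Bn) (\<lambda>q. E (c (fst q)) (fst (snd q)) (snd (snd q)))"
    by (auto simp: E_def)
qed

lemma Ah_smooth_joint:
  fixes c :: "'z::euclidean_space \<Rightarrow> 'a"
  assumes "plot GM S c"
  shows "smooth_on UNIV (S \<times> \<Lambda> \<times> Bn) (\<lambda>q. Ah (c (fst q)) (fst (snd q)) (snd (snd q)))"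
proof -
  note o = E_smooth_joint(1)[OF assms]
  define F where "F q = E (c (fst q)) (fst (snd q)) (snd (snd q))" for q
  have Fs: "smooth_on UNIV (S \<times> \<Lambda> \<times> Bn) F" unfolding F_def[abs_def] by (rule E_smooth_joint(2)[OF assms])
  have e: "dir_deriv b (E u l) v = dir_deriv (0, 0, b) F (z, l, v)" if "u = c z" for b u l v z
    using that by (simp add: dir_deriv_def F_def)
  have f2: "smooth_on UNIV (S \<times> \<Lambda> \<times> Bn) (\<lambda>q. snd (snd q))"
    by (rule smooth_on_linear_compose[OF linear_snd smooth_on_snd o])
  have "smooth_on UNIV (S \<times> \<Lambda> \<times> Bn) (\<lambda>q. \<Sum>b\<in>Basis. dir_deriv (0, 0, b) F q *\<^sub>R (b::'e))"
    by (rule smooth_on_sum[OF smooth_on_scaleR[OF smooth_on_dir_deriv[OF Fs UNIV_I] smooth_on_const o] o])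
  then have "smooth_on UNIV (S \<times> \<Lambda> \<times> Bn) (\<lambda>q. nu (\<Sum>b\<in>Basis. dir_deriv (0, 0, b) F q *\<^sub>R b) + (snd (snd q) - nu (snd (snd q))))"
    by (intro smooth_on_add smooth_on_diff smooth_on_linear_compose[OF nu_linear _ o] f2 o)
  then show ?thesis
    by (rule smooth_on_cong[OF _ o]) (auto simp: Ah_def grad_def e)
qed

lemma E_smooth: "u \<in> carrier G \<Longrightarrow> l \<in> \<Lambda> \<Longrightarrow> smooth_on UNIV Bn (E u l)"
  unfolding E_def[abs_def] by (rule smooth_map_real_plot[OF Mc hl_map act_translate_plot[OF sg_nu_plot]])

lemma Ah_smooth:
  assumes "u \<in> carrier G" "l \<in> \<Lambda>" shows "smooth_on UNIV Bn (Ah u l)"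
proof -
  have "plot GM (UNIV :: real set) (\<lambda>_. u)" by (rule const_plot[OF open_UNIV assms(1)])
  from Ah_smooth_joint[OF this]
  have "smooth_on UNIV ((UNIV :: real set) \<times> \<Lambda> \<times> Bn) (\<lambda>q. Ah u (fst (snd q)) (snd (snd q)))" .
  from smooth_on_compose[OF this smooth_on_Pair[OF smooth_on_const smooth_on_Pair[OF smooth_on_const smooth_on_id]], of Bn 0 l] assms Bn(1) \<Lambda>(1)
  show ?thesis by (simp add: open_Times)
qed

lemma E_nu: "E u l (nu v) = E u l v"
  by (simp add: E_def nu_props(3))

lemma E_dir_nu:
  assumes "u \<in> carrier G" "l \<in> \<Lambda>" "v \<in> Bn" "nu v = v"
  shows "dir_deriv (nu x) (E u l) v = dir_deriv x (E u l) v"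
proof -
  have n: "(nu has_derivative nu) (at v)" using nu_linear by (simp add: bounded_linear_imp_has_derivative linear_conv_bounded_linear)
  have "(E u l has_derivative (\<lambda>x. dir_deriv x (E u l) v)) (at (nu v))"
    using smooth_on_has_derivative[OF E_smooth[OF assms(1,2)] Bn(1) assms(3)] assms(4) by simp
  from dir_deriv_chain[OF this n, of x] show ?thesis by (simp add: E_nu)
qed

text \<open>The two summands lie in complementary spaces, so both vanish. As \<open>nu\<close> need
  not be an orthogonal projection, a gradient \<open>g\<close> with \<open>nu g = 0\<close> is not
  zero at once; but \<open>E\<close> does not change along the kernel of \<open>nu\<close>, whence
  \<open>g \<bullet> g = g \<bullet> nu g = 0\<close>.\<close>

lemma Ah_zero_iff:
  assumes u: "u \<in> carrier G" "l \<in> \<Lambda>" and v: "v \<in> Bn"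
  shows "Ah u l v = 0 \<longleftrightarrow> nu v = v \<and> (\<forall>x. dir_deriv x (E u l) v = 0)"
proof
  assume 0: "Ah u l v = 0"
  have "nu (Ah u l v) = nu (nu (grad (E u l) v)) + (nu v - nu (nu v))"
    by (simp add: Ah_def linear_add[OF nu_linear] linear_diff[OF nu_linear])
  then have 1: "nu (grad (E u l) v) = 0" using 0 linear_0[OF nu_linear] by (simp add: nu_props(3))
  then have 2: "nu v = v" using 0 by (simp add: Ah_def)
  let ?g = "grad (E u l) v"
  note gi = grad_inner[OF E_smooth[OF u] Bn(1) v]
  have "?g \<bullet> ?g = dir_deriv (nu ?g) (E u l) v" using gi[of ?g] E_dir_nu[OF u v 2, of ?g] by simp
  also have "\<dots> = ?g \<bullet> nu ?g" using gi[of "nu ?g"] by simp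
  finally have "?g = 0" using 1 by simp
  then show "nu v = v \<and> (\<forall>x. dir_deriv x (E u l) v = 0)" using gi 2 by (metis inner_zero_left)
next
  assume 0: "nu v = v \<and> (\<forall>x. dir_deriv x (E u l) v = 0)"
  then show "Ah u l v = 0" using linear_0[OF nu_linear] by (simp add: Ah_def grad_def)
qed

lemma E_h0: "u \<in> carrier G \<Longrightarrow> v \<in> Bn \<Longrightarrow> E u 0 v = E \<one> 0 v"
  using plot_in[OF sg_nu_plot] by (simp add: E_def hl0 act_closed h_inv)

lemma Ah_h0: "u \<in> carrier G \<Longrightarrow> v \<in> Bn \<Longrightarrow> Ah u 0 v = Ah \<one> 0 v"
proof -
  assume u: "u \<in> carrier G" and v: "v \<in> Bn"
  have "dir_deriv b (E u 0) v = dir_deriv b (E \<one> 0) v" for b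
    by (rule dir_deriv_cong(1)[OF Bn(1) v E_h0[OF u]])
  then show ?thesis by (simp add: Ah_def grad_def)
qed

lemma E_H: "a \<in> H \<Longrightarrow> u \<in> carrier G \<Longrightarrow> l \<in> \<Lambda> \<Longrightarrow> v \<in> Bn \<Longrightarrow> E (a \<otimes> u) l v = E u l v"
  using plot_in[OF sg_nu_plot] by (simp add: E_def act_mult H_carrier hl_inv act_closed)

lemma E_H_deriv: "a \<in> H \<Longrightarrow> u \<in> carrier G \<Longrightarrow> l \<in> \<Lambda> \<Longrightarrow> v \<in> Bn \<Longrightarrow> dir_deriv x (E (a \<otimes> u) l) v = dir_deriv x (E u l) v"
  by (rule dir_deriv_cong(1)[OF Bn(1) _ E_H])

lemma Ah_H: "a \<in> H \<Longrightarrow> u \<in> carrier G \<Longrightarrow> l \<in> \<Lambda> \<Longrightarrow> v \<in> Bn \<Longrightarrow> Ah (a \<otimes> u) l v = Ah u l v"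
  by (simp add: Ah_def grad_def E_H_deriv)

lemma Ah_H_deriv: "a \<in> H \<Longrightarrow> u \<in> carrier G \<Longrightarrow> l \<in> \<Lambda> \<Longrightarrow> v \<in> Bn \<Longrightarrow> dir_deriv x (Ah (a \<otimes> u) l) v = dir_deriv x (Ah u l) v"
  by (rule dir_deriv_cong(1)[OF Bn(1) _ Ah_H])

section \<open>Nondegeneracy on the slice\<close>

definition hM :: "'e \<Rightarrow> real" where "hM y = h (psiM y)"

lemma h_smooth: "smooth_map M real_line h"
proof (rule smooth_map_flatI[OF Mc subset_UNIV UNIV_I])
  fix c assume c: "c \<in> atlas M"
  note p = plot_chart_param[OF M c]
  show "smooth_on UNIV (chart_dom c) (\<lambda>y. h (chart_param c y))"
    by (rule smooth_on_cong[OF smooth_map_real_plot[OF Mc hl_map[OF \<Lambda>(2)] p] plot_open[OF p]]) (rule hl0[OF plot_in[OF p]])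
qed

lemma hM_smooth: "smooth_on UNIV domM hM"
  unfolding hM_def[abs_def] by (rule smooth_map_real_plot[OF Mc h_smooth psiM_plot])

lemma hM_crit: "dir_deriv x hM pM = 0"
  unfolding hM_def[abs_def]
  by (rule critical_point_plot[OF M h_smooth _ psiM_plot pM(1,2)])
     (use nondeg in \<open>simp add: nondegenerate_critical_point_def\<close>)

text \<open>The range of \<open>nu\<close> is a complement of the orbit directions, so it is one of
  the subspaces to which the nondegeneracy assumption applies.\<close>

lemma hM_hess:
  assumes "\<And>y. nu y = y \<Longrightarrow> dir_deriv x (dir_deriv y hM) pM = 0" "nu x = x"
  shows "x = 0"
proof -
  let ?N = "range nu"
  have N: "w \<in> ?N \<longleftrightarrow> nu w = w" for w using nu_props(3) by (metis rangeE rangeI)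
  have sN: "subspace ?N" by (rule linear_subspace_image[OF nu_linear subspace_UNIV])
  have "complementary_subspaces (tangent_space M m) ?N (orbit_tangent_space G GM M act m)"
    unfolding complementary_subspaces_def orbit_tangent_space_eq VM_def[symmetric]
  proof (intro conjI sN subspace_TO)
    show "?N \<inter> TO = {0}"
    proof (intro equalityI subsetI)
      fix w assume "w \<in> ?N \<inter> TO"
      then have "ppi w = 0" "ppi w = w" using N nu_fixed ppi_id by auto
      then show "w \<in> {0}" by simp
    qed (use subspace_0[OF sN] subspace_0[OF subspace_TO] in auto)
    show "{a + b |a b. a \<in> ?N \<and> b \<in> TO} = VM"
    proof (intro equalityI subsetI)
      fix w assume "w \<in> {a + b |a b. a \<in> ?N \<and> b \<in> TO}"
      then show "w \<in> VM" using subspace_add[OF subspace_VM] nu_props(5) TO_VM by auto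
    next
      fix w assume "w \<in> VM"
      then have "w = nu w + ppi w" using lprojM(3) by (simp add: nu_def)
      then show "w \<in> {a + b |a b. a \<in> ?N \<and> b \<in> TO}" using ppi_TO by blast
    qed
  qed
  then have nd: "(\<forall>v\<in>?N. hessian M h m u v = 0) \<Longrightarrow> u = 0" if "u \<in> ?N" for u
    using nondeg that unfolding nondegenerate_critical_point_def by blast
  have hs: "hessian M h m x y = dir_deriv x (dir_deriv y hM) pM" if y: "nu y = y" for y
  proof -
    have xy: "lproj VM x = x" "lproj VM y = y" using assms(2) y nu_props(1) by metis+
    have pa: "param_at M m = inv_into UM phiM" by (simp add: param_at_def chart_m coord_at_def)
    define f where "f = h \<circ> param_at M m"
    have hf: "hM = (\<lambda>z. f (lproj VM z))"
      by (simp add: hM_def[abs_def] psiM_def chart_param_def chart_m f_def pa)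
    have d1: "dir_deriv y hM = (\<lambda>z. dir_deriv y f (lproj VM z))"
      unfolding hf dir_deriv_lproj[OF subspace_VM] xy ..
    have "dir_deriv x (dir_deriv y hM) pM = dir_deriv x (dir_deriv y f) pM"
      unfolding d1 dir_deriv_lproj[OF subspace_VM, of x "dir_deriv y f"] xy pM(3) ..
    then show ?thesis by (simp add: hessian_def f_def coord_at_def[of M] chart_m pM_def)
  qed
  show ?thesis
    by (rule nd) (use assms N hs in auto)
qed

text \<open>A change of parameters alters second derivatives by a term containing the first
  derivative of \<open>hM\<close>, which vanishes at the critical point. What remains is the Hessian
  in the directions given by \<open>nu\<close>, the differential of the extended slice.\<close>

lemma E0_second_deriv:
  "dir_deriv x (dir_deriv b (E \<one> 0)) 0 = dir_deriv (nu x) (dir_deriv (nu b) hM) pM"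
proof -
  define \<sigma> where "\<sigma> v = phiM (sg (nu v))" for v
  have al: "{z \<in> Bn. sg (nu z) \<in> UM} = Bn" using sg_UM by (auto simp: Bn_def)
  note pf = phiM_plot[OF sg_nu_plot, unfolded al, folded \<sigma>_def]
  have \<sigma>0: "\<sigma> 0 = pM" by (simp add: \<sigma>_def linear_0[OF nu_linear] sg0 pM_def)
  have \<sigma>dom: "\<sigma> v \<in> domM" if "v \<in> Bn" for v using psiM_phiM(2) sg_UM that by (simp add: \<sigma>_def Bn_def)
  have Eh: "E \<one> 0 v = hM (\<sigma> v)" if "v \<in> Bn" for v
    using plot_in[OF sg_nu_plot that] psiM_phiM(1)[of "sg (nu v)"] sg_UM that
    by (simp add: E_def hM_def \<sigma>_def act_one hl0 Bn_def)
  have \<sigma>d: "dir_deriv v \<sigma> 0 = nu v" for v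
  proof -
    have al2: "{z \<in> ball 0 r. sg z \<in> UM} = ball 0 r" using sg_UM by auto
    note pf2 = phiM_plot[OF sg_plot, unfolded al2]
    have "((\<lambda>w. phiM (sg w)) has_derivative (\<lambda>v. dir_deriv v (\<lambda>w. phiM (sg w)) 0)) (at (nu 0))"
      using smooth_on_has_derivative[OF pf2(2,1)] r linear_0[OF nu_linear] by simp
    moreover have "(nu has_derivative nu) (at 0)" using nu_linear by (simp add: bounded_linear_imp_has_derivative linear_conv_bounded_linear)
    ultimately have "dir_deriv v (\<lambda>v. phiM (sg (nu v))) 0 = dir_deriv (nu v) (\<lambda>w. phiM (sg w)) 0" by (rule dir_deriv_chain)
    then show ?thesis by (simp add: \<sigma>_def[abs_def] sg_deriv nu_props(1))
  qed
  have d1: "dir_deriv b (E \<one> 0) v = (\<Sum>e\<in>Basis. (dir_deriv b \<sigma> v \<bullet> e) *\<^sub>R dir_deriv e hM (\<sigma> v))" if v: "v \<in> Bn" for v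
  proof -
    have "dir_deriv b (E \<one> 0) v = dir_deriv b (\<lambda>v. hM (\<sigma> v)) v" by (rule dir_deriv_cong(1)[OF Bn(1) v Eh])
    also have "\<dots> = dir_deriv (dir_deriv b \<sigma> v) hM (\<sigma> v)"
      by (rule dir_deriv_compose[OF hM_smooth pf(2,1) open_domM v \<sigma>dom[OF v]])
    also have "\<dots> = (\<Sum>e\<in>Basis. (dir_deriv b \<sigma> v \<bullet> e) *\<^sub>R dir_deriv e hM (\<sigma> v))"
      by (rule smooth_on_dir_deriv_expand[OF hM_smooth open_domM \<sigma>dom[OF v]])
    finally show ?thesis .
  qed
  have dq: "((\<lambda>v. dir_deriv e hM (\<sigma> v)) has_derivative (\<lambda>x. dir_deriv (nu x) (dir_deriv e hM) pM)) (at 0)" for e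
  proof -
    have "((dir_deriv e hM) has_derivative (\<lambda>x. dir_deriv x (dir_deriv e hM) pM)) (at (\<sigma> 0))"
      unfolding \<sigma>0 by (rule smooth_on_has_derivative[OF smooth_on_dir_deriv[OF hM_smooth UNIV_I] open_domM pM(1)])
    from diff_chain_at[OF smooth_on_has_derivative[OF pf(2,1) Bn(2)] this]
    show ?thesis by (simp add: comp_def \<sigma>d)
  qed
  have dp: "((\<lambda>v. dir_deriv b \<sigma> v \<bullet> e) has_derivative (\<lambda>x. dir_deriv x (dir_deriv b \<sigma>) 0 \<bullet> e)) (at 0)" for e
    by (rule has_derivative_inner_left[OF smooth_on_has_derivative[OF smooth_on_dir_deriv[OF pf(2) UNIV_I] pf(1) Bn(2)]])
  have "((\<lambda>v. \<Sum>e\<in>Basis. (dir_deriv b \<sigma> v \<bullet> e) *\<^sub>R dir_deriv e hM (\<sigma> v)) has_derivative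
     (\<lambda>x. \<Sum>e\<in>Basis. (dir_deriv b \<sigma> 0 \<bullet> e) *\<^sub>R dir_deriv (nu x) (dir_deriv e hM) pM + (dir_deriv x (dir_deriv b \<sigma>) 0 \<bullet> e) *\<^sub>R dir_deriv e hM (\<sigma> 0))) (at 0)"
    by (intro has_derivative_sum has_derivative_scaleR dp dq)
  note hd = this
  have "dir_deriv x (\<lambda>v. \<Sum>e\<in>Basis. (dir_deriv b \<sigma> v \<bullet> e) *\<^sub>R dir_deriv e hM (\<sigma> v)) 0 = (\<Sum>e\<in>Basis. (nu b \<bullet> e) *\<^sub>R dir_deriv (nu x) (dir_deriv e hM) pM)"
    unfolding has_derivative_dir_deriv[OF hd] by (simp add: \<sigma>0 hM_crit \<sigma>d)
  also have "\<dots> = dir_deriv (nu x) (dir_deriv (nu b) hM) pM"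
  proof -
    have "dir_deriv (nu x) (dir_deriv (nu b) hM) pM = dir_deriv (nu x) (\<lambda>z. \<Sum>e\<in>Basis. (nu b \<bullet> e) *\<^sub>R dir_deriv e hM z) pM"
      by (rule dir_deriv_cong(1)[OF open_domM pM(1)]) (rule smooth_on_dir_deriv_expand[OF hM_smooth open_domM])
    also have "\<dots> = (\<Sum>e\<in>Basis. (nu b \<bullet> e) *\<^sub>R dir_deriv (nu x) (dir_deriv e hM) pM)"
      by (rule has_derivative_dir_deriv) (intro has_derivative_sum has_derivative_scaleR_right
          smooth_on_has_derivative[OF smooth_on_dir_deriv[OF hM_smooth UNIV_I] open_domM pM(1)])
    finally show ?thesis by (rule sym)
  qed
  finally have "dir_deriv x (\<lambda>v. \<Sum>e\<in>Basis. (dir_deriv b \<sigma> v \<bullet> e) *\<^sub>R dir_deriv e hM (\<sigma> v)) 0 = dir_deriv (nu x) (dir_deriv (nu b) hM) pM" .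
  moreover have "dir_deriv x (dir_deriv b (E \<one> 0)) 0 = dir_deriv x (\<lambda>v. \<Sum>e\<in>Basis. (dir_deriv b \<sigma> v \<bullet> e) *\<^sub>R dir_deriv e hM (\<sigma> v)) 0"
    by (rule dir_deriv_cong(1)[OF Bn(1,2)]) (rule d1)
  ultimately show ?thesis by (rule trans[rotated])
qed

definition Lh :: "'e \<Rightarrow> 'e" where "Lh x = dir_deriv x (Ah \<one> 0) 0"

text \<open>The linearised equation in block form: the Hessian form on the range of
  \<open>nu\<close>, the identity on the kernel.\<close>

lemma Lh_eq: "Lh x = nu (\<Sum>b\<in>Basis. dir_deriv (nu x) (dir_deriv (nu b) hM) pM *\<^sub>R b) + (x - nu x)"
proof -
  have sm: "smooth_on UNIV Bn (E \<one> 0)" using E_smooth \<Lambda>(2) by simp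
  have nb: "bounded_linear nu" using nu_linear by (simp add: linear_conv_bounded_linear)
  have "((\<lambda>v. nu (\<Sum>b\<in>Basis. dir_deriv b (E \<one> 0) v *\<^sub>R b) + (v - nu v)) has_derivative
    (\<lambda>x. nu (\<Sum>b\<in>Basis. dir_deriv x (dir_deriv b (E \<one> 0)) 0 *\<^sub>R b) + (x - nu x))) (at 0)"
    by (intro has_derivative_add has_derivative_diff has_derivative_ident bounded_linear.has_derivative[OF nb] has_derivative_sum
      has_derivative_scaleR_left smooth_on_has_derivative[OF smooth_on_dir_deriv[OF sm UNIV_I] Bn(1,2)])
  from has_derivative_dir_deriv[OF this] show ?thesis
    by (simp add: Lh_def Ah_def[abs_def] grad_def E0_second_deriv)
qed

lemma Lh_linear: "linear Lh"
  unfolding Lh_def[abs_def]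
  by (rule bounded_linear.linear[OF smooth_on_dir_deriv_linear[OF Ah_smooth Bn(1,2)]]) (use \<Lambda>(2) in auto)

text \<open>Splitting as in \<open>Ah_zero_iff\<close> gives \<open>nu x = x\<close> and
  \<open>nu a = 0\<close>, where \<open>a\<close> represents the Hessian form paired with
  \<open>x\<close>. That form sees only \<open>nu\<close> of its argument, so
  \<open>a \<bullet> a = a \<bullet> nu a = 0\<close>, and nondegeneracy applies.\<close>

lemma Lh_inj: "Lh x = 0 \<Longrightarrow> x = 0"
proof -
  assume 0: "Lh x = 0"
  define a where "a = (\<Sum>b\<in>Basis. dir_deriv (nu x) (dir_deriv (nu b) hM) pM *\<^sub>R b)"
  have "nu (Lh x) = nu (nu a) + (nu x - nu (nu x))"
    unfolding Lh_eq a_def by (simp only: linear_add[OF nu_linear] linear_diff[OF nu_linear])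
  then have na: "nu a = 0" using 0 linear_0[OF nu_linear] by (simp add: nu_props(3))
  then have nx: "nu x = x" using 0 unfolding Lh_eq a_def[symmetric] by simp
  have ai: "a \<bullet> y = dir_deriv x (dir_deriv (nu y) hM) pM" for y
  proof -
    have hmd: "linear (\<lambda>w. dir_deriv x (dir_deriv w hM) pM)"
    proof -
      have "dir_deriv x (dir_deriv w hM) pM = (\<Sum>e\<in>Basis. (w \<bullet> e) *\<^sub>R dir_deriv x (dir_deriv e hM) pM)" for w
      proof -
        have "dir_deriv x (dir_deriv w hM) pM = dir_deriv x (\<lambda>z. \<Sum>e\<in>Basis. (w \<bullet> e) *\<^sub>R dir_deriv e hM z) pM"
          by (rule dir_deriv_cong(1)[OF open_domM pM(1)]) (rule smooth_on_dir_deriv_expand[OF hM_smooth open_domM])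
        also have "\<dots> = (\<Sum>e\<in>Basis. (w \<bullet> e) *\<^sub>R dir_deriv x (dir_deriv e hM) pM)"
          by (rule has_derivative_dir_deriv) (intro has_derivative_sum has_derivative_scaleR_right
              smooth_on_has_derivative[OF smooth_on_dir_deriv[OF hM_smooth UNIV_I] open_domM pM(1)])
        finally show ?thesis .
      qed
      then have e: "(\<lambda>w. dir_deriv x (dir_deriv w hM) pM) = (\<lambda>w. \<Sum>e\<in>Basis. (w \<bullet> e) *\<^sub>R dir_deriv x (dir_deriv e hM) pM)"
        by (rule ext)
      have "linear (\<lambda>w. \<Sum>e\<in>Basis. (w \<bullet> e) *\<^sub>R dir_deriv x (dir_deriv e hM) pM)"
        by (rule linear_compose_sum) (auto simp: linear_iff inner_add_left distrib_right)
      then show ?thesis by (rule ssubst[OF e])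
    qed
    have "a \<bullet> y = (\<Sum>b\<in>Basis. (y \<bullet> b) * dir_deriv x (dir_deriv (nu b) hM) pM)"
      unfolding a_def nx inner_sum_left inner_scaleR_left by (intro sum.cong refl) (simp add: inner_commute[of y])
    also have "\<dots> = dir_deriv x (dir_deriv (nu (\<Sum>b\<in>Basis. (y \<bullet> b) *\<^sub>R b)) hM) pM"
      by (simp only: linear_sum[OF nu_linear] linear_scale[OF nu_linear] linear_sum[OF hmd] linear_scale[OF hmd] real_scaleR_def)
    also have "(\<Sum>b\<in>Basis. (y \<bullet> b) *\<^sub>R b) = y" by (rule euclidean_representation)
    finally show ?thesis .
  qed
  have "a \<bullet> a = a \<bullet> nu a" unfolding ai nu_props(3) ..
  then have "a = 0" using na by simp
  then have "dir_deriv x (dir_deriv y hM) pM = 0" if "nu y = y" for y using ai[of y] that by simp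
  then show "x = 0" by (rule hM_hess[OF _ nx])
qed

end

context slice_pert begin

section \<open>Critical points along the slices\<close>

text \<open>For \<open>l = 0\<close> the maps \<open>Ah u 0\<close> all coincide because
  \<open>h\<close> is invariant under \<open>G\<close>. A tube around the compact ball of
  \<open>v\<close> then keeps values and first derivatives close for \<open>u\<close> near
  \<open>u0\<close> and \<open>l\<close> near \<open>0\<close>.\<close>

lemma near_estimate:
  assumes \<kappa>: "\<kappa> > 0" and \<eta>: "0 < \<eta>" "cball 0 \<eta> \<subseteq> Bn" and u0: "u0 \<in> carrier G"
  shows "\<exists>B0 \<delta>. openin (topo GM) B0 \<and> u0 \<in> B0 \<and> \<delta> > 0 \<and> (\<forall>u\<in>B0. \<forall>l. \<bar>l\<bar> < \<delta> \<longrightarrow> l \<in> \<Lambda> \<and>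
    (\<forall>v\<in>cball 0 \<eta>. norm (Ah u l v - Ah \<one> 0 v) < \<kappa> \<and>
      (\<forall>b\<in>Basis. norm (dir_deriv b (Ah u l) v - dir_deriv b (Ah \<one> 0) v) < \<kappa>)))"
proof -
  obtain U V \<phi> where ch: "(U, V, \<phi>) \<in> atlas GM" "u0 \<in> U" by (rule charted_obtain[OF GM(2)]) (use u0 GM(3) in auto)
  note tc = chartedD[OF GM(2) ch(1)]
  define c where "c = chart_param (U, V, \<phi>)"
  define S where "S = chart_dom (U, V, \<phi>)"
  have cp: "plot GM S c" unfolding c_def S_def by (rule plot_chart_param[OF GM(1) ch(1)])
  have u0': "\<phi> u0 \<in> S" "c (\<phi> u0) = u0" using chart_dom_chart_param(1,2)[OF tc ch(2)] by (auto simp: c_def S_def)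
  define D where "D = S \<times> \<Lambda> \<times> Bn"
  have oD: "open D" using E_smooth_joint(1)[OF cp] by (simp add: D_def)
  define F where "F q = Ah (c (fst q)) (fst (snd q)) (snd (snd q))" for q
  have F: "smooth_on UNIV D F" unfolding F_def[abs_def] D_def by (rule Ah_smooth_joint[OF cp])
  have dF: "dir_deriv b (Ah (c z) l) v = dir_deriv (0, 0, b) F (z, l, v)" for b z l v by (simp add: dir_deriv_def F_def)
  have A0: "smooth_on UNIV Bn (Ah \<one> 0)" using Ah_smooth \<Lambda>(2) by simp
  have f2: "smooth_on UNIV D (\<lambda>q. snd (snd q))"
    by (rule smooth_on_linear_compose[OF linear_snd smooth_on_snd oD])
  have d1: "smooth_on UNIV D (\<lambda>q. F q - Ah \<one> 0 (snd (snd q)))"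
    by (rule smooth_on_diff[OF F smooth_on_compose[OF A0 f2 oD Bn(1)] oD]) (auto simp: D_def)
  have d2: "smooth_on UNIV D (\<lambda>q. dir_deriv (0, 0, b) F q - dir_deriv b (Ah \<one> 0) (snd (snd q)))" for b
    by (rule smooth_on_diff[OF smooth_on_dir_deriv[OF F UNIV_I] smooth_on_compose[OF smooth_on_dir_deriv[OF A0 UNIV_I] f2 oD Bn(1)] oD]) (auto simp: D_def)
  define W where "W = {q\<in>D. F q - Ah \<one> 0 (snd (snd q)) \<in> ball 0 \<kappa>} \<inter>
    (\<Inter>b\<in>Basis. {q\<in>D. dir_deriv (0, 0, b) F q - dir_deriv b (Ah \<one> 0) (snd (snd q)) \<in> ball 0 \<kappa>})"
  have oW: "open W" unfolding W_def
    by (intro open_Int open_INT ballI smooth_on_vimage_open[OF d1 oD] smooth_on_vimage_open[OF d2 oD]) auto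
  have W0: "(\<phi> u0, 0, v) \<in> W" if v: "v \<in> cball 0 \<eta>" for v
  proof -
    have vB: "v \<in> Bn" using v \<eta>(2) by blast
    have "dir_deriv b (Ah u0 0) v = dir_deriv b (Ah \<one> 0) v" for b
      by (rule dir_deriv_cong(1)[OF Bn(1) vB Ah_h0[OF u0]])
    then show ?thesis using \<kappa> vB u0' \<Lambda>(2) Ah_h0[OF u0 vB] dF[of _ "\<phi> u0" 0 v]
      by (auto simp: W_def D_def F_def)
  qed
  \<comment> \<open>The variables are reordered so that the compact one comes first, as in
    \<open>tube_lemma\<close>.\<close>
  define W' where "W' = {p. (fst (snd p), snd (snd p), fst p) \<in> W}"
  have oW': "open W'"
  proof -
    have "continuous_on UNIV (\<lambda>p. (fst (snd p), snd (snd p), fst p))" by (intro continuous_intros)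
    from open_vimage[OF oW this] show ?thesis by (simp add: W'_def vimage_def)
  qed
  obtain X0 where X0: "openin (top_of_set UNIV) X0" "(\<phi> u0, 0) \<in> X0" "cball (0::'e) \<eta> \<times> X0 \<subseteq> (cball 0 \<eta> \<times> UNIV) \<inter> W'"
  proof (rule tube_lemma[of "cball (0::'e) \<eta>" "(\<phi> u0, 0)" "(cball 0 \<eta> \<times> UNIV) \<inter> W'" UNIV])
    show "cball 0 \<eta> \<noteq> ({}::'e set)" using \<eta>(1) by simp
    show "(\<lambda>x. (x, \<phi> u0, 0)) ` cball 0 \<eta> \<subseteq> cball 0 \<eta> \<times> UNIV \<inter> W'" using W0 by (auto simp: W'_def)
    show "openin (top_of_set (cball 0 \<eta> \<times> UNIV)) (cball 0 \<eta> \<times> UNIV \<inter> W')" by (rule openin_open_Int[OF oW'])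
  qed auto
  then have "open X0" by simp
  from open_prod_elim[OF this X0(2)] obtain A B where AB: "open A" "open B" "(\<phi> u0, 0) \<in> A \<times> B" "A \<times> B \<subseteq> X0" by blast
  obtain \<delta> where \<delta>: "\<delta> > 0" "ball 0 \<delta> \<subseteq> B" using AB(2,3) open_contains_ball by blast
  define O' where "O' = {x \<in> U. \<phi> x \<in> A}"
  have "openin (topo GM) O'" unfolding O'_def by (rule topological_chart_vimage_openin[OF tc AB(1)])
  moreover have "u0 \<in> O'" using ch(2) AB(3) by (simp add: O'_def)
  moreover have "l \<in> \<Lambda> \<and> (\<forall>v\<in>cball 0 \<eta>. norm (Ah u l v - Ah \<one> 0 v) < \<kappa> \<and>
      (\<forall>b\<in>Basis. norm (dir_deriv b (Ah u l) v - dir_deriv b (Ah \<one> 0) v) < \<kappa>))" if u: "u \<in> O'" and l: "\<bar>l\<bar> < \<delta>" for u l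
  proof -
    have uU: "u \<in> U" "c (\<phi> u) = u" using u chart_dom_chart_param(2)[OF tc] by (auto simp: O'_def c_def)
    have "l \<in> B" using l \<delta>(2) by auto
    then have "(\<phi> u, l) \<in> X0" using u AB(4) by (auto simp: O'_def)
    then have w: "(\<phi> u, l, v) \<in> W" if "v \<in> cball 0 \<eta>" for v
      using subsetD[OF X0(3), of "(v, \<phi> u, l)"] that by (auto simp: W'_def)
    have "(\<phi> u, l, 0) \<in> D" using w[of 0] \<eta>(1) by (simp add: W_def)
    then have "l \<in> \<Lambda>" by (simp add: D_def)
    moreover have "norm (Ah u l v - Ah \<one> 0 v) < \<kappa> \<and>
      (\<forall>b\<in>Basis. norm (dir_deriv b (Ah u l) v - dir_deriv b (Ah \<one> 0) v) < \<kappa>)" if v: "v \<in> cball 0 \<eta>" for v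
      using w[OF v] dF[of _ "\<phi> u" l v] by (auto simp: W_def F_def uU(2))
    ultimately show ?thesis by blast
  qed
  ultimately show ?thesis using \<delta>(1) by blast
qed

text \<open>\<open>G\<close> need not be compact, but \<open>P\<close> passes along the right cosets
  of \<open>H\<close>. Finitely many of the neighbourhoods have images covering the compact space of
  cosets, and the least of their bounds serves all of \<open>G\<close>.\<close>

lemma cocompact_uniform:
  assumes loc: "\<And>u0. u0 \<in> carrier G \<Longrightarrow> \<exists>B0 \<delta>. openin (topo GM) B0 \<and> u0 \<in> B0 \<and> (\<delta>::real) > 0 \<and> (\<forall>u\<in>B0. \<forall>l. \<bar>l\<bar> < \<delta> \<longrightarrow> P u l)"
    and inv: "\<And>a u l. a \<in> H \<Longrightarrow> u \<in> carrier G \<Longrightarrow> P u l \<Longrightarrow> P (a \<otimes> u) (l::real)"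
  shows "\<exists>\<delta>>0. \<forall>l. \<bar>l\<bar> < \<delta> \<longrightarrow> (\<forall>u\<in>carrier G. P u l)"
proof -
  let ?p = "\<lambda>a. H #> a" and ?X = "quotient_topology (topo GM) (\<lambda>a. H #> a)"
  have Xt: "topspace ?X = ?p ` carrier G"
    using quotient_imp_surjective_map[OF quotient_map_quotient_topology[of "topo GM" ?p]] GM(3) by simp
  define Q where "Q B0 \<delta> \<longleftrightarrow> openin (topo GM) B0 \<and> (\<delta>::real) > 0 \<and> (\<forall>u\<in>B0. \<forall>l. \<bar>l\<bar> < \<delta> \<longrightarrow> P u l)" for B0 \<delta>
  define \<O> where "\<O> = {B0. \<exists>\<delta>. Q B0 \<delta>}"
  \<comment> \<open>The projection to the cosets is open: the saturation of an open set is the union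
    of its preimages under left translations by elements of \<open>H\<close>.\<close>
  have op: "openin ?X (?p ` B0)" if B0: "openin (topo GM) B0" for B0
    unfolding openin_quotient_topology
  proof (intro conjI)
    have Oc: "B0 \<subseteq> carrier G" using openin_subset[OF B0] GM(3) by simp
    then show "?p ` B0 \<subseteq> ?p ` topspace (topo GM)" using GM(3) by blast
    have "{x \<in> topspace (topo GM). ?p x \<in> ?p ` B0} = (\<Union>a\<in>H. {x \<in> topspace (topo GM). a \<otimes> x \<in> B0})"
    proof (intro equalityI subsetI)
      fix x assume "x \<in> {x \<in> topspace (topo GM). ?p x \<in> ?p ` B0}"
      then obtain y where y: "x \<in> carrier G" "y \<in> B0" "?p x = ?p y" using GM(3) by auto
      have "y \<in> ?p y" using rcos_self[OF _ H(1)] y(2) Oc by blast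
      then have "y \<in> ?p x" using y(3) by simp
      then obtain a where "a \<in> H" "y = a \<otimes> x" by (auto simp: r_coset_def)
      then show "x \<in> (\<Union>a\<in>H. {x \<in> topspace (topo GM). a \<otimes> x \<in> B0})" using y GM(3) by auto
    next
      fix x assume "x \<in> (\<Union>a\<in>H. {x \<in> topspace (topo GM). a \<otimes> x \<in> B0})"
      then obtain a where a: "a \<in> H" "x \<in> carrier G" "a \<otimes> x \<in> B0" using GM(3) by auto
      have "?p (a \<otimes> x) = ?p x"
        using coset_mult_assoc[OF subgroup.subset[OF H(1)] H_carrier[OF a(1)] a(2)] coset_join2[OF H_carrier[OF a(1)] H(1) a(1)] by simp
      then show "x \<in> {x \<in> topspace (topo GM). ?p x \<in> ?p ` B0}" using a(2) imageI[OF a(3), of ?p] GM(3) by simp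
    qed
    moreover have "openin (topo GM) {x \<in> topspace (topo GM). a \<otimes> x \<in> B0}" if a: "a \<in> H" for a
    proof (rule openin_continuous_map_preimage[OF _ B0])
      have "continuous_map (topo GM) (prod_topology (topo GM) (topo GM)) (\<lambda>x. (a, x))"
        using H_carrier[OF a] GM(3) by (simp add: continuous_map_pairwise comp_def)
      from continuous_map_compose[OF this mult_continuous]
      show "continuous_map (topo GM) (topo GM) (\<lambda>x. a \<otimes> x)" by (simp add: comp_def)
    qed
    ultimately show "openin (topo GM) {x \<in> topspace (topo GM). ?p x \<in> ?p ` B0}" by auto
  qed
  have "\<exists>\<F>. finite \<F> \<and> \<F> \<subseteq> (\<lambda>B0. ?p ` B0) ` \<O> \<and> ?p ` carrier G \<subseteq> \<Union>\<F>"
  proof (rule compactinD)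
    show "compactin ?X (?p ` carrier G)" using H(2) Xt by (simp add: compact_space_def)
    show "openin ?X W" if "W \<in> (\<lambda>B0. ?p ` B0) ` \<O>" for W using that op by (auto simp: \<O>_def Q_def)
    show "?p ` carrier G \<subseteq> \<Union>((\<lambda>B0. ?p ` B0) ` \<O>)"
    proof
      fix C assume "C \<in> ?p ` carrier G"
      then obtain u where u: "u \<in> carrier G" "C = ?p u" by blast
      obtain B0 \<delta> where "openin (topo GM) B0 \<and> u \<in> B0 \<and> (\<delta>::real) > 0 \<and> (\<forall>u\<in>B0. \<forall>l. \<bar>l\<bar> < \<delta> \<longrightarrow> P u l)"
        using loc[OF u(1)] by blast
      then have "B0 \<in> \<O>" "C \<in> ?p ` B0" using u(2) by (auto simp: \<O>_def Q_def)
      then show "C \<in> \<Union>((\<lambda>B0. ?p ` B0) ` \<O>)" by blast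
    qed
  qed
  then obtain \<F> where F0: "finite \<F>" "\<F> \<subseteq> (\<lambda>B0. ?p ` B0) ` \<O>" "?p ` carrier G \<subseteq> \<Union>\<F>" by blast
  obtain \<G> where G0: "\<G> \<subseteq> \<O>" "finite \<G>" "\<F> = (\<lambda>B0. ?p ` B0) ` \<G>" using finite_subset_image[OF F0(1,2)] by blast
  define \<delta> where "\<delta> B0 = (SOME \<delta>. Q B0 \<delta>)" for B0
  have \<delta>: "Q B0 (\<delta> B0)" if "B0 \<in> \<G>" for B0
    unfolding \<delta>_def by (rule someI_ex) (use G0(1) that in \<open>auto simp: \<O>_def\<close>)
  define d0 where "d0 = Min (insert 1 (\<delta> ` \<G>))"
  have "d0 > 0" unfolding d0_def using G0(2) \<delta> by (auto simp: Q_def)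
  moreover have "P u l" if l: "\<bar>l\<bar> < d0" and u: "u \<in> carrier G" for l u
  proof -
    obtain B0 where B0: "B0 \<in> \<G>" "?p u \<in> ?p ` B0" using F0(3) G0(3) u by blast
    then obtain y where y: "y \<in> B0" "?p u = ?p y" by blast
    have Q: "Q B0 (\<delta> B0)" using \<delta>[OF B0(1)] .
    have yc: "y \<in> carrier G" using Q y(1) openin_subset[of "topo GM" B0] GM(3) by (auto simp: Q_def)
    have "u \<in> ?p u" using rcos_self[OF u H(1)] .
    then have "u \<in> ?p y" using y(2) by simp
    then obtain a where a: "a \<in> H" "u = a \<otimes> y" by (auto simp: r_coset_def)
    have "d0 \<le> \<delta> B0" unfolding d0_def using G0(2) B0(1) by (intro Min_le) auto
    then have "P y l" using Q y(1) l by (simp add: Q_def)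
    then show ?thesis using inv[OF a(1) yc] a(2) by simp
  qed
  ultimately show ?thesis by blast
qed

lemma Ah_base: "Ah \<one> 0 0 = 0"
proof -
  have "dir_deriv x (E \<one> 0) 0 = 0" for x
  proof -
    have "dir_deriv x (E \<one> 0) 0 = dir_deriv x (\<lambda>v. h (sg (nu v))) 0"
      by (rule dir_deriv_cong(1)[OF Bn(1,2)]) (use plot_in[OF sg_nu_plot] in \<open>simp add: E_def act_one hl0\<close>)
    also have "\<dots> = 0"
      by (rule critical_point_plot[OF M h_smooth _ sg_nu_plot Bn(2)])
        (use nondeg linear_0[OF nu_linear] sg0 in \<open>auto simp: nondegenerate_critical_point_def\<close>)
    finally show ?thesis .
  qed
  then show ?thesis using Ah_zero_iff[OF one_closed \<Lambda>(2) Bn(2)] linear_0[OF nu_linear] by simp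
qed

text \<open>Existence comes from the ball of radius \<open>\<rho>\<close>, whose vectors fixed by
  \<open>nu\<close> lie in \<open>disc r'\<close>; uniqueness from the ball of radius
  \<open>r'\<close>, which contains \<open>disc r'\<close>. Two radii appear because the invariant
  norm and the Euclidean one are only comparable.\<close>

lemma slice_zero_unique:
  obtains r' \<delta> where "0 < r'" "r' \<le> r" "\<delta> > 0" "\<And>l. \<bar>l\<bar> < \<delta> \<Longrightarrow> l \<in> \<Lambda>"
    "\<And>l u. \<bar>l\<bar> < \<delta> \<Longrightarrow> u \<in> carrier G \<Longrightarrow> \<exists>!v. v \<in> disc r' \<and> Ah u l v = 0"
    "\<And>l u v x. \<bar>l\<bar> < \<delta> \<Longrightarrow> u \<in> carrier G \<Longrightarrow> v \<in> disc r' \<Longrightarrow> dir_deriv x (Ah u l) v = 0 \<Longrightarrow> x = 0"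
proof -
  have "inj Lh" using Lh_inj Lh_linear by (simp add: linear_injective_0)
  from linear_injective_isomorphism[OF Lh_linear this]
  obtain R where R: "linear R" "\<And>x. R (Lh x) = x" "\<And>x. Lh (R x) = x" by auto
  obtain C where C: "C > 0" "\<And>x. norm (R x) \<le> C * norm x" using linear_bounded_pos[OF R(1)] by blast
  have R0: "R x = 0 \<Longrightarrow> x = 0" for x using R(3)[of x] linear_0[OF Lh_linear] by simp
  \<comment> \<open>Fitted to the contraction condition of \<open>perturbed_zero\<close>. Half of it
    is spent on moving \<open>v\<close> away from \<open>0\<close>, the other half on changing
    \<open>u\<close> and \<open>l\<close>.\<close>
  define \<kappa> where "\<kappa> = 1 / (2 * C * DIM('e))"
  have \<kappa>: "\<kappa> > 0" "C * (DIM('e) * \<kappa>) \<le> 1 / 2" using C(1) by (auto simp: \<kappa>_def)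
  have A0: "smooth_on UNIV Bn (Ah \<one> 0)" using Ah_smooth \<Lambda>(2) by simp
  define N where "N = Bn \<inter> (\<Inter>b\<in>Basis. {v\<in>Bn. dir_deriv b (Ah \<one> 0) v \<in> ball (Lh b) (\<kappa> / 2)})"
  have "open N" unfolding N_def
    by (intro open_Int open_INT ballI Bn(1) smooth_on_vimage_open[OF smooth_on_dir_deriv[OF A0 UNIV_I] Bn(1)]) auto
  moreover have "0 \<in> N" using Bn(2) \<kappa>(1) by (auto simp: N_def Lh_def)
  ultimately obtain \<eta> where \<eta>: "\<eta> > 0" "cball 0 \<eta> \<subseteq> N" using open_contains_cball by blast
  define r' where "r' = min \<eta> r"
  have r': "0 < r'" "r' \<le> r" "cball 0 r' \<subseteq> N" using \<eta> r by (auto simp: r'_def)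
  have r'B: "cball 0 r' \<subseteq> Bn" using r'(3) by (auto simp: N_def)
  have near0: "norm (dir_deriv b (Ah \<one> 0) v - Lh b) < \<kappa> / 2" if "v \<in> cball 0 r'" "b \<in> Basis" for v b
    using r'(3) that by (auto simp: N_def dist_norm norm_minus_commute subset_iff)
  obtain C1 where C1: "C1 \<ge> 0" "\<And>k v. k \<in> K \<Longrightarrow> norm (rho k v) \<le> C1 * norm v" using rho_bound by blast
  \<comment> \<open>\<open>C1\<close> compares the invariant norm with the Euclidean one, so that
    \<open>C1 * \<rho> < r'\<close> puts the short vectors fixed by \<open>nu\<close> into
    \<open>disc r'\<close>.\<close>
  define \<rho> where "\<rho> = r' / (2 * (C1 + 1))"
  have \<rho>: "\<rho> > 0" using r' C1 by (simp add: \<rho>_def)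
  have \<rho>2: "2 * (C1 + 1) * \<rho> = r'" using C1 by (simp add: \<rho>_def)
  have "0 \<le> C1 * \<rho>" using C1(1) \<rho> by simp
  then have \<rho>3: "\<rho> \<le> r'" "C1 * \<rho> < r'" using \<rho>2 \<rho> r'(1) by (auto simp: algebra_simps)
  have disc\<rho>: "v \<in> disc r'" if v: "v \<in> cball 0 \<rho>" "nu v = v" for v
  proof -
    have "pn v \<le> C1 * \<rho>"
      by (rule pn_le) (use C1 v(1) in \<open>auto intro: order_trans[OF C1(2)] mult_left_mono\<close>)
    then show ?thesis using v(2) \<rho>3(2) by (simp add: disc_def)
  qed
  have disc_cball: "v \<in> cball 0 r'" if "v \<in> disc r'" for v using disc_norm[OF that] by simp
  \<comment> \<open>The first bound is the half of \<open>\<kappa>\<close> left for the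
    perturbation. The second keeps the defect \<open>Ah u l 0\<close>, which is zero for the
    unperturbed map, small enough to find a zero within \<open>\<rho>\<close>.\<close>
  define \<kappa>' where "\<kappa>' = min (\<kappa> / 2) (\<rho> / (2 * C))"
  have \<kappa>': "\<kappa>' > 0" "\<kappa>' \<le> \<kappa> / 2" "C * \<kappa>' \<le> \<rho> / 2"
  proof -
    show "\<kappa>' > 0" "\<kappa>' \<le> \<kappa> / 2" using \<kappa> \<rho> C(1) by (auto simp: \<kappa>'_def)
    have "C * \<kappa>' \<le> C * (\<rho> / (2 * C))" using C(1) by (intro mult_left_mono) (auto simp: \<kappa>'_def)
    then show "C * \<kappa>' \<le> \<rho> / 2" using C(1) by simp
  qed
  define P where "P u l \<longleftrightarrow> l \<in> \<Lambda> \<and> (\<forall>v\<in>cball 0 r'. norm (Ah u l v - Ah \<one> 0 v) < \<kappa>' \<and>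
      (\<forall>b\<in>Basis. norm (dir_deriv b (Ah u l) v - dir_deriv b (Ah \<one> 0) v) < \<kappa>'))" for u l
  have "\<exists>\<delta>>0. \<forall>l. \<bar>l\<bar> < \<delta> \<longrightarrow> (\<forall>u\<in>carrier G. P u l)"
  proof (rule cocompact_uniform)
    show "\<exists>B0 \<delta>. openin (topo GM) B0 \<and> u0 \<in> B0 \<and> (\<delta>::real) > 0 \<and> (\<forall>u\<in>B0. \<forall>l. \<bar>l\<bar> < \<delta> \<longrightarrow> P u l)" if "u0 \<in> carrier G" for u0
      unfolding P_def by (rule near_estimate[OF \<kappa>'(1) r'(1) r'B that])
    show "P (a \<otimes> u) l" if "a \<in> H" "u \<in> carrier G" "P u l" for a u l
      using that r'B by (auto simp: P_def Ah_H Ah_H_deriv subset_iff simp del: mem_cball)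
  qed
  then obtain \<delta> where \<delta>: "\<delta> > 0" "\<And>l u. \<bar>l\<bar> < \<delta> \<Longrightarrow> u \<in> carrier G \<Longrightarrow> P u l" by blast
  have l\<Lambda>: "l \<in> \<Lambda>" if "\<bar>l\<bar> < \<delta>" for l using \<delta>(2)[OF that one_closed] by (simp add: P_def)
  have near: "norm (dir_deriv b (Ah u l) v - Lh b) \<le> \<kappa>" if "\<bar>l\<bar> < \<delta>" "u \<in> carrier G" "v \<in> cball 0 r'" "b \<in> Basis" for l u v b
  proof -
    have "norm (dir_deriv b (Ah u l) v - dir_deriv b (Ah \<one> 0) v) < \<kappa>'"
      using \<delta>(2)[OF that(1,2)] that(3,4) unfolding P_def by blast
    then show ?thesis using near0[OF that(3,4)] \<kappa>'(2)
        norm_triangle_ineq[of "dir_deriv b (Ah u l) v - dir_deriv b (Ah \<one> 0) v" "dir_deriv b (Ah \<one> 0) v - Lh b"] by simp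
  qed
  have small: "C * norm (Ah u l 0) \<le> \<rho> / 2" if "\<bar>l\<bar> < \<delta>" "u \<in> carrier G" for l u
  proof -
    have "(0::'e) \<in> cball 0 r'" using r'(1) by simp
    then have "norm (Ah u l 0) < \<kappa>'" using \<delta>(2)[OF that] Ah_base unfolding P_def by fastforce
    then have "C * norm (Ah u l 0) \<le> C * \<kappa>'" using C(1) by (intro mult_left_mono) auto
    then show ?thesis using \<kappa>'(3) by linarith
  qed
  show ?thesis
  proof (rule that[OF r'(1,2) \<delta>(1) l\<Lambda>])
    fix l u assume l: "\<bar>l\<bar> < \<delta>" and u: "u \<in> carrier G"
    note pz = perturbed_zero[OF Bn(1) r'B Ah_smooth[OF u l\<Lambda>[OF l]] R(1) C(2) C(1) R(2) _ Lh_linear near[OF l u] \<kappa>(2) \<rho> \<rho>3(1) small[OF l u]]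
    obtain v where v: "v \<in> cball 0 \<rho>" "Ah u l v = 0" using pz(1)[OF R0] by auto
    have "v \<in> cball 0 r'" using v(1) \<rho>3(1) by simp
    then have "v \<in> Bn" using r'B by blast
    then have "nu v = v" using v(2) Ah_zero_iff[OF u l\<Lambda>[OF l]] by blast
    then have "v \<in> disc r'" by (rule disc\<rho>[OF v(1)])
    moreover have "w = v" if "w \<in> disc r'" "Ah u l w = 0" for w
      using pz(2)[OF R0 _ _ disc_cball[OF that(1)] \<open>v \<in> cball 0 r'\<close> that(2) v(2)] by simp
    ultimately show "\<exists>!v. v \<in> disc r' \<and> Ah u l v = 0" using v(2) by blast
  next
    fix l u v x assume l: "\<bar>l\<bar> < \<delta>" and u: "u \<in> carrier G" and v: "v \<in> disc r'" "dir_deriv x (Ah u l) v = 0"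
    note pz = perturbed_zero[OF Bn(1) r'B Ah_smooth[OF u l\<Lambda>[OF l]] R(1) C(2) C(1) R(2) _ Lh_linear near[OF l u] \<kappa>(2) \<rho> \<rho>3(1) small[OF l u]]
    show "x = 0" using pz(3)[OF R0 _ _ disc_cball[OF v(1)] v(2)] by simp
  qed
qed

end

section \<open>The critical point on each translated slice, for a fixed parameter\<close>

locale slice_crit = slice_pert G GM M act m d s Oe r sg H h hl \<Lambda> for G (structure) and GM :: "('a, 'k::euclidean_space) manifold"
    and M :: "('m, 'e::euclidean_space) manifold" and act m d s Oe r sg H h hl \<Lambda> +
  fixes r' l :: real
  assumes r': "0 < r'" "r' \<le> r" and l: "l \<in> \<Lambda>"
    and zero_ex1: "\<And>u. u \<in> carrier G \<Longrightarrow> \<exists>!v. v \<in> disc r' \<and> Ah u l v = 0"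
    and zero_nondeg: "\<And>u v x. u \<in> carrier G \<Longrightarrow> v \<in> disc r' \<Longrightarrow> dir_deriv x (Ah u l) v = 0 \<Longrightarrow> x = 0"
begin

definition vl :: "'a \<Rightarrow> 'e" where "vl u = (THE v. v \<in> disc r' \<and> Ah u l v = 0)"
definition bl :: "'a \<Rightarrow> 'm" where "bl u = act u (sg (vl u))"

lemma vl: "u \<in> carrier G \<Longrightarrow> vl u \<in> disc r'" "u \<in> carrier G \<Longrightarrow> Ah u l (vl u) = 0"
  using theI'[OF zero_ex1] unfolding vl_def by auto

lemma vl_eqI: "u \<in> carrier G \<Longrightarrow> v \<in> disc r' \<Longrightarrow> Ah u l v = 0 \<Longrightarrow> vl u = v"
  using zero_ex1 vl by blast

lemma disc_r': "disc r' \<subseteq> disc r" by (rule disc_mono[OF r'(2)])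

lemma vl_Bn: "u \<in> carrier G \<Longrightarrow> vl u \<in> Bn" and vl_nu: "u \<in> carrier G \<Longrightarrow> nu (vl u) = vl u"
  and vl_ball: "u \<in> carrier G \<Longrightarrow> vl u \<in> ball 0 r"
  using vl(1)[of u] Bn(3) disc_r' disc_nu[of "vl u" r'] disc_norm[of "vl u" r] by auto

lemma vl_crit: "u \<in> carrier G \<Longrightarrow> dir_deriv x (E u l) (vl u) = 0"
  using Ah_zero_iff[OF _ l vl_Bn] vl(2) by blast

lemma sg_vl: "u \<in> carrier G \<Longrightarrow> sg (vl u) \<in> TM"
  using plot_in[OF sg_plot vl_ball] .

lemma bl_TM: "u \<in> carrier G \<Longrightarrow> bl u \<in> TM"
  unfolding bl_def by (intro act_closed sg_vl)

lemma vl_H: "a \<in> H \<Longrightarrow> u \<in> carrier G \<Longrightarrow> vl (a \<otimes> u) = vl u"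
  by (rule vl_eqI) (auto simp: H_carrier vl Ah_H vl_Bn l)

lemma bl_H: "a \<in> H \<Longrightarrow> u \<in> carrier G \<Longrightarrow> bl (a \<otimes> u) = act a (bl u)"
  by (simp add: bl_def vl_H act_mult sg_vl H_carrier)

lemma open_pn: "open {v. pn (nu v) < c}"
proof -
  have "continuous_on UNIV (\<lambda>v. pn (nu v))"
    by (rule continuous_on_compose2[OF pn_continuous smooth_on_continuous[OF smooth_nu] subset_UNIV])
  then show ?thesis by (intro open_Collect_less continuous_intros)
qed

text \<open>Moving the slice by \<open>k\<close> permutes its points through \<open>rho k\<close>,
  so \<open>rho (inv k) (vl u)\<close> satisfies the equation that characterises
  \<open>vl (u \<otimes> k)\<close>; uniqueness concludes.\<close>

lemma vl_K:
  assumes u: "u \<in> carrier G" and k: "k \<in> K"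
  shows "vl (u \<otimes> k) = rho (inv k) (vl u)"
proof -
  have ki: "inv k \<in> K" using subgroup.m_inv_closed[OF K_sub k] .
  have kc: "k \<in> carrier G" using K_carrier[OF k] .
  define w where "w = rho (inv k) (vl u)"
  have wd: "w \<in> disc r'" unfolding w_def by (rule disc_rho[OF vl(1)[OF u] ki])
  have rw: "rho k (nu w) = vl u"
    using rho_inv(1)[OF k, of "vl u"] disc_nu[OF wd] lprojM(3)[OF disc_VM[OF vl(1)[OF u]]] by (simp add: w_def)
  have Ek: "E (u \<otimes> k) l v = E u l (rho k (nu v))" if v: "v \<in> {v. pn (nu v) < r}" for v
  proof -
    have nd: "nu v \<in> disc r" using v nu_props(3) by (simp add: disc_def)
    have "sg (nu v) \<in> TM" using plot_in[OF sg_plot] disc_norm[OF nd] by simp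
    then show ?thesis using sg_equiv[OF k nd] disc_nu[OF disc_rho[OF nd k]] u kc by (simp add: E_def act_mult)
  qed
  have wB: "w \<in> Bn" using wd disc_r' Bn(3) by blast
  have "dir_deriv x (E (u \<otimes> k) l) w = 0" for x
  proof -
    have "w \<in> {v. pn (nu v) < r}" using wd r'(2) disc_nu[OF wd] by (auto simp: disc_def)
    from dir_deriv_cong(1)[OF open_pn this Ek]
    have "dir_deriv x (E (u \<otimes> k) l) w = dir_deriv x (\<lambda>v. E u l (rho k (nu v))) w" .
    also have "\<dots> = dir_deriv (rho k (nu x)) (E u l) (vl u)"
    proof -
      have "(E u l has_derivative (\<lambda>x. dir_deriv x (E u l) (vl u))) (at (rho k (nu w)))"
        unfolding rw by (rule smooth_on_has_derivative[OF E_smooth[OF u l] Bn(1) vl_Bn[OF u]])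
      have "bounded_linear nu" using nu_linear by (simp add: linear_conv_bounded_linear)
      then have "((\<lambda>v. rho k (nu v)) has_derivative (\<lambda>v. rho k (nu v))) (at w)"
        by (rule bounded_linear_imp_has_derivative[OF bounded_linear_compose[OF rho_linear_K[OF k]]])
      from dir_deriv_chain[OF \<open>(E u l has_derivative _) _\<close> this, of x] show ?thesis .
    qed
    also have "\<dots> = 0" by (rule vl_crit[OF u])
    finally show ?thesis .
  qed
  then have "Ah (u \<otimes> k) l w = 0" using Ah_zero_iff[OF _ l wB] disc_nu[OF wd] u kc by simp
  then show ?thesis unfolding w_def[symmetric] using vl_eqI[OF _ wd] u kc by simp
qed

lemma bl_K:
  assumes u: "u \<in> carrier G" and k: "k \<in> K"
  shows "bl (u \<otimes> k) = bl u"
proof -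
  have ki: "inv k \<in> K" using subgroup.m_inv_closed[OF K_sub k] .
  have d: "vl u \<in> disc r" using vl(1)[OF u] disc_r' by blast
  have d2: "rho (inv k) (vl u) \<in> disc r" by (rule disc_rho[OF d ki])
  have "sg (rho (inv k) (vl u)) \<in> TM" using plot_in[OF sg_plot] disc_norm[OF d2] by simp
  then have "bl (u \<otimes> k) = act u (act k (sg (rho (inv k) (vl u))))"
    using u K_carrier[OF k] by (simp add: bl_def vl_K[OF u k] act_mult)
  also have "\<dots> = bl u"
    unfolding sg_equiv[OF k d2] rho_inv(1)[OF k] lprojM(3)[OF disc_VM[OF d]] bl_def ..
  finally show ?thesis .
qed

text \<open>The implicit function theorem, obtained by inverting
  \<open>(z, v) \<mapsto> (z, Ah (c z) l v)\<close>; \<open>zero_nondeg\<close> makes the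
  differential injective at the solution.\<close>

lemma vl_smooth:
  fixes c :: "'z::euclidean_space \<Rightarrow> 'a"
  assumes c: "plot GM S c"
  shows "smooth_on UNIV S (\<lambda>z. vl (c z))"
proof (rule smooth_on_local)
  fix z0 assume z0: "z0 \<in> S"
  have cc: "c z \<in> carrier G" if "z \<in> S" for z using plot_in[OF c that] GM(3) by simp
  define D where "D = S \<times> Bn"
  have oD: "open D" unfolding D_def by (intro open_Times plot_open[OF c] Bn(1))
  have sA: "smooth_on UNIV D (\<lambda>p. Ah (c (fst p)) l (snd p))"
  proof -
    have "smooth_on UNIV D (\<lambda>p. (fst p, l, snd p))"
      by (rule smooth_on_Pair[OF smooth_on_fst smooth_on_Pair[OF smooth_on_const smooth_on_snd oD] oD])
    from smooth_on_compose[OF Ah_smooth_joint[OF c] this oD E_smooth_joint(1)[OF c]]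
    show ?thesis using l by (auto simp: D_def)
  qed
  define f where "f p = (fst p, Ah (c (fst p)) l (snd p))" for p
  have fs: "smooth_on UNIV D f" unfolding f_def[abs_def] by (rule smooth_on_Pair[OF smooth_on_fst sA oD])
  define p0 where "p0 = (z0, vl (c z0))"
  have p0: "p0 \<in> D" using z0 vl_Bn[OF cc] by (simp add: p0_def D_def)
  have inj: "x = 0" if x: "dir_deriv x f p0 = 0" for x
  proof -
    have d1: "((\<lambda>p. Ah (c (fst p)) l (snd p)) has_derivative (\<lambda>x. dir_deriv x (\<lambda>p. Ah (c (fst p)) l (snd p)) p0)) (at p0)"
      by (rule smooth_on_has_derivative[OF sA oD p0])
    have "(f has_derivative (\<lambda>x. (fst x, dir_deriv x (\<lambda>p. Ah (c (fst p)) l (snd p)) p0))) (at p0)"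
      unfolding f_def[abs_def] by (rule has_derivative_Pair[OF bounded_linear_imp_has_derivative[OF bounded_linear_fst] d1])
    from has_derivative_dir_deriv[OF this, of x] x
    have f0: "fst x = 0" and s0: "dir_deriv x (\<lambda>p. Ah (c (fst p)) l (snd p)) p0 = 0" by (auto simp: zero_prod_def)
    have xe: "x = (0, snd x)" using f0 by (metis prod.collapse)
    have "dir_deriv x (\<lambda>p. Ah (c (fst p)) l (snd p)) p0 = dir_deriv (snd x) (Ah (c z0) l) (vl (c z0))"
      by (subst xe) (simp add: dir_deriv_def p0_def)
    then have "snd x = 0" using zero_nondeg[OF cc[OF z0] vl(1)[OF cc[OF z0]]] s0 by simp
    then show "x = 0" using f0 by (simp add: prod_eq_iff)
  qed
  obtain A B g where AB: "open A" "p0 \<in> A" "A \<subseteq> D" "open B" "homeomorphism A B f g" "smooth_on UNIV B g"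
    by (rule smooth_inverse_function[OF oD p0 fs inj]) auto
  have fp0: "f p0 = (z0, 0)" using vl(2)[OF cc[OF z0]] by (simp add: f_def p0_def)
  have z0B: "(z0, 0) \<in> B" using imageI[OF AB(2), of f] unfolding homeomorphism_image1[OF AB(5)] fp0 .
  have g0: "g (z0, 0) = p0" using homeomorphism_apply1[OF AB(5,2)] unfolding fp0 .
  have gA: "g (z, 0) \<in> A" "f (g (z, 0)) = (z, 0)" if "(z, 0) \<in> B" for z
    using imageI[OF that, of g] homeomorphism_apply2[OF AB(5) that] unfolding homeomorphism_image2[OF AB(5)] by blast+
  define R where "R = {z. (z, 0::'e) \<in> B}"
  have oR: "open R" unfolding R_def using open_vimage[OF AB(4), of "\<lambda>z. (z, 0)"] by (simp add: vimage_def continuous_intros)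
  have s1: "smooth_on UNIV R (\<lambda>z. g (z, 0))"
    by (rule smooth_on_compose[OF AB(6) smooth_on_Pair[OF smooth_on_id smooth_on_const oR] oR AB(4)]) (simp add: R_def)
  have s2: "smooth_on UNIV R (\<lambda>z. snd (g (z, 0)))"
    by (rule smooth_on_linear_compose[OF linear_snd s1 oR])
  \<comment> \<open>Together with \<open>nu v = v\<close>, which follows from the equation, this
    open condition puts the local solution into \<open>disc r'\<close>, where the zero is unique; so
    it is \<open>vl (c z)\<close>.\<close>
  define R' where "R' = {z\<in>R. snd (g (z, 0)) \<in> {v. pn (nu v) < r'}}"
  have oR': "open R'" unfolding R'_def by (rule smooth_on_vimage_open[OF s2 oR open_pn])
  have z0R: "z0 \<in> R'" using z0B g0 vl(1)[OF cc[OF z0]] vl_nu[OF cc[OF z0]] by (auto simp: R'_def R_def p0_def disc_def)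
  have e: "snd (g (z, 0)) = vl (c z)" if z: "z \<in> R'" for z
  proof -
    have zB: "(z, 0) \<in> B" using z by (simp add: R'_def R_def)
    obtain z' v where zv: "g (z, 0) = (z', v)" by (cases "g (z, 0)")
    have "z' = z" "Ah (c z) l v = 0" using gA(2)[OF zB] zv by (auto simp: f_def)
    moreover have "z' \<in> S" "v \<in> Bn" using gA(1)[OF zB] zv AB(3) by (auto simp: D_def)
    moreover have "nu v = v" using Ah_zero_iff[OF cc l] calculation by blast
    moreover have "v \<in> disc r'" using calculation z zv by (simp add: R'_def disc_def)
    ultimately show ?thesis using vl_eqI[OF cc] zv by simp
  qed
  have R'S: "R' \<subseteq> S"
  proof
    fix z assume z: "z \<in> R'"
    have zB: "(z, 0) \<in> B" using z by (simp add: R'_def R_def)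
    have "g (z, 0) \<in> D" "f (g (z, 0)) = (z, 0)" using AB(3) gA[OF zB] by auto
    then show "z \<in> S" by (auto simp: f_def D_def)
  qed
  have "smooth_on UNIV R' (\<lambda>z. vl (c z))"
    by (rule smooth_on_cong[OF smooth_on_subset[OF s2] oR' e]) (auto simp: R'_def)
  then have "smooth_on UNIV (R' \<inter> S) (\<lambda>z. vl (c z))" by (rule smooth_on_subset) blast
  then show "\<exists>U. open U \<and> z0 \<in> U \<and> smooth_on UNIV (U \<inter> S) (\<lambda>z. vl (c z))" using oR' z0R by blast
qed

lemma bl_plot:
  assumes c: "plot GM S c" shows "plot M S (\<lambda>z. bl (c z))"
  unfolding bl_def
proof (rule act_plot[OF c], rule plot_compose[OF sg_plot vl_smooth[OF c] plot_open[OF c] _ Mc])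
  show "vl (c z) \<in> ball 0 r" if "z \<in> S" for z using vl_ball plot_in[OF c that] GM(3) by simp
qed

lemma hl_bl_smooth: "plot GM S c \<Longrightarrow> smooth_on UNIV S (\<lambda>z. hl l (bl (c z)))"
  by (rule smooth_map_real_plot[OF Mc hl_map[OF l] bl_plot])

lemma s_translate_plot: "u \<in> carrier G \<Longrightarrow> plot GM (ball 0 d) (\<lambda>t. u \<otimes> s t)"
  by (rule translate_plot(1)[OF s_plot])

text \<open>An envelope argument: as \<open>t\<close> varies, the critical point moves on the slice
  too, but the function is stationary along the slice, so this motion contributes nothing to first
  order.\<close>

lemma hl_bl_deriv:
  assumes u: "u \<in> carrier G"
  shows "dir_deriv w (\<lambda>t. hl l (bl (u \<otimes> s t))) 0 = dir_deriv w (\<lambda>t. hl l (act u (act (s t) (sg (vl u))))) 0"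
proof -
  note sp = s_translate_plot[OF u]
  have b0: "0 \<in> ball (0::'e) d" using d by simp
  have sc: "s t \<in> carrier G" if "t \<in> ball 0 d" for t using plot_in[OF s_plot that] GM(3) by simp
  have us0: "u \<otimes> s 0 = u" using s0 u by simp
  define D where "D = ball (0::'e) d \<times> Bn"
  have oD: "open D" unfolding D_def by (intro open_Times Bn(1)) auto
  define P where "P p = E (u \<otimes> s (fst p)) l (snd p)" for p
  have sP: "smooth_on UNIV D P"
  proof -
    have "smooth_on UNIV D (\<lambda>p. (fst p, l, snd p))"
      by (rule smooth_on_Pair[OF smooth_on_fst smooth_on_Pair[OF smooth_on_const smooth_on_snd oD] oD])
    from smooth_on_compose[OF E_smooth_joint(2)[OF sp] this oD E_smooth_joint(1)[OF sp]]
    show ?thesis using l by (auto simp: D_def P_def[abs_def])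
  qed
  have "dir_deriv w (\<lambda>t. hl l (bl (u \<otimes> s t))) 0 = dir_deriv w (\<lambda>t. P (t, vl (u \<otimes> s t))) 0"
  proof (rule dir_deriv_cong(1)[OF open_ball b0])
    fix t assume "t \<in> ball (0::'e) d"
    then show "hl l (bl (u \<otimes> s t)) = P (t, vl (u \<otimes> s t))" using sc u vl_nu[of "u \<otimes> s t"] by (simp add: bl_def P_def E_def)
  qed
  also have "\<dots> = dir_deriv w (\<lambda>t. P (t, vl (u \<otimes> s 0))) 0 + dir_deriv (dir_deriv w (\<lambda>t. vl (u \<otimes> s t)) 0) (\<lambda>v. P (0, v)) (vl (u \<otimes> s 0))"
    by (rule dir_deriv_graph[OF sP oD _ smooth_on_has_derivative[OF vl_smooth[OF sp] open_ball b0]]) (simp add: us0 D_def d vl_Bn[OF u])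
  also have "dir_deriv x (\<lambda>v. P (0, v)) (vl (u \<otimes> s 0)) = 0" for x
    using vl_crit[OF u, of x] by (simp add: P_def us0)
  also have "dir_deriv w (\<lambda>t. P (t, vl (u \<otimes> s 0))) 0 = dir_deriv w (\<lambda>t. hl l (act (u \<otimes> s t) (sg (vl u)))) 0"
    by (simp add: P_def E_def us0 vl_nu[OF u])
  also have "\<dots> = dir_deriv w (\<lambda>t. hl l (act u (act (s t) (sg (vl u))))) 0"
    by (rule dir_deriv_cong(1)[OF open_ball b0]) (simp add: act_mult sg_vl u sc)
  finally show ?thesis by simp
qed

text \<open>Stationarity along the slice holds by construction of \<open>vl\<close>, so
  \<open>sg_crit\<close> leaves only the orbit directions to test, and \<open>hl_bl_deriv\<close>
  identifies those derivatives with derivatives of the reduced function.\<close>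

lemma bl_critical_iff:
  assumes u: "u \<in> carrier G"
  shows "critical_point M (hl l) (bl u) \<longleftrightarrow> (\<forall>w. dir_deriv w (\<lambda>t. hl l (bl (u \<otimes> s t))) 0 = 0)"
proof
  assume c: "critical_point M (hl l) (bl u)"
  have "bl (u \<otimes> s 0) = bl u" using s0 u by simp
  moreover have "0 \<in> ball (0::'e) d" using d by simp
  ultimately show "\<forall>w. dir_deriv w (\<lambda>t. hl l (bl (u \<otimes> s t))) 0 = 0"
    using critical_point_plot[OF M hl_map[OF l] c bl_plot[OF s_translate_plot[OF u]]] by blast
next
  assume z: "\<forall>w. dir_deriv w (\<lambda>t. hl l (bl (u \<otimes> s t))) 0 = 0"
  show "critical_point M (hl l) (bl u)"
    unfolding bl_def
  proof (rule sg_crit[OF hl_map[OF l] u])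
    show "vl u \<in> disc r" using vl(1)[OF u] disc_r' by blast
    show "dir_deriv w (\<lambda>w. hl l (act u (sg (nu w)))) (vl u) = 0" for w
      using vl_crit[OF u, of w] by (simp add: E_def[abs_def])
    show "dir_deriv w (\<lambda>t. hl l (act u (act (s t) (sg (vl u))))) 0 = 0" for w
      using z hl_bl_deriv[OF u, of w] by simp
  qed
qed

definition Ur :: "'m set" where "Ur = {act g (sg v) | g v. g \<in> carrier G \<and> v \<in> disc r'}"

lemma bl_Ur: "u \<in> carrier G \<Longrightarrow> bl u \<in> Ur"
  using vl(1) by (auto simp: bl_def Ur_def)

lemma critical_in_Ur:
  assumes x: "x \<in> Ur" "critical_point M (hl l) x"
  obtains u where "u \<in> carrier G" "x = bl u"
proof -
  obtain g v where gv: "g \<in> carrier G" "v \<in> disc r'" "x = act g (sg v)" using x(1) by (auto simp: Ur_def)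
  have vB: "v \<in> Bn" "nu v = v" using gv(2) disc_r' Bn(3) disc_nu by auto
  have "dir_deriv w (E g l) v = 0" for w
    unfolding E_def[abs_def]
    by (rule critical_point_plot[OF M hl_map[OF l] x(2) act_translate_plot[OF sg_nu_plot gv(1)] vB(1)]) (simp add: vB gv(3))
  then have "Ah g l v = 0" using Ah_zero_iff[OF gv(1) l vB(1)] vB(2) by blast
  then have "vl g = v" by (rule vl_eqI[OF gv(1,2)])
  then show ?thesis using that[OF gv(1)] gv(3) by (simp add: bl_def)
qed

lemma bl_eq_imp:
  assumes "u \<in> carrier G" "w \<in> carrier G" "bl u = bl w"
  shows "inv w \<otimes> u \<in> K"
proof (rule sg_sep)
  show "vl u \<in> disc r" "vl w \<in> disc r" using vl(1) assms disc_r' by auto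
  have "act (inv w \<otimes> u) (sg (vl u)) = act (inv w) (bl u)" using assms sg_vl by (simp add: bl_def act_mult)
  also have "\<dots> = sg (vl w)" unfolding assms(3) unfolding bl_def by (rule act_inv(1)[OF sg_vl]) (use assms in auto)
  finally show "act (inv w \<otimes> u) (sg (vl u)) = sg (vl w)" .
qed (use assms in auto)

end

section \<open>Charts of the homogeneous space\<close>

context slice begin

abbreviation Q :: "('a set, 'k) manifold" where "Q \<equiv> homogeneous_space G GM K"

lemma pK_rep:
  assumes a: "a \<in> carrier G" shows "\<exists>k\<in>K. (SOME b. b \<in> pK a) = a \<otimes> k"
proof -
  have "a \<in> pK a" using mem_pK[OF a, of a] a subgroup.one_closed[OF K_sub] by simp
  then have "(SOME b. b \<in> pK a) \<in> pK a" by (rule someI)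
  then show ?thesis by (auto simp: l_coset_def)
qed

lemma Q_topo: "topo Q = quotient_topology (topo GM) pK" and
  Q_atlas: "atlas Q = {(U, V, \<phi>) | U V \<phi>. topological_chart (topo Q) (U, V, \<phi>) \<and>
            smooth_submersion (open_submanifold GM {a \<in> topspace (topo GM). pK a \<in> U})
                              (flat_manifold V (\<phi> ` U)) (\<phi> \<circ> pK)}"
  by (simp_all add: homogeneous_space_def Let_def)

lemma Q_quotient: "quotient_map (topo GM) (topo Q) pK"
  unfolding Q_topo by (rule quotient_map_quotient_topology)

lemma Q_top: "topspace (topo Q) = pK ` carrier G"
  using quotient_imp_surjective_map[OF Q_quotient] GM(3) by simp

lemma openin_pK_vimage: "openin (topo Q) U \<Longrightarrow> openin (topo GM) {a \<in> topspace (topo GM). pK a \<in> U}"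
  unfolding Q_topo openin_quotient_topology by blast

lemma NU_image_open:
  assumes u: "u \<in> carrier G" and T: "open T"
  shows "openin (topo Q) (pK ` NU u T)"
proof -
  have "{x \<in> carrier G. pK x \<in> pK ` NU u T} = NU u T"
  proof (intro equalityI subsetI)
    fix x assume "x \<in> {x \<in> carrier G. pK x \<in> pK ` NU u T}"
    then obtain a where "x \<in> carrier G" "a \<in> NU u T" "pK x = pK a" by blast
    then show "x \<in> NU u T" using NU_sat[OF u] by blast
  qed (use NU_D(1)[OF u] in blast)
  moreover have "pK ` NU u T \<subseteq> pK ` carrier G" using NU_D(1)[OF u] by blast
  ultimately show ?thesis using NU_open[OF u T] unfolding Q_topo openin_quotient_topology GM(3) by simp
qed

text \<open>The section gives both directions: \<open>tcoord\<close> is the coordinate of a coset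
  near that of \<open>u\<close>, and \<open>t \<mapsto> u \<otimes> s t\<close> followed by the
  projection is the inverse.\<close>

lemma Q_chart_exists:
  assumes u: "u \<in> carrier G"
  shows "\<exists>c\<in>atlas Q. pK u \<in> fst c"
proof -
  obtain \<alpha> where \<alpha>: "linear \<alpha>" "\<And>t. t \<in> TO \<Longrightarrow> dpi (\<alpha> t) = t"
    using linear_exists_right_inverse_on[OF dpi_linear subspace_UNIV] by (auto simp: TO_def)
  have "open {t \<in> ball 0 d. s t \<in> Oe}" by (rule plot_vimage_open[OF s_plot Oe(1)])
  moreover have "0 \<in> {t \<in> ball 0 d. s t \<in> Oe}" using d s0 Oe(2) by simp
  \<comment> \<open>On this smaller ball \<open>s t\<close> lies in \<open>Oe\<close>, so that
    \<open>u \<otimes> s t\<close> belongs to the neighbourhood \<open>NU\<close>.\<close>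
  ultimately obtain d' where d': "d' > 0" "ball 0 d' \<subseteq> {t \<in> ball 0 d. s t \<in> Oe}" using open_contains_ball by blast
  define B where "B = ball (0::'e) d'"
  have B: "open B" "0 \<in> B" "t \<in> B \<Longrightarrow> t \<in> ball 0 d" "t \<in> B \<Longrightarrow> s t \<in> Oe" for t using d' by (auto simp: B_def subset_iff)
  \<comment> \<open>Charts of \<open>G/K\<close> take values in the coordinate type of
    \<open>G\<close>, while \<open>TO\<close> lives in that of \<open>M\<close>. So
    \<open>TO\<close> is carried over by \<open>\<alpha>\<close>, with \<open>dpi\<close> as
    inverse.\<close>
  define V where "V = \<alpha> ` TO"
  define U where "U = pK ` NU u B"
  define \<phi> where "\<phi> C = \<alpha> (tcoord (inv u \<otimes> (SOME a. a \<in> C)))" for C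
  have \<phi>: "\<phi> (pK a) = \<alpha> (tcoord (inv u \<otimes> a))" if a: "a \<in> carrier G" for a
  proof -
    obtain k where k: "k \<in> K" "(SOME b. b \<in> pK a) = a \<otimes> k" using pK_rep[OF a] by blast
    have "inv u \<otimes> (a \<otimes> k) = inv u \<otimes> a \<otimes> k" using u a K_carrier[OF k(1)] by (simp add: m_assoc)
    then show ?thesis using tcoord_K[OF _ k(1), of "inv u \<otimes> a"] u a by (simp add: \<phi>_def k(2))
  qed
  have us: "u \<otimes> s t \<in> NU u B" "\<phi> (pK (u \<otimes> s t)) = \<alpha> t" if t: "t \<in> TO" "t \<in> B" for t
  proof -
    have e: "inv u \<otimes> (u \<otimes> s t) = s t" using u s_carrier[OF B(3)[OF t(2)]] by (simp add: m_assoc[symmetric])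
    show "u \<otimes> s t \<in> NU u B" using e B(4)[OF t(2)] t tcoord_s[OF B(3)] subgroup.one_closed[OF K_sub] u s_carrier[OF B(3)[OF t(2)]]
      by (auto simp: NU_def intro!: bexI[of _ \<one>])
    show "\<phi> (pK (u \<otimes> s t)) = \<alpha> t" using \<phi>[of "u \<otimes> s t"] e tcoord_s[OF B(3)] t u s_carrier[OF B(3)[OF t(2)]] by simp
  qed
  have im: "\<phi> ` U = \<alpha> ` (TO \<inter> B)"
  proof (intro equalityI subsetI)
    fix z assume "z \<in> \<phi> ` U"
    then obtain a where a: "a \<in> NU u B" "z = \<phi> (pK a)" by (auto simp: U_def)
    then show "z \<in> \<alpha> ` (TO \<inter> B)" using \<phi>[OF NU_D(1)[OF u a(1)]] NU_D(3)[OF u a(1)] tcoord_TO by auto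
  next
    fix z assume "z \<in> \<alpha> ` (TO \<inter> B)"
    then obtain t where t: "t \<in> TO" "t \<in> B" "z = \<alpha> t" by blast
    then show "z \<in> \<phi> ` U" using imageI[OF imageI[OF us(1)[OF t(1,2)], of pK], of \<phi>] us(2)[OF t(1,2)] t(3) by (simp add: U_def)
  qed
  have im': "\<phi> ` U = V \<inter> dpi -` B"
    unfolding im V_def
  proof (intro equalityI subsetI)
    fix z assume "z \<in> \<alpha> ` TO \<inter> dpi -` B"
    then obtain t where "t \<in> TO" "z = \<alpha> t" "dpi z \<in> B" by blast
    then show "z \<in> \<alpha> ` (TO \<inter> B)" using \<alpha>(2) by simp
  qed (use \<alpha>(2) in auto)
  have dc: "continuous_on UNIV dpi" using linear_continuous_on[of dpi] dpi_linear by (simp add: linear_conv_bounded_linear)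
  have sV: "subspace V" unfolding V_def by (rule linear_subspace_image[OF \<alpha>(1) subspace_TO])
  have oV: "openin (top_of_set V) (\<phi> ` U)" unfolding im' by (rule openin_open_Int[OF open_vimage[OF B(1) dc]])
  have oU: "openin (topo Q) U" unfolding U_def by (rule NU_image_open[OF u B(1)])
  define j where "j z = pK (u \<otimes> s (dpi z))" for z
  have j\<phi>: "j (\<phi> C) = C" if C: "C \<in> U" for C
  proof -
    obtain a where a: "a \<in> NU u B" "C = pK a" using C by (auto simp: U_def)
    then show ?thesis using \<phi>[OF NU_D(1)[OF u a(1)]] \<alpha>(2)[OF tcoord_TO] NU_D(5)[OF u a(1)] by (simp add: j_def)
  qed
  have \<phi>j: "\<phi> (j z) = z" and jU: "j z \<in> U" if z: "z \<in> \<phi> ` U" for z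
  proof -
    obtain t where t: "t \<in> TO" "t \<in> B" "z = \<alpha> t" using z unfolding im by blast
    show "\<phi> (j z) = z" "j z \<in> U" using us[OF t(1,2)] \<alpha>(2)[OF t(1)] t(3) by (auto simp: j_def U_def)
  qed
  have c\<phi>: "continuous_map (subtopology (topo Q) U) (top_of_set (\<phi> ` U)) \<phi>"
  proof -
    have "continuous_map (subtopology (topo Q) U) euclidean \<phi>"
      unfolding continuous_map_def
    proof (intro conjI allI impI)
      fix T :: "'k set" assume "openin euclidean T"
      then have T: "open T" by simp
      have oT: "open (B \<inter> \<alpha> -` T)"
        by (intro open_Int B(1) open_vimage[OF T] linear_continuous_on) (use \<alpha>(1) linear_conv_bounded_linear in blast)
      have Ut: "U \<subseteq> topspace (topo Q)" using openin_subset[OF oU] .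
      have "{C \<in> topspace (subtopology (topo Q) U). \<phi> C \<in> T} = pK ` NU u (B \<inter> \<alpha> -` T)"
      proof (intro equalityI subsetI)
        fix C assume C: "C \<in> {C \<in> topspace (subtopology (topo Q) U). \<phi> C \<in> T}"
        then obtain a where a: "a \<in> NU u B" "C = pK a" by (auto simp: U_def)
        have "\<alpha> (tcoord (inv u \<otimes> a)) \<in> T" using C \<phi>[OF NU_D(1)[OF u a(1)]] a(2) by simp
        moreover obtain k where k: "k \<in> K" "inv u \<otimes> a \<otimes> k \<in> Oe" "tcoord (inv u \<otimes> a \<otimes> k) \<in> B" "a \<in> carrier G"
          using a(1) by (auto simp: NU_def)
        moreover have "tcoord (inv u \<otimes> a \<otimes> k) = tcoord (inv u \<otimes> a)" using tcoord_K[OF _ k(1)] u k(4) by simp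
        ultimately have "a \<in> NU u (B \<inter> \<alpha> -` T)" by (auto simp: NU_def)
        then show "C \<in> pK ` NU u (B \<inter> \<alpha> -` T)" using a(2) by blast
      next
        fix C assume "C \<in> pK ` NU u (B \<inter> \<alpha> -` T)"
        then obtain a where a: "a \<in> NU u (B \<inter> \<alpha> -` T)" "C = pK a" by blast
        have "a \<in> NU u B" using a(1) by (auto simp: NU_def)
        then have "C \<in> U" using a(2) by (auto simp: U_def)
        then show "C \<in> {C \<in> topspace (subtopology (topo Q) U). \<phi> C \<in> T}"
          using NU_D(3)[OF u a(1)] \<phi>[OF NU_D(1)[OF u a(1)]] a(2) Ut by auto
      qed
      moreover have "pK ` NU u (B \<inter> \<alpha> -` T) \<subseteq> U" by (auto simp: NU_def U_def)
      ultimately show "openin (subtopology (topo Q) U) {C \<in> topspace (subtopology (topo Q) U). \<phi> C \<in> T}"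
        using NU_image_open[OF u oT] oU by (auto simp: openin_open_subtopology)
    qed simp
    then show ?thesis by (auto simp: continuous_map_in_subtopology)
  qed
  have cj: "continuous_map (top_of_set (\<phi> ` U)) (subtopology (topo Q) U) j"
  proof -
    have o: "open (dpi -` ball 0 d)" by (rule open_vimage[OF open_ball dc])
    have "plot GM (dpi -` ball 0 d) (\<lambda>z. u \<otimes> s (dpi z))"
      by (rule translate_plot(1)[OF plot_compose[OF s_plot smooth_on_linear[OF dpi_linear] o _ GM(2)] u]) simp
    from continuous_map_compose[OF plot_continuous[OF this] quotient_imp_continuous_map[OF Q_quotient]]
    have "continuous_map (top_of_set (dpi -` ball 0 d)) (topo Q) j" by (simp add: comp_def j_def[abs_def])
    then have "continuous_map (top_of_set (\<phi> ` U)) (topo Q) j"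
      by (rule continuous_map_from_subtopology_mono) (use B(3) im' in auto)
    then show ?thesis using jU by (auto simp: continuous_map_in_subtopology)
  qed
  have "homeomorphic_maps (subtopology (topo Q) U) (top_of_set (\<phi> ` U)) \<phi> j"
    using c\<phi> cj j\<phi> \<phi>j by (auto simp: homeomorphic_maps_def)
  then have "homeomorphic_map (subtopology (topo Q) U) (top_of_set (\<phi> ` U)) \<phi>" by (rule homeomorphic_maps_map[THEN iffD1, THEN conjunct1])
  then have tc: "topological_chart (topo Q) (U, V, \<phi>)" using oU sV oV by simp
  define P where "P = {a \<in> topspace (topo GM). pK a \<in> U}"
  have oP: "openin (topo GM) P" unfolding P_def by (rule openin_pK_vimage[OF oU])
  have PN: "P = NU u B"
  proof (intro equalityI subsetI)
    fix x assume "x \<in> P"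
    then obtain a where "x \<in> carrier G" "a \<in> NU u B" "pK x = pK a" unfolding P_def U_def GM(3) by blast
    then show "x \<in> NU u B" using NU_sat[OF u] by blast
  next
    fix x assume "x \<in> NU u B"
    then show "x \<in> P" unfolding P_def U_def GM(3) using NU_D(1)[OF u] by blast
  qed
  note cP = charted_open_submanifold[OF GM(2) oP]
  have SV: "\<phi> ` U \<subseteq> V" by (simp add: im')
  have fS: "(\<phi> \<circ> pK) x \<in> \<phi> ` U" if "x \<in> P" for x using that by (simp add: P_def)
  have sm: "smooth_map (open_submanifold GM P) (flat_manifold V (\<phi> ` U)) (\<phi> \<circ> pK)"
  proof (rule smooth_map_flatI[OF cP(1) SV])
    show "\<And>x. x \<in> topspace (topo (open_submanifold GM P)) \<Longrightarrow> (\<phi> \<circ> pK) x \<in> \<phi> ` U" using fS cP(2) by simp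
    fix c assume c: "c \<in> atlas (open_submanifold GM P)"
    note q = plot_submanifold_chart_param[OF GM(1) oP c]
    note tp = translate_plot(1)[OF q(1) inv_closed[OF u]]
    have "smooth_on UNIV (chart_dom c) (\<lambda>y. \<alpha> (tcoord (inv u \<otimes> chart_param c y)))"
      by (rule smooth_on_linear_compose[OF \<alpha>(1) tcoord_smooth[OF tp] plot_open[OF tp]]) (use q(2) NU_D(2)[OF u] PN in blast)
    then show "smooth_on UNIV (chart_dom c) (\<lambda>y. (\<phi> \<circ> pK) (chart_param c y))"
      by (rule smooth_on_cong[OF _ plot_open[OF tp]]) (use \<phi>[OF NU_D(1)[OF u q(2)[unfolded PN]]] in simp)
  qed
  have sub: "smooth_submersion (open_submanifold GM P) (flat_manifold V (\<phi> ` U)) (\<phi> \<circ> pK)"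
  proof (rule smooth_submersion_flatI[OF cP(1) SV oV sV sm])
    fix x v assume "x \<in> topspace (topo (open_submanifold GM P))" and v: "v \<in> V"
    then have xP: "x \<in> NU u B" using cP(2) PN by simp
    define t0 where "t0 = tcoord (inv u \<otimes> x)"
    have t0: "t0 \<in> B" "t0 \<in> TO" "pK x = pK (u \<otimes> s t0)" using NU_D(3,5)[OF u xP] tcoord_TO by (auto simp: t0_def)
    obtain k where k: "k \<in> K" "x = u \<otimes> s t0 \<otimes> k" using pK_eqD[OF NU_D(1)[OF u xP] _ t0(3)] u s_carrier[OF B(3)[OF t0(1)]] by auto
    obtain w where w: "w \<in> TO" "v = \<alpha> w" using v by (auto simp: V_def)
    \<comment> \<open>The plot has to pass through \<open>x\<close> itself and not just through
      another element of its coset; the factor \<open>k\<close> takes care of that.\<close>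
    define q where "q t = u \<otimes> s t \<otimes> k" for t
    define D where "D = {t. t \<in> B \<and> ppi t \<in> B}"
    have lp: "continuous_on UNIV ppi" using linear_continuous_on[of ppi] ppi_linear by (simp add: linear_conv_bounded_linear)
    have oD: "open D" unfolding D_def using open_Int[OF B(1) open_vimage[OF B(1) lp]] by (simp add: vimage_def Int_def)
    have t0D: "t0 \<in> D" using t0 ppi_id[OF t0(2)] by (simp add: D_def)
    have "plot GM D s" by (rule plot_subset[OF s_plot oD _ GM(2)]) (use B(3) in \<open>auto simp: D_def\<close>)
    then have "plot GM D q" unfolding q_def by (intro translate_plot u K_carrier k)
    moreover have qp: "pK (q t) = pK (u \<otimes> s (ppi t))" if "t \<in> D" for t
      using pK_K[OF _ k(1), of "u \<otimes> s t"] u s_carrier[OF B(3)] that by (simp add: q_def s_ppi D_def)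
    moreover have "q t \<in> P" if t: "t \<in> D" for t
    proof -
      have "pK (q t) \<in> U" unfolding qp[OF t] U_def using us(1)[OF ppi_TO] t by (auto simp: D_def)
      then show ?thesis using plot_in[OF \<open>plot GM D q\<close> t] by (simp add: P_def)
    qed
    ultimately have qP: "plot (open_submanifold GM P) D q" by (intro plot_open_submanifold)
    have "dir_deriv w (\<lambda>t. (\<phi> \<circ> pK) (q t)) t0 = dir_deriv w (\<lambda>t. \<alpha> (ppi t)) t0"
      by (rule dir_deriv_cong(1)[OF oD t0D]) (use qp us(2)[OF ppi_TO] in \<open>auto simp: D_def\<close>)
    also have "\<dots> = \<alpha> (ppi w)"
      using has_derivative_dir_deriv[OF bounded_linear_imp_has_derivative[OF bounded_linear_compose[of \<alpha> ppi]]] \<alpha>(1) ppi_linear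
      by (simp add: linear_conv_bounded_linear)
    also have "\<dots> = v" by (simp add: ppi_id[OF w(1)] w(2))
    finally show "\<exists>D q t w. plot (open_submanifold GM P) D (q :: 'e \<Rightarrow> 'a) \<and> t \<in> D \<and> q t = x \<and> dir_deriv w (\<lambda>t. (\<phi> \<circ> pK) (q t)) t = v"
      using qP t0D k(2) unfolding q_def by blast
  qed
  have "(U, V, \<phi>) \<in> atlas Q" unfolding Q_atlas using tc sub by (simp add: P_def)
  moreover have "pK u \<in> U" using NU_self[OF u B(2)] by (simp add: U_def)
  ultimately show ?thesis by force
qed

lemma Q_charted: "charted Q"
  unfolding charted_def
proof (intro conjI ballI)
  show "topological_chart (topo Q) c" if "c \<in> atlas Q" for c using that unfolding Q_atlas by blast
  then have "fst c \<subseteq> topspace (topo Q)" if "c \<in> atlas Q" for c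
    using topological_chartD(2)[of "topo Q" "fst c" "fst (snd c)" "snd (snd c)"] that by simp
  moreover have "C \<in> (\<Union>c\<in>atlas Q. fst c)" if "C \<in> topspace (topo Q)" for C
    using that Q_chart_exists unfolding Q_top by blast
  ultimately show "(\<Union>(U, V, \<phi>)\<in>atlas Q. U) = topspace (topo Q)" unfolding split_beta by blast
qed

end

section \<open>Functions on the homogeneous space and their critical points\<close>

context slice begin

text \<open>The atlas of \<open>G/K\<close> is maximal, so an arbitrary chart has to be handled.
  Near \<open>u\<close> the projection factors through \<open>t \<mapsto> u \<otimes> s t\<close> by
  means of \<open>tcoord\<close>, and the surjectivity of its differential is passed on to this
  plot.\<close>

lemma Q_chart_curve:
  assumes c: "(U, V, \<phi>) \<in> atlas Q" and u: "u \<in> carrier G" "pK u \<in> U"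
  obtains D where "open D" "0 \<in> D" "D \<subseteq> ball 0 d" "smooth_on UNIV D (\<lambda>t. \<phi> (pK (u \<otimes> s t)))"
    "\<And>t. t \<in> D \<Longrightarrow> pK (u \<otimes> s t) \<in> U" "V \<subseteq> range (\<lambda>w. dir_deriv w (\<lambda>t. \<phi> (pK (u \<otimes> s t))) 0)"
proof -
  have tc: "topological_chart (topo Q) (U, V, \<phi>)" by (rule chartedD[OF Q_charted c])
  note tcD = topological_chartD[OF tc]
  define P where "P = {a \<in> topspace (topo GM). pK a \<in> U}"
  have oP: "openin (topo GM) P" unfolding P_def by (rule openin_pK_vimage[OF tcD(1)])
  have uP: "u \<in> P" using u GM(3) by (simp add: P_def)
  have sub: "smooth_submersion (open_submanifold GM P) (flat_manifold V (\<phi> ` U)) (\<phi> \<circ> pK)"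
    using c unfolding Q_atlas P_def by blast
  have sm: "smooth_map (open_submanifold GM P) (flat_manifold V (\<phi> ` U)) (\<phi> \<circ> pK)"
    using sub by (simp add: smooth_submersion_def)
  note cP = charted_open_submanifold[OF GM(2) oP]
  note smp = smooth_map_flat_plot[OF cP(1) tcD(4,3) sm]
  have sc: "u \<otimes> s t \<in> carrier G" if "t \<in> ball 0 d" for t using u s_carrier[OF that] by simp
  define D where "D = {t \<in> ball 0 d. u \<otimes> s t \<in> P}"
  note sp = translate_plot(1)[OF s_plot u(1)]
  have oD: "open D" unfolding D_def by (rule plot_vimage_open[OF sp oP])
  have D0: "0 \<in> D" using d uP s0 u by (simp add: D_def)
  have Dd: "D \<subseteq> ball 0 d" by (auto simp: D_def)
  have "plot (open_submanifold GM P) D (\<lambda>t. u \<otimes> s t)"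
    by (rule plot_open_submanifold[OF plot_subset[OF sp oD Dd GM(2)]]) (simp add: D_def)
  from smp[OF this] have \<kappa>s: "smooth_on UNIV D (\<lambda>t. \<phi> (pK (u \<otimes> s t)))" by simp
  define x where "x = coord_at (open_submanifold GM P) u"
  define c' where "c' = chart_at (open_submanifold GM P) u"
  have ca: "c' \<in> atlas (open_submanifold GM P)" "u \<in> fst c'"
    using chart_at[OF cP(1), of u] uP cP(2) by (auto simp: c'_def)
  have tc': "topological_chart (topo (open_submanifold GM P)) c'" using cP(1) ca(1) by (auto simp: charted_def)
  have xu: "x u \<in> chart_dom c'" "chart_param c' (x u) = u"
    using chart_dom_chart_param(1,2)[of _ "fst c'" "fst (snd c')" "snd (snd c')"] tc' ca(2)
    by (auto simp: x_def coord_at_def c'_def)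
  note q = plot_submanifold_chart_param[OF GM(1) oP ca(1)]
  define D1 where "D1 = {y \<in> chart_dom c'. chart_param c' y \<in> NU u UNIV}"
  have oD1: "open D1" unfolding D1_def by (rule plot_vimage_open[OF q(1) NU_open[OF u(1) open_UNIV]])
  have xD1: "x u \<in> D1" using xu NU_self[OF u(1)] by (simp add: D1_def)
  define \<tau> where "\<tau> y = tcoord (inv u \<otimes> chart_param c' y)" for y
  have pD1: "plot GM D1 (chart_param c')" by (rule plot_subset[OF q(1) oD1 _ GM(2)]) (auto simp: D1_def)
  have \<tau>s: "smooth_on UNIV D1 \<tau>"
    unfolding \<tau>_def[abs_def] by (rule tcoord_smooth[OF translate_plot(1)[OF pD1 inv_closed[OF u(1)]]])
      (use NU_D(2)[OF u(1), of _ UNIV] in \<open>auto simp: D1_def\<close>)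
  have \<tau>p: "\<tau> y \<in> D" "pK (chart_param c' y) = pK (u \<otimes> s (\<tau> y))" if y: "y \<in> D1" for y
  proof -
    have N: "chart_param c' y \<in> NU u UNIV" using y by (simp add: D1_def)
    have P: "chart_param c' y \<in> P" using q(2) y by (simp add: D1_def)
    show e: "pK (chart_param c' y) = pK (u \<otimes> s (\<tau> y))" using NU_D(5)[OF u(1) N] by (simp add: \<tau>_def)
    have b: "\<tau> y \<in> ball 0 d" using NU_D(4)[OF u(1) N] by (simp add: \<tau>_def)
    show "\<tau> y \<in> D" using P e sc[OF b] b GM(3) by (simp add: D_def P_def)
  qed
  have \<tau>x: "\<tau> (x u) = 0" using xu(2) u tcoord_one by (simp add: \<tau>_def)
  have ufS: "(\<phi> \<circ> pK) u \<in> \<phi> ` U" using u by simp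
  have "V = tangent_space (flat_manifold V (\<phi> ` U)) ((\<phi> \<circ> pK) u)"
    using ufS by (simp add: tangent_space_def chart_at_flat)
  also have "\<dots> = differential (open_submanifold GM P) (flat_manifold V (\<phi> ` U)) (\<phi> \<circ> pK) u ` tangent_space (open_submanifold GM P) u"
    using sub uP cP(2) by (simp add: smooth_submersion_def)
  also have "\<dots> = range (\<lambda>v. dir_deriv v (\<lambda>y. (\<phi> \<circ> pK) (chart_param c' y)) (x u))"
    using differential_flat_image[where f="\<phi> \<circ> pK" and S="\<phi> ` U" and V=V, OF cP(1) _ ufS] uP cP(2) by (simp add: c'_def x_def)
  finally have V: "V = range (\<lambda>v. dir_deriv v (\<lambda>y. (\<phi> \<circ> pK) (chart_param c' y)) (x u))" .
  have "V \<subseteq> range (\<lambda>w. dir_deriv w (\<lambda>t. \<phi> (pK (u \<otimes> s t))) 0)"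
  proof
    fix z assume "z \<in> V"
    then obtain v where "z = dir_deriv v (\<lambda>y. (\<phi> \<circ> pK) (chart_param c' y)) (x u)" unfolding V by blast
    also have "\<dots> = dir_deriv v (\<lambda>y. \<phi> (pK (u \<otimes> s (\<tau> y)))) (x u)"
      by (rule dir_deriv_cong(1)[OF oD1 xD1]) (simp add: \<tau>p(2))
    also have "\<dots> = dir_deriv (dir_deriv v \<tau> (x u)) (\<lambda>t. \<phi> (pK (u \<otimes> s t))) (\<tau> (x u))"
      by (rule dir_deriv_compose[OF \<kappa>s \<tau>s oD1 oD xD1 \<tau>p(1)[OF xD1]])
    finally show "z \<in> range (\<lambda>w. dir_deriv w (\<lambda>t. \<phi> (pK (u \<otimes> s t))) 0)" unfolding \<tau>x by blast
  qed
  note V' = this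
  have pU: "pK (u \<otimes> s t) \<in> U" if "t \<in> D" for t using that by (simp add: D_def P_def)
  show ?thesis by (rule that[OF oD D0 Dd \<kappa>s pU V'])
qed

context
  fixes F :: "'a \<Rightarrow> real"
  assumes FK: "\<And>a k. a \<in> carrier G \<Longrightarrow> k \<in> K \<Longrightarrow> F (a \<otimes> k) = F a"
    and Fs: "\<And>S (c :: 'e \<Rightarrow> 'a). plot GM S c \<Longrightarrow> smooth_on UNIV S (\<lambda>z. F (c z))"
begin

definition fQ :: "'a set \<Rightarrow> real" where "fQ C = F (SOME a. a \<in> C)"

lemma fQ_pK: "a \<in> carrier G \<Longrightarrow> fQ (pK a) = F a"
  using pK_rep[of a] FK[of a] by (auto simp: fQ_def)

text \<open>A submersion has local sections: a right inverse \<open>R\<close> of the differential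
  selects parameters on which \<open>\<kappa>\<close> is invertible, and \<open>F\<close> along the
  resulting section is \<open>fQ\<close> in the chart.\<close>

lemma fQ_chart_smooth:
  assumes c: "(U, V, \<phi>) \<in> atlas Q"
  shows "smooth_on UNIV (chart_dom (U, V, \<phi>)) (\<lambda>y. fQ (chart_param (U, V, \<phi>) y))"
proof (rule smooth_on_local)
  fix y0 assume y0: "y0 \<in> chart_dom (U, V, \<phi>)"
  have tc: "topological_chart (topo Q) (U, V, \<phi>)" by (rule chartedD[OF Q_charted c])
  note tcD = topological_chartD[OF tc]
  define cp where "cp = chart_param (U, V, \<phi>)"
  have "cp y0 \<in> U" "\<phi> (cp y0) = lproj V y0" using chart_dom_chart_param(3,4)[OF tc y0] by (auto simp: cp_def)
  moreover obtain u where u: "u \<in> carrier G" "cp y0 = pK u"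
    using \<open>cp y0 \<in> U\<close> tcD(2) unfolding Q_top by blast
  ultimately have uU: "pK u \<in> U" "\<phi> (pK u) = lproj V y0" by auto
  obtain D where D: "open D" "0 \<in> D" "D \<subseteq> ball 0 d" "smooth_on UNIV D (\<lambda>t. \<phi> (pK (u \<otimes> s t)))"
    "\<And>t. t \<in> D \<Longrightarrow> pK (u \<otimes> s t) \<in> U" "V \<subseteq> range (\<lambda>w. dir_deriv w (\<lambda>t. \<phi> (pK (u \<otimes> s t))) 0)"
    using Q_chart_curve[OF c u(1) uU(1)] by blast
  define \<kappa> where "\<kappa> t = \<phi> (pK (u \<otimes> s t))" for t
  have \<kappa>V: "lproj V (\<kappa> t) = \<kappa> t" if "t \<in> D" for t
    using D(5)[OF that] chart_dom_chart_param(5)[OF tc] by (simp add: \<kappa>_def)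
  have blL: "bounded_linear (\<lambda>w. dir_deriv w \<kappa> 0)"
    unfolding \<kappa>_def[abs_def] by (rule smooth_on_dir_deriv_linear[OF D(4,1,2)])
  then have "linear (\<lambda>w. dir_deriv w \<kappa> 0)" by (rule bounded_linear.linear)
  from linear_exists_right_inverse_on[OF this subspace_UNIV]
  obtain R where R: "linear R" "\<And>v. v \<in> V \<Longrightarrow> dir_deriv (R v) \<kappa> 0 = v"
    using D(6) unfolding \<kappa>_def[abs_def] by blast
  have lP: "linear (lproj V)" by (rule lproj(1)[OF tcD(3)])
  define RP where "RP z = R (lproj V z)" for z
  have lRP: "linear RP" using linear_compose[OF lP R(1)] by (simp add: RP_def[abs_def] comp_def)
  define S where "S = RP -` D"
  have oS: "open S" unfolding S_def
    by (rule open_vimage[OF D(1) linear_continuous_on]) (use lRP linear_conv_bounded_linear in blast)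
  \<comment> \<open>\<open>\<kappa>\<close> on the parameters selected by \<open>R\<close>,
    completed by the kernel of the projection to a map of the whole type whose differential at
    \<open>0\<close> is the identity.\<close>
  define g where "g z = \<kappa> (RP z) + (z - lproj V z)" for z
  have gs: "smooth_on UNIV S g" unfolding g_def[abs_def]
    by (intro smooth_on_add smooth_on_diff smooth_on_id smooth_on_linear[OF lP] oS
      smooth_on_compose[OF D(4)[folded \<kappa>_def] smooth_on_linear[OF lRP] oS D(1)]) (simp add: S_def)
  have S0: "0 \<in> S" using D(2) linear_0[OF lRP] by (simp add: S_def)
  have gd: "dir_deriv v g 0 = v" for v
  proof -
    have "(\<kappa> has_derivative (\<lambda>w. dir_deriv w \<kappa> 0)) (at (RP 0))"
      unfolding linear_0[OF lRP] \<kappa>_def[abs_def] by (rule smooth_on_has_derivative[OF D(4,1,2)])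
    moreover have "(RP has_derivative RP) (at 0)"
      using lRP by (simp add: bounded_linear_imp_has_derivative linear_conv_bounded_linear)
    ultimately have "((\<lambda>z. \<kappa> (RP z)) has_derivative (\<lambda>v. dir_deriv (RP v) \<kappa> 0)) (at 0)"
      using diff_chain_at[of RP RP 0 \<kappa>] by (simp add: comp_def)
    moreover have "((\<lambda>z. z - lproj V z) has_derivative (\<lambda>v. v - lproj V v)) (at 0)"
      by (rule has_derivative_diff[OF has_derivative_ident bounded_linear_imp_has_derivative]) (use lP linear_conv_bounded_linear in blast)
    ultimately have "(g has_derivative (\<lambda>v. dir_deriv (RP v) \<kappa> 0 + (v - lproj V v))) (at 0)"
      unfolding g_def[abs_def] by (rule has_derivative_add)
    from has_derivative_dir_deriv[OF this] show ?thesis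
      using R(2)[OF lproj(2)[OF tcD(3)], of v] by (simp add: RP_def)
  qed
  have ginj: "v = 0" if "dir_deriv v g 0 = 0" for v using that gd by simp
  obtain A B j where AB: "open A" "0 \<in> A" "A \<subseteq> S" "open B" "homeomorphism A B g j" "smooth_on UNIV B j"
    by (rule smooth_inverse_function[OF oS S0 gs ginj]) auto
  have g0: "g 0 = lproj V y0" using linear_0[OF lRP] linear_0[OF lP] uU(2) u(1) s0 by (simp add: g_def \<kappa>_def)
  have "g 0 \<in> B" using imageI[OF AB(2), of g] unfolding homeomorphism_image1[OF AB(5)] .
  then have y0B: "lproj V y0 \<in> B" unfolding g0 .
  define W where "W = {y \<in> chart_dom (U, V, \<phi>). lproj V y \<in> B}"
  have oW: "open W" unfolding W_def
    by (rule smooth_on_vimage_open[OF smooth_on_linear[OF lP] chart_dom_open[OF tc] AB(4)])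
  have Fu: "smooth_on UNIV D (\<lambda>t. F (u \<otimes> s t))"
    by (rule Fs) (rule translate_plot(1)[OF plot_subset[OF s_plot D(1,3) GM(2)] u(1)])
  have jW: "RP (j (lproj V y)) \<in> D" if "y \<in> W" for y
  proof -
    have "lproj V y \<in> B" using that by (simp add: W_def)
    from imageI[OF this, of j] have "j (lproj V y) \<in> A" unfolding homeomorphism_image2[OF AB(5)] .
    then show ?thesis using AB(3) by (auto simp: S_def)
  qed
  have s1: "smooth_on UNIV W (\<lambda>y. j (lproj V y))"
    by (rule smooth_on_compose[OF AB(6) smooth_on_linear[OF lP] oW AB(4)]) (simp add: W_def)
  have "smooth_on UNIV W (\<lambda>y. F (u \<otimes> s (RP (j (lproj V y)))))"
    by (rule smooth_on_compose[OF Fu smooth_on_linear_compose[OF lRP s1 oW] oW D(1) jW])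
  then have "smooth_on UNIV W (\<lambda>y. fQ (cp y))"
  proof (rule smooth_on_cong[OF _ oW])
    fix y assume y: "y \<in> W"
    define z where "z = j (lproj V y)"
    define t where "t = RP z"
    have tD: "t \<in> D" using jW[OF y] by (simp add: t_def z_def)
    have "lproj V y \<in> B" using y by (simp add: W_def)
    from homeomorphism_apply2[OF AB(5) this] have "lproj V y = \<kappa> t + (z - lproj V z)" by (simp add: g_def t_def z_def)
    then have "lproj V (lproj V y) = lproj V (\<kappa> t) + (lproj V z - lproj V (lproj V z))"
      by (simp only: linear_add[OF lP] linear_diff[OF lP])
    then have ly: "lproj V y = \<phi> (pK (u \<otimes> s t))"
      using lproj(3)[OF tcD(3) lproj(2)[OF tcD(3)]] \<kappa>V[OF tD] by (simp add: \<kappa>_def)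
    have "cp y = pK (u \<otimes> s t)"
      unfolding cp_def chart_param_def fst_conv snd_conv ly by (rule inv_into_f_f[OF tcD(5) D(5)[OF tD]])
    then show "F (u \<otimes> s (RP (j (lproj V y)))) = fQ (cp y)"
      using fQ_pK[of "u \<otimes> s t"] u(1) s_carrier tD D(3) by (auto simp: t_def z_def)
  qed
  then have "smooth_on UNIV (W \<inter> chart_dom (U, V, \<phi>)) (\<lambda>y. fQ (cp y))" by (rule smooth_on_subset) blast
  moreover have "y0 \<in> W" using y0 y0B by (simp add: W_def)
  ultimately show "\<exists>W. open W \<and> y0 \<in> W \<and> smooth_on UNIV (W \<inter> chart_dom (U, V, \<phi>)) (\<lambda>y. fQ (chart_param (U, V, \<phi>) y))"
    using oW unfolding cp_def by blast
qed

lemma fQ_smooth: "smooth_map Q real_line fQ"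
  by (rule smooth_map_flatI[OF Q_charted subset_UNIV UNIV_I]) (use fQ_chart_smooth in auto)

text \<open>By \<open>Q_chart_curve\<close> the derivatives of
  \<open>t \<mapsto> u \<otimes> s t\<close> in the chart exhaust the tangent space of
  \<open>G/K\<close>, so this plot can take the place of the chart.\<close>

lemma fQ_critical:
  assumes u: "u \<in> carrier G"
  shows "critical_point Q fQ (pK u) \<longleftrightarrow> (\<forall>w. dir_deriv w (\<lambda>t. F (u \<otimes> s t)) 0 = 0)"
proof -
  have uT: "pK u \<in> topspace (topo Q)" using u by (simp add: Q_top)
  obtain U V \<phi> where c: "chart_at Q (pK u) = (U, V, \<phi>)" by (cases "chart_at Q (pK u)")
  note ca = chart_at[OF Q_charted uT, unfolded c, simplified]
  have tc: "topological_chart (topo Q) (U, V, \<phi>)" by (rule chartedD[OF Q_charted ca(1)])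
  note tcD = topological_chartD[OF tc]
  define f where "f y = fQ (chart_param (U, V, \<phi>) y)" for y
  have fs: "smooth_on UNIV (chart_dom (U, V, \<phi>)) f" unfolding f_def[abs_def] by (rule fQ_chart_smooth[OF ca(1)])
  obtain D where D: "open D" "0 \<in> D" "D \<subseteq> ball 0 d" "smooth_on UNIV D (\<lambda>t. \<phi> (pK (u \<otimes> s t)))"
    "\<And>t. t \<in> D \<Longrightarrow> pK (u \<otimes> s t) \<in> U" "V \<subseteq> range (\<lambda>w. dir_deriv w (\<lambda>t. \<phi> (pK (u \<otimes> s t))) 0)"
    using Q_chart_curve[OF ca(1) u ca(2)] by blast
  have \<kappa>0: "\<phi> (pK (u \<otimes> s 0)) = \<phi> (pK u)" using u s0 by simp
  have px: "\<phi> (pK u) \<in> chart_dom (U, V, \<phi>)" using chart_dom_chart_param(1)[OF tc ca(2)] .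
  have d1: "dir_deriv w (\<lambda>t. F (u \<otimes> s t)) 0 = dir_deriv (dir_deriv w (\<lambda>t. \<phi> (pK (u \<otimes> s t))) 0) f (\<phi> (pK u))" for w
  proof -
    have "dir_deriv w (\<lambda>t. F (u \<otimes> s t)) 0 = dir_deriv w (\<lambda>t. f (\<phi> (pK (u \<otimes> s t)))) 0"
    proof (rule dir_deriv_cong(1)[OF D(1,2)])
      fix t assume t: "t \<in> D"
      then have "u \<otimes> s t \<in> carrier G" using u s_carrier D(3) by auto
      then show "F (u \<otimes> s t) = f (\<phi> (pK (u \<otimes> s t)))"
        using chart_dom_chart_param(2)[OF tc D(5)[OF t]] fQ_pK by (simp add: f_def)
    qed
    also have "\<dots> = dir_deriv (dir_deriv w (\<lambda>t. \<phi> (pK (u \<otimes> s t))) 0) f (\<phi> (pK (u \<otimes> s 0)))"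
      by (rule dir_deriv_compose[OF fs D(4,1) chart_dom_open[OF tc] D(2)]) (use px \<kappa>0 in simp)
    finally show ?thesis unfolding \<kappa>0 .
  qed
  have d2: "dir_deriv v f (\<phi> (pK u)) = dir_deriv (lproj V v) f (\<phi> (pK u))" for v
    unfolding f_def[abs_def] dir_deriv_chart_param[OF tc] using lproj(3)[OF tcD(3) lproj(2)[OF tcD(3)], of v] by simp
  have "(\<forall>v. dir_deriv v f (\<phi> (pK u)) = 0) \<longleftrightarrow> (\<forall>w. dir_deriv w (\<lambda>t. F (u \<otimes> s t)) 0 = 0)"
  proof (intro iffI allI)
    fix v assume z: "\<forall>w. dir_deriv w (\<lambda>t. F (u \<otimes> s t)) 0 = 0"
    obtain w where "lproj V v = dir_deriv w (\<lambda>t. \<phi> (pK (u \<otimes> s t))) 0"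
      using D(6) lproj(2)[OF tcD(3), of v] by blast
    then show "dir_deriv v f (\<phi> (pK u)) = 0" using d1[of w] d2[of v] z by simp
  qed (simp add: d1)
  then show ?thesis unfolding critical_point_chart[OF Q_charted uT] c
    by (simp add: f_def[abs_def] coord_at_def c)
qed

end

end

text \<open>The coset of \<open>u\<close> goes to \<open>bl u\<close>: well defined by
  \<open>bl_K\<close>, injective by \<open>bl_eq_imp\<close>, onto by \<open>critical_in_Ur\<close>.
  On both sides criticality is the vanishing of the same derivatives along \<open>s\<close>.\<close>

lemma (in slice_crit) critical_point_correspondence:
  "\<exists>f\<in>invariant_smooth_functions Q H (\<lambda>a C. a <# C).
    \<exists>\<beta>. bij_betw \<beta> {C. critical_point Q f C} {x \<in> Ur. critical_point M (hl l) x}"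
proof -
  define F where "F u = hl l (bl u)" for u
  have FK: "F (a \<otimes> k) = F a" if "a \<in> carrier G" "k \<in> K" for a k using bl_K[OF that] by (simp add: F_def)
  have Fs: "smooth_on UNIV S (\<lambda>z. F (c z))" if "plot GM S c" for S and c :: "'e \<Rightarrow> 'a"
    unfolding F_def by (rule hl_bl_smooth[OF that])
  have fs: "smooth_map Q real_line (fQ F)" by (rule fQ_smooth) (use FK Fs in auto)
  have fp: "fQ F (pK u) = F u" if "u \<in> carrier G" for u by (rule fQ_pK) (use FK Fs that in auto)
  have fc: "critical_point Q (fQ F) (pK u) \<longleftrightarrow> (\<forall>w. dir_deriv w (\<lambda>t. F (u \<otimes> s t)) 0 = 0)" if "u \<in> carrier G" for u
    by (rule fQ_critical) (use FK Fs that in auto)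
  define f where "f = fQ F"
  have crit: "critical_point Q f (pK u) \<longleftrightarrow> critical_point M (hl l) (bl u)" if u: "u \<in> carrier G" for u
    unfolding f_def fc[OF u] bl_critical_iff[OF u] by (simp add: F_def)
  have "f (a <# C) = f C" if a: "a \<in> H" and C: "C \<in> topspace (topo Q)" for a C
  proof -
    obtain u where u: "u \<in> carrier G" "C = pK u" using C unfolding Q_top by blast
    have "a <# C = pK (a \<otimes> u)" unfolding u(2)
      by (rule lcos_m_assoc[OF subgroup.subset[OF K_sub] H_carrier[OF a] u(1)])
    then show ?thesis using fp[of u] fp[of "a \<otimes> u"] u H_carrier[OF a] bl_H[OF a u(1)] hl_inv[OF l a bl_TM[OF u(1)]]
      by (simp add: f_def F_def)
  qed
  then have finv: "f \<in> invariant_smooth_functions Q H (\<lambda>a C. a <# C)"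
    using fs by (simp add: invariant_smooth_functions_def f_def)
  define \<beta> where "\<beta> C = bl (SOME a. a \<in> C)" for C
  have \<beta>: "\<beta> (pK u) = bl u" if u: "u \<in> carrier G" for u
    using pK_rep[OF u] bl_K[OF u] by (auto simp: \<beta>_def)
  have cQ: "C \<in> topspace (topo Q)" if "critical_point Q f C" for C using that by (simp add: critical_point_def)
  have "bij_betw \<beta> {C. critical_point Q f C} {x \<in> Ur. critical_point M (hl l) x}"
  proof (rule bij_betw_imageI)
    show "inj_on \<beta> {C. critical_point Q f C}"
    proof (rule inj_onI)
      fix C C' assume C: "C \<in> {C. critical_point Q f C}" "C' \<in> {C. critical_point Q f C}" "\<beta> C = \<beta> C'"
      obtain u u' where u: "u \<in> carrier G" "C = pK u" "u' \<in> carrier G" "C' = pK u'"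
        using C(1,2) cQ unfolding Q_top by blast
      then have "bl u = bl u'" using C(3) \<beta> by simp
      then show "C = C'" using bl_eq_imp[OF u(1,3)] pK_eq_iff[OF u(1,3)] u(2,4) by simp
    qed
    show "\<beta> ` {C. critical_point Q f C} = {x \<in> Ur. critical_point M (hl l) x}"
    proof (intro equalityI subsetI)
      fix x assume "x \<in> \<beta> ` {C. critical_point Q f C}"
      then obtain C where C: "critical_point Q f C" "x = \<beta> C" by blast
      obtain u where u: "u \<in> carrier G" "C = pK u" using cQ[OF C(1)] unfolding Q_top by blast
      then show "x \<in> {x \<in> Ur. critical_point M (hl l) x}" using C \<beta> crit bl_Ur by simp
    next
      fix x assume "x \<in> {x \<in> Ur. critical_point M (hl l) x}"
      then obtain u where u: "u \<in> carrier G" "x = bl u" "critical_point M (hl l) x" using critical_in_Ur by blast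
      then have "critical_point Q f (pK u)" "x = \<beta> (pK u)" using crit \<beta> by auto
      then show "x \<in> \<beta> ` {C. critical_point Q f C}" by blast
    qed
  qed
  then show ?thesis using finv by blast
qed

theorem theorem2p2:
  fixes G :: "('g, 'x) monoid_scheme"
    and GM :: "('g, 'k::euclidean_space) manifold"
    and M :: "('m, 'e::euclidean_space) manifold"
    and act :: "'g \<Rightarrow> 'm \<Rightarrow> 'm"
    and H :: "'g set"
    and h :: "'m \<Rightarrow> real"
    and h_pert :: "real \<Rightarrow> 'm \<Rightarrow> real"
    and m :: 'm
  assumes "lie_group G GM"
    and "smooth_manifold M"
    and "proper_smooth_action G GM M act"
    and "closed_cocompact_subgroup G GM H"
    and "h \<in> invariant_smooth_functions M (carrier G) act"
    and "is_perturbation M H act h h_pert"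
    and "nondegenerate_critical_point G GM M act h m"
  defines "Q \<equiv> homogeneous_space G GM (stabilizer G act m)"
  shows "\<exists>U. openin (topo M) U \<and> m \<in> U \<and> (\<forall>g\<in>carrier G. \<forall>x\<in>U. act g x \<in> U) \<and>
           (\<forall>\<^sub>F l in nhds 0.
              \<exists>f\<in>invariant_smooth_functions Q H (\<lambda>a C. a <#\<^bsub>G\<^esub> C).
                \<exists>\<beta>. bij_betw \<beta> {C. critical_point Q f C} {x \<in> U. critical_point M (h_pert l) x})"
proof -
  have mT: "m \<in> topspace (topo M)"
    using assms(7) by (simp add: nondegenerate_critical_point_def critical_point_def)
  interpret group G using assms(1) by (simp add: lie_group_def)
  interpret lie_action G GM M act m
    by unfold_locales (use assms(1-3) mT in auto)
  obtain \<Lambda> where \<Lambda>: "open \<Lambda>" "0 \<in> \<Lambda>" "\<And>l. l \<in> \<Lambda> \<Longrightarrow> h_pert l \<in> invariant_smooth_functions M H act"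
    "smooth_map (prod_manifold M (flat_manifold UNIV \<Lambda>)) real_line (\<lambda>(x, l). h_pert l x)"
    and h0: "\<And>x. x \<in> topspace (topo M) \<Longrightarrow> h_pert 0 x = h x"
    using assms(6) unfolding is_perturbation_def by blast
  obtain d s Oe where os: "orbit_section G GM M act m d s Oe" using local_section by blast
  obtain r sg where sl: "slice G GM M act m d s Oe r sg" using orbit_section.slice_theorem[OF os] by blast
  interpret slice G GM M act m d s Oe r sg by (rule sl)
  interpret slice_pert G GM M act m d s Oe r sg H h h_pert \<Lambda>
    by (rule slice_pert.intro[OF sl slice_pert_axioms.intro])
       (use assms(4,5,7) \<Lambda> h0 in \<open>auto simp: closed_cocompact_subgroup_def invariant_smooth_functions_def\<close>)
  obtain r' \<delta> where r': "0 < r'" "r' \<le> r" "\<delta> > 0" "\<And>l. \<bar>l\<bar> < \<delta> \<Longrightarrow> l \<in> \<Lambda>"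
    "\<And>l u. \<bar>l\<bar> < \<delta> \<Longrightarrow> u \<in> carrier G \<Longrightarrow> \<exists>!v. v \<in> disc r' \<and> Ah u l v = 0"
    "\<And>l u v x. \<bar>l\<bar> < \<delta> \<Longrightarrow> u \<in> carrier G \<Longrightarrow> v \<in> disc r' \<Longrightarrow> dir_deriv x (Ah u l) v = 0 \<Longrightarrow> x = 0"
    using slice_zero_unique by blast
  \<comment> \<open>The neighbourhood is fixed before \<open>l\<close> is chosen: \<open>r'\<close>
    does not depend on \<open>l\<close>, so one and the same tube serves all small
    parameters.\<close>
  define U where "U = {act g (sg v) | g v. g \<in> carrier G \<and> v \<in> disc r'}"
  have "openin (topo M) U" unfolding U_def by (rule sg_open[OF r'(2)])
  moreover have "m \<in> U" unfolding U_def using disc_zero[OF r'(1)] sg0 act_one[OF mT] by force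
  moreover have "act g x \<in> U" if g: "g \<in> carrier G" and x: "x \<in> U" for g x
  proof -
    obtain a v where av: "a \<in> carrier G" "v \<in> disc r'" "x = act a (sg v)" using x by (auto simp: U_def)
    have "sg v \<in> TM" using plot_in[OF sg_plot] disc_norm[OF av(2)] r'(2) by simp
    then have "act g x = act (g \<otimes>\<^bsub>G\<^esub> a) (sg v)" using av g by (simp add: act_mult)
    then show ?thesis using av g unfolding U_def by blast
  qed
  moreover have "\<forall>\<^sub>F l in nhds 0. \<exists>f\<in>invariant_smooth_functions Q H (\<lambda>a C. a <#\<^bsub>G\<^esub> C).
      \<exists>\<beta>. bij_betw \<beta> {C. critical_point Q f C} {x \<in> U. critical_point M (h_pert l) x}"
    unfolding eventually_nhds_metric
  proof (intro exI[of _ \<delta>] conjI allI impI r'(3))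
    fix l :: real assume "dist l 0 < \<delta>"
    then have l: "\<bar>l\<bar> < \<delta>" by simp
    interpret slice_crit G GM M act m d s Oe r sg H h h_pert \<Lambda> r' l
      by unfold_locales (use r' l in blast)+
    show "\<exists>f\<in>invariant_smooth_functions Q H (\<lambda>a C. a <#\<^bsub>G\<^esub> C).
      \<exists>\<beta>. bij_betw \<beta> {C. critical_point Q f C} {x \<in> U. critical_point M (h_pert l) x}"
      using critical_point_correspondence unfolding Ur_def U_def Q_def K_def .
  qed
  ultimately show ?thesis by blast
qed

end
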